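(* Let $X$ be a complex space of pure dimension $n$ and $E\to X$ a holomorphic vector bundle with a singular Hermitian metric $h$. For any resolution of singularities $\pi:\widetilde X\to X$, one has $$\omega_X^{GR}(E,h)=\pi_*\bigl(K_{\widetilde X}\otimes\mathscr E(\pi^*h)\bigr).$$ In particular, if $X$ is smooth, then $\omega_X^{GR}(E,h)=K_X\otimes\mathscr E(h)$, and $\pi:\widetilde X\to X$ can be taken to be any proper modification.
   Context: Conventions: all complex spaces are reduced; $X_{reg}$ is the regular locus. Hermitian metrics on $X$ are locally restrictions, via closed holomorphic embeddings into open subsets of $\mathbb C^N$, of Hermitian metrics there. $L^1_{loc}(U)$ means integrable on $K_{reg}$ for every $K\Subset U$. A singular Hermitian metric $h$ on $E$ is a measurable map from $X$ to the semi-positive Hermitian forms on the fibres of $E$ with $0<\det h<+\infty$ almost everywhere. On a complex manifold, $\mathscr E(h)$ is the sheaf of germs of holomorphic sections $s$ of the bundle such that $|s|^2_h$ is locally integrable. The Grauert–Riemenschneider canonical sheaf $\omega_X^{GR}$ is defined by $\Gamma(U,\omega_X^{GR})=\{s\in\Gamma(U\cap X_{reg},\omega_{X_{reg}})\mid i^{n^2}s\wedge\overline s\in L^1_{loc}(U)\}$ for $U\subset X$ open. The Grauert–Riemenschneider canonical $L^2$-subsheaf $\omega_X^{GR}(E,h)$ is the $\mathcal O_X$-subsheaf of $\omega_X^{GR}\otimes\mathcal O_X(E)$ of those sections $s$ (viewed as holomorphic sections of $\omega_{X_{reg}}\otimes\mathcal O_X(E)$ on the regular locus) for which $|s|^2_{h,\omega}\,dV_\omega$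 is integrable over the regular part of a neighborhood of each point, for a Hermitian metric $\omega$ on $X$; this is independent of $\omega$. *)

theory Defs
  imports "HOL-Analysis.Analysis" "Jordan_Normal_Form.Determinant"
begin

unbundle no vec_syntax

section \<open>Holomorphic functions of several variables\<close>

text \<open>
  The space of \<open>N\<close>-tuples of complex numbers is the set of extensional functions on \<open>{..<N}\<close>,
  so that the dimension is an ordinary number, which may vary from chart to chart; \<open>N = 0\<close> is
  allowed. Note that \<open>z(i := w)\<close> remains in this set if \<open>i < N\<close>.
\<close>

definition Cn :: "nat \<Rightarrow> (nat \<Rightarrow> complex) topology" where
  "Cn N = product_topology (\<lambda>_. euclidean) {..<N}"

definition lebesgue_Cn :: "nat \<Rightarrow> (nat \<Rightarrow> complex) measure" where
  "lebesgue_Cn N = completion (Pi\<^sub>M {..<N} (\<lambda>_. lborel))"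

definition holo :: "nat \<Rightarrow> (nat \<Rightarrow> complex) set \<Rightarrow> ((nat \<Rightarrow> complex) \<Rightarrow> complex) \<Rightarrow> bool" where
  "holo N D f \<longleftrightarrow> openin (Cn N) D \<and> continuous_map (subtopology (Cn N) D) euclidean f \<and>
     (\<forall>z\<in>D. \<forall>i<N. (\<lambda>w. f (z(i := w))) field_differentiable (at (z i)))"

definition pderiv_at :: "nat \<Rightarrow> ((nat \<Rightarrow> complex) \<Rightarrow> complex) \<Rightarrow> (nat \<Rightarrow> complex) \<Rightarrow> complex" where
  "pderiv_at i f z = deriv (\<lambda>w. f (z(i := w))) (z i)"

definition jacobian ::
    "nat \<Rightarrow> nat \<Rightarrow> ((nat \<Rightarrow> complex) \<Rightarrow> (nat \<Rightarrow> complex)) \<Rightarrow> (nat \<Rightarrow> complex) \<Rightarrow> complex mat" where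
  "jacobian m n F z = mat m n (\<lambda>(i, j). pderiv_at j (\<lambda>z. F z i) z)"

text \<open>Real differentiability of class \<open>C\<^sup>k\<close>: the directions \<open>1\<close> and \<open>\<i>\<close> in the
  \<open>i\<close>-th coordinate are the two real coordinate directions.\<close>

primrec ck_on ::
    "nat \<Rightarrow> nat \<Rightarrow> (nat \<Rightarrow> complex) set \<Rightarrow> ((nat \<Rightarrow> complex) \<Rightarrow> complex) \<Rightarrow> bool" where
  "ck_on 0 N D f \<longleftrightarrow> continuous_map (subtopology (Cn N) D) euclidean f"
| "ck_on (Suc k) N D f \<longleftrightarrow> continuous_map (subtopology (Cn N) D) euclidean f \<and>
     (\<forall>i<N. \<forall>d\<in>{1, \<i>}. \<exists>g. ck_on k N D g \<and>
        (\<forall>z\<in>D. ((\<lambda>t::real. f (z(i := z i + of_real t * d))) has_vector_derivative g z) (at 0)))"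

definition smooth_on_Cn ::
    "nat \<Rightarrow> (nat \<Rightarrow> complex) set \<Rightarrow> ((nat \<Rightarrow> complex) \<Rightarrow> complex) \<Rightarrow> bool" where
  "smooth_on_Cn N D f \<longleftrightarrow> (\<forall>k. ck_on k N D f)"

definition analytic_subset :: "nat \<Rightarrow> (nat \<Rightarrow> complex) set \<Rightarrow> (nat \<Rightarrow> complex) set \<Rightarrow> bool" where
  "analytic_subset N D A \<longleftrightarrow> closedin (subtopology (Cn N) D) A \<and>
     (\<forall>a\<in>D. \<exists>V fs. openin (Cn N) V \<and> a \<in> V \<and> V \<subseteq> D \<and> finite fs \<and> (\<forall>f\<in>fs. holo N V f) \<and>
        A \<inter> V = {z\<in>V. \<forall>f\<in>fs. f z = 0})"

definition locally_restr_holo ::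
    "nat \<Rightarrow> (nat \<Rightarrow> complex) set \<Rightarrow> ((nat \<Rightarrow> complex) \<Rightarrow> complex) \<Rightarrow> bool" where
  "locally_restr_holo N W g \<longleftrightarrow>
     (\<forall>a\<in>W. \<exists>V F. a \<in> V \<and> holo N V F \<and> (\<forall>z\<in>V \<inter> W. g z = F z))"

section \<open>Reduced complex spaces\<close>

text \<open>
  The structure sheaf of a reduced complex space is a sheaf of complex-valued functions. Its sections
  are represented by total functions of which only the values on the open set in question matter
  (for complex spaces this follows from the gluing axiom and the local models).
\<close>

record 'a cspace =
  top :: "'a topology"
  str :: "'a set \<Rightarrow> ('a \<Rightarrow> complex) set"

abbreviation points :: "'a cspace \<Rightarrow> 'a set" where
  "points X \<equiv> topspace (top X)"

text \<open>A pair \<open>(U, \<phi>)\<close>; only the restriction of \<open>\<phi>\<close> to \<open>U\<close> is relevant.\<close>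

type_synonym 'a chart = "'a set \<times> ('a \<Rightarrow> nat \<Rightarrow> complex)"

definition inv_chart :: "'a chart \<Rightarrow> (nat \<Rightarrow> complex) \<Rightarrow> 'a" where
  "inv_chart c = inv_into (fst c) (snd c)"

text \<open>A closed holomorphic embedding of the open subspace \<open>U\<close> into the open subset \<open>D\<close>, i.e.
  an isomorphism onto an analytic subset of \<open>D\<close> with its reduced structure.\<close>

definition closed_embedding ::
    "'a cspace \<Rightarrow> nat \<Rightarrow> (nat \<Rightarrow> complex) set \<Rightarrow> 'a chart \<Rightarrow> bool" where
  "closed_embedding X N D = (\<lambda>(U, \<phi>). openin (top X) U \<and> openin (Cn N) D \<and>
     analytic_subset N D (\<phi> ` U) \<and>
     homeomorphic_map (subtopology (top X) U) (subtopology (Cn N) (\<phi> ` U)) \<phi> \<and>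
     (\<forall>V f. openin (top X) V \<longrightarrow> V \<subseteq> U \<longrightarrow>
        (f \<in> str X V \<longleftrightarrow> locally_restr_holo N (\<phi> ` V) (f \<circ> inv_chart (U, \<phi>)))))"

definition complex_space :: "'a cspace \<Rightarrow> bool" where
  "complex_space X \<longleftrightarrow> Hausdorff_space (top X) \<and>
     (\<forall>U V. openin (top X) U \<longrightarrow> openin (top X) V \<longrightarrow> V \<subseteq> U \<longrightarrow> str X U \<subseteq> str X V) \<and>
     (\<forall>U f. openin (top X) U \<longrightarrow>
        (\<forall>x\<in>U. \<exists>V. openin (top X) V \<and> x \<in> V \<and> V \<subseteq> U \<and> f \<in> str X V) \<longrightarrow> f \<in> str X U) \<and>
     (\<forall>x\<in>points X. \<exists>N D c. closed_embedding X N D c \<and> x \<in> fst c)"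

text \<open>Holomorphic coordinate charts, i.e. isomorphisms of an open subspace with an open set of
  \<open>n\<close>-tuples. All of them are used, not only those of a chosen atlas.\<close>

definition is_chart :: "'a cspace \<Rightarrow> nat \<Rightarrow> 'a chart \<Rightarrow> bool" where
  "is_chart X n = (\<lambda>(U, \<phi>). openin (top X) U \<and> openin (Cn n) (\<phi> ` U) \<and>
     homeomorphic_map (subtopology (top X) U) (subtopology (Cn n) (\<phi> ` U)) \<phi> \<and>
     (\<forall>V f. openin (top X) V \<longrightarrow> V \<subseteq> U \<longrightarrow>
        (f \<in> str X V \<longleftrightarrow> holo n (\<phi> ` V) (f \<circ> inv_chart (U, \<phi>)))))"

definition reg :: "'a cspace \<Rightarrow> 'a set" where
  "reg X = {x. \<exists>m c. is_chart X m c \<and> x \<in> fst c}"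

definition complex_manifold :: "'a cspace \<Rightarrow> bool" where
  "complex_manifold X \<longleftrightarrow> complex_space X \<and> reg X = points X"

text \<open>The dimension of a reduced space at \<open>x\<close> is the largest dimension of the manifold of regular
  points arbitrarily close to \<open>x\<close>, and regular points are dense; so \<open>X\<close> has pure dimension \<open>n\<close> iff
  it has dimension \<open>n\<close> at every regular point.\<close>

definition pure_dim :: "'a cspace \<Rightarrow> nat \<Rightarrow> bool" where
  "pure_dim X n \<longleftrightarrow> (\<forall>x\<in>reg X. \<exists>c. is_chart X n c \<and> x \<in> fst c)"

definition analytic_in :: "'a cspace \<Rightarrow> 'a set \<Rightarrow> bool" where
  "analytic_in X A \<longleftrightarrow> closedin (top X) A \<and>
     (\<forall>x\<in>points X. \<exists>V fs. openin (top X) V \<and> x \<in> V \<and> finite fs \<and> fs \<subseteq> str X V \<and>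
        A \<inter> V = {y\<in>V. \<forall>f\<in>fs. f y = 0})"

definition nowhere_dense_in :: "'a cspace \<Rightarrow> 'a set \<Rightarrow> bool" where
  "nowhere_dense_in X A \<longleftrightarrow> top X interior_of (top X closure_of A) = {}"

definition preim :: "'b cspace \<Rightarrow> ('b \<Rightarrow> 'a) \<Rightarrow> 'a set \<Rightarrow> 'b set" where
  "preim Y p U = {y\<in>points Y. p y \<in> U}"

definition holomorphic_map :: "'b cspace \<Rightarrow> 'a cspace \<Rightarrow> ('b \<Rightarrow> 'a) \<Rightarrow> bool" where
  "holomorphic_map Y X p \<longleftrightarrow> continuous_map (top Y) (top X) p \<and>
     (\<forall>V f. openin (top X) V \<longrightarrow> f \<in> str X V \<longrightarrow> f \<circ> p \<in> str Y (preim Y p V))"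

definition biholomorphic_over :: "'b cspace \<Rightarrow> 'a cspace \<Rightarrow> ('b \<Rightarrow> 'a) \<Rightarrow> 'a set \<Rightarrow> bool" where
  "biholomorphic_over Y X p U \<longleftrightarrow> openin (top X) U \<and>
     homeomorphic_map (subtopology (top Y) (preim Y p U)) (subtopology (top X) U) p \<and>
     (\<forall>V f. openin (top X) V \<longrightarrow> V \<subseteq> U \<longrightarrow> (f \<in> str X V \<longleftrightarrow> f \<circ> p \<in> str Y (preim Y p V)))"

definition proper_modification :: "'b cspace \<Rightarrow> 'a cspace \<Rightarrow> ('b \<Rightarrow> 'a) \<Rightarrow> bool" where
  "proper_modification Y X p \<longleftrightarrow> complex_space Y \<and> complex_space X \<and>
     holomorphic_map Y X p \<and> proper_map (top Y) (top X) p \<and> p ` points Y = points X \<and>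
     (\<exists>S. analytic_in X S \<and> nowhere_dense_in X S \<and> nowhere_dense_in Y (preim Y p S) \<and>
        biholomorphic_over Y X p (points X - S))"

text \<open>The centre of the modification is not required to be the singular locus; resolutions that
  are isomorphisms over the regular locus are a special case.\<close>

definition resolution_of_singularities :: "'b cspace \<Rightarrow> 'a cspace \<Rightarrow> ('b \<Rightarrow> 'a) \<Rightarrow> bool" where
  "resolution_of_singularities Y X p \<longleftrightarrow> complex_manifold Y \<and> proper_modification Y X p"

section \<open>Holomorphic vector bundles\<close>

text \<open>
  A bundle is given by its fibres and by a set of local trivializations \<open>(V, r, \<tau>)\<close>, where
  \<open>\<tau> x\<close> identifies the fibre at \<open>x \<in> V\<close> with the column vectors of length \<open>r\<close>. The total space
  is \<open>SIGMA x : points X. fibre E x\<close>; the fibres carry the vector space structure for which the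
  maps \<open>\<tau> x\<close> are linear isomorphisms, well defined as the transition functions are linear. The
  rank may differ between connected components.
\<close>

record ('a, 'e) vbundle =
  fibre :: "'a \<Rightarrow> 'e set"
  trivs :: "('a set \<times> nat \<times> ('a \<Rightarrow> 'e \<Rightarrow> complex Matrix.vec)) set"

definition hol_vector_bundle :: "'a cspace \<Rightarrow> ('a, 'e) vbundle \<Rightarrow> bool" where
  "hol_vector_bundle X E \<longleftrightarrow>
     (\<forall>(V, r, \<tau>)\<in>trivs E. openin (top X) V \<and>
        (\<forall>x\<in>V. bij_betw (\<tau> x) (fibre E x) (carrier_vec r))) \<and>
     (\<forall>x\<in>points X. \<exists>(V, r, \<tau>)\<in>trivs E. x \<in> V) \<and>
     (\<forall>(V, r, \<tau>)\<in>trivs E. \<forall>(V', r', \<tau>')\<in>trivs E. V \<inter> V' \<noteq> {} \<longrightarrow> r = r' \<and>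
        (\<exists>g :: 'a \<Rightarrow> complex mat.
           (\<forall>x\<in>V \<inter> V'. g x \<in> carrier_mat r r \<and> (\<forall>e\<in>fibre E x. \<tau>' x e = g x *\<^sub>v \<tau> x e)) \<and>
           (\<forall>i<r. \<forall>j<r. (\<lambda>x. g x $$ (i, j)) \<in> str X (V \<inter> V'))))"

definition pullback_bundle :: "'b cspace \<Rightarrow> ('b \<Rightarrow> 'a) \<Rightarrow> ('a, 'e) vbundle \<Rightarrow> ('b, 'e) vbundle" where
  "pullback_bundle Y p E = \<lparr>fibre = (\<lambda>y. fibre E (p y)),
     trivs = (\<lambda>(V, r, \<tau>). (preim Y p V, r, \<lambda>y. \<tau> (p y))) ` trivs E\<rparr>"

definition hol_section :: "'a cspace \<Rightarrow> ('a, 'e) vbundle \<Rightarrow> 'a set \<Rightarrow> ('a \<Rightarrow> 'e) \<Rightarrow> bool" where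
  "hol_section X E W s \<longleftrightarrow> (\<forall>x\<in>W. s x \<in> fibre E x) \<and>
     (\<forall>(V, r, \<tau>)\<in>trivs E. \<forall>i<r. (\<lambda>x. \<tau> x (s x) $ i) \<in> str X (V \<inter> W))"

section \<open>Singular Hermitian metrics\<close>

definition sesqui :: "complex mat \<Rightarrow> complex Matrix.vec \<Rightarrow> complex Matrix.vec \<Rightarrow> complex" where
  "sesqui A v w = (\<Sum>i<dim_vec v. \<Sum>j<dim_vec w. A $$ (i, j) * v $ i * cnj (w $ j))"

definition hermitian_mat :: "nat \<Rightarrow> complex mat \<Rightarrow> bool" where
  "hermitian_mat r A \<longleftrightarrow> A \<in> carrier_mat r r \<and> (\<forall>i<r. \<forall>j<r. A $$ (j, i) = cnj (A $$ (i, j)))"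

definition semipos_mat :: "nat \<Rightarrow> complex mat \<Rightarrow> bool" where
  "semipos_mat r A \<longleftrightarrow> hermitian_mat r A \<and> (\<forall>v\<in>carrier_vec r. 0 \<le> Re (sesqui A v v))"

definition pos_mat :: "nat \<Rightarrow> complex mat \<Rightarrow> bool" where
  "pos_mat r A \<longleftrightarrow> hermitian_mat r A \<and> (\<forall>v\<in>carrier_vec r - {0\<^sub>v r}. 0 < Re (sesqui A v v))"

text \<open>
  A semi-positive Hermitian form is given by its squared norm \<open>q\<close>. As the condition
  \<open>det h < \<infinity>\<close> is only imposed almost everywhere, the value \<open>\<infinity>\<close> is admitted: \<open>q\<close> is
  then a semi-positive Hermitian form \<open>H\<close> on a linear subspace \<open>F\<close>, and infinite off \<open>F\<close>.
\<close>

definition semipos_form :: "nat \<Rightarrow> (complex Matrix.vec \<Rightarrow> ennreal) \<Rightarrow> bool" where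
  "semipos_form r q \<longleftrightarrow> (\<exists>F H.
     F \<subseteq> carrier_vec r \<and> 0\<^sub>v r \<in> F \<and> (\<forall>u\<in>F. \<forall>v\<in>F. u + v \<in> F) \<and> (\<forall>a. \<forall>v\<in>F. a \<cdot>\<^sub>v v \<in> F) \<and>
     (\<forall>u\<in>F. \<forall>v\<in>F. \<forall>w\<in>F. H (u + v) w = H u w + H v w) \<and>
     (\<forall>a. \<forall>u\<in>F. \<forall>v\<in>F. H (a \<cdot>\<^sub>v u) v = a * H u v) \<and>
     (\<forall>u\<in>F. \<forall>v\<in>F. H v u = cnj (H u v)) \<and> (\<forall>v\<in>F. 0 \<le> Re (H v v)) \<and>
     (\<forall>v\<in>carrier_vec r. q v = (if v \<in> F then ennreal (Re (H v v)) else \<infinity>)))"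

text \<open>\<open>0 < det q < \<infinity>\<close>: the form is finite everywhere and the determinant of its matrix is
  positive. Positivity of the determinant does not depend on the frame.\<close>

definition det_pos_finite :: "nat \<Rightarrow> (complex Matrix.vec \<Rightarrow> ennreal) \<Rightarrow> bool" where
  "det_pos_finite r q \<longleftrightarrow> (\<exists>A. semipos_mat r A \<and>
     (\<forall>v\<in>carrier_vec r. q v = ennreal (Re (sesqui A v v))) \<and> 0 < Re (Determinant.det A))"

text \<open>The singular locus is regarded as a null set, so that only charts of the regular locus
  matter. The condition is local: no countability assumption on \<open>X\<close> is made.\<close>

definition ae_on :: "'a cspace \<Rightarrow> nat \<Rightarrow> ('a \<Rightarrow> bool) \<Rightarrow> bool" where
  "ae_on X n P \<longleftrightarrow>
     (\<forall>c. is_chart X n c \<longrightarrow> {z \<in> snd c ` fst c. \<not> P (inv_chart c z)} \<in> null_sets (lebesgue_Cn n))"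

text \<open>The metric is represented by its squared norm function: \<open>h x e\<close> is \<open>|e|\<^sup>2\<close> with respect
  to \<open>h\<close>, for \<open>e\<close> in the fibre at \<open>x\<close>.\<close>

definition form_in_triv ::
    "('a, 'e) vbundle \<Rightarrow> ('a \<Rightarrow> 'e \<Rightarrow> complex Matrix.vec) \<Rightarrow> ('a \<Rightarrow> 'e \<Rightarrow> ennreal) \<Rightarrow> 'a
      \<Rightarrow> complex Matrix.vec \<Rightarrow> ennreal" where
  "form_in_triv E \<tau> h x v = h x (inv_into (fibre E x) (\<tau> x) v)"

definition singular_hermitian_metric ::
    "'a cspace \<Rightarrow> nat \<Rightarrow> ('a, 'e) vbundle \<Rightarrow> ('a \<Rightarrow> 'e \<Rightarrow> ennreal) \<Rightarrow> bool" where
  "singular_hermitian_metric X n E h \<longleftrightarrow> (\<forall>(V, r, \<tau>)\<in>trivs E.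
     (\<forall>x\<in>V. semipos_form r (form_in_triv E \<tau> h x)) \<and>
     (\<forall>c v. is_chart X n c \<longrightarrow> v \<in> carrier_vec r \<longrightarrow>
        (\<lambda>z. form_in_triv E \<tau> h (inv_chart c z) v)
          \<in> borel_measurable (restrict_space (lebesgue_Cn n) (snd c ` (fst c \<inter> V)))) \<and>
     ae_on X n (\<lambda>x. x \<in> V \<longrightarrow> det_pos_finite r (form_in_triv E \<tau> h x)))"

definition pullback_metric ::
    "('b \<Rightarrow> 'a) \<Rightarrow> ('a \<Rightarrow> 'e \<Rightarrow> ennreal) \<Rightarrow> ('b \<Rightarrow> 'e \<Rightarrow> ennreal)" where
  "pullback_metric p h = (\<lambda>y. h (p y))"

section \<open>Hermitian metrics on complex spaces\<close>

definition hermitian_metric_Cn ::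
    "nat \<Rightarrow> (nat \<Rightarrow> complex) set \<Rightarrow> ((nat \<Rightarrow> complex) \<Rightarrow> complex mat) \<Rightarrow> bool" where
  "hermitian_metric_Cn N D G \<longleftrightarrow> (\<forall>z\<in>D. pos_mat N (G z)) \<and>
     (\<forall>i<N. \<forall>j<N. smooth_on_Cn N D (\<lambda>z. G z $$ (i, j)))"

text \<open>
  A Hermitian metric on \<open>X\<close> is given by its coefficient matrices \<open>\<omega> c x\<close> in the charts \<open>c\<close> of the
  regular locus; these must be induced near every point of \<open>X\<close>, singular points included, by a
  smooth Hermitian metric \<open>G\<close> on the ambient space of a closed embedding. With \<open>J\<close> the Jacobian
  matrix of the embedding in the coordinates \<open>c\<close>, the restriction of \<open>G\<close> is the transpose of
  \<open>J\<close> times \<open>G\<close> times the conjugate of \<open>J\<close>.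
\<close>

definition hermitian_metric ::
    "'a cspace \<Rightarrow> nat \<Rightarrow> ('a chart \<Rightarrow> 'a \<Rightarrow> complex mat) \<Rightarrow> bool" where
  "hermitian_metric X n \<omega> \<longleftrightarrow> (\<forall>x\<in>points X. \<exists>N D e G.
     closed_embedding X N D e \<and> x \<in> fst e \<and> hermitian_metric_Cn N D G \<and>
     (\<forall>c y. is_chart X n c \<longrightarrow> y \<in> fst c \<inter> fst e \<longrightarrow>
        (let J = jacobian N n (snd e \<circ> inv_chart c) (snd c y) in
         \<omega> c y = mat n n (\<lambda>(j, k).
           \<Sum>a<N. \<Sum>b<N. G (snd e y) $$ (a, b) * J $$ (a, j) * cnj (J $$ (b, k))))))"

section \<open>Canonical forms and their integrals\<close>

text \<open>
  A form of bidegree \<open>(n, 0)\<close> is represented by the family of its coefficients \<open>f c\<close>, where the form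
  is \<open>f c dz\<^sub>0 \<and> \<dots> \<and> dz\<^sub>n\<^sub>-\<^sub>1\<close> in the coordinates \<open>z\<close> of the chart \<open>c\<close>. Here only the values of
  \<open>f c\<close> on \<open>fst c \<inter> W\<close> matter.
\<close>

definition hol_nform ::
    "'a cspace \<Rightarrow> nat \<Rightarrow> 'a set \<Rightarrow> ('a chart \<Rightarrow> 'a \<Rightarrow> complex) \<Rightarrow> bool" where
  "hol_nform X n W f \<longleftrightarrow>
     (\<forall>c. is_chart X n c \<longrightarrow> f c \<in> str X (fst c \<inter> W)) \<and>
     (\<forall>c c' x. is_chart X n c \<longrightarrow> is_chart X n c' \<longrightarrow> x \<in> fst c \<inter> fst c' \<inter> W \<longrightarrow>
        f c x = Determinant.det (jacobian n n (snd c' \<circ> inv_chart c) (snd c x)) * f c' x)"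

text \<open>Integral over \<open>S\<close> of the measure given in every chart \<open>c\<close> by the density \<open>\<rho> c \<ge> 0\<close> with
  respect to Lebesgue measure: the supremum over finite families of disjoint measurable pieces of
  \<open>S\<close>, each contained in a chart.\<close>

definition chart_pieces :: "'a cspace \<Rightarrow> nat \<Rightarrow> 'a set \<Rightarrow> ('a chart \<times> 'a set) set set" where
  "chart_pieces X n S = {F. finite F \<and>
     (\<forall>(c, B)\<in>F. is_chart X n c \<and> B \<subseteq> fst c \<inter> S \<and> snd c ` B \<in> sets (lebesgue_Cn n)) \<and>
     pairwise (\<lambda>p p'. snd p \<inter> snd p' = {}) F}"

definition integral_density ::
    "'a cspace \<Rightarrow> nat \<Rightarrow> 'a set \<Rightarrow> ('a chart \<Rightarrow> 'a \<Rightarrow> ennreal) \<Rightarrow> ennreal" where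
  "integral_density X n S \<rho> = (SUP F\<in>chart_pieces X n S.
     \<Sum>(c, B)\<in>F. \<integral>\<^sup>+z\<in>snd c ` B. \<rho> c (inv_chart c z) \<partial>lebesgue_Cn n)"

text \<open>The form \<open>i^(n^2) s \<and> conj s\<close> for \<open>s = f dz\<^sub>0 \<and> \<dots> \<and> dz\<^sub>n\<^sub>-\<^sub>1\<close> is
  \<open>2^n |f|\<^sup>2\<close> times Lebesgue measure, since \<open>i dz \<and> conj dz = 2 dx \<and> dy\<close>.\<close>

definition GR_form ::
    "'a cspace \<Rightarrow> nat \<Rightarrow> 'a set \<Rightarrow> ('a chart \<Rightarrow> 'a \<Rightarrow> complex) \<Rightarrow> bool" where
  "GR_form X n U f \<longleftrightarrow> hol_nform X n (U \<inter> reg X) f \<and>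
     (\<forall>K. compactin (top X) K \<longrightarrow> K \<subseteq> U \<longrightarrow>
        integral_density X n (K \<inter> reg X) (\<lambda>c x. ennreal (2 ^ n * (cmod (f c x))\<^sup>2)) < \<infinity>)"

section \<open>Forms with values in a bundle\<close>

text \<open>Coefficients \<open>s c x\<close> are now elements of the fibre at \<open>x\<close>. The coefficients are
  extensional, so that sections over \<open>W\<close> are equal iff they are equal as functions.\<close>

definition E_forms ::
    "'a cspace \<Rightarrow> nat \<Rightarrow> ('a, 'e) vbundle \<Rightarrow> 'a set \<Rightarrow> ('a chart \<Rightarrow> 'a \<Rightarrow> 'e) set" where
  "E_forms X n E W = {s.
     (\<forall>c x. if is_chart X n c \<and> x \<in> fst c \<inter> W then s c x \<in> fibre E x else s c x = undefined) \<and>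
     (\<forall>(V, r, \<tau>)\<in>trivs E. \<forall>i<r. hol_nform X n (V \<inter> W) (\<lambda>c x. \<tau> x (s c x) $ i))}"

text \<open>Sections over \<open>U\<close> of the tensor product of the Grauert--Riemenschneider sheaf with the locally
  free sheaf of sections of \<open>E\<close>: in every local frame of \<open>E\<close>, the components belong to the
  Grauert--Riemenschneider sheaf.\<close>

definition GR_tensor ::
    "'a cspace \<Rightarrow> nat \<Rightarrow> ('a, 'e) vbundle \<Rightarrow> 'a set \<Rightarrow> ('a chart \<Rightarrow> 'a \<Rightarrow> 'e) set" where
  "GR_tensor X n E U = {s \<in> E_forms X n E (U \<inter> reg X).
     \<forall>(V, r, \<tau>)\<in>trivs E. \<forall>i<r. GR_form X n (U \<inter> V) (\<lambda>c x. \<tau> x (s c x) $ i)}"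

text \<open>In a chart with metric coefficients \<open>g\<close>, the form \<open>dz\<^sub>0 \<and> \<dots> \<and> dz\<^sub>n\<^sub>-\<^sub>1\<close> has squared
  norm \<open>1 / det g\<close> and the volume form is \<open>det g\<close> times Lebesgue measure. (Another normalization
  would only change the integrals by a positive constant.)\<close>

definition norm_sq_form ::
    "('a \<Rightarrow> 'e \<Rightarrow> ennreal) \<Rightarrow> ('a chart \<Rightarrow> 'a \<Rightarrow> complex mat) \<Rightarrow> ('a chart \<Rightarrow> 'a \<Rightarrow> 'e)
      \<Rightarrow> 'a chart \<Rightarrow> 'a \<Rightarrow> ennreal" where
  "norm_sq_form h \<omega> s c x = h x (s c x) * ennreal (1 / Re (Determinant.det (\<omega> c x)))"

definition volume_density ::
    "('a chart \<Rightarrow> 'a \<Rightarrow> complex mat) \<Rightarrow> 'a chart \<Rightarrow> 'a \<Rightarrow> ennreal" where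
  "volume_density \<omega> c x = ennreal (Re (Determinant.det (\<omega> c x)))"

definition GR_L2 ::
    "'a cspace \<Rightarrow> nat \<Rightarrow> ('a, 'e) vbundle \<Rightarrow> ('a \<Rightarrow> 'e \<Rightarrow> ennreal)
      \<Rightarrow> ('a chart \<Rightarrow> 'a \<Rightarrow> complex mat) \<Rightarrow> 'a set \<Rightarrow> ('a chart \<Rightarrow> 'a \<Rightarrow> 'e) set" where
  "GR_L2 X n E h \<omega> U = {s \<in> GR_tensor X n E U.
     \<forall>x\<in>U. \<exists>B. openin (top X) B \<and> x \<in> B \<and> B \<subseteq> U \<and>
       integral_density X n (B \<inter> reg X)
         (\<lambda>c y. norm_sq_form h \<omega> s c y * volume_density \<omega> c y) < \<infinity>}"

text \<open>Sections over \<open>W\<close> of the sheaf of locally square integrable holomorphic sections of a bundle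
  on a complex manifold; local integrability may be tested in any chart.\<close>

definition L2_section ::
    "'a cspace \<Rightarrow> nat \<Rightarrow> ('a, 'e) vbundle \<Rightarrow> ('a \<Rightarrow> 'e \<Rightarrow> ennreal) \<Rightarrow> 'a set \<Rightarrow> ('a \<Rightarrow> 'e) \<Rightarrow> bool" where
  "L2_section M n E h W s \<longleftrightarrow> hol_section M E W s \<and>
     (\<forall>x\<in>W. \<exists>c B. is_chart M n c \<and> openin (top M) B \<and> x \<in> B \<and> B \<subseteq> fst c \<inter> W \<and>
        (\<integral>\<^sup>+z\<in>snd c ` B. h (inv_chart c z) (s (inv_chart c z)) \<partial>lebesgue_Cn n) < \<infinity>)"

text \<open>Tensor product of that sheaf with the canonical line bundle: in the local frame
  \<open>dz\<^sub>0 \<and> \<dots> \<and> dz\<^sub>n\<^sub>-\<^sub>1\<close> of the latter, the coefficient belongs to the sheaf.\<close>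

definition K_tensor_L2 ::
    "'a cspace \<Rightarrow> nat \<Rightarrow> ('a, 'e) vbundle \<Rightarrow> ('a \<Rightarrow> 'e \<Rightarrow> ennreal) \<Rightarrow> 'a set
      \<Rightarrow> ('a chart \<Rightarrow> 'a \<Rightarrow> 'e) set" where
  "K_tensor_L2 M n E h W = {s \<in> E_forms M n E W.
     \<forall>c. is_chart M n c \<longrightarrow> L2_section M n E h (fst c \<inter> W) (s c)}"

section \<open>Pullback of forms and direct images\<close>

definition direct_image :: "'b cspace \<Rightarrow> ('b \<Rightarrow> 'a) \<Rightarrow> ('b set \<Rightarrow> 's set) \<Rightarrow> 'a set \<Rightarrow> 's set" where
  "direct_image Y p \<F> U = \<F> (preim Y p U)"

text \<open>\<open>t\<close> agrees with the pullback of the form \<open>s\<close> wherever the latter is defined, i.e. over the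
  regular part of \<open>U\<close>. Equality in the fibre is expressed in a trivialization, as scalar multiplication
  is involved.\<close>

definition is_pullback_form ::
    "'b cspace \<Rightarrow> 'a cspace \<Rightarrow> ('b \<Rightarrow> 'a) \<Rightarrow> nat \<Rightarrow> ('a, 'e) vbundle \<Rightarrow> 'a set
      \<Rightarrow> ('a chart \<Rightarrow> 'a \<Rightarrow> 'e) \<Rightarrow> ('b chart \<Rightarrow> 'b \<Rightarrow> 'e) \<Rightarrow> bool" where
  "is_pullback_form Y X p n E U s t \<longleftrightarrow>
     (\<forall>c' c y. is_chart Y n c' \<longrightarrow> is_chart X n c \<longrightarrow> y \<in> fst c' \<longrightarrow> p y \<in> fst c \<inter> U \<inter> reg X \<longrightarrow>
        (\<forall>(V, r, \<tau>)\<in>trivs E. p y \<in> V \<longrightarrow>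
           \<tau> (p y) (t c' y) =
             Determinant.det (jacobian n n (snd c \<circ> p \<circ> inv_chart c') (snd c' y))
               \<cdot>\<^sub>v \<tau> (p y) (s c (p y))))"

text \<open>
  The canonical identification of a sheaf \<open>\<G>\<close> of \<open>E\<close>-valued forms on the regular locus of \<open>X\<close> with
  the direct image of a sheaf \<open>\<F>\<close> of forms on \<open>Y\<close>: over every open set, pullback of forms is a
  bijection between the sections. (On spaces of pure dimension \<open>n\<close> the map \<open>\<Phi>\<close> is determined by
  the pullback condition, since holomorphic forms agreeing on a dense set are equal; hence it is
  linear over the structure sheaf and compatible with restrictions.)
\<close>

definition equals_direct_image ::
    "'b cspace \<Rightarrow> 'a cspace \<Rightarrow> ('b \<Rightarrow> 'a) \<Rightarrow> nat \<Rightarrow> ('a, 'e) vbundle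
      \<Rightarrow> ('a set \<Rightarrow> ('a chart \<Rightarrow> 'a \<Rightarrow> 'e) set) \<Rightarrow> ('b set \<Rightarrow> ('b chart \<Rightarrow> 'b \<Rightarrow> 'e) set) \<Rightarrow> bool" where
  "equals_direct_image Y X p n E \<G> \<F> \<longleftrightarrow> (\<forall>U. openin (top X) U \<longrightarrow>
     (\<exists>\<Phi>. bij_betw \<Phi> (\<G> U) (direct_image Y p \<F> U) \<and>
        (\<forall>s\<in>\<G> U. is_pullback_form Y X p n E U s (\<Phi> s))))"

end

theory Submission
  imports Defs "HOL-Complex_Analysis.Complex_Analysis"
begin

text \<open>
  For a form with values in \<open>E\<close>, the measure \<open>\<bar>s\<bar>\<^sup>2 dV\<close> built from \<open>h\<close> and \<open>\<omega>\<close> does not depend on \<open>\<omega>\<close>: in a chart it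
  is the squared \<open>h\<close>-norm of the coefficient times Lebesgue measure (\<open>norm_volume\<close>). It is thus natural under
  biholomorphic maps, by the change of variables formula (\<open>nn_integral_change_of_variables\<close>).

  Let \<open>p\<close> be a modification of \<open>X\<close> by a manifold \<open>Y\<close>, biholomorphic outside the nowhere dense analytic set \<open>S\<close> and its
  preimage \<open>T\<close>. Both are null sets in all charts. Hence the integral of a form over a part of \<open>X\<close> is the integral of its
  pullback over the preimage. Because \<open>p\<close> is proper, the fibre over a point \<open>x\<close>, singular or not, is compact, and
  neighbourhoods of the fibre contain preimages of neighbourhoods of \<open>x\<close>. So integrability near \<open>x\<close> follows from
  integrability near each point of the fibre (\<open>dominated_finite_local\<close>), and the reverse implication is immediate
  (\<open>push_piece_le\<close>).

  It remains to extend forms. A form on the regular locus of \<open>X\<close> is pulled back to \<open>Y - T\<close>, where its components in a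
  frame of \<open>E\<close> are locally square integrable up to \<open>T\<close>, since those of the given form belong to the
  Grauert--Riemenschneider sheaf; and square integrable holomorphic functions extend across nowhere dense analytic sets
  (\<open>L2_extend\<close>, \<open>E_forms_extend\<close>). This gives the pullback (\<open>pullback_exists\<close>). Conversely, a form on \<open>Y\<close> is
  transported to \<open>X - S\<close>. Its components are bounded upstairs, hence square integrable downstairs, and the
  transported form extends to the regular locus (\<open>pushforward_exists\<close>). The two constructions are inverse to each
  other, as forms are determined by their values on dense sets. The equality of the sheaves on a manifold is the case of
  the identity map.

  The extension theorem is reduced to one complex variable: on almost every line in a suitable direction the function
  is square integrable with finitely many isolated singularities, which are removable, and the mean over a circle free of
  singularities is the desired extension.

  All nonnegative integrals are lower integrals. The estimates between densities on \<open>X\<close> and \<open>Y\<close> use only properties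
  that lower integrals share, namely monotonicity, superadditivity on disjoint pieces, subadditivity on covers by
  measurable sets, and transformation under biholomorphic maps.
\<close>

unbundle no vec_syntax
no_notation fps_nth (infixl \<open>$\<close> 75)

section \<open>Polydiscs and continuity\<close>

abbreviation tuples :: "nat \<Rightarrow> (nat \<Rightarrow> complex) set" where
  "tuples n \<equiv> {..<n} \<rightarrow>\<^sub>E UNIV"

definition polydisc :: "nat \<Rightarrow> (nat \<Rightarrow> complex) \<Rightarrow> real \<Rightarrow> (nat \<Rightarrow> complex) set" where
  "polydisc n a e = {z \<in> tuples n. \<forall>i<n. dist (z i) (a i) < e}"

lemma topspace_Cn [simp]: "topspace (Cn n) = tuples n"
  by (simp add: Cn_def topspace_product_topology)

lemma tuples_upd [simp]: "z \<in> tuples n \<Longrightarrow> i < n \<Longrightarrow> z(i := w) \<in> tuples n"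
  by (auto simp: PiE_def extensional_def)

lemma tuples_eqI: "z \<in> tuples n \<Longrightarrow> y \<in> tuples n \<Longrightarrow> (\<And>i. i < n \<Longrightarrow> z i = y i) \<Longrightarrow> z = y"
  by (rule PiE_ext[of z "{..<n}" "\<lambda>_. UNIV" y]) auto

lemma polydisc_tuples: "polydisc n a e \<subseteq> tuples n"
  by (auto simp: polydisc_def)

lemma polydisc_centre: "a \<in> tuples n \<Longrightarrow> 0 < e \<Longrightarrow> a \<in> polydisc n a e"
  by (simp add: polydisc_def)

lemma polydisc_mono: "d \<le> e \<Longrightarrow> polydisc n a d \<subseteq> polydisc n a e"
  by (force simp: polydisc_def)

lemma polydisc_triangle:
  assumes "b \<in> polydisc n a d" "d + d' \<le> e"
  shows "polydisc n b d' \<subseteq> polydisc n a e"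
proof
  fix z assume "z \<in> polydisc n b d'"
  then show "z \<in> polydisc n a e"
    using assms unfolding polydisc_def
    by (smt (verit, best) dist_triangle mem_Collect_eq)
qed

lemma polydisc_upd:
  "z \<in> polydisc n a e \<Longrightarrow> i < n \<Longrightarrow> dist w (a i) < e \<Longrightarrow> z(i := w) \<in> polydisc n a e"
  by (simp add: polydisc_def)

lemma openin_polydisc: "openin (Cn n) (polydisc n a e)"
proof -
  have "polydisc n a e = PiE {..<n} (\<lambda>i. ball (a i) e)"
    by (fastforce simp: polydisc_def PiE_def Pi_def dist_commute extensional_def)
  then show ?thesis
    by (simp add: Cn_def openin_PiE)
qed

lemma openin_Cn_iff:
  "openin (Cn n) D \<longleftrightarrow> D \<subseteq> tuples n \<and> (\<forall>a\<in>D. \<exists>e>0. polydisc n a e \<subseteq> D)"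
proof (intro iffI conjI ballI)
  assume D: "openin (Cn n) D"
  then show "D \<subseteq> tuples n"
    using openin_subset by fastforce
  fix a assume "a \<in> D"
  then have "\<exists>U. (\<forall>i\<in>{..<n}. open (U i)) \<and> a \<in> PiE {..<n} U \<and> PiE {..<n} U \<subseteq> D"
    using D unfolding Cn_def openin_product_topology_alt by auto
  then obtain U where U: "\<And>i. i < n \<Longrightarrow> open (U i)" "a \<in> PiE {..<n} U" "PiE {..<n} U \<subseteq> D"
    by (metis lessThan_iff)
  have "\<exists>e>0. ball (a i) e \<subseteq> U i" if "i < n" for i
    using U(1)[OF that] U(2) that open_contains_ball by (metis PiE_mem lessThan_iff)
  then obtain e where e: "\<And>i. i < n \<Longrightarrow> e i > 0" "\<And>i. i < n \<Longrightarrow> ball (a i) (e i) \<subseteq> U i"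
    by metis
  define d where "d = Min (insert 1 (e ` {..<n}))"
  have "d > 0" unfolding d_def using e(1) by (subst Min_gr_iff) auto
  have "polydisc n a d \<subseteq> PiE {..<n} U"
  proof
    fix z assume z: "z \<in> polydisc n a d"
    have "z i \<in> U i" if "i < n" for i
    proof -
      have "d \<le> e i" unfolding d_def using that by (intro Min_le) auto
      then have "z i \<in> ball (a i) (e i)" using z that by (auto simp: polydisc_def dist_commute)
      then show ?thesis using e(2)[OF that] by blast
    qed
    then show "z \<in> PiE {..<n} U" using z by (auto simp: polydisc_def PiE_def)
  qed
  then show "\<exists>e>0. polydisc n a e \<subseteq> D" using \<open>d > 0\<close> U(3) by blast
next
  assume D: "D \<subseteq> tuples n \<and> (\<forall>a\<in>D. \<exists>e>0. polydisc n a e \<subseteq> D)"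
  show "openin (Cn n) D"
  proof (subst openin_subopen, intro ballI)
    fix a assume "a \<in> D"
    then obtain e where "e > 0" "polydisc n a e \<subseteq> D" using D by blast
    then show "\<exists>T. openin (Cn n) T \<and> a \<in> T \<and> T \<subseteq> D"
      using openin_polydisc polydisc_centre[of a n e] \<open>a \<in> D\<close> D by (intro exI[of _ "polydisc n a e"]) auto
  qed
qed

lemma openin_CnD:
  assumes "openin (Cn n) D"
  shows "D \<subseteq> tuples n" "a \<in> D \<Longrightarrow> \<exists>e>0. polydisc n a e \<subseteq> D"
  using assms openin_Cn_iff by auto

lemma continuous_Cn_iff:
  fixes f :: "_ \<Rightarrow> 'b::metric_space"
  assumes D: "openin (Cn n) D"
  shows "continuous_map (subtopology (Cn n) D) euclidean f \<longleftrightarrow>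
    (\<forall>a\<in>D. \<forall>e>0. \<exists>d>0. polydisc n a d \<subseteq> D \<and> (\<forall>z\<in>polydisc n a d. dist (f z) (f a) < e))"
proof
  assume f: "continuous_map (subtopology (Cn n) D) euclidean f"
  show "\<forall>a\<in>D. \<forall>e>0. \<exists>d>0. polydisc n a d \<subseteq> D \<and> (\<forall>z\<in>polydisc n a d. dist (f z) (f a) < e)"
  proof (intro ballI allI impI)
    fix a and e :: real assume a: "a \<in> D" "e > 0"
    have "openin (subtopology (Cn n) D) {x \<in> topspace (subtopology (Cn n) D). f x \<in> ball (f a) e}"
      using f by (rule openin_continuous_map_preimage) auto
    then have "openin (Cn n) {x \<in> topspace (subtopology (Cn n) D). f x \<in> ball (f a) e}"
      using D openin_open_subtopology by blast
    moreover have "a \<in> {x \<in> topspace (subtopology (Cn n) D). f x \<in> ball (f a) e}"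
      using a openin_CnD(1)[OF D] by auto
    ultimately obtain d where "d > 0"
      "polydisc n a d \<subseteq> {x \<in> topspace (subtopology (Cn n) D). f x \<in> ball (f a) e}"
      using openin_CnD(2) by blast
    then show "\<exists>d>0. polydisc n a d \<subseteq> D \<and> (\<forall>z\<in>polydisc n a d. dist (f z) (f a) < e)"
      by (intro exI[of _ d]) (auto simp: dist_commute)
  qed
next
  assume *: "\<forall>a\<in>D. \<forall>e>0. \<exists>d>0. polydisc n a d \<subseteq> D \<and> (\<forall>z\<in>polydisc n a d. dist (f z) (f a) < e)"
  have top: "topspace (subtopology (Cn n) D) = D" using openin_CnD(1)[OF D] by auto
  show "continuous_map (subtopology (Cn n) D) euclidean f"
    unfolding continuous_map_def
  proof (intro conjI allI impI)
    fix U :: "'b set" assume "openin euclidean U"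
    then have U: "open U" by simp
    have "openin (Cn n) {x \<in> D. f x \<in> U}"
      unfolding openin_Cn_iff
    proof (intro conjI ballI)
      fix a assume a: "a \<in> {x \<in> D. f x \<in> U}"
      then obtain e where e: "e > 0" "ball (f a) e \<subseteq> U" using U open_contains_ball by blast
      then obtain d where "d > 0" "polydisc n a d \<subseteq> D" "\<forall>z\<in>polydisc n a d. dist (f z) (f a) < e"
        using * a by blast
      then show "\<exists>e>0. polydisc n a e \<subseteq> {x \<in> D. f x \<in> U}"
        using e by (intro exI[of _ d]) (auto simp: dist_commute)
    qed (use openin_CnD(1)[OF D] in auto)
    then show "openin (subtopology (Cn n) D) {x \<in> topspace (subtopology (Cn n) D). f x \<in> U}"
      using D top by (simp add: openin_open_subtopology)
  qed auto
qed

lemma continuous_CnD: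
  fixes f :: "_ \<Rightarrow> 'b::metric_space"
  assumes "continuous_map (subtopology (Cn n) D) euclidean f" "openin (Cn n) D" "a \<in> D" "e > 0"
  obtains d where "d > 0" "polydisc n a d \<subseteq> D" "\<And>z. z \<in> polydisc n a d \<Longrightarrow> dist (f z) (f a) < e"
  using assms continuous_Cn_iff[OF assms(2), of f] by blast

lemma continuous_map_into_Cn:
  "continuous_map T (Cn n) g \<longleftrightarrow>
     g \<in> topspace T \<rightarrow> tuples n \<and> (\<forall>i<n. continuous_map T euclidean (\<lambda>x. g x i))"
  by (auto simp: Cn_def continuous_map_componentwise PiE_def Pi_def)

lemma continuous_map_coordinate:
  "i < n \<Longrightarrow> continuous_map (subtopology (Cn n) D) euclidean (\<lambda>z. z i)"
  unfolding Cn_def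
  by (intro continuous_map_from_subtopology continuous_map_product_projection) auto

text \<open>A Lebesgue number argument; it stands in for uniform continuity near compact sets.\<close>

lemma uniform_near_compact:
  fixes f :: "_ \<Rightarrow> 'b::metric_space"
  assumes D: "openin (Cn n) D" and f: "continuous_map (subtopology (Cn n) D) euclidean f"
    and K: "compactin (Cn n) K" "K \<subseteq> D" and e: "e > 0"
  obtains d where "d > 0" "\<And>k z. k \<in> K \<Longrightarrow> z \<in> polydisc n k d \<Longrightarrow> z \<in> D \<and> dist (f z) (f k) < e"
proof -
  have "\<exists>d>0. polydisc n k d \<subseteq> D \<and> (\<forall>z\<in>polydisc n k d. dist (f z) (f k) < e / 2)" if "k \<in> K" for k
    using continuous_CnD[OF f D, of k "e/2"] K(2) e that by (metis half_gt_zero subsetD)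
  then obtain d where d: "\<And>k. k \<in> K \<Longrightarrow> d k > 0" "\<And>k. k \<in> K \<Longrightarrow> polydisc n k (d k) \<subseteq> D"
     "\<And>k z. k \<in> K \<Longrightarrow> z \<in> polydisc n k (d k) \<Longrightarrow> dist (f z) (f k) < e / 2"
    by metis
  let ?U = "(\<lambda>k. polydisc n k (d k / 2)) ` K"
  have KT: "K \<subseteq> tuples n" using K(2) openin_CnD(1)[OF D] by blast
  have "k \<in> polydisc n k (d k / 2)" if "k \<in> K" for k
    using d(1)[OF that] KT that by (intro polydisc_centre) auto
  then have "K \<subseteq> \<Union>?U" by blast
  moreover have "\<forall>u\<in>?U. openin (Cn n) u" using openin_polydisc by auto
  ultimately obtain F where F: "finite F" "F \<subseteq> ?U" "K \<subseteq> \<Union>F"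
    using compactinD[OF K(1), of ?U] by blast
  then obtain K0 where K0: "K0 \<subseteq> K" "finite K0" "F = (\<lambda>k. polydisc n k (d k / 2)) ` K0"
    by (meson finite_subset_image)
  define \<delta> where "\<delta> = Min (insert 1 ((\<lambda>k. d k / 2) ` K0))"
  have "\<delta> > 0" unfolding \<delta>_def using K0 d(1) by (subst Min_gr_iff) auto
  moreover have "z \<in> D \<and> dist (f z) (f k) < e" if k: "k \<in> K" and z: "z \<in> polydisc n k \<delta>" for k z
  proof -
    obtain k0 where k0: "k0 \<in> K0" "k \<in> polydisc n k0 (d k0 / 2)" using F(3) K0(3) k by blast
    have "\<delta> \<le> d k0 / 2" unfolding \<delta>_def using K0 k0 by (intro Min_le) auto
    then have "z \<in> polydisc n k0 (d k0)" using polydisc_triangle[OF k0(2), of \<delta> "d k0"] z by auto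
    moreover have "k \<in> polydisc n k0 (d k0)"
      using k0 polydisc_mono[of "d k0 / 2" "d k0" n k0] d(1) K0(1)
      by (metis field_sum_of_halves less_add_same_cancel1 half_gt_zero less_imp_le subsetD)
    ultimately have "z \<in> D" "dist (f z) (f k0) < e / 2" "dist (f k) (f k0) < e / 2"
      using d k0(1) K0(1) by blast+
    then show ?thesis using dist_triangle_half_l by blast
  qed
  ultimately show ?thesis using that by blast
qed

section \<open>Holomorphic functions of several variables\<close>

lemma holo_openD: "holo n D f \<Longrightarrow> openin (Cn n) D"
  and holo_contD: "holo n D f \<Longrightarrow> continuous_map (subtopology (Cn n) D) euclidean f"
  by (auto simp: holo_def)

lemma holo_pderiv:
  "holo n D f \<Longrightarrow> z \<in> D \<Longrightarrow> i < n \<Longrightarrow>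
    ((\<lambda>w. f (z(i := w))) has_field_derivative pderiv_at i f z) (at (z i))"
  by (simp add: holo_def pderiv_at_def field_differentiable_derivI)

lemma holo_pderiv_upd:
  assumes "holo n D f" "z(i := w) \<in> D" "i < n"
  shows "((\<lambda>w. f (z(i := w))) has_field_derivative pderiv_at i f (z(i := w))) (at w)"
  using holo_pderiv[OF assms] by simp

lemma pderiv_at_upd: "pderiv_at i f (z(i := w)) = deriv (\<lambda>w. f (z(i := w))) w"
  by (simp add: pderiv_at_def)

text \<open>For \<open>z\<close> close to \<open>a\<close>, the functions \<open>w \<mapsto> f (z(i := w))\<close> and \<open>w \<mapsto> f (a(i := w))\<close> are uniformly
  close on a disc, and Cauchy's inequality passes this on to their derivatives.\<close>

lemma continuous_pderiv:
  assumes f: "holo n D f" and i: "i < n"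
  shows "continuous_map (subtopology (Cn n) D) euclidean (pderiv_at i f)"
proof (subst continuous_Cn_iff[OF holo_openD[OF f]], intro ballI allI impI)
  fix a and \<epsilon> :: real assume a: "a \<in> D" and \<epsilon>: "\<epsilon> > 0"
  have D: "openin (Cn n) D" using f holo_openD by blast
  then obtain e where e: "e > 0" "polydisc n a e \<subseteq> D" using openin_CnD(2)[OF D a] by blast
  have aT: "a \<in> tuples n" using a openin_CnD(1)[OF D] by blast
  define K where "K = (\<lambda>w. a(i := w)) ` cball (a i) (e/2)"
  have contg: "continuous_map euclidean (Cn n) (\<lambda>w. a(i := w))"
    using aT i by (auto simp: continuous_map_into_Cn)
  then have K: "compactin (Cn n) K"
    unfolding K_def by (intro image_compactin[OF _ contg]) auto
  have "a(i := w) \<in> polydisc n a e" if "w \<in> cball (a i) (e/2)" for w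
    using that e(1) i by (intro polydisc_upd polydisc_centre aT) (auto simp: dist_commute)
  then have KD: "K \<subseteq> D" using e(2) by (auto simp: K_def)
  define \<eta> where "\<eta> = \<epsilon> * e / 16"
  have "\<eta> > 0" using \<epsilon> e by (simp add: \<eta>_def)
  from uniform_near_compact[OF D holo_contD[OF f] K KD this]
  obtain d where d: "d > 0" "\<And>k z. k \<in> K \<Longrightarrow> z \<in> polydisc n k d \<Longrightarrow> z \<in> D \<and> dist (f z) (f k) < \<eta>"
    by blast
  let ?\<phi> = "\<lambda>w. f (a(i := w))"
  have "?\<phi> field_differentiable at w" if "w \<in> ball (a i) (e/2)" for w
  proof -
    have "a(i := w) \<in> D" using KD that by (auto simp: K_def)
    then show ?thesis using holo_pderiv_upd[OF f _ i] field_differentiable_def by blast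
  qed
  then have hol: "?\<phi> holomorphic_on ball (a i) (e/2)"
    by (simp add: holomorphic_on_def field_differentiable_at_within)
  then have "continuous_on (ball (a i) (e/2)) (deriv ?\<phi>)"
    by (intro holomorphic_on_imp_continuous_on holomorphic_deriv) auto
  then have "isCont (deriv ?\<phi>) (a i)"
    using e by (simp add: continuous_on_eq_continuous_at)
  then obtain d2 where d2: "d2 > 0" "\<And>w. dist w (a i) < d2 \<Longrightarrow> dist (deriv ?\<phi> w) (deriv ?\<phi> (a i)) < \<epsilon>/2"
    unfolding continuous_at_eps_delta using \<epsilon> by (meson half_gt_zero)
  define d3 where "d3 = Min {d, d2, e/4}"
  have d3: "d3 > 0" "d3 \<le> d" "d3 \<le> d2" "d3 \<le> e/4" using d d2 e by (auto simp: d3_def)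
  have "dist (pderiv_at i f z) (pderiv_at i f a) < \<epsilon>" if z: "z \<in> polydisc n a d3" for z
  proof -
    have zT: "z \<in> tuples n" using z by (simp add: polydisc_def)
    have zi: "dist (z i) (a i) < d3" using z i by (simp add: polydisc_def)
    have near: "z(i := w) \<in> D \<and> dist (f (z(i := w))) (f (a(i := w))) < \<eta>" if w: "w \<in> cball (a i) (e/2)" for w
    proof (rule d(2))
      show "a(i := w) \<in> K" using w by (auto simp: K_def)
      have "dist (z j) (a j) < d" if "j < n" for j using z d3 that by (force simp: polydisc_def)
      then show "z(i := w) \<in> polydisc n (a(i := w)) d" using zT i d(1)
        by (auto simp: polydisc_def)
    qed
    let ?\<psi> = "\<lambda>w. f (z(i := w)) - f (a(i := w))"
    have sub: "cball (z i) (e/4) \<subseteq> cball (a i) (e/2)"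
    proof
      fix w assume "w \<in> cball (z i) (e/4)"
      then show "w \<in> cball (a i) (e/2)" using zi d3 dist_triangle[of "a i" w "z i"] by (auto simp: dist_commute)
    qed
    have der: "(?\<psi> has_field_derivative pderiv_at i f (z(i := w)) - pderiv_at i f (a(i := w))) (at w)"
      if "w \<in> cball (a i) (e/2)" for w
      using near[OF that] KD that by (intro DERIV_diff holo_pderiv_upd[OF f _ i]) (auto simp: K_def)
    have holw: "?\<psi> holomorphic_on cball (z i) (e/4)"
      using der sub unfolding holomorphic_on_def field_differentiable_def
      by (meson has_field_derivative_at_within subsetD)
    have "norm ((deriv ^^ 1) ?\<psi> (z i)) \<le> fact 1 * \<eta> / (e/4)^1"
    proof (rule Cauchy_inequality)
      show "?\<psi> holomorphic_on ball (z i) (e/4)" using holw by (rule holomorphic_on_subset) auto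
      show "continuous_on (cball (z i) (e/4)) ?\<psi>" using holw by (rule holomorphic_on_imp_continuous_on)
      show "norm (?\<psi> x) \<le> \<eta>" if "norm (z i - x) = e/4" for x
        using near[of x] sub that by (force simp: dist_norm)
    qed (use e in auto)
    moreover have "deriv ?\<psi> (z i) = pderiv_at i f z - pderiv_at i f (a(i := z i))"
      using DERIV_imp_deriv[OF der[of "z i"]] zi d3 e by (simp add: dist_commute)
    ultimately have "norm (pderiv_at i f z - pderiv_at i f (a(i := z i))) \<le> \<epsilon> / 4"
      using e by (simp add: \<eta>_def)
    moreover have "dist (pderiv_at i f (a(i := z i))) (pderiv_at i f a) < \<epsilon>/2"
      using d2(2)[of "z i"] zi d3 pderiv_at_upd[of i f a "z i"] by (simp add: pderiv_at_def)
    ultimately show ?thesis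
      using dist_triangle[of "pderiv_at i f z" "pderiv_at i f a" "pderiv_at i f (a(i := z i))"] \<epsilon>
      by (simp add: dist_norm)
  qed
  moreover have "polydisc n a d3 \<subseteq> D" using d3 e polydisc_mono[of d3 e n a] by auto
  ultimately show "\<exists>d>0. polydisc n a d \<subseteq> D \<and> (\<forall>z\<in>polydisc n a d. dist (pderiv_at i f z) (pderiv_at i f a) < \<epsilon>)"
    using d3(1) by blast
qed

text \<open>Separate holomorphy gives the partial derivatives, and their continuity makes them a total
  derivative.\<close>

lemma holo_total_derivative:
  assumes f: "holo n D f" and b: "b \<in> D" and \<epsilon>: "\<epsilon> > 0"
  obtains d where "d > 0" "polydisc n b d \<subseteq> D"
    "\<And>y. y \<in> polydisc n b d \<Longrightarrow>
       cmod (f y - f b - (\<Sum>i<n. pderiv_at i f b * (y i - b i))) \<le> \<epsilon> * (\<Sum>i<n. cmod (y i - b i))"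
proof -
  have D: "openin (Cn n) D" using f holo_openD by blast
  have bT: "b \<in> tuples n" using b openin_CnD(1)[OF D] by blast
  have "\<exists>d>0. polydisc n b d \<subseteq> D \<and> (\<forall>z\<in>polydisc n b d. dist (pderiv_at i f z) (pderiv_at i f b) < \<epsilon>)"
    if "i < n" for i
    using continuous_CnD[OF continuous_pderiv[OF f that] D b \<epsilon>] by metis
  then obtain e where e: "\<And>i. i < n \<Longrightarrow> e i > 0" 
    "\<And>i z. i < n \<Longrightarrow> z \<in> polydisc n b (e i) \<Longrightarrow> dist (pderiv_at i f z) (pderiv_at i f b) < \<epsilon>"
    by metis
  obtain e0 where e0: "e0 > 0" "polydisc n b e0 \<subseteq> D" using openin_CnD(2)[OF D b] by blast
  define d where "d = Min (insert e0 (e ` {..<n}))"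
  have d: "d > 0" unfolding d_def using e(1) e0 by (subst Min_gr_iff) auto
  have dle: "d \<le> e0" "\<And>i. i < n \<Longrightarrow> d \<le> e i" unfolding d_def by (auto intro!: Min_le)
  have sub: "polydisc n b d \<subseteq> D" using polydisc_mono[OF dle(1)] e0(2) by blast
  have "cmod (f y - f b - (\<Sum>i<n. pderiv_at i f b * (y i - b i))) \<le> \<epsilon> * (\<Sum>i<n. cmod (y i - b i))"
    if y: "y \<in> polydisc n b d" for y
  proof -
    \<comment> \<open>replace the coordinates one after the other\<close>
    define p where "p k = (\<lambda>i. if i < k then y i else b i)" for k :: nat
    have yT: "y \<in> tuples n" using y by (simp add: polydisc_def)
    have pn: "p n = y" using yT bT by (auto simp: p_def PiE_def extensional_def)
    have p0: "p 0 = b" by (simp add: p_def)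
    have step: "cmod (f (p (Suc k)) - f (p k) - pderiv_at k f b * (y k - b k)) \<le> \<epsilon> * cmod (y k - b k)"
      if k: "k < n" for k
    proof -
      have pS: "p (Suc k) = (p k)(k := y k)" by (auto simp: p_def fun_eq_iff less_Suc_eq)
      have pk: "p k = (p k)(k := b k)" by (auto simp: p_def fun_eq_iff)
      let ?S = "ball (b k) d"
      let ?\<psi> = "\<lambda>w. f ((p k)(k := w)) - pderiv_at k f b * w"
      have mem: "(p k)(k := w) \<in> polydisc n b d" if "w \<in> ?S" for w
        using y k bT that d by (auto simp: polydisc_def p_def PiE_def extensional_def dist_commute)
      have der: "(?\<psi> has_field_derivative (pderiv_at k f ((p k)(k := w)) - pderiv_at k f b)) (at w within ?S)"
        if "w \<in> ?S" for w
        using mem[OF that] sub k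
        by (intro DERIV_diff has_field_derivative_at_within[OF holo_pderiv_upd[OF f]])
           (auto intro!: derivative_eq_intros)
      have "cmod (?\<psi> (y k) - ?\<psi> (b k)) \<le> \<epsilon> * cmod (y k - b k)"
      proof (rule field_differentiable_bound[OF convex_ball der])
        fix w assume "w \<in> ?S"
        then have "(p k)(k := w) \<in> polydisc n b (e k)" using mem polydisc_mono[OF dle(2)[OF k]] by blast
        then show "cmod (pderiv_at k f ((p k)(k := w)) - pderiv_at k f b) \<le> \<epsilon>"
          using e(2)[OF k] by (force simp: dist_norm)
      qed (use y k d in \<open>auto simp: polydisc_def dist_commute\<close>)
      then show ?thesis using pS pk by (simp add: algebra_simps)
    qed
    have "f y - f b = (\<Sum>k<n. f (p (Suc k)) - f (p k))"
      by (subst sum_lessThan_telescope) (simp add: pn p0)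
    then have "cmod (f y - f b - (\<Sum>i<n. pderiv_at i f b * (y i - b i)))
        = cmod (\<Sum>k<n. f (p (Suc k)) - f (p k) - pderiv_at k f b * (y k - b k))"
      by (simp add: sum_subtractf)
    also have "\<dots> \<le> (\<Sum>k<n. \<epsilon> * cmod (y k - b k))"
      using step by (intro sum_norm_le) auto
    finally show ?thesis by (simp add: sum_distrib_left)
  qed
  then show ?thesis using that d sub by blast
qed

text \<open>The total derivative yields the chain rule. The parameter is complex, so that this covers the
  restriction of \<open>f\<close> to complex lines as well as, one variable at a time, composition with holomorphic maps.\<close>

lemma holo_curve:
  assumes f: "holo n D f" and mem: "\<gamma> w0 \<in> D" "\<forall>\<^sub>F w in at w0. \<gamma> w \<in> tuples n"
    and \<gamma>: "\<And>i. i < n \<Longrightarrow> ((\<lambda>w. \<gamma> w i) has_field_derivative d i) (at w0)"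
  shows "((\<lambda>w. f (\<gamma> w)) has_field_derivative (\<Sum>i<n. pderiv_at i f (\<gamma> w0) * d i)) (at w0)"
proof -
  let ?p = "\<lambda>i. pderiv_at i f (\<gamma> w0)"
  let ?q = "\<lambda>i w. (\<gamma> w i - \<gamma> w0 i) / (w - w0)"
  define R where "R w = (f (\<gamma> w) - f (\<gamma> w0) - (\<Sum>i<n. ?p i * (\<gamma> w i - \<gamma> w0 i))) / (w - w0)" for w
  have q: "(?q i \<longlongrightarrow> d i) (at w0)" if "i < n" for i
    using \<gamma>[OF that] by (simp add: has_field_derivative_iff)
  define C where "C = (\<Sum>i<n. cmod (d i))"
  have C: "0 \<le> C" by (simp add: C_def sum_nonneg)
  have "((\<lambda>w. \<Sum>i<n. cmod (?q i w)) \<longlongrightarrow> C) (at w0)"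
    unfolding C_def using q by (intro tendsto_sum tendsto_norm) auto
  then have evC: "\<forall>\<^sub>F w in at w0. (\<Sum>i<n. cmod (?q i w)) < C + 1"
    by (rule order_tendstoD) simp
  have "(R \<longlongrightarrow> 0) (at w0)"
  proof (rule tendstoI)
    fix \<epsilon> :: real assume \<epsilon>: "\<epsilon> > 0"
    define \<epsilon>' where "\<epsilon>' = \<epsilon> / (C + 1)"
    have \<epsilon>': "\<epsilon>' > 0" "\<epsilon>' * (C + 1) = \<epsilon>" using \<epsilon> C by (auto simp: \<epsilon>'_def)
    obtain \<delta> where \<delta>: "\<delta> > 0" "\<And>y. y \<in> polydisc n (\<gamma> w0) \<delta> \<Longrightarrow>
       cmod (f y - f (\<gamma> w0) - (\<Sum>i<n. ?p i * (y i - \<gamma> w0 i))) \<le> \<epsilon>' * (\<Sum>i<n. cmod (y i - \<gamma> w0 i))"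
      by (rule holo_total_derivative[OF f mem(1) \<epsilon>'(1)]) (rule that)
    have "\<forall>\<^sub>F w in at w0. dist (\<gamma> w i) (\<gamma> w0 i) < \<delta>" if "i < n" for i
      using DERIV_isCont[OF \<gamma>[OF that]] \<delta>(1) unfolding isCont_def by (rule tendstoD)
    then have "\<forall>\<^sub>F w in at w0. \<forall>i\<in>{..<n}. dist (\<gamma> w i) (\<gamma> w0 i) < \<delta>"
      by (intro eventually_ball_finite) auto
    moreover have "\<forall>\<^sub>F w in at w0. w \<noteq> w0" by (simp add: eventually_at_filter)
    ultimately show "\<forall>\<^sub>F w in at w0. dist (R w) 0 < \<epsilon>"
      using evC mem(2)
    proof eventually_elim
      case (elim w)
      then have "\<gamma> w \<in> polydisc n (\<gamma> w0) \<delta>" by (auto simp: polydisc_def)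
      then have "cmod (R w) \<le> \<epsilon>' * (\<Sum>i<n. cmod (\<gamma> w i - \<gamma> w0 i)) / cmod (w - w0)"
        unfolding R_def norm_divide by (intro divide_right_mono \<delta>(2)) auto
      also have "\<dots> = \<epsilon>' * (\<Sum>i<n. cmod (?q i w))"
        by (simp add: sum_divide_distrib[symmetric] norm_divide)
      also have "\<dots> < \<epsilon>' * (C + 1)" using elim \<epsilon>'(1) by (intro mult_strict_left_mono) auto
      finally show ?case using \<epsilon>'(2) by simp
    qed
  qed
  then have "((\<lambda>w. R w + (\<Sum>i<n. ?p i * ?q i w)) \<longlongrightarrow> 0 + (\<Sum>i<n. ?p i * d i)) (at w0)"
    using q by (intro tendsto_add tendsto_sum tendsto_mult tendsto_const) auto
  moreover have "R w + (\<Sum>i<n. ?p i * ?q i w) = (f (\<gamma> w) - f (\<gamma> w0)) / (w - w0)" for w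
  proof -
    have "(\<Sum>i<n. ?p i * ?q i w) = (\<Sum>i<n. ?p i * (\<gamma> w i - \<gamma> w0 i)) / (w - w0)"
      by (simp add: sum_divide_distrib)
    then show ?thesis unfolding R_def by (simp add: add_divide_distrib[symmetric])
  qed
  ultimately show ?thesis by (simp add: has_field_derivative_iff)
qed

lemma eventually_upd_mem:
  assumes "openin (Cn n) D" "z \<in> D" "i < n"
  shows "\<forall>\<^sub>F w in nhds (z i). z(i := w) \<in> D"
proof -
  obtain e where e: "e > 0" "polydisc n z e \<subseteq> D" using openin_CnD(2)[OF assms(1,2)] by blast
  have zT: "z \<in> tuples n" using openin_CnD(1)[OF assms(1)] assms(2) by blast
  have "z(i := w) \<in> D" if "dist w (z i) < e" for w
    using polydisc_upd[OF polydisc_centre[OF zT e(1)] assms(3) that] e by blast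
  then show ?thesis using e(1) eventually_nhds_metric by blast
qed

lemma pderiv_at_cong:
  assumes "openin (Cn n) D" "z \<in> D" "i < n" "\<And>y. y \<in> D \<Longrightarrow> f y = g y"
  shows "pderiv_at i f z = pderiv_at i g z"
  unfolding pderiv_at_def
  using eventually_upd_mem[OF assms(1-3)]
  by (intro deriv_cong_ev) (auto elim!: eventually_mono simp: assms(4))

lemma holo_cong:
  assumes "\<And>z. z \<in> D \<Longrightarrow> f z = g z" "holo n D f"
  shows "holo n D g"
  unfolding holo_def
proof (intro conjI ballI allI impI)
  show D: "openin (Cn n) D" using assms holo_openD by blast
  show "continuous_map (subtopology (Cn n) D) euclidean g"
    using continuous_map_eq[OF holo_contD[OF assms(2)]] assms(1) by auto
  fix z i assume zi: "z \<in> D" "i < n"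
  have "((\<lambda>w. g (z(i := w))) has_field_derivative pderiv_at i f z) (at (z i))"
    using eventually_upd_mem[OF D zi] holo_pderiv[OF assms(2) zi]
    by (subst DERIV_cong_ev[OF refl _ refl, of _ "\<lambda>w. f (z(i := w))"])
       (auto elim!: eventually_mono simp: assms(1))
  then show "(\<lambda>w. g (z(i := w))) field_differentiable at (z i)"
    using field_differentiable_def by blast
qed

lemma holo_subset: "holo n D f \<Longrightarrow> D' \<subseteq> D \<Longrightarrow> openin (Cn n) D' \<Longrightarrow> holo n D' f"
  unfolding holo_def by (metis continuous_map_from_subtopology_mono subsetD)

lemma holo_local:
  assumes "\<And>a. a \<in> D \<Longrightarrow> \<exists>V. a \<in> V \<and> V \<subseteq> D \<and> holo n V f"
  shows "holo n D f"
  unfolding holo_def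
proof (intro conjI ballI allI impI)
  show D: "openin (Cn n) D" 
    by (subst openin_subopen) (metis assms holo_openD)
  show "continuous_map (subtopology (Cn n) D) euclidean f"
    unfolding continuous_Cn_iff[OF D]
  proof (intro ballI allI impI)
    fix a and e :: real assume "a \<in> D" "e > 0"
    then obtain V where V: "a \<in> V" "V \<subseteq> D" "holo n V f" using assms by blast
    obtain d where "d > 0" "polydisc n a d \<subseteq> V" "\<And>z. z \<in> polydisc n a d \<Longrightarrow> dist (f z) (f a) < e"
      using continuous_CnD[OF holo_contD[OF V(3)] holo_openD[OF V(3)] V(1) \<open>e > 0\<close>] by blast
    then show "\<exists>d>0. polydisc n a d \<subseteq> D \<and> (\<forall>z\<in>polydisc n a d. dist (f z) (f a) < e)"
      using V(2) by blast
  qed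
  show "(\<lambda>w. f (z(i := w))) field_differentiable at (z i)" if "z \<in> D" "i < n" for z i
    using assms[OF that(1)] that(2) by (auto simp: holo_def)
qed

lemma holo_coordinate: "openin (Cn n) D \<Longrightarrow> i < n \<Longrightarrow> holo n D (\<lambda>z. z i)"
  unfolding holo_def
proof (intro conjI ballI allI impI)
  show "(\<lambda>w. (z(j := w)) i) field_differentiable at (z j)" for z :: "nat \<Rightarrow> complex" and j
    by (cases "i = j") auto
qed (auto intro: continuous_map_coordinate)

definition holo_map ::
    "nat \<Rightarrow> nat \<Rightarrow> (nat \<Rightarrow> complex) set \<Rightarrow> (nat \<Rightarrow> complex) set
      \<Rightarrow> ((nat \<Rightarrow> complex) \<Rightarrow> (nat \<Rightarrow> complex)) \<Rightarrow> bool" where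
  "holo_map m n D D' F \<longleftrightarrow> openin (Cn m) D \<and> openin (Cn n) D' \<and> F \<in> D \<rightarrow> D' \<and>
     (\<forall>i<n. holo m D (\<lambda>z. F z i))"

lemma holo_mapD:
  assumes "holo_map m n D D' F"
  shows "openin (Cn m) D" "openin (Cn n) D'" "z \<in> D \<Longrightarrow> F z \<in> D'" "i < n \<Longrightarrow> holo m D (\<lambda>z. F z i)"
  using assms by (auto simp: holo_map_def)

lemma pderiv_compose:
  assumes f: "holo n D' f" and F: "holo_map m n D D' F" and z: "z \<in> D" and j: "j < m"
  shows "((\<lambda>w. f (F (z(j := w)))) has_field_derivative
     (\<Sum>i<n. pderiv_at i f (F z) * pderiv_at j (\<lambda>z. F z i) z)) (at (z j))"
proof -
  have "F (z(j := z j)) \<in> D'" using holo_mapD(3)[OF F z] by simp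
  moreover have "\<forall>\<^sub>F w in at (z j). F (z(j := w)) \<in> tuples n"
    using eventually_upd_mem[OF holo_mapD(1)[OF F] z j] holo_mapD(3)[OF F] 
       openin_CnD(1)[OF holo_mapD(2)[OF F]]
    by (auto simp: eventually_at_filter elim!: eventually_mono)
  ultimately show ?thesis
    using holo_curve[OF f, of "\<lambda>w. F (z(j := w))" "z j"] holo_pderiv[OF holo_mapD(4)[OF F] z j] by simp
qed

lemma jacobian_carrier [simp]: "jacobian m n F z \<in> carrier_mat m n"
  and jacobian_index: "i < m \<Longrightarrow> j < n \<Longrightarrow> jacobian m n F z $$ (i, j) = pderiv_at j (\<lambda>z. F z i) z"
  by (auto simp: jacobian_def)

lemma jacobian_compose:
  assumes F: "holo_map m n D D' F" and G: "holo_map n k D' D'' G" and z: "z \<in> D"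
  shows "jacobian k m (\<lambda>z. G (F z)) z = jacobian k n G (F z) * jacobian n m F z"
proof (rule eq_matI)
  fix i j assume "i < dim_row (jacobian k n G (F z) * jacobian n m F z)"
    "j < dim_col (jacobian k n G (F z) * jacobian n m F z)"
  then have ij: "i < k" "j < m" by (auto simp: jacobian_def)
  have "pderiv_at j (\<lambda>z. G (F z) i) z = (\<Sum>l<n. pderiv_at l (\<lambda>z. G z i) (F z) * pderiv_at j (\<lambda>z. F z l) z)"
    using pderiv_compose[OF holo_mapD(4)[OF G ij(1)] F z ij(2)]
    unfolding pderiv_at_def[of j "\<lambda>z. G (F z) i"] by (rule DERIV_imp_deriv)
  also have "\<dots> = (jacobian k n G (F z) * jacobian n m F z) $$ (i, j)"
    using ij by (simp add: jacobian_def scalar_prod_def lessThan_atLeast0)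
  finally show "jacobian k m (\<lambda>z. G (F z)) z $$ (i, j) = (jacobian k n G (F z) * jacobian n m F z) $$ (i, j)"
    using ij by (simp add: jacobian_index)
qed (auto simp: jacobian_def)

lemma jacobian_cong:
  assumes "openin (Cn n) D" "z \<in> D" "\<And>y i. y \<in> D \<Longrightarrow> i < m \<Longrightarrow> F y i = G y i"
  shows "jacobian m n F z = jacobian m n G z"
  by (rule eq_matI) (auto simp: jacobian_def intro!: pderiv_at_cong[OF assms(1,2)] assms(3))

lemma jacobian_ident: "jacobian n n (\<lambda>z. z) z = 1\<^sub>m n"
proof (rule eq_matI)
  fix i j assume "i < dim_row (1\<^sub>m n)" "j < dim_col (1\<^sub>m n)"
  moreover have "deriv (\<lambda>w. (z(j := w)) i) (z j) = (if i = j then 1 else 0)"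
    by (auto simp: fun_upd_def)
  ultimately show "jacobian n n (\<lambda>z. z) z $$ (i, j) = (1\<^sub>m n :: complex mat) $$ (i, j)"
    by (simp add: jacobian_def pderiv_at_def)
qed (auto simp: jacobian_def)

lemma jacobian_left_inverse:
  assumes F: "holo_map m n D D' F" and G: "holo_map n m D' D'' G" and z: "z \<in> D"
    and inv: "\<And>y. y \<in> D \<Longrightarrow> G (F y) = y"
  shows "jacobian m n G (F z) * jacobian n m F z = 1\<^sub>m m"
proof -
  have "jacobian m m (\<lambda>z. G (F z)) z = jacobian m m (\<lambda>z. z) z"
    using inv by (intro jacobian_cong[OF holo_mapD(1)[OF F] z]) auto
  then show ?thesis using jacobian_compose[OF F G z] jacobian_ident by simp
qed

lemma continuous_map_mult_field:
  fixes f g :: "'a \<Rightarrow> 'b::real_normed_field"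
  shows "continuous_map T euclidean f \<Longrightarrow> continuous_map T euclidean g \<Longrightarrow>
    continuous_map T euclidean (\<lambda>x. f x * g x)"
  by (simp add: continuous_map_atin tendsto_mult)

lemma continuous_map_prod_field:
  fixes f :: "'i \<Rightarrow> 'a \<Rightarrow> 'b::real_normed_field"
  shows "(\<And>i. i \<in> I \<Longrightarrow> continuous_map T euclidean (f i)) \<Longrightarrow>
    continuous_map T euclidean (\<lambda>x. \<Prod>i\<in>I. f i x)"
  by (simp add: continuous_map_atin tendsto_prod)

lemma continuous_det_jacobian:
  assumes F: "holo_map n n D D' F"
  shows "continuous_map (subtopology (Cn n) D) euclidean (\<lambda>z. Determinant.det (jacobian n n F z))"
proof -
  have "Determinant.det (jacobian n n F z) =
    (\<Sum>p | p permutes {0..<n}. signof p * (\<Prod>i = 0..<n. pderiv_at (p i) (\<lambda>z. F z i) z))" for z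
    unfolding det_def'[OF jacobian_carrier]
    by (intro sum.cong refl arg_cong2[where f="(*)"] prod.cong) 
       (auto simp: jacobian_index permutes_def permutes_in_image)
  moreover have "continuous_map (subtopology (Cn n) D) euclidean
     (\<lambda>z. \<Sum>p | p permutes {0..<n}. signof p * (\<Prod>i = 0..<n. pderiv_at (p i) (\<lambda>z. F z i) z))"
    using holo_mapD(4)[OF F]
    by (intro continuous_map_sum continuous_map_mult_field continuous_map_prod_field continuous_pderiv)
       (auto simp: finite_permutations permutes_in_image)
  ultimately show ?thesis by simp
qed

section \<open>Lebesgue measure on tuples\<close>

abbreviation lam :: "nat \<Rightarrow> (nat \<Rightarrow> complex) measure" where
  "lam n \<equiv> Pi\<^sub>M {..<n} (\<lambda>_. lborel)"

interpretation clborel: product_sigma_finite "\<lambda>_::nat. lborel :: complex measure"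
  by (simp add: product_sigma_finite_def lborel.sigma_finite_measure_axioms)

lemma space_lam [simp]: "space (lam n) = tuples n"
  by (simp add: space_PiM)

lemma sigma_finite_lam: "finite I \<Longrightarrow> sigma_finite_measure (Pi\<^sub>M (I :: nat set) (\<lambda>_. lborel :: complex measure))"
  by (rule clborel.sigma_finite)

lemma coordinate_measurable_lam [measurable]: "i < n \<Longrightarrow> (\<lambda>z. z i) \<in> borel_measurable (lam n)"
  using measurable_component_singleton[of i "{..<n}" "\<lambda>_. lborel :: complex measure"] by simp

lemma measurable_into_lam:
  assumes "\<And>x. x \<in> space M \<Longrightarrow> f x \<in> tuples n" "\<And>i. i < n \<Longrightarrow> (\<lambda>x. f x i) \<in> borel_measurable M"
  shows "f \<in> measurable M (lam n)"
  by (rule measurable_PiM_single') (use assms in auto)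

lemma measure_preserving_PiM:
  fixes T :: "nat \<Rightarrow> complex \<Rightarrow> complex"
  assumes I: "finite I" and T: "\<And>i. i \<in> I \<Longrightarrow> T i \<in> borel_measurable borel"
    "\<And>i. i \<in> I \<Longrightarrow> distr lborel borel (T i) = lborel"
  shows "distr (Pi\<^sub>M I (\<lambda>_. lborel)) (Pi\<^sub>M I (\<lambda>_. lborel)) (\<lambda>z. \<lambda>i\<in>I. T i (z i)) = Pi\<^sub>M I (\<lambda>_. lborel)"
    (is "distr ?M ?M ?T = _")
proof (rule clborel.PiM_eqI[OF I])
  have comp: "(\<lambda>z. z i) \<in> measurable ?M borel" if "i \<in> I" for i
    using measurable_component_singleton[OF that, of "\<lambda>_. lborel :: complex measure"] by simp
  have meas: "?T \<in> measurable ?M ?M"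
  proof (rule measurable_restrict)
    show "(\<lambda>z. T i (z i)) \<in> measurable ?M lborel" if "i \<in> I" for i
      using measurable_compose[OF comp[OF that] T(1)[OF that]] by simp
  qed
  fix A :: "nat \<Rightarrow> complex set" assume A: "\<And>i. i \<in> I \<Longrightarrow> A i \<in> sets lborel"
  have TA: "T i -` A i \<in> sets lborel" if "i \<in> I" for i
    using measurable_sets[OF T(1)[OF that], of "A i"] A[OF that] by simp
  have "emeasure (distr ?M ?M ?T) (Pi\<^sub>E I A) = emeasure ?M (?T -` Pi\<^sub>E I A \<inter> space ?M)"
    using A I by (intro emeasure_distr meas sets_PiM_I_finite) auto
  also have "?T -` Pi\<^sub>E I A \<inter> space ?M = Pi\<^sub>E I (\<lambda>i. T i -` A i)"
    by (auto simp: space_PiM PiE_def Pi_def)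
  also have "emeasure ?M \<dots> = (\<Prod>i\<in>I. emeasure lborel (T i -` A i))"
    using TA by (intro clborel.emeasure_PiM I) auto
  also have "\<dots> = (\<Prod>i\<in>I. emeasure lborel (A i))"
  proof (intro prod.cong refl)
    fix i assume i: "i \<in> I"
    have "emeasure (distr lborel borel (T i)) (A i) = emeasure lborel (T i -` A i \<inter> space lborel)"
      using A[OF i] T(1)[OF i] by (intro emeasure_distr) auto
    then show "emeasure lborel (T i -` A i) = emeasure lborel (A i)" using T(2)[OF i] by simp
  qed
  finally show "emeasure (distr ?M ?M ?T) (Pi\<^sub>E I A) = (\<Prod>i\<in>I. emeasure lborel (A i))" .
qed simp

lemma nn_integral_translate_lam:
  assumes u: "u \<in> borel_measurable (lam n)"
  shows "(\<integral>\<^sup>+z. u (\<lambda>i\<in>{..<n}. z i + b i) \<partial>lam n) = (\<integral>\<^sup>+z. u z \<partial>lam n)"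
proof -
  have "distr lborel borel (\<lambda>w. w + b i) = lborel" for i
    using lborel_distr_plus[of "b i"] by (simp add: add.commute[of _ "b i"])
  then have "distr (lam n) (lam n) (\<lambda>z. \<lambda>i\<in>{..<n}. z i + b i) = lam n"
    by (intro measure_preserving_PiM[where T="\<lambda>i w. w + b i"]) auto
  moreover have "(\<lambda>z. \<lambda>i\<in>{..<n}. z i + b i) \<in> measurable (lam n) (lam n)"
    by (rule measurable_into_lam) auto
  ultimately show ?thesis
    using nn_integral_distr[of "\<lambda>z. \<lambda>i\<in>{..<n}. z i + b i" "lam n" "lam n" u] u by simp
qed

lemma measurable_Complex [measurable (raw)]:
  "f \<in> borel_measurable M \<Longrightarrow> g \<in> borel_measurable M \<Longrightarrow> (\<lambda>x. Complex (f x) (g x)) \<in> borel_measurable M"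
proof -
  assume [measurable]: "f \<in> borel_measurable M" "g \<in> borel_measurable M"
  have "(\<lambda>x. Complex (f x) (g x)) = (\<lambda>x. complex_of_real (f x) + \<i> * complex_of_real (g x))"
    by (auto simp: fun_eq_iff complex_eq_iff)
  then show ?thesis by simp
qed

lemma nn_integral_lborel_complex:
  fixes u :: "complex \<Rightarrow> ennreal"
  assumes [measurable]: "u \<in> borel_measurable borel"
  shows "(\<integral>\<^sup>+w. u w \<partial>lborel) = (\<integral>\<^sup>+y. \<integral>\<^sup>+x. u (Complex x y) \<partial>lborel \<partial>lborel)"
proof -
  have meas: "(\<lambda>(x, y). Complex x y) \<in> borel_measurable (lborel \<Otimes>\<^sub>M lborel)"
  proof -
    have "(\<lambda>(x, y). Complex x y) = (\<lambda>p. complex_of_real (fst p) + \<i> * complex_of_real (snd p))"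
      by (auto simp: fun_eq_iff complex_eq_iff)
    then show ?thesis by simp
  qed
  have "lborel = distr (lborel \<Otimes>\<^sub>M lborel) borel (\<lambda>(x, y). Complex x y)" (is "_ = ?M")
  proof (rule lborel_eqI)
    fix l u :: complex assume le: "\<And>b. b \<in> Basis \<Longrightarrow> l \<bullet> b \<le> u \<bullet> b"
    have lu: "Re l \<le> Re u" "Im l \<le> Im u"
      using le[of 1] le[of \<i>] by (auto simp: Basis_complex_def)
    have "emeasure ?M (box l u) = emeasure (lborel \<Otimes>\<^sub>M lborel) ({Re l<..<Re u} \<times> {Im l<..<Im u})"
      using meas by (subst emeasure_distr) (auto intro!: arg_cong2[where f=emeasure] simp: in_box_complex_iff space_pair_measure)
    also have "\<dots> = ennreal (Re u - Re l) * ennreal (Im u - Im l)"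
      using lu by (simp add: lborel.emeasure_pair_measure_Times)
    also have "\<dots> = (\<Prod>b\<in>Basis. (u - l) \<bullet> b)"
      using lu by (simp add: Basis_complex_def ennreal_mult)
    finally show "emeasure ?M (box l u) = (\<Prod>b\<in>Basis. (u - l) \<bullet> b)" .
  qed simp
  then have "(\<integral>\<^sup>+w. u w \<partial>lborel) = (\<integral>\<^sup>+w. u w \<partial>distr (lborel \<Otimes>\<^sub>M lborel) borel (\<lambda>(x, y). Complex x y))"
    by (rule arg_cong[of _ _ "\<lambda>M. nn_integral M u"])
  also have "\<dots> = (\<integral>\<^sup>+p. u (case p of (x, y) \<Rightarrow> Complex x y) \<partial>(lborel \<Otimes>\<^sub>M lborel))"
    by (rule nn_integral_distr[OF meas]) simp
  also have "\<dots> = (\<integral>\<^sup>+y. \<integral>\<^sup>+x. u (Complex x y) \<partial>lborel \<partial>lborel)"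
    using meas by (subst lborel_pair.nn_integral_snd[symmetric]) (auto simp: measurable_compose[OF meas])
  finally show ?thesis .
qed

text \<open>Multiplication by \<open>a\<close> is decomposed into real affine substitutions of one real variable at a
  time, whose factors multiply to \<open>\<bar>a\<bar>\<^sup>2\<close>.\<close>

lemma nn_integral_complex_scale:
  fixes u :: "complex \<Rightarrow> ennreal"
  assumes [measurable]: "u \<in> borel_measurable borel" and a: "a \<noteq> 0"
  shows "(\<integral>\<^sup>+w. u w \<partial>lborel) = ennreal ((cmod a)\<^sup>2) * (\<integral>\<^sup>+w. u (a * w) \<partial>lborel)"
proof -
  \<comment> \<open>if \<open>Re a \<noteq> 0\<close>, substitute first for \<open>x\<close> and then for \<open>y\<close> in \<open>a * (x + \<i> y)\<close>\<close>
  have main: "(\<integral>\<^sup>+w. u w \<partial>lborel) = ennreal ((cmod a)\<^sup>2) * (\<integral>\<^sup>+w. u (a * w) \<partial>lborel)"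
    if a: "Re a \<noteq> 0" and [measurable]: "u \<in> borel_measurable borel" for a and u :: "complex \<Rightarrow> ennreal"
  proof -
    let ?p = "Re a" and ?q = "Im a"
    let ?c = "(cmod a)\<^sup>2 / ?p"
    have c: "?c \<noteq> 0" "\<bar>?c\<bar> * \<bar>?p\<bar> = (cmod a)\<^sup>2"
      using a by (auto simp: abs_mult[symmetric])
    have c3: "?c * y = ?p * y + ?q\<^sup>2 * y / ?p" for y
      unfolding cmod_power2 using a by (simp add: field_simps power2_eq_square)
    have "(\<integral>\<^sup>+w. u w \<partial>lborel) = (\<integral>\<^sup>+y. \<integral>\<^sup>+x. u (Complex x y) \<partial>lborel \<partial>lborel)"
      by (rule nn_integral_lborel_complex) simp
    also have "\<dots> = (\<integral>\<^sup>+x. \<integral>\<^sup>+y. u (Complex x y) \<partial>lborel \<partial>lborel)"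
      by (rule lborel_pair.Fubini') simp
    also have "\<dots> = (\<integral>\<^sup>+x. ennreal \<bar>?c\<bar> * (\<integral>\<^sup>+y. u (Complex x (?q / ?p * x + ?c * y)) \<partial>lborel) \<partial>lborel)"
      using c(1) by (intro nn_integral_cong nn_integral_real_affine) auto
    also have "\<dots> = ennreal \<bar>?c\<bar> * (\<integral>\<^sup>+x. (\<integral>\<^sup>+y. u (Complex x (?q / ?p * x + ?c * y)) \<partial>lborel) \<partial>lborel)"
      by (intro nn_integral_cmult) simp
    also have "(\<integral>\<^sup>+x. (\<integral>\<^sup>+y. u (Complex x (?q / ?p * x + ?c * y)) \<partial>lborel) \<partial>lborel)
       = (\<integral>\<^sup>+y. (\<integral>\<^sup>+x. u (Complex x (?q / ?p * x + ?c * y)) \<partial>lborel) \<partial>lborel)"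
      by (rule lborel_pair.Fubini') simp
    also have "\<dots> = (\<integral>\<^sup>+y. ennreal \<bar>?p\<bar> * (\<integral>\<^sup>+x. u (Complex (- ?q * y + ?p * x) (?q / ?p * (- ?q * y + ?p * x) + ?c * y)) \<partial>lborel) \<partial>lborel)"
      using a by (intro nn_integral_cong nn_integral_real_affine[where t="- ?q * y" for y]) auto
    also have "\<dots> = (\<integral>\<^sup>+y. ennreal \<bar>?p\<bar> * (\<integral>\<^sup>+x. u (a * Complex x y) \<partial>lborel) \<partial>lborel)"
    proof -
      have "Complex (- ?q * y + ?p * x) (?q / ?p * (- ?q * y + ?p * x) + ?c * y) = a * Complex x y" for x y
        using a unfolding c3 by (simp add: complex_eq_iff field_simps power2_eq_square)
      then show ?thesis by simp
    qed
    also have "\<dots> = ennreal \<bar>?p\<bar> * (\<integral>\<^sup>+y. (\<integral>\<^sup>+x. u (a * Complex x y) \<partial>lborel) \<partial>lborel)"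
      by (intro nn_integral_cmult) simp
    also have "(\<integral>\<^sup>+y. (\<integral>\<^sup>+x. u (a * Complex x y) \<partial>lborel) \<partial>lborel) = (\<integral>\<^sup>+w. u (a * w) \<partial>lborel)"
      by (rule nn_integral_lborel_complex[symmetric]) simp
    finally show ?thesis
      using c(2) by (simp add: mult.assoc[symmetric] ennreal_mult[symmetric])
  qed
  show ?thesis
  proof (cases "Re a = 0")
    case True
    \<comment> \<open>an imaginary number is a product of two numbers with non-zero real part\<close>
    define b where "b = complex_of_real (Im a / 2) * (1 + \<i>)"
    have ab: "a = b * (1 + \<i>)" using True by (simp add: b_def complex_eq_iff)
    have "Re b \<noteq> 0" using a True by (auto simp: b_def complex_eq_iff)
    then have "(\<integral>\<^sup>+w. u w \<partial>lborel) = ennreal ((cmod b)\<^sup>2) * (\<integral>\<^sup>+w. u (b * w) \<partial>lborel)"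
      by (rule main) simp
    also have "(\<integral>\<^sup>+w. u (b * w) \<partial>lborel) = ennreal ((cmod (1 + \<i>))\<^sup>2) * (\<integral>\<^sup>+w. u (b * ((1 + \<i>) * w)) \<partial>lborel)"
      by (rule main) auto
    finally show ?thesis
      unfolding ab norm_mult power_mult_distrib by (simp add: mult.assoc ennreal_mult)
  next
    case False
    then show ?thesis by (rule main) (rule assms(1))
  qed
qed

section \<open>Linear maps and Lebesgue measure\<close>

definition lin :: "nat \<Rightarrow> complex mat \<Rightarrow> (nat \<Rightarrow> complex) \<Rightarrow> (nat \<Rightarrow> complex)" where
  "lin n T z = (\<lambda>i\<in>{..<n}. \<Sum>j<n. T $$ (i, j) * z j)"

text \<open>The transformation formula for the linear map with matrix \<open>T\<close>; its determinant as a real linear map is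
  \<open>\<bar>det T\<bar>\<^sup>2\<close>. The property is multiplicative in \<open>T\<close>, so that elementary matrices suffice.\<close>

definition scales_measure :: "nat \<Rightarrow> complex mat \<Rightarrow> bool" where
  "scales_measure n T \<longleftrightarrow> (\<forall>u\<in>borel_measurable (lam n).
     (\<integral>\<^sup>+z. u z \<partial>lam n) = ennreal ((cmod (Determinant.det T))\<^sup>2) * (\<integral>\<^sup>+z. u (lin n T z) \<partial>lam n))"

lemma scales_measureD:
  assumes "scales_measure n T" "u \<in> borel_measurable (lam n)"
  shows "(\<integral>\<^sup>+z. u z \<partial>lam n) = ennreal ((cmod (Determinant.det T))\<^sup>2) * (\<integral>\<^sup>+z. u (lin n T z) \<partial>lam n)"
  using assms unfolding scales_measure_def by (rule bspec)

lemma lin_tuples [simp]: "lin n T z \<in> tuples n"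
  by (simp add: lin_def)

lemma lin_index: "i < n \<Longrightarrow> lin n T z i = (\<Sum>j<n. T $$ (i, j) * z j)"
  by (simp add: lin_def)

lemma lin_measurable [measurable]: "lin n T \<in> measurable (lam n) (lam n)"
  by (rule measurable_into_lam) (auto simp: lin_index)

lemma lin_mult:
  assumes "S \<in> carrier_mat n n" "T \<in> carrier_mat n n"
  shows "lin n (S * T) z = lin n S (lin n T z)"
proof (rule tuples_eqI[of _ n])
  fix i assume i: "i < n"
  have "lin n (S * T) z i = (\<Sum>j<n. (\<Sum>k<n. S $$ (i, k) * T $$ (k, j)) * z j)"
    using assms i by (simp add: lin_index scalar_prod_def lessThan_atLeast0)
  also have "\<dots> = (\<Sum>j<n. \<Sum>k<n. S $$ (i, k) * (T $$ (k, j) * z j))"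
    by (simp add: sum_distrib_right mult.assoc)
  also have "\<dots> = (\<Sum>k<n. \<Sum>j<n. S $$ (i, k) * (T $$ (k, j) * z j))"
    by (rule sum.swap)
  also have "\<dots> = lin n S (lin n T z) i"
    using i by (simp add: lin_index sum_distrib_left)
  finally show "lin n (S * T) z i = lin n S (lin n T z) i" .
qed auto

lemma lin_one: "z \<in> tuples n \<Longrightarrow> lin n (1\<^sub>m n) z = z"
  by (rule tuples_eqI[of _ n]) (auto simp: lin_index if_distrib[of "\<lambda>x. x * _"] cong: if_cong)

lemma scales_measure_mult:
  assumes "S \<in> carrier_mat n n" "T \<in> carrier_mat n n" "scales_measure n S" "scales_measure n T"
  shows "scales_measure n (S * T)"
  unfolding scales_measure_def
proof
  fix u :: "_ \<Rightarrow> ennreal" assume u [measurable]: "u \<in> borel_measurable (lam n)"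
  have "(\<integral>\<^sup>+z. u z \<partial>lam n) = ennreal ((cmod (Determinant.det S))\<^sup>2) * (\<integral>\<^sup>+z. u (lin n S z) \<partial>lam n)"
    by (rule scales_measureD[OF assms(3) u])
  also have "(\<integral>\<^sup>+z. u (lin n S z) \<partial>lam n)
      = ennreal ((cmod (Determinant.det T))\<^sup>2) * (\<integral>\<^sup>+z. u (lin n S (lin n T z)) \<partial>lam n)"
  proof -
    have "(\<lambda>z. u (lin n S z)) \<in> borel_measurable (lam n)" by simp
    then show ?thesis by (rule scales_measureD[OF assms(4)])
  qed
  finally show "(\<integral>\<^sup>+z. u z \<partial>lam n) = ennreal ((cmod (Determinant.det (S * T)))\<^sup>2) * (\<integral>\<^sup>+z. u (lin n (S * T) z) \<partial>lam n)"
    by (simp add: lin_mult[OF assms(1,2)] det_mult[OF assms(1,2)] norm_mult power_mult_distrib ennreal_mult mult.assoc)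
qed

lemma nn_integral_lam_split:
  assumes "k < n" "u \<in> borel_measurable (lam n)"
  shows "(\<integral>\<^sup>+z. u z \<partial>lam n) = (\<integral>\<^sup>+x. \<integral>\<^sup>+y. u (x(k := y)) \<partial>lborel \<partial>Pi\<^sub>M ({..<n} - {k}) (\<lambda>_. lborel))"
    "x \<in> space (Pi\<^sub>M ({..<n} - {k}) (\<lambda>_. lborel :: complex measure)) \<Longrightarrow> (\<lambda>y. u (x(k := y))) \<in> borel_measurable borel"
proof -
  have ins: "insert k ({..<n} - {k}) = {..<n}" using assms(1) by auto
  show "(\<integral>\<^sup>+z. u z \<partial>lam n) = (\<integral>\<^sup>+x. \<integral>\<^sup>+y. u (x(k := y)) \<partial>lborel \<partial>Pi\<^sub>M ({..<n} - {k}) (\<lambda>_. lborel))"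
    using clborel.product_nn_integral_insert[of "{..<n} - {k}" k u, unfolded ins] assms by simp
  assume x: "x \<in> space (Pi\<^sub>M ({..<n} - {k}) (\<lambda>_. lborel :: complex measure))"
  have "(\<lambda>y. x(k := y)) \<in> measurable borel (lam n)"
  proof (rule measurable_into_lam)
    show "x(k := y) \<in> tuples n" for y
      using x assms(1) by (auto simp: space_PiM PiE_def extensional_def)
    show "(\<lambda>y. (x(k := y)) i) \<in> borel_measurable borel" for i
      by (cases "i = k") auto
  qed
  then show "(\<lambda>y. u (x(k := y))) \<in> borel_measurable borel"
    using assms(2) by (rule measurable_compose)
qed

text \<open>With the other coordinates fixed, this map is a translation of the coordinate \<open>k\<close>.\<close>

lemma scales_measure_addrow_mat:
  assumes k: "k < n" and l: "l < n" and kl: "k \<noteq> l"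
  shows "scales_measure n (addrow_mat n a k l)"
  unfolding scales_measure_def
proof
  fix u :: "_ \<Rightarrow> ennreal" assume u [measurable]: "u \<in> borel_measurable (lam n)"
  let ?T = "addrow_mat n a k l" and ?M = "Pi\<^sub>M ({..<n} - {k}) (\<lambda>_. lborel :: complex measure)"
  have T: "lin n ?T (x(k := y)) = x(k := y + a * x l)" if "x \<in> space ?M" for x y
  proof (rule tuples_eqI[of _ n])
    show "x(k := y + a * x l) \<in> tuples n" using that k by (auto simp: space_PiM PiE_def extensional_def)
    fix i assume i: "i < n"
    show "lin n ?T (x(k := y)) i = (x(k := y + a * x l)) i"
    proof (cases "i = k")
      case True
      have "lin n ?T (x(k := y)) i = (\<Sum>j<n. (if j = l then a * x l else 0) + (if j = k then y else 0))"
        unfolding lin_index[OF i] using True kl i by (intro sum.cong) auto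
      then show ?thesis using True k l by (simp add: sum.distrib)
    next
      case False
      then have "lin n ?T (x(k := y)) i = (\<Sum>j<n. (if j = i then x i else 0))"
        unfolding lin_index[OF i] using kl i by (intro sum.cong) auto
      then show ?thesis using False i by simp
    qed
  qed simp
  have "(\<integral>\<^sup>+z. u (lin n ?T z) \<partial>lam n) = (\<integral>\<^sup>+x. \<integral>\<^sup>+y. u (lin n ?T (x(k := y))) \<partial>lborel \<partial>?M)"
    by (rule nn_integral_lam_split[OF k]) simp
  also have "\<dots> = (\<integral>\<^sup>+x. \<integral>\<^sup>+y. u (x(k := y)) \<partial>lborel \<partial>?M)"
  proof (rule nn_integral_cong)
    fix x assume x: "x \<in> space ?M"
    have "(\<integral>\<^sup>+y. u (x(k := y)) \<partial>lborel) = (\<integral>\<^sup>+y. u (x(k := y)) \<partial>(distr lborel borel ((+) (a * x l))))"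
      by (simp add: lborel_distr_plus)
    also have "\<dots> = (\<integral>\<^sup>+y. u (x(k := y + a * x l)) \<partial>lborel)"
      using nn_integral_lam_split(2)[OF k u x] by (subst nn_integral_distr) (auto simp: add.commute)
    finally show "(\<integral>\<^sup>+y. u (lin n ?T (x(k := y))) \<partial>lborel) = (\<integral>\<^sup>+y. u (x(k := y)) \<partial>lborel)"
      using T[OF x] by simp
  qed
  also have "\<dots> = (\<integral>\<^sup>+z. u z \<partial>lam n)"
    by (rule nn_integral_lam_split(1)[OF k u, symmetric])
  finally show "(\<integral>\<^sup>+z. u z \<partial>lam n) = ennreal ((cmod (Determinant.det ?T))\<^sup>2) * (\<integral>\<^sup>+z. u (lin n ?T z) \<partial>lam n)"
    by (simp add: det_addrow_mat[OF kl])
qed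

lemma scales_measure_multrow_mat:
  assumes k: "k < n" and a: "a \<noteq> 0"
  shows "scales_measure n (multrow_mat n k a)"
  unfolding scales_measure_def
proof
  fix u :: "_ \<Rightarrow> ennreal" assume u [measurable]: "u \<in> borel_measurable (lam n)"
  let ?T = "multrow_mat n k a" and ?M = "Pi\<^sub>M ({..<n} - {k}) (\<lambda>_. lborel :: complex measure)"
  have T: "lin n ?T (x(k := y)) = x(k := a * y)" if "x \<in> space ?M" for x y
  proof (rule tuples_eqI[of _ n])
    show "x(k := a * y) \<in> tuples n" using that k by (auto simp: space_PiM PiE_def extensional_def)
    fix i assume i: "i < n"
    have "lin n ?T (x(k := y)) i = (\<Sum>j<n. if j = i then (x(k := a * y)) i else 0)"
      unfolding lin_index[OF i] using i by (intro sum.cong) auto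
    then show "lin n ?T (x(k := y)) i = (x(k := a * y)) i" using i by simp
  qed simp
  have "(\<integral>\<^sup>+z. u z \<partial>lam n) = (\<integral>\<^sup>+x. \<integral>\<^sup>+y. u (x(k := y)) \<partial>lborel \<partial>?M)"
    by (rule nn_integral_lam_split(1)[OF k u])
  also have "\<dots> = (\<integral>\<^sup>+x. ennreal ((cmod a)\<^sup>2) * (\<integral>\<^sup>+y. u (lin n ?T (x(k := y))) \<partial>lborel) \<partial>?M)"
  proof (rule nn_integral_cong)
    fix x assume x: "x \<in> space ?M"
    show "(\<integral>\<^sup>+y. u (x(k := y)) \<partial>lborel) = ennreal ((cmod a)\<^sup>2) * (\<integral>\<^sup>+y. u (lin n ?T (x(k := y))) \<partial>lborel)"
      using nn_integral_complex_scale[OF nn_integral_lam_split(2)[OF k u x] a] T[OF x] by simp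
  qed
  also have "\<dots> = ennreal ((cmod a)\<^sup>2) * (\<integral>\<^sup>+x. (\<integral>\<^sup>+y. u (lin n ?T (x(k := y))) \<partial>lborel) \<partial>?M)"
  proof (rule nn_integral_cmult)
    have ins: "insert k ({..<n} - {k}) = {..<n}" using k by auto
    have "(\<lambda>p. (fst p)(k := snd p)) \<in> measurable (?M \<Otimes>\<^sub>M lborel) (lam n)"
      using measurable_add_dim[of k "{..<n} - {k}" "\<lambda>_. lborel :: complex measure"] ins
      by (simp add: case_prod_beta')
    then have "(\<lambda>p. u (lin n ?T ((fst p)(k := snd p)))) \<in> borel_measurable (?M \<Otimes>\<^sub>M lborel)"
      by measurable
    then show "(\<lambda>x. \<integral>\<^sup>+y. u (lin n ?T (x(k := y))) \<partial>lborel) \<in> borel_measurable ?M"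
      using lborel.borel_measurable_nn_integral_fst by fastforce
  qed
  also have "(\<integral>\<^sup>+x. (\<integral>\<^sup>+y. u (lin n ?T (x(k := y))) \<partial>lborel) \<partial>?M) = (\<integral>\<^sup>+z. u (lin n ?T z) \<partial>lam n)"
    by (rule nn_integral_lam_split(1)[OF k, symmetric]) simp
  finally show "(\<integral>\<^sup>+z. u z \<partial>lam n) = ennreal ((cmod (Determinant.det ?T))\<^sup>2) * (\<integral>\<^sup>+z. u (lin n ?T z) \<partial>lam n)"
    by (simp add: det_multrow_mat[OF k])
qed

lemma scales_measure_addrow:
  assumes T: "T \<in> carrier_mat n n" and k: "k < n" and l: "l < n" and kl: "k \<noteq> l"
    and *: "scales_measure n (addrow a k l T)"
  shows "scales_measure n T"
proof -
  have c: "addrow a k l T \<in> carrier_mat n n" using T by auto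
  have "T = addrow (- a) k l (addrow a k l T)"
    using T k l kl by (intro eq_matI) auto
  also have "\<dots> = addrow_mat n (- a) k l * addrow a k l T"
    by (rule addrow_mat[OF c l])
  finally have eq: "T = addrow_mat n (- a) k l * addrow a k l T" .
  show ?thesis
    by (subst eq, rule scales_measure_mult[OF addrow_mat_carrier c scales_measure_addrow_mat[OF k l kl] *])
qed

lemma scales_measure_multrow:
  assumes T: "T \<in> carrier_mat n n" and k: "k < n" and a: "a \<noteq> 0"
    and *: "scales_measure n (multrow k a T)"
  shows "scales_measure n T"
proof -
  have c: "multrow k a T \<in> carrier_mat n n" using T by auto
  have "T = multrow k (1 / a) (multrow k a T)"
    using T k a by (intro eq_matI) auto
  also have "\<dots> = multrow_mat n k (1 / a) * multrow k a T"
    by (rule multrow_mat[OF c])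
  finally have eq: "T = multrow_mat n k (1 / a) * multrow k a T" .
  show ?thesis
    by (subst eq, rule scales_measure_mult[OF multrow_mat_carrier c scales_measure_multrow_mat[OF k] *])
       (use a in simp)
qed

text \<open>Row reduction: the columns are turned into unit vectors one after the other.\<close>

lemma scales_measure_unit_columns:
  assumes "k \<le> n" "T \<in> carrier_mat n n" "Determinant.det T \<noteq> 0"
    "\<And>i j. i < n \<Longrightarrow> j < k \<Longrightarrow> T $$ (i, j) = (if i = j then 1 else 0)"
  shows "scales_measure n T"
  using assms
proof (induction k arbitrary: T rule: inc_induct)
  case base
  then have "T = 1\<^sub>m n" by (intro eq_matI) auto
  then show ?case by (auto simp: scales_measure_def lin_one intro!: nn_integral_cong)
next
  case (step k)
  note IH = step.IH and k = step.hyps(2)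
  have one: "scales_measure n T"
    if "T \<in> carrier_mat n n" "Determinant.det T \<noteq> 0" "T $$ (k, k) = 1"
      "\<And>i j. i < n \<Longrightarrow> j < k \<Longrightarrow> T $$ (i, j) = (if i = j then 1 else 0)" for T
    using that
  proof (induction "card {i. i < n \<and> i \<noteq> k \<and> T $$ (i, k) \<noteq> 0}" arbitrary: T rule: less_induct)
    case (less T)
    show ?case
    proof (cases "\<exists>i<n. i \<noteq> k \<and> T $$ (i, k) \<noteq> 0")
      case False
      then show ?thesis using less.prems by (intro IH) (auto simp: less_Suc_eq)
    next
      case True
      then obtain i where i: "i < n" "i \<noteq> k" "T $$ (i, k) \<noteq> 0" by blast
      let ?a = "- T $$ (i, k)"
      let ?T = "addrow ?a i k T"
      note T = less.prems(1)
      have "{j. j < n \<and> j \<noteq> k \<and> ?T $$ (j, k) \<noteq> 0} \<subset> {j. j < n \<and> j \<noteq> k \<and> T $$ (j, k) \<noteq> 0}"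
      proof -
        define c where "c j = ?T $$ (j, k)" for j
        have c: "c j = (if j = i then 0 else T $$ (j, k))" if "j < n" for j
          using T i k less.prems(3) that by (simp add: c_def)
        have "{j. j < n \<and> j \<noteq> k \<and> c j \<noteq> 0} = {j. j < n \<and> j \<noteq> k \<and> T $$ (j, k) \<noteq> 0} - {i}"
          using c by (auto split: if_splits)
        then show ?thesis using i by (auto simp: c_def)
      qed
      then have "card {j. j < n \<and> j \<noteq> k \<and> ?T $$ (j, k) \<noteq> 0} < card {j. j < n \<and> j \<noteq> k \<and> T $$ (j, k) \<noteq> 0}"
        by (intro psubset_card_mono) auto
      moreover have "Determinant.det ?T \<noteq> 0"
        using det_addrow[OF k i(2) T] less.prems(2) by simp
      ultimately have "scales_measure n ?T"
        using T i k less.prems(3,4) by (intro less.hyps) auto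
      then show ?thesis by (rule scales_measure_addrow[OF T i(1) k i(2)])
    qed
  qed
  have pivot: "scales_measure n T"
    if T: "T \<in> carrier_mat n n" and nz: "Determinant.det T \<noteq> 0" "T $$ (k, k) \<noteq> 0"
      and cols: "\<And>i j. i < n \<Longrightarrow> j < k \<Longrightarrow> T $$ (i, j) = (if i = j then 1 else 0)" for T
  proof -
    let ?T = "multrow k (1 / T $$ (k, k)) T"
    have "Determinant.det ?T \<noteq> 0" using det_multrow[OF k T] nz by simp
    then have "scales_measure n ?T" using T nz k cols by (intro one) auto
    then show ?thesis using nz by (intro scales_measure_multrow[OF T k]) auto
  qed
  show ?case
  proof (cases "T $$ (k, k) = 0")
    case False
    then show ?thesis using step.prems by (intro pivot) auto
  next
    case True
    note T = step.prems(1)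
    \<comment> \<open>otherwise column \<open>k\<close> would be a combination of the unit columns to its left\<close>
    have "\<exists>i<n. k < i \<and> T $$ (i, k) \<noteq> 0"
    proof (rule ccontr)
      assume "\<not> ?thesis"
      then have z: "T $$ (i, k) = 0" if "i < n" "\<not> i < k" for i
        using that True by (metis linorder_neqE_nat)
      define v where "v = Matrix.vec n (\<lambda>j. if j = k then 1 else if j < k then - T $$ (j, k) else 0)"
      have "T *\<^sub>v v = 0\<^sub>v n"
      proof (rule eq_vecI)
        fix i assume "i < dim_vec (0\<^sub>v n)"
        then have i: "i < n" by simp
        have "(T *\<^sub>v v) $ i = (\<Sum>j<n. T $$ (i, j) * v $ j)"
          using T i by (simp add: scalar_prod_def v_def lessThan_atLeast0)
        also have "\<dots> = (\<Sum>j<n. (if j = k then T $$ (i, k) else 0) + (if j = i then (if i < k then - T $$ (i, k) else 0) else 0))"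
          using step.prems(3) i by (intro sum.cong) (auto simp: v_def)
        also have "\<dots> = 0" using i k z[OF i] by (simp add: sum.distrib)
        finally show "(T *\<^sub>v v) $ i = 0\<^sub>v n $ i" using i by simp
      qed (use T in auto)
      moreover have "v \<in> carrier_vec n" by (simp add: v_def)
      moreover have "v \<noteq> 0\<^sub>v n"
      proof
        assume "v = 0\<^sub>v n"
        then have "v $ k = 0" using k by simp
        then show False using k by (simp add: v_def)
      qed
      ultimately show False using det_0_iff_vec_prod_zero[OF T] step.prems(2) by blast
    qed
    then obtain i where i: "i < n" "k < i" "T $$ (i, k) \<noteq> 0" by blast
    let ?T = "addrow 1 k i T"
    have "Determinant.det ?T \<noteq> 0" using det_addrow[OF i(1) _ T, of k] i step.prems(2) by simp
    then have "scales_measure n ?T" using T i k True step.prems(3) by (intro pivot) auto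
    then show ?thesis using i k by (intro scales_measure_addrow[OF T k i(1)]) auto
  qed
qed

theorem nn_integral_lin:
  assumes "T \<in> carrier_mat n n" "Determinant.det T \<noteq> 0" "u \<in> borel_measurable (lam n)"
  shows "(\<integral>\<^sup>+z. u z \<partial>lam n) = ennreal ((cmod (Determinant.det T))\<^sup>2) * (\<integral>\<^sup>+z. u (lin n T z) \<partial>lam n)"
  using scales_measure_unit_columns[of 0 n T] assms by (intro scales_measureD) auto

section \<open>Dyadic cubes\<close>

definition csquare :: "complex \<Rightarrow> real \<Rightarrow> complex set" where
  "csquare l s = {w. Re l \<le> Re w \<and> Re w < Re l + s \<and> Im l \<le> Im w \<and> Im w < Im l + s}"

definition cube :: "nat \<Rightarrow> (nat \<Rightarrow> complex) \<Rightarrow> real \<Rightarrow> (nat \<Rightarrow> complex) set" where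
  "cube n l s = PiE {..<n} (\<lambda>i. csquare (l i) s)"

text \<open>The half-open cube of side length \<open>1 / 2^m\<close> in the dyadic grid that contains \<open>x\<close>.\<close>

definition dcube :: "nat \<Rightarrow> nat \<Rightarrow> (nat \<Rightarrow> complex) \<Rightarrow> (nat \<Rightarrow> complex) set" where
  "dcube n m x = {z \<in> tuples n. \<forall>i<n. \<lfloor>2 ^ m * Re (z i)\<rfloor> = \<lfloor>2 ^ m * Re (x i)\<rfloor> \<and>
     \<lfloor>2 ^ m * Im (z i)\<rfloor> = \<lfloor>2 ^ m * Im (x i)\<rfloor>}"

lemma csquare_borel [measurable]: "csquare l s \<in> sets borel"
proof -
  have "csquare l s = {w \<in> space borel. Re l \<le> Re w \<and> Re w < Re l + s \<and> Im l \<le> Im w \<and> Im w < Im l + s}"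
    by (auto simp: csquare_def)
  then show ?thesis by simp
qed

lemma emeasure_csquare:
  assumes "0 \<le> s"
  shows "emeasure lborel (csquare l s) = ennreal (s\<^sup>2)"
proof (rule antisym)
  let ?u = "l + Complex s s"
  have "emeasure lborel (csquare l s) \<le> emeasure lborel (cbox l ?u)"
    by (rule emeasure_mono) (auto simp: csquare_def in_cbox_complex_iff)
  also have "\<dots> = ennreal (s\<^sup>2)"
    using assms by (subst emeasure_lborel_cbox) (auto simp: Basis_complex_def power2_eq_square)
  finally show "emeasure lborel (csquare l s) \<le> ennreal (s\<^sup>2)" .
  have "ennreal (s\<^sup>2) = emeasure lborel (box l ?u)"
    using assms by (subst emeasure_lborel_box) (auto simp: Basis_complex_def power2_eq_square)
  also have "\<dots> \<le> emeasure lborel (csquare l s)"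
    by (rule emeasure_mono) (auto simp: csquare_def in_box_complex_iff)
  finally show "ennreal (s\<^sup>2) \<le> emeasure lborel (csquare l s)" .
qed

lemma cube_sets [measurable]: "cube n l s \<in> sets (lam n)"
  unfolding cube_def by (rule sets_PiM_I_finite) auto

lemma emeasure_cube:
  assumes "0 \<le> s"
  shows "emeasure (lam n) (cube n l s) = ennreal ((s\<^sup>2) ^ n)"
proof -
  have "emeasure (lam n) (cube n l s) = (\<Prod>i<n. emeasure lborel (csquare (l i) s))"
    unfolding cube_def by (intro clborel.emeasure_PiM) auto
  then show ?thesis using assms by (simp add: emeasure_csquare ennreal_power)
qed

lemma dcube_eq_cube:
  "dcube n m x = cube n (\<lambda>i. Complex (\<lfloor>2 ^ m * Re (x i)\<rfloor> / 2 ^ m) (\<lfloor>2 ^ m * Im (x i)\<rfloor> / 2 ^ m)) (1 / 2 ^ m)"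
proof -
  have "\<lfloor>2 ^ m * r\<rfloor> = k \<longleftrightarrow> of_int k / 2 ^ m \<le> r \<and> r < of_int k / 2 ^ m + 1 / 2 ^ m" for r :: real and k
    unfolding floor_eq_iff add_divide_distrib[symmetric] by (simp add: field_simps)
  then show ?thesis
    by (auto simp: dcube_def cube_def csquare_def PiE_def Pi_def)
qed

lemma dcube_sets [measurable]: "dcube n m x \<in> sets (lam n)"
  by (simp add: dcube_eq_cube)

lemma dcube_tuples: "dcube n m x \<subseteq> tuples n"
  by (auto simp: dcube_def)

lemma dcube_self: "x \<in> tuples n \<Longrightarrow> x \<in> dcube n m x"
  by (simp add: dcube_def)

lemma dcube_eq: "z \<in> dcube n m x \<Longrightarrow> dcube n m z = dcube n m x"
  by (auto simp: dcube_def)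

lemma dcube_nested:
  assumes "k \<le> m"
  shows "dcube n m x \<subseteq> dcube n k x"
proof -
  have "\<lfloor>2 ^ k * r\<rfloor> = \<lfloor>2 ^ m * r\<rfloor> div 2 ^ (m - k)" for r :: real
  proof -
    have "2 ^ m = (2 ^ k * 2 ^ (m - k) :: real)" using assms by (simp flip: power_add)
    then have "2 ^ k * r = (2 ^ m * r) / of_int (2 ^ (m - k))" by simp
    then show ?thesis using floor_divide_real_eq_div[of "2 ^ (m - k)" "2 ^ m * r"] by simp
  qed
  then show ?thesis by (auto simp: dcube_def)
qed

lemma dcube_close:
  assumes "z \<in> dcube n m x" "i < n"
  shows "cmod (z i - x i) \<le> 2 / 2 ^ m"
proof -
  have *: "\<bar>r - r'\<bar> \<le> 1 / 2 ^ m" if "\<lfloor>2 ^ m * r\<rfloor> = \<lfloor>2 ^ m * r'\<rfloor>" for r r' :: real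
  proof -
    have "\<bar>2 ^ m * r - 2 ^ m * r'\<bar> \<le> 1" using that by linarith
    then have "2 ^ m * \<bar>r - r'\<bar> \<le> 1" by (simp add: abs_mult flip: right_diff_distrib)
    then show ?thesis by (simp add: field_simps)
  qed
  have "cmod (z i - x i) \<le> \<bar>Re (z i - x i)\<bar> + \<bar>Im (z i - x i)\<bar>" by (rule cmod_le)
  also have "\<dots> \<le> 1 / 2 ^ m + 1 / 2 ^ m"
    using assms *[of "Re (z i)" "Re (x i)"] *[of "Im (z i)" "Im (x i)"] by (simp add: dcube_def)
  finally show ?thesis by simp
qed

lemma countable_dcubes: "countable {dcube n m x | m x. True}"
proof -
  let ?f = "\<lambda>(m, \<kappa>). {z \<in> tuples n. \<forall>i<n. (\<lfloor>2 ^ m * Re (z i)\<rfloor>, \<lfloor>2 ^ m * Im (z i)\<rfloor>) = \<kappa> i}"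
  have "{dcube n m x | m x. True} \<subseteq> ?f ` (UNIV \<times> PiE {..<n} (\<lambda>_. UNIV :: (int \<times> int) set))"
  proof safe
    fix m x
    show "dcube n m x \<in> ?f ` (UNIV \<times> PiE {..<n} (\<lambda>_. UNIV :: (int \<times> int) set))"
      by (rule image_eqI[of _ _ "(m, \<lambda>i\<in>{..<n}. (\<lfloor>2 ^ m * Re (x i)\<rfloor>, \<lfloor>2 ^ m * Im (x i)\<rfloor>))"])
         (auto simp: dcube_def)
  qed
  moreover have "countable (UNIV \<times> PiE {..<n} (\<lambda>_. UNIV :: (int \<times> int) set) :: (nat \<times> _) set)"
    by (intro countable_SIGMA countable_PiE) auto
  ultimately show ?thesis by (meson countable_image countable_subset)
qed

text \<open>The maximal ones among the admissible cubes are disjoint.\<close>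

lemma dyadic_partition:
  assumes W: "W \<subseteq> tuples n" and P: "\<And>x. x \<in> W \<Longrightarrow> \<exists>m. dcube n m x \<subseteq> W \<and> P (dcube n m x)"
  obtains F where "countable F" "disjoint F" "\<Union>F = W"
    "\<And>Q. Q \<in> F \<Longrightarrow> P Q \<and> (\<exists>m x. x \<in> W \<and> Q = dcube n m x)"
proof -
  let ?G = "\<lambda>m x. dcube n m x \<subseteq> W \<and> P (dcube n m x)"
  define \<mu> where "\<mu> x = (LEAST m. ?G m x)" for x
  define F where "F = (\<lambda>x. dcube n (\<mu> x) x) ` W"
  have G: "?G (\<mu> x) x" if "x \<in> W" for x
    unfolding \<mu>_def using P[OF that] by (rule LeastI_ex)
  have key: "dcube n (\<mu> z) z = dcube n (\<mu> x) x" if x: "x \<in> W" and z: "z \<in> dcube n (\<mu> x) x" for x z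
  proof -
    have same: "dcube n k z = dcube n k x" if "k \<le> \<mu> x" for k
      using dcube_eq dcube_nested[OF that] z by blast
    have "\<mu> z = \<mu> x"
      unfolding \<mu>_def[of z]
    proof (rule Least_equality)
      show "?G (\<mu> x) z" using same[of "\<mu> x"] G[OF x] by simp
      fix k assume k: "?G k z"
      show "\<mu> x \<le> k"
      proof (rule ccontr)
        assume "\<not> \<mu> x \<le> k"
        then have "?G k x" using k same[of k] by simp
        then show False using \<open>\<not> \<mu> x \<le> k\<close> not_less_Least[of k "\<lambda>m. ?G m x"] \<mu>_def by simp
      qed
    qed
    then show ?thesis using same[of "\<mu> x"] by simp
  qed
  show ?thesis
  proof
    show "countable F" by (rule countable_subset[OF _ countable_dcubes[of n]]) (auto simp: F_def)
    show "disjoint F"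
    proof (rule disjointI)
      fix Q Q' assume Q: "Q \<in> F" "Q' \<in> F" "Q \<noteq> Q'"
      show "Q \<inter> Q' = {}"
      proof (rule ccontr)
        assume "Q \<inter> Q' \<noteq> {}"
        then obtain z where "z \<in> Q" "z \<in> Q'" by blast
        then have "dcube n (\<mu> z) z = Q" "dcube n (\<mu> z) z = Q'" using Q(1,2) key unfolding F_def by blast+
        then show False using Q(3) by simp
      qed
    qed
    show "\<Union>F = W"
    proof
      show "\<Union>F \<subseteq> W" using G by (auto simp: F_def)
      show "W \<subseteq> \<Union>F"
      proof
        fix x assume x: "x \<in> W"
        then have "x \<in> dcube n (\<mu> x) x" using dcube_self W by blast
        then show "x \<in> \<Union>F" using x by (auto simp: F_def)
      qed
    qed
    show "P Q \<and> (\<exists>m x. x \<in> W \<and> Q = dcube n m x)" if "Q \<in> F" for Q using that G by (auto simp: F_def)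
  qed
qed

lemma dcube_in_polydisc:
  assumes "x \<in> tuples n" "e > 0"
  shows "\<exists>m. dcube n m x \<subseteq> polydisc n x e"
proof -
  obtain m where m: "(1/2) ^ m < e / 2" using real_arch_pow_inv[of "e/2" "1/2"] assms(2) by auto
  have "dcube n m x \<subseteq> polydisc n x e"
  proof
    fix z assume z: "z \<in> dcube n m x"
    have "dist (z i) (x i) < e" if "i < n" for i
      using dcube_close[OF z that] m by (simp add: dist_norm power_divide)
    then show "z \<in> polydisc n x e" using z dcube_tuples[of n m x] by (auto simp: polydisc_def)
  qed
  then show ?thesis by blast
qed

lemma openin_sets_lam:
  assumes "openin (Cn n) U"
  shows "U \<in> sets (lam n)"
proof -
  have U: "U \<subseteq> tuples n" using openin_CnD(1)[OF assms] .
  have "\<exists>m. dcube n m x \<subseteq> U \<and> True" if x: "x \<in> U" for x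
  proof -
    obtain e where e: "e > 0" "polydisc n x e \<subseteq> U" using openin_CnD(2)[OF assms x] by blast
    obtain m where "dcube n m x \<subseteq> polydisc n x e" using dcube_in_polydisc[OF subsetD[OF U x] e(1)] by blast
    then show ?thesis using e(2) by blast
  qed
  from dyadic_partition[OF U this]
  obtain F where F: "countable F" "\<Union>F = U" "\<And>Q. Q \<in> F \<Longrightarrow> \<exists>m x. Q = dcube n m x"
    by (metis (no_types, lifting))
  have "Q \<in> sets (lam n)" if "Q \<in> F" for Q
    using F(3)[OF that] dcube_sets by metis
  then have "\<Union>F \<in> sets (lam n)" using F(1) by (intro sets.countable_Union) auto
  then show ?thesis using F(2) by simp
qed

lemma sets_lam_eq_sigma_open: "sets (lam n) = sigma_sets (tuples n) {U. openin (Cn n) U}"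
proof
  let ?N = "sigma (tuples n) {U. openin (Cn n) U}"
  have Pow: "{U. openin (Cn n) U} \<subseteq> Pow (tuples n)" using openin_CnD(1) by blast
  have space: "space ?N = tuples n" and sets: "sets ?N = sigma_sets (tuples n) {U. openin (Cn n) U}"
    using Pow by auto
  have "id \<in> measurable ?N (lam n)"
  proof (rule measurable_into_lam)
    fix i assume i: "i < n"
    show "(\<lambda>x. id x i) \<in> borel_measurable ?N"
    proof (rule borel_measurableI)
      fix S :: "complex set" assume "open S"
      then have "openin (Cn n) {z \<in> topspace (Cn n). z i \<in> S}"
        using continuous_map_coordinate[OF i, of UNIV]
        by (intro openin_continuous_map_preimage[of _ euclidean]) auto
      then show "(\<lambda>x. id x i) -` S \<inter> space ?N \<in> sets ?N"
        unfolding space sets by (auto simp: vimage_def Int_def conj_commute intro: sigma_sets.Basic)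
    qed
  qed (use space in auto)
  then show "sets (lam n) \<subseteq> sigma_sets (tuples n) {U. openin (Cn n) U}"
    using measurable_sets[of id ?N "lam n"] space sets sets.sets_into_space[of _ "lam n"]
    by (auto simp: Int_absorb2 vimage_id)
  show "sigma_sets (tuples n) {U. openin (Cn n) U} \<subseteq> sets (lam n)"
    using sets.sigma_sets_subset[of "{U. openin (Cn n) U}" "lam n"] openin_sets_lam by auto
qed

lemma emeasure_disjoint_Union:
  assumes "countable F" "disjoint F" "F \<subseteq> sets M"
  shows "emeasure M (\<Union>F) = (\<integral>\<^sup>+Q. emeasure M Q \<partial>count_space F)"
proof -
  have "emeasure M (\<Union> ((\<lambda>Q. Q) ` F)) = (\<integral>\<^sup>+Q. emeasure M Q \<partial>count_space F)"
    using assms by (intro emeasure_UN_countable) (auto simp: disjoint_family_on_def disjoint_def)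
  then show ?thesis by simp
qed

text \<open>If a cube violates the inequality by more than \<open>\<epsilon>\<close> times its volume, then so does one of its
  children; the cubes of a violating sequence shrink to a point at which the local estimate fails. That point is at
  distance at most \<open>4 s\<close> from the corner of each of these cubes, in every coordinate, if \<open>s\<close> is the side length.\<close>

lemma emeasure_dcube_le:
  assumes sets: "sets M1 = sets (lam n)" "sets M2 = sets (lam n)"
    and loc: "\<And>a \<epsilon>. a \<in> D \<Longrightarrow> \<epsilon> > 0 \<Longrightarrow> \<exists>\<delta>>0. \<forall>l s. 0 < s \<and> s < \<delta> \<and> (\<forall>i<n. cmod (l i - a i) \<le> 4 * s) \<longrightarrow>
      emeasure M1 (cube n l s) \<le> emeasure M2 (cube n l s) + ennreal \<epsilon> * emeasure (lam n) (cube n l s)"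
    and x0: "x0 \<in> tuples n" and fat: "\<And>a. a \<in> tuples n \<Longrightarrow> \<forall>i<n. cmod (a i - x0 i) \<le> 2 / 2 ^ m0 \<Longrightarrow> a \<in> D"
  shows "emeasure M1 (dcube n m0 x0) \<le> emeasure M2 (dcube n m0 x0)"
proof -
  have eps: "emeasure M1 (dcube n m0 x0) \<le> emeasure M2 (dcube n m0 x0) + ennreal \<epsilon> * emeasure (lam n) (dcube n m0 x0)"
    if \<epsilon>: "\<epsilon> > 0" for \<epsilon>
  proof (rule ccontr)
    define ok where "ok m x \<longleftrightarrow> emeasure M1 (dcube n m x) \<le> emeasure M2 (dcube n m x) + ennreal \<epsilon> * emeasure (lam n) (dcube n m x)" for m x
    assume "\<not> ?thesis"
    then have bad0: "\<not> ok m0 x0" by (simp add: ok_def)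
    have child: "\<exists>y\<in>dcube n m x. \<not> ok (Suc m) y" if "\<not> ok m x" for m x
    proof (rule ccontr)
      assume *: "\<not> ?thesis"
      let ?P = "\<lambda>Q. emeasure M1 Q \<le> emeasure M2 Q + ennreal \<epsilon> * emeasure (lam n) Q"
      have "\<exists>k. dcube n k y \<subseteq> dcube n m x \<and> ?P (dcube n k y)" if "y \<in> dcube n m x" for y
        using * that dcube_eq[OF that] dcube_nested[of m "Suc m" n y] by (intro exI[of _ "Suc m"]) (auto simp: ok_def)
      from dyadic_partition[OF dcube_tuples this]
      obtain F where F: "countable F" "disjoint F" "\<Union>F = dcube n m x"
        "\<And>Q. Q \<in> F \<Longrightarrow> ?P Q \<and> (\<exists>k y. y \<in> dcube n m x \<and> Q = dcube n k y)" by metis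
      have FS: "F \<subseteq> sets (lam n)" using F(4) dcube_sets by blast
      have "emeasure M1 (\<Union>F) = (\<integral>\<^sup>+Q. emeasure M1 Q \<partial>count_space F)"
        using F FS sets by (intro emeasure_disjoint_Union) auto
      also have "\<dots> \<le> (\<integral>\<^sup>+Q. emeasure M2 Q + ennreal \<epsilon> * emeasure (lam n) Q \<partial>count_space F)"
        using F(4) by (intro nn_integral_mono) auto
      also have "\<dots> = (\<integral>\<^sup>+Q. emeasure M2 Q \<partial>count_space F) + ennreal \<epsilon> * (\<integral>\<^sup>+Q. emeasure (lam n) Q \<partial>count_space F)"
        by (simp add: nn_integral_add nn_integral_cmult)
      also have "\<dots> = emeasure M2 (\<Union>F) + ennreal \<epsilon> * emeasure (lam n) (\<Union>F)"
        using F FS sets by (subst (1 2) emeasure_disjoint_Union) auto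
      finally show False using that F(3) by (simp add: ok_def)
    qed
    have "\<exists>X. \<forall>k. (\<not> ok (m0 + k) (X k) \<and> X k \<in> tuples n \<and> (k = 0 \<longrightarrow> X k = x0)) \<and> X (Suc k) \<in> dcube n (m0 + k) (X k)"
    proof (rule dependent_nat_choice)
      show "\<exists>x. \<not> ok (m0 + 0) x \<and> x \<in> tuples n \<and> (0 = (0::nat) \<longrightarrow> x = x0)" using bad0 x0 by auto
      show "\<exists>y. (\<not> ok (m0 + Suc k) y \<and> y \<in> tuples n \<and> (Suc k = 0 \<longrightarrow> y = x0)) \<and> y \<in> dcube n (m0 + k) x"
        if bad: "\<not> ok (m0 + k) x \<and> x \<in> tuples n \<and> (k = 0 \<longrightarrow> x = x0)" for x k
      proof -
        obtain y where y: "y \<in> dcube n (m0 + k) x" "\<not> ok (Suc (m0 + k)) y"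
          using child[of "m0 + k" x] bad by blast
        then have "y \<in> tuples n" using dcube_tuples by blast
        then show ?thesis using y by auto
      qed
    qed
    then obtain X where X: "\<And>k. \<not> ok (m0 + k) (X k)" "\<And>k. X k \<in> tuples n" "X 0 = x0"
      "\<And>k. X (Suc k) \<in> dcube n (m0 + k) (X k)" by blast
    have nest: "X j \<in> dcube n (m0 + k) (X k)" if "k \<le> j" for j k
      using that
    proof (induction j rule: dec_induct)
      case base
      show ?case using dcube_self X(2) by blast
    next
      case (step j)
      then have "X (Suc j) \<in> dcube n (m0 + k) (X j)" using X(4)[of j] dcube_nested[of "m0 + k" "m0 + j"] by auto
      then show ?case using dcube_eq[OF step.IH] by simp
    qed
    have small: "2 / 2 ^ (m0 + k) \<le> 2 * (1/2 :: real) ^ k" for k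
      by (simp add: power_add power_divide field_simps)
    have close: "cmod (X j i - X k i) \<le> 2 / 2 ^ (m0 + k)" if "k \<le> j" "i < n" for j k i
      using dcube_close[OF nest[OF that(1)] that(2)] .
    have "Cauchy (\<lambda>j. X j i)" if i: "i < n" for i
    proof (rule metric_CauchyI)
      fix e :: real assume "e > 0"
      then obtain k where k: "(1/2 :: real) ^ k < e / 4" using real_arch_pow_inv[of "e/4" "1/2"] by auto
      have "dist (X j i) (X j' i) < e" if "k \<le> j" "k \<le> j'" for j j'
      proof -
        have "dist (X j i) (X k i) < e / 2" "dist (X j' i) (X k i) < e / 2"
          using close[OF that(1) i] close[OF that(2) i] small[of k] k unfolding dist_norm by linarith+
        then show ?thesis by (rule dist_triangle_half_l)
      qed
      then show "\<exists>M. \<forall>m\<ge>M. \<forall>n\<ge>M. dist (X m i) (X n i) < e" by blast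
    qed
    then have conv: "(\<lambda>j. X j i) \<longlonglongrightarrow> lim (\<lambda>j. X j i)" if "i < n" for i
      using that Cauchy_convergent_iff convergent_LIMSEQ_iff by blast
    define a where "a = (\<lambda>i\<in>{..<n}. lim (\<lambda>j. X j i))"
    have aX: "cmod (a i - X k i) \<le> 2 / 2 ^ (m0 + k)" if i: "i < n" for i k
    proof (rule tendsto_upperbound)
      show "(\<lambda>j. cmod (X j i - X k i)) \<longlonglongrightarrow> cmod (a i - X k i)"
        using conv[OF i] i by (auto simp: a_def intro!: tendsto_intros)
      show "\<forall>\<^sub>F j in sequentially. cmod (X j i - X k i) \<le> 2 / 2 ^ (m0 + k)"
        using close[OF _ i] by (auto intro: eventually_sequentiallyI)
    qed auto
    have "a \<in> D" using aX[of _ 0] X(3) by (intro fat) (auto simp: a_def)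
    then obtain \<delta> where \<delta>: "\<delta> > 0" "\<And>l s. 0 < s \<Longrightarrow> s < \<delta> \<Longrightarrow> (\<forall>i<n. cmod (l i - a i) \<le> 4 * s) \<Longrightarrow>
      emeasure M1 (cube n l s) \<le> emeasure M2 (cube n l s) + ennreal \<epsilon> * emeasure (lam n) (cube n l s)"
      using loc[OF _ \<epsilon>] by blast
    obtain k where k: "(1/2 :: real) ^ k < \<delta>" using real_arch_pow_inv[of \<delta> "1/2"] \<delta>(1) by auto
    define s :: real where "s = 1 / 2 ^ (m0 + k)"
    define l where "l = (\<lambda>i. Complex (\<lfloor>2 ^ (m0 + k) * Re (X k i)\<rfloor> / 2 ^ (m0 + k)) (\<lfloor>2 ^ (m0 + k) * Im (X k i)\<rfloor> / 2 ^ (m0 + k)))"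
    have Q: "dcube n (m0 + k) (X k) = cube n l s"
      unfolding l_def s_def by (rule dcube_eq_cube)
    have s: "0 < s" "s < \<delta>" using small[of k] k by (auto simp: s_def)
    have "cmod (l i - a i) \<le> 4 * s" if i: "i < n" for i
    proof -
      have "X k i \<in> csquare (l i) s" using dcube_self[OF X(2)[of k], of "m0 + k"] i unfolding Q cube_def by auto
      then have "cmod (l i - X k i) \<le> 2 * s"
        using cmod_le[of "l i - X k i"] by (auto simp: csquare_def)
      moreover have "cmod (X k i - a i) \<le> 2 * s"
        using aX[OF i, of k] by (simp add: s_def norm_minus_commute)
      ultimately show ?thesis using norm_triangle_ineq[of "l i - X k i" "X k i - a i"] by simp
    qed
    then have "ok (m0 + k) (X k)" unfolding ok_def Q by (intro \<delta>(2) s) auto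
    then show False using X(1) by blast
  qed
  show ?thesis
  proof (rule ennreal_le_epsilon)
    fix e :: real assume e: "e > 0"
    let ?c = "((1 / 2 ^ m0)\<^sup>2) ^ n :: real"
    have c: "?c > 0" by simp
    have "emeasure M1 (dcube n m0 x0) \<le> emeasure M2 (dcube n m0 x0) + ennreal (e / ?c) * emeasure (lam n) (dcube n m0 x0)"
      using e c by (intro eps) auto
    also have "ennreal (e / ?c) * emeasure (lam n) (dcube n m0 x0) = ennreal e"
      unfolding dcube_eq_cube using e c by (subst emeasure_cube) (auto simp flip: ennreal_mult)
    finally show "emeasure M1 (dcube n m0 x0) \<le> emeasure M2 (dcube n m0 x0) + ennreal e" .
  qed
qed

text \<open>Small dyadic cubes have the same, finite, measure; the intersection of an open set with such
  a cube is a countable disjoint union of dyadic cubes, and the open sets are a generator stable under intersection. A partition of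
  \<open>D\<close> into such cubes gives the general case.\<close>

lemma emeasure_eq_on_open:
  assumes sets: "sets M1 = sets (lam n)" "sets M2 = sets (lam n)"
    and D: "openin (Cn n) D"
    and le: "\<And>a \<epsilon>. a \<in> D \<Longrightarrow> \<epsilon> > 0 \<Longrightarrow> \<exists>\<delta>>0. \<forall>l s. 0 < s \<and> s < \<delta> \<and> (\<forall>i<n. cmod (l i - a i) \<le> 4 * s) \<longrightarrow>
      emeasure M1 (cube n l s) \<le> emeasure M2 (cube n l s) + ennreal \<epsilon> * emeasure (lam n) (cube n l s)"
    and ge: "\<And>a \<epsilon>. a \<in> D \<Longrightarrow> \<epsilon> > 0 \<Longrightarrow> \<exists>\<delta>>0. \<forall>l s. 0 < s \<and> s < \<delta> \<and> (\<forall>i<n. cmod (l i - a i) \<le> 4 * s) \<longrightarrow>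
      emeasure M2 (cube n l s) \<le> emeasure M1 (cube n l s) + ennreal \<epsilon> * emeasure (lam n) (cube n l s)"
    and fin: "\<And>a. a \<in> D \<Longrightarrow> \<exists>\<delta>>0. emeasure M1 (polydisc n a \<delta>) < \<infinity>"
    and B: "B \<in> sets (lam n)"
  shows "emeasure M1 (B \<inter> D) = emeasure M2 (B \<inter> D)"
proof -
  have DT: "D \<subseteq> tuples n" using openin_CnD(1)[OF D] .
  define fat where "fat Q \<longleftrightarrow> emeasure M1 Q = emeasure M2 Q \<and> emeasure M1 Q < \<infinity>" for Q
  have fat_ex: "\<exists>k. dcube n m x \<subseteq> Q \<longrightarrow> k \<ge> m \<and> dcube n k x \<subseteq> Q \<and> fat (dcube n k x)" if x: "x \<in> D" for x m Q
  proof -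
    have xT: "x \<in> tuples n" using x DT by blast
    obtain e where e: "e > 0" "polydisc n x e \<subseteq> D" using openin_CnD(2)[OF D x] by blast
    obtain \<delta> where \<delta>: "\<delta> > 0" "emeasure M1 (polydisc n x \<delta>) < \<infinity>" using fin[OF x] by blast
    obtain m1 where m1: "dcube n m1 x \<subseteq> polydisc n x \<delta>" using dcube_in_polydisc[OF xT \<delta>(1)] by blast
    obtain m2 where m2: "(1/2 :: real) ^ m2 < e / 2" using real_arch_pow_inv[of "e/2" "1/2"] e(1) by auto
    define k where "k = Max {m, m1, m2}"
    have k: "m \<le> k" "m1 \<le> k" "m2 \<le> k" by (auto simp: k_def)
    have "2 / 2 ^ k = 2 * (1/2 :: real) ^ k" by (simp add: power_divide)
    also have "\<dots> \<le> 2 * (1/2) ^ m2" using k by (intro mult_left_mono power_decreasing) auto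
    finally have ke: "2 / 2 ^ k < e" using m2 by simp
    have inD: "a \<in> D" if "a \<in> tuples n" "\<forall>i<n. cmod (a i - x i) \<le> 2 / 2 ^ k" for a
      using that ke e(2) by (force simp: polydisc_def dist_norm)
    have "emeasure M1 (dcube n k x) = emeasure M2 (dcube n k x)"
    proof (rule antisym)
      show "emeasure M1 (dcube n k x) \<le> emeasure M2 (dcube n k x)"
        by (rule emeasure_dcube_le[OF sets le xT inD])
      show "emeasure M2 (dcube n k x) \<le> emeasure M1 (dcube n k x)"
        by (rule emeasure_dcube_le[OF sets(2,1) ge xT inD])
    qed
    moreover have "emeasure M1 (dcube n k x) \<le> emeasure M1 (polydisc n x \<delta>)"
      using dcube_nested[OF k(2), of n x] m1 openin_sets_lam[OF openin_polydisc] sets by (intro emeasure_mono) auto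
    ultimately have "fat (dcube n k x)" using \<delta>(2) by (auto simp: fat_def)
    then show ?thesis using k(1) dcube_nested[OF k(1), of n x] by blast
  qed
  \<comment> \<open>equality on sets that are unions of cubes in \<open>D\<close>\<close>
  have eq_cubical: "emeasure M1 W = emeasure M2 W"
    if W: "W \<subseteq> D" "\<And>x. x \<in> W \<Longrightarrow> \<exists>m. dcube n m x \<subseteq> W" for W
  proof -
    have "\<exists>m. dcube n m x \<subseteq> W \<and> fat (dcube n m x)" if "x \<in> W" for x
      using W(2)[OF that] fat_ex[of x _ W] W(1) that by blast
    from dyadic_partition[OF order_trans[OF W(1) DT] this]
    obtain F where F: "countable F" "disjoint F" "\<Union>F = W" "\<And>Q. Q \<in> F \<Longrightarrow> fat Q \<and> (\<exists>m x. x \<in> W \<and> Q = dcube n m x)"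
      by metis
    have FS: "F \<subseteq> sets (lam n)" using F(4) dcube_sets by blast
    have "emeasure M1 (\<Union>F) = (\<integral>\<^sup>+Q. emeasure M1 Q \<partial>count_space F)"
      using F FS sets by (intro emeasure_disjoint_Union) auto
    also have "\<dots> = (\<integral>\<^sup>+Q. emeasure M2 Q \<partial>count_space F)"
      using F(4) by (intro nn_integral_cong) (auto simp: fat_def)
    also have "\<dots> = emeasure M2 (\<Union>F)"
      using F FS sets by (subst emeasure_disjoint_Union) auto
    finally show ?thesis using F(3) by simp
  qed
  have cell: "emeasure M1 (B \<inter> Q) = emeasure M2 (B \<inter> Q)"
    if Q: "Q = dcube n m x" "Q \<subseteq> D" "fat Q" and B: "B \<in> sets (lam n)" for Q m x B
  proof -
    have QS: "Q \<in> sets (lam n)" using Q dcube_sets by blast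
    let ?N1 = "density M1 (indicator Q)" and ?N2 = "density M2 (indicator Q)"
    have N: "emeasure ?N1 A = emeasure M1 (A \<inter> Q)" "emeasure ?N2 A = emeasure M2 (A \<inter> Q)" if "A \<in> sets (lam n)" for A
    proof -
      have "(\<lambda>x. indicator Q x * indicator A x :: ennreal) = indicator (A \<inter> Q)" by (auto simp: indicator_def)
      then show "emeasure ?N1 A = emeasure M1 (A \<inter> Q)" "emeasure ?N2 A = emeasure M2 (A \<inter> Q)"
        using that QS sets by (auto simp: emeasure_density sets.Int)
    qed
    have "?N1 = ?N2"
    proof (rule measure_eqI_generator_eq[where A="\<lambda>_. tuples n" and \<Omega>="tuples n"])
      show "Int_stable {U. openin (Cn n) U}" by (auto simp: Int_stable_def)
      show "{U. openin (Cn n) U} \<subseteq> Pow (tuples n)" using openin_CnD(1) by blast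
      show "sets ?N1 = sigma_sets (tuples n) {U. openin (Cn n) U}"
        "sets ?N2 = sigma_sets (tuples n) {U. openin (Cn n) U}"
        using sets sets_lam_eq_sigma_open by auto
      show "range (\<lambda>_::nat. tuples n) \<subseteq> {U. openin (Cn n) U}"
        using openin_topspace[of "Cn n"] by auto
      have "tuples n \<in> sets (lam n)" using sets.top[of "lam n"] by simp
      then show "emeasure ?N1 (tuples n) \<noteq> \<infinity>"
        using Q dcube_tuples[of n m x] by (subst N) (auto simp: fat_def Int_absorb1)
      fix U assume "U \<in> {U. openin (Cn n) U}"
      then have U: "openin (Cn n) U" by simp
      have "emeasure M1 (U \<inter> Q) = emeasure M2 (U \<inter> Q)"
      proof (rule eq_cubical)
        fix y assume y: "y \<in> U \<inter> Q"
        obtain e where e: "e > 0" "polydisc n y e \<subseteq> U" using openin_CnD(2)[OF U] y by blast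
        have yT: "y \<in> tuples n" using y dcube_tuples[of n m x] Q(1) by auto
        obtain k where "dcube n k y \<subseteq> polydisc n y e" using dcube_in_polydisc[OF yT e(1)] by blast
        then have k: "dcube n k y \<subseteq> U" using e(2) by simp
        have "dcube n m y = Q" using y Q(1) dcube_eq[of y n m x] by simp
        then have "dcube n (max k m) y \<subseteq> U \<inter> Q"
          using dcube_nested[of k "max k m" n y] dcube_nested[of m "max k m" n y] k by auto
        then show "\<exists>m. dcube n m y \<subseteq> U \<inter> Q" by blast
      qed (use Q in auto)
      then show "emeasure ?N1 U = emeasure ?N2 U" using N[OF openin_sets_lam[OF U]] by simp
    qed auto
    then show ?thesis using N[OF B] by simp
  qed
  have "\<exists>m. dcube n m x \<subseteq> D \<and> fat (dcube n m x)" if x: "x \<in> D" for x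
  proof -
    obtain e where e: "e > 0" "polydisc n x e \<subseteq> D" using openin_CnD(2)[OF D x] by blast
    obtain m where "dcube n m x \<subseteq> D" using dcube_in_polydisc[of x n e] e x DT by blast
    then show ?thesis using fat_ex[OF x] by blast
  qed
  from dyadic_partition[OF DT this]
  obtain F where F: "countable F" "disjoint F" "\<Union>F = D" "\<And>Q. Q \<in> F \<Longrightarrow> fat Q \<and> (\<exists>m x. x \<in> D \<and> Q = dcube n m x)"
    by metis
  let ?F = "(\<lambda>Q. B \<inter> Q)"
  have FS: "Q \<in> sets (lam n)" if "Q \<in> F" for Q using F(4)[OF that] dcube_sets by blast
  have dis: "disjoint_family_on ?F F" using F(2) by (auto simp: disjoint_family_on_def disjoint_def)
  have BD: "B \<inter> D = \<Union> (?F ` F)" using F(3) by auto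
  have "emeasure M1 (\<Union> (?F ` F)) = (\<integral>\<^sup>+Q. emeasure M1 (B \<inter> Q) \<partial>count_space F)"
    using F(1) FS B sets dis by (intro emeasure_UN_countable) auto
  also have "\<dots> = (\<integral>\<^sup>+Q. emeasure M2 (B \<inter> Q) \<partial>count_space F)"
  proof (rule nn_integral_cong)
    fix Q assume "Q \<in> space (count_space F)"
    then have "Q \<in> F" by simp
    then show "emeasure M1 (B \<inter> Q) = emeasure M2 (B \<inter> Q)" using F(3,4) cell[OF _ _ _ B] by blast
  qed
  also have "\<dots> = emeasure M2 (\<Union> (?F ` F))"
    using F(1) FS B sets dis by (intro emeasure_UN_countable[symmetric]) auto
  finally show ?thesis unfolding BD .
qed

section \<open>Change of variables\<close>

lemma borel_measurable_continuous_open: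
  fixes f :: "_ \<Rightarrow> 'b::{metric_space, zero}"
  assumes D: "openin (Cn n) D" and f: "continuous_map (subtopology (Cn n) D) euclidean f"
  shows "(\<lambda>z. if z \<in> D then f z else 0) \<in> borel_measurable (lam n)"
proof (rule borel_measurableI)
  fix S :: "'b set" assume "open S"
  then have "openin (subtopology (Cn n) D) {z \<in> topspace (subtopology (Cn n) D). f z \<in> S}"
    using f by (intro openin_continuous_map_preimage) auto
  then have *: "{z \<in> topspace (subtopology (Cn n) D). f z \<in> S} \<in> sets (lam n)"
    using D openin_open_subtopology openin_sets_lam by blast
  have DT: "D \<subseteq> tuples n" "D \<in> sets (lam n)" using openin_CnD(1)[OF D] openin_sets_lam[OF D] by auto
  have "(\<lambda>z. if z \<in> D then f z else 0) -` S \<inter> space (lam n) =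
     {z \<in> topspace (subtopology (Cn n) D). f z \<in> S} \<union> (if 0 \<in> S then space (lam n) - D else {})"
    using DT(1) by (auto split: if_splits)
  then show "(\<lambda>z. if z \<in> D then f z else 0) -` S \<inter> space (lam n) \<in> sets (lam n)"
    using * DT(2) by (auto intro!: sets.Un sets.compl_sets)
qed

lemma holo_map_total_derivative:
  assumes F: "holo_map m n D D' F" and b: "b \<in> D" and \<epsilon>: "\<epsilon> > 0"
  shows "\<exists>d>0. polydisc m b d \<subseteq> D \<and> (\<forall>y\<in>polydisc m b d. \<forall>i<n.
    cmod (F y i - F b i - (\<Sum>j<m. jacobian n m F b $$ (i, j) * (y j - b j))) \<le> \<epsilon> * (\<Sum>j<m. cmod (y j - b j)))"
proof -
  define P where "P i y \<longleftrightarrow> cmod (F y i - F b i - (\<Sum>j<m. jacobian n m F b $$ (i, j) * (y j - b j))) \<le> \<epsilon> * (\<Sum>j<m. cmod (y j - b j))" for i y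
  have "\<exists>d>0. \<forall>y\<in>polydisc m b d. P i y" if i: "i < n" for i
  proof -
    obtain d where d: "d > 0" "\<And>y. y \<in> polydisc m b d \<Longrightarrow>
       cmod (F y i - F b i - (\<Sum>j<m. pderiv_at j (\<lambda>z. F z i) b * (y j - b j))) \<le> \<epsilon> * (\<Sum>j<m. cmod (y j - b j))"
      by (rule holo_total_derivative[OF holo_mapD(4)[OF F i] b \<epsilon>]) (rule that)
    have "(\<Sum>j<m. jacobian n m F b $$ (i, j) * (y j - b j)) = (\<Sum>j<m. pderiv_at j (\<lambda>z. F z i) b * (y j - b j))" for y
      using i by (intro sum.cong) (auto simp: jacobian_index)
    then show ?thesis using d by (intro exI[of _ d]) (simp add: P_def)
  qed
  then obtain d where d: "\<And>i. i < n \<Longrightarrow> d i > 0" "\<And>i y. i < n \<Longrightarrow> y \<in> polydisc m b (d i) \<Longrightarrow> P i y"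
    by metis
  obtain e where e: "e > 0" "polydisc m b e \<subseteq> D" using openin_CnD(2)[OF holo_mapD(1)[OF F] b] by blast
  define \<delta> where "\<delta> = Min (insert e (d ` {..<n}))"
  have \<delta>: "\<delta> > 0" unfolding \<delta>_def using d(1) e(1) by (subst Min_gr_iff) auto
  have le: "\<delta> \<le> e" "\<And>i. i < n \<Longrightarrow> \<delta> \<le> d i" unfolding \<delta>_def by (auto intro!: Min_le)
  have "P i y" if "y \<in> polydisc m b \<delta>" "i < n" for y i
    using d(2)[OF that(2)] polydisc_mono[OF le(2)[OF that(2)]] that(1) by blast
  then show ?thesis using \<delta> e(2) polydisc_mono[OF le(1)] unfolding P_def by blast
qed

definition mat_bound :: "nat \<Rightarrow> complex mat \<Rightarrow> real" where
  "mat_bound n T = (\<Sum>i<n. \<Sum>j<n. cmod (T $$ (i, j)))"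

lemma mat_bound: 
  assumes "i < n" "0 \<le> r" "\<And>j. j < n \<Longrightarrow> cmod (v j) \<le> r"
  shows "cmod (\<Sum>j<n. T $$ (i, j) * v j) \<le> mat_bound n T * r"
proof -
  have "cmod (\<Sum>j<n. T $$ (i, j) * v j) \<le> (\<Sum>j<n. cmod (T $$ (i, j)) * r)"
    using assms by (intro sum_norm_le) (auto simp: norm_mult intro!: mult_left_mono)
  also have "\<dots> = (\<Sum>j<n. cmod (T $$ (i, j))) * r" by (simp add: sum_distrib_right)
  also have "\<dots> \<le> mat_bound n T * r"
    unfolding mat_bound_def using assms(1,2) by (intro mult_right_mono member_le_sum[of i]) (auto intro: sum_nonneg)
  finally show ?thesis .
qed

lemma emeasure_affine_preimage_cube:
  assumes T: "T \<in> carrier_mat n n" and S: "S \<in> carrier_mat n n" and TS: "T * S = 1\<^sub>m n" and s: "0 \<le> s"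
  shows "emeasure (lam n) {z \<in> tuples n. (\<lambda>i\<in>{..<n}. lin n S z i + b i) \<in> cube n l s}
     = ennreal ((cmod (Determinant.det T))\<^sup>2 * (s\<^sup>2) ^ n)" (is "emeasure _ ?B = _")
proof -
  have "Determinant.det T * Determinant.det S = 1"
    using det_mult[OF T S] TS det_one[of n] by simp
  then have det: "(cmod (Determinant.det T))\<^sup>2 * (cmod (Determinant.det S))\<^sup>2 = 1" "Determinant.det S \<noteq> 0"
    by (auto simp flip: power_mult_distrib norm_mult)
  define tr where "tr z = (\<lambda>i\<in>{..<n}. z i + b i)" for z :: "nat \<Rightarrow> complex"
  have tr: "tr \<in> measurable (lam n) (lam n)"
    unfolding tr_def by (rule measurable_into_lam) auto
  let ?u = "\<lambda>z. indicator (cube n l s) (tr z) :: ennreal"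
  have u: "?u \<in> borel_measurable (lam n)"
    using tr by (rule measurable_compose) simp
  have B: "?B = {z \<in> space (lam n). tr (lin n S z) \<in> cube n l s}"
    by (simp add: tr_def)
  have "(\<lambda>z. tr (lin n S z)) \<in> measurable (lam n) (lam n)"
    using lin_measurable tr by (rule measurable_compose)
  then have "?B \<in> sets (lam n)"
    unfolding B by (rule measurable_sets_Collect) (simp add: Collect_mem_eq sets.sets_into_space)
  then have "emeasure (lam n) ?B = (\<integral>\<^sup>+z. indicator ?B z \<partial>lam n)" by simp
  also have "\<dots> = (\<integral>\<^sup>+z. ?u (lin n S z) \<partial>lam n)"
    unfolding B by (intro nn_integral_cong) (auto simp: indicator_def)
  finally have 1: "emeasure (lam n) ?B = (\<integral>\<^sup>+z. ?u (lin n S z) \<partial>lam n)" .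
  have "ennreal ((s\<^sup>2) ^ n) = (\<integral>\<^sup>+z. indicator (cube n l s) z \<partial>lam n)"
    using emeasure_cube[OF s, of n l] by simp
  also have "\<dots> = (\<integral>\<^sup>+z. ?u z \<partial>lam n)"
    unfolding tr_def by (rule nn_integral_translate_lam[symmetric]) simp
  also have "\<dots> = ennreal ((cmod (Determinant.det S))\<^sup>2) * (\<integral>\<^sup>+z. ?u (lin n S z) \<partial>lam n)"
    by (rule nn_integral_lin[OF S det(2) u])
  finally have "ennreal ((cmod (Determinant.det T))\<^sup>2) * ennreal ((s\<^sup>2) ^ n) = emeasure (lam n) ?B"
    using det(1) unfolding 1 by (simp add: mult.assoc[symmetric] ennreal_mult[symmetric])
  then show ?thesis by (simp add: ennreal_mult)
qed

lemma csquare_enlarge: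
  assumes "w \<in> csquare l s" "cmod (w' - w) < d"
  shows "w' \<in> csquare (l - Complex d d) (s + 2 * d)"
  using assms abs_Re_le_cmod[of "w' - w"] abs_Im_le_cmod[of "w' - w"] by (auto simp: csquare_def)

lemma csquare_close:
  assumes "w \<in> csquare l s" "cmod (l - a) \<le> 4 * s"
  shows "cmod (w - a) \<le> 6 * s"
proof -
  have "cmod (w - l) \<le> 2 * s" using assms(1) cmod_le[of "w - l"] by (auto simp: csquare_def)
  then show ?thesis using assms(2) norm_triangle_ineq[of "w - l" "l - a"] by simp
qed

text \<open>Near \<open>a\<close>, the image of a cube under \<open>G\<close> lies between the images of two slightly smaller and larger
  cubes under the affine approximation of \<open>G\<close>.\<close>

lemma emeasure_image_cube:
  assumes G: "holo_map n n D D' G" and F: "holo_map n n D' D F"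
    and FG: "\<And>w. w \<in> D \<Longrightarrow> F (G w) = w" and GF: "\<And>z. z \<in> D' \<Longrightarrow> G (F z) = z"
    and a: "a \<in> D" and \<epsilon>: "\<epsilon> > 0"
  defines "c \<equiv> (cmod (Determinant.det (jacobian n n G a)))\<^sup>2"
  shows "\<exists>\<delta>>0. \<forall>l s. 0 < s \<and> s < \<delta> \<and> (\<forall>i<n. cmod (l i - a i) \<le> 4 * s) \<longrightarrow>
     emeasure (lam n) {z \<in> D'. F z \<in> cube n l s} \<le> ennreal ((c + \<epsilon>) * (s\<^sup>2) ^ n) \<and>
     ennreal ((c - \<epsilon>) * (s\<^sup>2) ^ n) \<le> emeasure (lam n) {z \<in> D'. F z \<in> cube n l s}"
proof -
  define T where "T = jacobian n n G a"
  define S where "S = jacobian n n F (G a)"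
  have Ga: "G a \<in> D'" using holo_mapD(3)[OF G a] .
  have DT: "D \<subseteq> tuples n" "D' \<subseteq> tuples n" using openin_CnD(1) holo_mapD(1,2)[OF G] by auto
  have TS: "T \<in> carrier_mat n n" "S \<in> carrier_mat n n" "S * T = 1\<^sub>m n" "T * S = 1\<^sub>m n"
    using jacobian_left_inverse[OF G F a FG] jacobian_left_inverse[OF F G Ga GF] FG[OF a]
    by (auto simp: T_def S_def)
  define K where "K = mat_bound n S + mat_bound n T + 1"
  have mb: "0 \<le> mat_bound n M" for M unfolding mat_bound_def by (intro sum_nonneg) auto
  have K: "1 \<le> K" "mat_bound n S \<le> K" "mat_bound n T \<le> K" using mb[of S] mb[of T] by (auto simp: K_def)
  have "((\<lambda>\<eta>. c * ((1 + 2 * \<eta>)\<^sup>2) ^ n) \<longlongrightarrow> c * ((1 + 2 * 0)\<^sup>2) ^ n) (at_right (0::real))"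
    "((\<lambda>\<eta>. c * ((1 - 2 * \<eta>)\<^sup>2) ^ n) \<longlongrightarrow> c * ((1 - 2 * 0)\<^sup>2) ^ n) (at_right (0::real))"
    by (intro tendsto_intros)+
  then have "\<forall>\<^sub>F \<eta> in at_right 0. c * ((1 + 2 * \<eta>)\<^sup>2) ^ n < c + \<epsilon>"
    "\<forall>\<^sub>F \<eta> in at_right 0. c - \<epsilon> < c * ((1 - 2 * \<eta>)\<^sup>2) ^ n"
    using \<epsilon> by (auto intro: order_tendstoD)
  moreover have "\<forall>\<^sub>F \<eta> in at_right (0::real). 0 < \<eta> \<and> \<eta> < 1 / 4"
    using eventually_at_right[of 0 "1/4::real"] by (auto intro: exI[of _ "1/4"])
  ultimately have "\<forall>\<^sub>F \<eta> in at_right (0::real). c * ((1 + 2 * \<eta>)\<^sup>2) ^ n < c + \<epsilon> \<and> c - \<epsilon> < c * ((1 - 2 * \<eta>)\<^sup>2) ^ n \<and> 0 < \<eta> \<and> \<eta> < 1 / 4"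
    by eventually_elim auto
  then obtain \<eta> :: real where \<eta>: "c * ((1 + 2 * \<eta>)\<^sup>2) ^ n < c + \<epsilon>" "c - \<epsilon> < c * ((1 - 2 * \<eta>)\<^sup>2) ^ n" "0 < \<eta>" "\<eta> < 1 / 4"
    using eventually_happens'[OF trivial_limit_at_right_real] by blast
  \<comment> \<open>a relative error \<open>\<epsilon>'\<close> of the linear approximations on a cube of side length \<open>s\<close>, transported by \<open>S\<close> or \<open>T\<close>, stays below \<open>\<eta> s\<close>\<close>
  define \<epsilon>' where "\<epsilon>' = \<eta> / (6 * K * (real n + 1))"
  have \<epsilon>': "\<epsilon>' > 0" using \<eta> K by (simp add: \<epsilon>'_def)
  have small: "K * (\<epsilon>' * (real n * (6 * s))) < \<eta> * s" if "s > 0" for s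
  proof -
    have "K * (\<epsilon>' * (real n * (6 * s))) = \<eta> * s * (real n / (real n + 1))"
    proof -
      have "\<epsilon>' * (6 * K * (real n + 1)) = \<eta>" using K by (simp add: \<epsilon>'_def)
      moreover have "K * (\<epsilon>' * (real n * (6 * s))) * (real n + 1) = \<epsilon>' * (6 * K * (real n + 1)) * s * real n" by (simp only: mult_ac)
      ultimately have "K * (\<epsilon>' * (real n * (6 * s))) * (real n + 1) = \<eta> * s * real n" by (simp only:)
      then show ?thesis by (simp add: eq_divide_eq)
    qed
    also have "\<dots> < \<eta> * s * 1" using \<eta> that by (intro mult_strict_left_mono) auto
    finally show ?thesis by simp
  qed
  obtain \<delta>1 where "\<delta>1 > 0" and total1: "\<forall>w\<in>polydisc n a \<delta>1. \<forall>i<n.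
      cmod (G w i - G a i - (\<Sum>j<n. T $$ (i, j) * (w j - a j))) \<le> \<epsilon>' * (\<Sum>j<n. cmod (w j - a j))"
    using holo_map_total_derivative[OF G a \<epsilon>', folded T_def] by (elim exE conjE) (rule that)
  then have \<delta>1: "\<delta>1 > 0" "\<And>w i. w \<in> polydisc n a \<delta>1 \<Longrightarrow> i < n \<Longrightarrow>
      cmod (G w i - G a i - (\<Sum>j<n. T $$ (i, j) * (w j - a j))) \<le> \<epsilon>' * (\<Sum>j<n. cmod (w j - a j))"
    by blast+
  obtain \<delta>2 where "\<delta>2 > 0" "polydisc n (G a) \<delta>2 \<subseteq> D'" and total2: "\<forall>z\<in>polydisc n (G a) \<delta>2. \<forall>i<n.
      cmod (F z i - a i - (\<Sum>j<n. S $$ (i, j) * (z j - G a j))) \<le> \<epsilon>' * (\<Sum>j<n. cmod (z j - G a j))"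
    using holo_map_total_derivative[OF F Ga \<epsilon>', folded S_def, unfolded FG[OF a]]
    by (elim exE conjE) (rule that)
  then have \<delta>2: "\<delta>2 > 0" "polydisc n (G a) \<delta>2 \<subseteq> D'" "\<And>z i. z \<in> polydisc n (G a) \<delta>2 \<Longrightarrow> i < n \<Longrightarrow>
      cmod (F z i - a i - (\<Sum>j<n. S $$ (i, j) * (z j - G a j))) \<le> \<epsilon>' * (\<Sum>j<n. cmod (z j - G a j))"
    by blast+
  define b where "b i = a i - lin n S (G a) i" for i
  define A where "A z = (\<lambda>i\<in>{..<n}. lin n S z i + b i)" for z
  have A: "A z i - a i = (\<Sum>j<n. S $$ (i, j) * (z j - G a j))" if "i < n" for z i
    using that by (simp add: A_def b_def lin_index right_diff_distrib sum_subtractf)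
  \<comment> \<open>points of the cube are within \<open>6 s\<close> of \<open>a\<close>, and their images under the inverse of \<open>A\<close> within \<open>6 K s\<close> of \<open>G a\<close>\<close>
  define \<delta> where "\<delta> = min \<delta>1 \<delta>2 / (6 * K)"
  have "\<delta> > 0" using \<delta>1(1) \<delta>2(1) K by (simp add: \<delta>_def)
  moreover have "emeasure (lam n) {z \<in> D'. F z \<in> cube n l s} \<le> ennreal ((c + \<epsilon>) * (s\<^sup>2) ^ n) \<and>
     ennreal ((c - \<epsilon>) * (s\<^sup>2) ^ n) \<le> emeasure (lam n) {z \<in> D'. F z \<in> cube n l s}"
    if s: "0 < s" "s < \<delta>" and l: "\<And>i. i < n \<Longrightarrow> cmod (l i - a i) \<le> 4 * s" for l s
  proof -
    have sK: "6 * K * s < \<delta>1" "6 * K * s < \<delta>2" 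
      using s K by (auto simp: \<delta>_def field_simps)
    have "6 * s \<le> 6 * K * s" using K s by simp
    then have s6: "6 * s < \<delta>1" using sK by simp
    let ?P = "{z \<in> D'. F z \<in> cube n l s}"
    let ?Q1 = "cube n (\<lambda>i. l i - Complex (\<eta> * s) (\<eta> * s)) (s + 2 * (\<eta> * s))"
    let ?l2 = "\<lambda>i. l i + Complex (\<eta> * s) (\<eta> * s)"
    let ?s2 = "s - 2 * (\<eta> * s)"
    have \<eta>s: "0 < \<eta> * s" "\<eta> * s \<le> s / 4" using \<eta> s by auto
    have PS: "?P \<in> sets (lam n)"
    proof -
      have "(\<lambda>z. (\<lambda>i\<in>{..<n}. if z \<in> D' then F z i else 0)) \<in> measurable (lam n) (lam n)"
      proof (rule measurable_into_lam)
        fix i assume i: "i < n"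
        have "(\<lambda>z. if z \<in> D' then F z i else 0) \<in> borel_measurable (lam n)"
          using holo_contD[OF holo_mapD(4)[OF F i]] holo_mapD(1)[OF F] by (intro borel_measurable_continuous_open)
        then show "(\<lambda>z. (\<lambda>i\<in>{..<n}. if z \<in> D' then F z i else 0) i) \<in> borel_measurable (lam n)"
          using i by simp
      qed simp
      from measurable_sets[OF this cube_sets]
      have "(\<lambda>z. (\<lambda>i\<in>{..<n}. if z \<in> D' then F z i else 0)) -` cube n l s \<inter> space (lam n) \<inter> D' \<in> sets (lam n)"
        using openin_sets_lam[OF holo_mapD(2)[OF G]] by blast
      moreover have "(\<lambda>i\<in>{..<n}. if z \<in> D' then F z i else 0) = F z" if "z \<in> D'" for z
        using holo_mapD(3)[OF F that] DT(1) that by (intro tuples_eqI[of _ n]) auto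
      then have "(\<lambda>z. (\<lambda>i\<in>{..<n}. if z \<in> D' then F z i else 0)) -` cube n l s \<inter> space (lam n) \<inter> D' = ?P"
        using DT(2) by auto
      ultimately show ?thesis by simp
    qed
    have AS: "{z \<in> tuples n. A z \<in> cube n l' s'} \<in> sets (lam n)" for l' s'
    proof -
      have "A \<in> measurable (lam n) (lam n)"
        unfolding A_def by (rule measurable_into_lam) (auto simp: lin_index)
      from measurable_sets[OF this cube_sets] show ?thesis by (simp add: vimage_def Int_def conj_commute)
    qed
    have up: "?P \<subseteq> {z \<in> tuples n. A z \<in> ?Q1}"
    proof
      fix z assume z: "z \<in> ?P"
      define w where "w = F z"
      have w: "w \<in> D" "w \<in> cube n l s" "G w = z" using z holo_mapD(3)[OF F] GF by (auto simp: w_def)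
      have wa: "cmod (w j - a j) \<le> 6 * s" if "j < n" for j
        using w(2) l[OF that] that by (intro csquare_close) (auto simp: cube_def)
      then have wp: "w \<in> polydisc n a \<delta>1" using s6 w(1) DT by (force simp: polydisc_def dist_norm)
      have "cmod (A z i - w i) < \<eta> * s" if i: "i < n" for i
      proof -
        let ?r = "\<lambda>j. G w j - G a j - (\<Sum>k<n. T $$ (j, k) * (w k - a k))"
        have r: "cmod (?r j) \<le> \<epsilon>' * (real n * (6 * s))" if "j < n" for j
        proof -
          have "(\<Sum>k<n. cmod (w k - a k)) \<le> real n * (6 * s)"
            using sum_bounded_above[of "{..<n}" "\<lambda>k. cmod (w k - a k)" "6 * s"] wa by simp
          then have "\<epsilon>' * (\<Sum>k<n. cmod (w k - a k)) \<le> \<epsilon>' * (real n * (6 * s))"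
            using \<epsilon>' by (intro mult_left_mono) auto
          with \<delta>1(2)[OF wp that] show ?thesis by (rule order_trans)
        qed
        have ST: "w i - a i = (\<Sum>j<n. S $$ (i, j) * (\<Sum>k<n. T $$ (j, k) * (w k - a k)))"
        proof -
          have "lin n S (lin n T (\<lambda>k\<in>{..<n}. w k - a k)) = (\<lambda>k\<in>{..<n}. w k - a k)"
            unfolding lin_mult[OF TS(2,1), symmetric] TS(3) by (rule lin_one) simp
          from fun_cong[OF this, of i] show ?thesis using i by (simp add: lin_index)
        qed
        have "A z i - w i = (A z i - a i) - (w i - a i)" by simp
        also have "\<dots> = (\<Sum>j<n. S $$ (i, j) * ?r j)"
          unfolding A[OF i] ST w(3)[symmetric] by (simp add: right_diff_distrib sum_subtractf)
        also have "cmod \<dots> \<le> mat_bound n S * (\<epsilon>' * (real n * (6 * s)))"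
          using r \<epsilon>' s by (intro mat_bound i) auto
        also have "\<dots> \<le> K * (\<epsilon>' * (real n * (6 * s)))"
          using K \<epsilon>' s by (intro mult_right_mono) auto
        finally show ?thesis using small[OF s(1)] by simp
      qed
      then have "A z \<in> ?Q1"
        using w(2) by (auto simp: cube_def A_def intro!: csquare_enlarge)
      then show "z \<in> {z \<in> tuples n. A z \<in> ?Q1}" using z DT by auto
    qed
    have low: "{z \<in> tuples n. A z \<in> cube n ?l2 ?s2} \<subseteq> ?P"
    proof
      fix z assume z: "z \<in> {z \<in> tuples n. A z \<in> cube n ?l2 ?s2}"
      have Az: "A z j \<in> csquare (?l2 j) ?s2" if "j < n" for j using z that by (auto simp: cube_def)
      have "A z j \<in> csquare (l j) s" if "j < n" for j
        using Az[OF that] \<eta>s by (auto simp: csquare_def)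
      then have Aa: "cmod (A z j - a j) \<le> 6 * s" if "j < n" for j
        using l that by (intro csquare_close) auto
      have zG: "cmod (z j - G a j) \<le> K * (6 * s)" if j: "j < n" for j
      proof -
        have "lin n T (lin n S (\<lambda>k\<in>{..<n}. z k - G a k)) = (\<lambda>k\<in>{..<n}. z k - G a k)"
          unfolding lin_mult[OF TS(1,2), symmetric] TS(4) by (rule lin_one) simp
        from fun_cong[OF this, of j]
        have "z j - G a j = (\<Sum>k<n. T $$ (j, k) * (A z k - a k))" using j by (simp add: lin_index A)
        also have "cmod \<dots> \<le> mat_bound n T * (6 * s)" using Aa s by (intro mat_bound j) auto
        also have "\<dots> \<le> K * (6 * s)" using K s by (intro mult_right_mono) auto
        finally show ?thesis .
      qed
      then have zp: "z \<in> polydisc n (G a) \<delta>2" using z sK by (force simp: polydisc_def dist_norm)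
      then have zD: "z \<in> D'" using \<delta>2(2) by blast
      have "F z i \<in> csquare (l i) s" if i: "i < n" for i
      proof -
        have "(\<Sum>k<n. cmod (z k - G a k)) \<le> real n * (K * (6 * s))"
          using sum_bounded_above[of "{..<n}" "\<lambda>k. cmod (z k - G a k)" "K * (6 * s)"] zG by simp
        then have "\<epsilon>' * (\<Sum>k<n. cmod (z k - G a k)) \<le> \<epsilon>' * (real n * (K * (6 * s)))"
          using \<epsilon>' by (intro mult_left_mono) auto
        with \<delta>2(3)[OF zp i] have "cmod (F z i - a i - (A z i - a i)) \<le> \<epsilon>' * (real n * (K * (6 * s)))"
          unfolding A[OF i] by (rule order_trans)
        also have "\<dots> = K * (\<epsilon>' * (real n * (6 * s)))" by simp
        finally have "cmod (F z i - A z i) < \<eta> * s" using small[OF s(1)] by simp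
        from csquare_enlarge[OF Az[OF i] this] show ?thesis by simp
      qed
      then have "F z \<in> cube n l s" using holo_mapD(3)[OF F zD] DT by (auto simp: cube_def PiE_def)
      then show "z \<in> ?P" using zD by simp
    qed
    have pow: "((s + 2 * (\<eta> * s))\<^sup>2) ^ n = ((1 + 2 * \<eta>)\<^sup>2) ^ n * (s\<^sup>2) ^ n" "((s - 2 * (\<eta> * s))\<^sup>2) ^ n = ((1 - 2 * \<eta>)\<^sup>2) ^ n * (s\<^sup>2) ^ n"
    proof -
      have "s + 2 * (\<eta> * s) = (1 + 2 * \<eta>) * s" "s - 2 * (\<eta> * s) = (1 - 2 * \<eta>) * s" by (auto simp: algebra_simps)
      then show "((s + 2 * (\<eta> * s))\<^sup>2) ^ n = ((1 + 2 * \<eta>)\<^sup>2) ^ n * (s\<^sup>2) ^ n" "((s - 2 * (\<eta> * s))\<^sup>2) ^ n = ((1 - 2 * \<eta>)\<^sup>2) ^ n * (s\<^sup>2) ^ n"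
        by (simp_all add: power_mult_distrib)
    qed
    have meas: "emeasure (lam n) {z \<in> tuples n. A z \<in> cube n l' s'} = ennreal (c * (s'\<^sup>2) ^ n)" if "0 \<le> s'" for l' s'
      using emeasure_affine_preimage_cube[OF TS(1,2,4) that, of b l'] by (simp add: A_def c_def T_def)
    have "emeasure (lam n) ?P \<le> emeasure (lam n) {z \<in> tuples n. A z \<in> ?Q1}"
      using up AS by (rule emeasure_mono)
    also have "\<dots> = ennreal (c * ((1 + 2 * \<eta>)\<^sup>2) ^ n * (s\<^sup>2) ^ n)"
      using \<eta>s s by (subst meas) (auto simp: pow mult.assoc)
    also have "\<dots> \<le> ennreal ((c + \<epsilon>) * (s\<^sup>2) ^ n)"
      using \<eta>(1) by (intro ennreal_leI mult_right_mono) auto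
    finally have upper: "emeasure (lam n) ?P \<le> ennreal ((c + \<epsilon>) * (s\<^sup>2) ^ n)" .
    have "ennreal ((c - \<epsilon>) * (s\<^sup>2) ^ n) \<le> ennreal (c * ((1 - 2 * \<eta>)\<^sup>2) ^ n * (s\<^sup>2) ^ n)"
      using \<eta>(2) by (intro ennreal_leI mult_right_mono) auto
    also have "\<dots> = emeasure (lam n) {z \<in> tuples n. A z \<in> cube n ?l2 ?s2}"
      using \<eta>s s by (subst meas) (auto simp: pow mult.assoc)
    also have "\<dots> \<le> emeasure (lam n) ?P" using low PS by (rule emeasure_mono)
    finally show ?thesis using upper by blast
  qed
  ultimately show ?thesis by (intro exI[of _ \<delta>]) auto
qed

lemma ennreal_le_add: "x \<le> y + z \<Longrightarrow> 0 \<le> z \<Longrightarrow> ennreal x \<le> ennreal y + ennreal z"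
  by (cases "0 \<le> y") (auto simp flip: ennreal_plus intro: ennreal_leI order_trans simp: ennreal_neg)

lemma emeasure_polydisc_finite: "emeasure (lam n) (polydisc n a d) < \<infinity>"
proof (cases "0 \<le> d")
  case True
  have "polydisc n a d \<subseteq> cube n (\<lambda>i. a i - Complex d d) (0 + 2 * d)"
  proof
    fix z assume z: "z \<in> polydisc n a d"
    have "z i \<in> csquare (a i - Complex d d) (2 * d)" if "i < n" for i
      using abs_Re_le_cmod[of "z i - a i"] abs_Im_le_cmod[of "z i - a i"] z that
      by (auto simp: polydisc_def csquare_def dist_norm)
    then show "z \<in> cube n (\<lambda>i. a i - Complex d d) (0 + 2 * d)"
      using z by (auto simp: cube_def polydisc_def PiE_def)
  qed
  then have "emeasure (lam n) (polydisc n a d) \<le> ennreal (((2 * d)\<^sup>2) ^ n)"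
    using True emeasure_mono[of "polydisc n a d" _ "lam n"] emeasure_cube[of "2 * d" n] by (metis add_0 cube_sets mult_nonneg_nonneg zero_le_numeral)
  then show ?thesis using le_less_trans by fastforce
next
  case False
  have "polydisc n a d = {} \<or> n = 0"
  proof (rule ccontr)
    assume "\<not> ?thesis"
    then obtain z where "z \<in> polydisc n a d" "0 < n" by auto
    then have "dist (z 0) (a 0) < d" by (simp add: polydisc_def)
    then show False using False zero_le_dist[of "z 0" "a 0"] by linarith
  qed
  then show ?thesis
  proof
    assume "n = 0"
    then have "polydisc n a d \<subseteq> cube n a 0" by (auto simp: polydisc_def cube_def)
    then have "emeasure (lam n) (polydisc n a d) \<le> emeasure (lam n) (cube n a 0)" by (intro emeasure_mono) auto
    also have "\<dots> < \<infinity>" by (simp add: emeasure_cube)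
    finally show ?thesis .
  qed simp
qed

text \<open>The measure with density \<open>\<bar>det G'\<bar>\<^sup>2\<close> and the image of Lebesgue measure under \<open>F\<close> agree on small
  cubes up to a small multiple of the volume, because \<open>G\<close> is nearly affine there; hence they are equal.\<close>

theorem nn_integral_change_of_variables:
  assumes G: "holo_map n n D D' G" and F: "holo_map n n D' D F"
    and FG: "\<And>w. w \<in> D \<Longrightarrow> F (G w) = w" and GF: "\<And>z. z \<in> D' \<Longrightarrow> G (F z) = z"
    and v: "v \<in> borel_measurable (lam n)"
  shows "(\<integral>\<^sup>+w. ennreal ((cmod (Determinant.det (jacobian n n G w)))\<^sup>2) * indicator D w * v w \<partial>lam n)
    = (\<integral>\<^sup>+z. indicator D' z * v (F z) \<partial>lam n)"
proof -
  let ?d = "\<lambda>w. (cmod (Determinant.det (jacobian n n G w)))\<^sup>2"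
  let ?f = "\<lambda>w. ennreal (?d w) * indicator D w"
  define F' where "F' z = (\<lambda>i\<in>{..<n}. if z \<in> D' then F z i else 0)" for z
  define M1 where "M1 = density (lam n) ?f"
  define M2 where "M2 = distr (density (lam n) (indicator D')) (lam n) F'"
  have DT: "D \<subseteq> tuples n" "D' \<subseteq> tuples n" using openin_CnD(1) holo_mapD(1,2)[OF G] by auto
  have DS: "D \<in> sets (lam n)" "D' \<in> sets (lam n)" using openin_sets_lam holo_mapD(1,2)[OF G] by auto
  have F': "F' z = F z" if "z \<in> D'" for z
    using holo_mapD(3)[OF F that] DT(1) that by (intro tuples_eqI[of _ n]) (auto simp: F'_def)
  have F'm: "F' \<in> measurable (lam n) (lam n)"
  proof (rule measurable_into_lam)
    fix i assume i: "i < n"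
    have "(\<lambda>z. if z \<in> D' then F z i else 0) \<in> borel_measurable (lam n)"
      using holo_contD[OF holo_mapD(4)[OF F i]] holo_mapD(1)[OF F] by (intro borel_measurable_continuous_open)
    then show "(\<lambda>z. F' z i) \<in> borel_measurable (lam n)"
      using i by (simp add: F'_def)
  qed (simp add: F'_def)
  have dcont: "continuous_map (subtopology (Cn n) D) euclidean ?d"
    using continuous_det_jacobian[OF G] by (simp add: continuous_map_atin tendsto_norm tendsto_power)
  have fm: "?f \<in> borel_measurable (lam n)"
  proof -
    have "(\<lambda>w. if w \<in> D then ?d w else 0) \<in> borel_measurable (lam n)"
      using holo_mapD(1)[OF G] dcont by (rule borel_measurable_continuous_open)
    then have "(\<lambda>w. ennreal (if w \<in> D then ?d w else 0)) \<in> borel_measurable (lam n)" by measurable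
    moreover have "(\<lambda>w. ennreal (if w \<in> D then ?d w else 0)) = ?f" by (auto simp: indicator_def)
    ultimately show ?thesis by simp
  qed
  have sets: "sets M1 = sets (lam n)" "sets M2 = sets (lam n)" by (auto simp: M1_def M2_def)
  have M1: "emeasure M1 B = (\<integral>\<^sup>+w. ?f w * indicator B w \<partial>lam n)" if "B \<in> sets (lam n)" for B
    unfolding M1_def using fm that by (rule emeasure_density)
  have M2: "emeasure M2 B = emeasure (lam n) {z \<in> D'. F z \<in> B}" if B: "B \<in> sets (lam n)" for B
  proof -
    have "emeasure M2 B = emeasure (density (lam n) (indicator D')) (F' -` B \<inter> space (lam n))"
      unfolding M2_def using F'm B by (subst emeasure_distr) auto
    also have "\<dots> = (\<integral>\<^sup>+z. indicator D' z * indicator (F' -` B \<inter> space (lam n)) z \<partial>lam n)"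
      using DS measurable_sets[OF F'm B] by (intro emeasure_density) auto
    also have "\<dots> = (\<integral>\<^sup>+z. indicator (D' \<inter> (F' -` B \<inter> space (lam n))) z \<partial>lam n)"
      by (intro nn_integral_cong) (auto simp: indicator_def)
    also have "\<dots> = emeasure (lam n) (D' \<inter> (F' -` B \<inter> space (lam n)))"
      using DS measurable_sets[OF F'm B] by (intro nn_integral_indicator) auto
    also have "D' \<inter> (F' -` B \<inter> space (lam n)) = {z \<in> D'. F z \<in> B}"
      using F' DT by auto
    finally show ?thesis .
  qed
  have loc: "\<exists>\<delta>>0. \<forall>l s. 0 < s \<and> s < \<delta> \<and> (\<forall>i<n. cmod (l i - a i) \<le> 4 * s) \<longrightarrow>
      emeasure M1 (cube n l s) \<le> emeasure M2 (cube n l s) + ennreal \<epsilon> * emeasure (lam n) (cube n l s) \<and>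
      emeasure M2 (cube n l s) \<le> emeasure M1 (cube n l s) + ennreal \<epsilon> * emeasure (lam n) (cube n l s)"
    if a: "a \<in> D" and \<epsilon>: "\<epsilon> > 0" for a \<epsilon>
  proof -
    have \<epsilon>2: "\<epsilon> / 2 > 0" using \<epsilon> by simp
    obtain \<delta>1 where \<delta>1: "\<delta>1 > 0" "\<And>l s. 0 < s \<Longrightarrow> s < \<delta>1 \<Longrightarrow> \<forall>i<n. cmod (l i - a i) \<le> 4 * s \<Longrightarrow>
     emeasure (lam n) {z \<in> D'. F z \<in> cube n l s} \<le> ennreal ((?d a + \<epsilon>/2) * (s\<^sup>2) ^ n) \<and>
     ennreal ((?d a - \<epsilon>/2) * (s\<^sup>2) ^ n) \<le> emeasure (lam n) {z \<in> D'. F z \<in> cube n l s}"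
      using emeasure_image_cube[OF G F FG GF a \<epsilon>2] by blast
    obtain \<delta>2 where \<delta>2: "\<delta>2 > 0" "polydisc n a \<delta>2 \<subseteq> D" "\<And>w. w \<in> polydisc n a \<delta>2 \<Longrightarrow> dist (?d w) (?d a) < \<epsilon> / 2"
      using continuous_CnD[OF dcont holo_mapD(1)[OF G] a \<epsilon>2] by blast
    have "emeasure M1 Q \<le> emeasure M2 Q + ennreal \<epsilon> * emeasure (lam n) Q \<and>
          emeasure M2 Q \<le> emeasure M1 Q + ennreal \<epsilon> * emeasure (lam n) Q"
      if s: "0 < s" "s < min \<delta>1 (\<delta>2 / 6)" and l: "\<forall>i<n. cmod (l i - a i) \<le> 4 * s" and Q: "Q = cube n l s" for l s Q
    proof -
      have QS: "Q \<in> sets (lam n)" using Q by simp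
      have "dist (w i) (a i) < \<delta>2" if "w \<in> Q" "i < n" for w i
        using csquare_close[of "w i" "l i" s "a i"] l that s by (force simp: Q cube_def dist_norm)
      then have Qsub: "Q \<subseteq> polydisc n a \<delta>2" by (auto simp: Q polydisc_def cube_def)
      have near: "w \<in> D" "?d w \<le> ?d a + \<epsilon>/2" "?d a - \<epsilon>/2 \<le> ?d w" if "w \<in> Q" for w
      proof -
        have "\<bar>?d w - ?d a\<bar> < \<epsilon> / 2" using \<delta>2(3)[of w] that Qsub by (auto simp: dist_real_def)
        then show "?d w \<le> ?d a + \<epsilon>/2" "?d a - \<epsilon>/2 \<le> ?d w" by linarith+
        show "w \<in> D" using \<delta>2(2) that Qsub by blast
      qed
      have vol: "emeasure (lam n) Q = ennreal ((s\<^sup>2) ^ n)" using s by (simp add: Q emeasure_cube)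
      let ?v = "(s\<^sup>2) ^ n"
      have v: "0 \<le> ?v" by simp
      have "emeasure M1 Q = (\<integral>\<^sup>+w. ?f w * indicator Q w \<partial>lam n)" by (rule M1[OF QS])
      also have "\<dots> \<le> (\<integral>\<^sup>+w. ennreal (?d a + \<epsilon>/2) * indicator Q w \<partial>lam n)"
        using near by (intro nn_integral_mono) (auto simp: indicator_def intro!: ennreal_leI)
      also have "\<dots> = ennreal ((?d a + \<epsilon>/2) * ?v)"
        using \<epsilon> QS by (simp add: nn_integral_cmult_indicator vol ennreal_mult)
      finally have M1u: "emeasure M1 Q \<le> ennreal ((?d a + \<epsilon>/2) * ?v)" .
      have "ennreal ((?d a - \<epsilon>/2) * ?v) = (\<integral>\<^sup>+w. ennreal (?d a - \<epsilon>/2) * indicator Q w \<partial>lam n)"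
        using QS by (simp add: nn_integral_cmult_indicator vol ennreal_mult'')
      also have "\<dots> \<le> (\<integral>\<^sup>+w. ?f w * indicator Q w \<partial>lam n)"
        using near by (intro nn_integral_mono) (auto simp: indicator_def intro!: ennreal_leI)
      also have "\<dots> = emeasure M1 Q" by (rule M1[OF QS, symmetric])
      finally have M1l: "ennreal ((?d a - \<epsilon>/2) * ?v) \<le> emeasure M1 Q" .
      have M2b: "emeasure M2 Q \<le> ennreal ((?d a + \<epsilon>/2) * ?v)" "ennreal ((?d a - \<epsilon>/2) * ?v) \<le> emeasure M2 Q"
      proof -
        have "emeasure M2 Q = emeasure (lam n) {z \<in> D'. F z \<in> cube n l s}"
          by (subst M2[OF QS]) (simp only: Q)
        then show "emeasure M2 Q \<le> ennreal ((?d a + \<epsilon>/2) * ?v)" "ennreal ((?d a - \<epsilon>/2) * ?v) \<le> emeasure M2 Q"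
          using \<delta>1(2)[of s l] s l by auto
      qed
      have gap: "ennreal ((?d a + \<epsilon>/2) * ?v) \<le> ennreal ((?d a - \<epsilon>/2) * ?v) + ennreal (\<epsilon> * ?v)"
        using \<epsilon> v by (intro ennreal_le_add) (auto simp: algebra_simps)
      have \<epsilon>v: "ennreal \<epsilon> * emeasure (lam n) Q = ennreal (\<epsilon> * ?v)"
        using \<epsilon> by (simp add: vol ennreal_mult)
      show ?thesis
        unfolding \<epsilon>v
        using order_trans[OF M1u order_trans[OF gap add_right_mono[OF M2b(2)]]]
          order_trans[OF M2b(1) order_trans[OF gap add_right_mono[OF M1l]]] by blast
    qed
    moreover have "min \<delta>1 (\<delta>2 / 6) > 0" using \<delta>1(1) \<delta>2(1) by simp
    ultimately show ?thesis by blast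
  qed
  have fin: "\<exists>\<delta>>0. emeasure M1 (polydisc n a \<delta>) < \<infinity>" if a: "a \<in> D" for a
  proof -
    obtain \<delta> where \<delta>: "\<delta> > 0" "polydisc n a \<delta> \<subseteq> D" "\<And>w. w \<in> polydisc n a \<delta> \<Longrightarrow> dist (?d w) (?d a) < 1"
      using continuous_CnD[OF dcont holo_mapD(1)[OF G] a, of 1] by auto
    define C where "C = ?d a + 1"
    have le: "?d w \<le> C" if "w \<in> polydisc n a \<delta>" for w using \<delta>(3)[OF that] by (auto simp: dist_real_def C_def)
    have PS: "polydisc n a \<delta> \<in> sets (lam n)" by (rule openin_sets_lam[OF openin_polydisc])
    have "emeasure M1 (polydisc n a \<delta>) \<le> (\<integral>\<^sup>+w. ennreal C * indicator (polydisc n a \<delta>) w \<partial>lam n)"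
      unfolding M1[OF PS] using le by (intro nn_integral_mono) (auto simp: indicator_def intro!: ennreal_leI)
    also have "\<dots> = ennreal C * emeasure (lam n) (polydisc n a \<delta>)"
      using PS by (rule nn_integral_cmult_indicator)
    also have "\<dots> < \<infinity>" using emeasure_polydisc_finite[of n a \<delta>] by (simp add: ennreal_mult_less_top)
    finally show ?thesis using \<delta>(1) by blast
  qed
  have "emeasure M1 (B \<inter> D) = emeasure M2 (B \<inter> D)" if "B \<in> sets (lam n)" for B
  proof (rule emeasure_eq_on_open[OF sets holo_mapD(1)[OF G] _ _ fin that])
    fix a \<epsilon> assume "a \<in> D" "(0::real) < \<epsilon>"
    from loc[OF this] show "\<exists>\<delta>>0. \<forall>l s. 0 < s \<and> s < \<delta> \<and> (\<forall>i<n. cmod (l i - a i) \<le> 4 * s) \<longrightarrow>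
      emeasure M1 (cube n l s) \<le> emeasure M2 (cube n l s) + ennreal \<epsilon> * emeasure (lam n) (cube n l s)"
      "\<exists>\<delta>>0. \<forall>l s. 0 < s \<and> s < \<delta> \<and> (\<forall>i<n. cmod (l i - a i) \<le> 4 * s) \<longrightarrow>
      emeasure M2 (cube n l s) \<le> emeasure M1 (cube n l s) + ennreal \<epsilon> * emeasure (lam n) (cube n l s)"
      by meson+
  qed
  moreover have "emeasure M1 (B \<inter> D) = emeasure M1 B" if "B \<in> sets (lam n)" for B
    using that DS by (subst (1 2) M1) (auto intro!: nn_integral_cong simp: indicator_def)
  moreover have "emeasure M2 (B \<inter> D) = emeasure M2 B" if "B \<in> sets (lam n)" for B
    using that DS holo_mapD(3)[OF F] by (subst (1 2) M2) (auto intro!: arg_cong[where f="emeasure _"])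
  ultimately have M12: "M1 = M2"
    using sets by (intro measure_eqI) auto
  have "(\<integral>\<^sup>+w. ?f w * v w \<partial>lam n) = (\<integral>\<^sup>+w. v w \<partial>M1)"
    unfolding M1_def using fm v by (rule nn_integral_density[symmetric])
  also have "\<dots> = (\<integral>\<^sup>+z. v (F' z) \<partial>density (lam n) (indicator D'))"
    unfolding M12 M2_def using F'm v by (intro nn_integral_distr) auto
  also have "\<dots> = (\<integral>\<^sup>+z. indicator D' z * v (F' z) \<partial>lam n)"
    using DS measurable_compose[OF F'm v] by (intro nn_integral_density) auto
  also have "\<dots> = (\<integral>\<^sup>+z. indicator D' z * v (F z) \<partial>lam n)"
    using F' by (intro nn_integral_cong) (auto simp: indicator_def)
  finally show ?thesis .
qed

section \<open>Integrals of non-measurable functions\<close>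

text \<open>The densities below are arbitrary functions, and their \<open>nn_integral\<close> is the lower integral: a
  supremum over simple functions. An upper bound may therefore be tested on these, which are measurable.\<close>

lemma nn_integral_le_simple:
  assumes "\<And>g. simple_function M g \<Longrightarrow> g \<le> f \<Longrightarrow> (\<integral>\<^sup>+x. g x \<partial>M) \<le> C"
  shows "(\<integral>\<^sup>+x. f x \<partial>M) \<le> C"
  unfolding nn_integral_def
proof (rule SUP_least)
  fix g assume "g \<in> {g. simple_function M g \<and> g \<le> f}"
  then show "integral\<^sup>S M g \<le> C" using assms[of g] by (simp add: nn_integral_eq_simple_integral)
qed

lemma nn_integral_finite_cover_le:
  assumes "finite J" "\<And>j. j \<in> J \<Longrightarrow> A j \<in> sets M"
    and cover: "\<And>x. x \<in> space M \<Longrightarrow> f x \<noteq> 0 \<Longrightarrow> \<exists>j\<in>J. x \<in> A j"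
  shows "(\<integral>\<^sup>+x. f x \<partial>M) \<le> (\<Sum>j\<in>J. \<integral>\<^sup>+x. f x * indicator (A j) x \<partial>M)"
proof (rule nn_integral_le_simple)
  fix g assume g: "simple_function M g" "g \<le> f"
  have [measurable]: "g \<in> borel_measurable M" using g(1) by (rule borel_measurable_simple_function)
  have gf: "g x \<le> f x" for x using g(2) by (simp add: le_fun_def)
  have "(\<integral>\<^sup>+x. g x \<partial>M) \<le> (\<integral>\<^sup>+x. (\<Sum>j\<in>J. g x * indicator (A j) x) \<partial>M)"
  proof (rule nn_integral_mono)
    fix x assume x: "x \<in> space M"
    show "g x \<le> (\<Sum>j\<in>J. g x * indicator (A j) x)"
    proof (cases "g x = 0")
      case False
      then have "f x \<noteq> 0" using gf[of x] by auto
      then obtain j where j: "j \<in> J" "x \<in> A j" using cover[OF x] by blast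
      have "g x = g x * indicator (A j) x" using j by simp
      also have "\<dots> \<le> (\<Sum>j\<in>J. g x * indicator (A j) x)" using j assms(1) by (intro member_le_sum) auto
      finally show ?thesis .
    qed simp
  qed
  also have "\<dots> = (\<Sum>j\<in>J. \<integral>\<^sup>+x. g x * indicator (A j) x \<partial>M)"
    using assms(2) by (intro nn_integral_sum) auto
  also have "\<dots> \<le> (\<Sum>j\<in>J. \<integral>\<^sup>+x. f x * indicator (A j) x \<partial>M)"
    using gf by (intro sum_mono nn_integral_mono mult_right_mono) auto
  finally show "(\<integral>\<^sup>+x. g x \<partial>M) \<le> (\<Sum>j\<in>J. \<integral>\<^sup>+x. f x * indicator (A j) x \<partial>M)" .
qed

lemma nn_integral_superadditive:
  "(\<integral>\<^sup>+x. f x \<partial>M) + (\<integral>\<^sup>+x. h x \<partial>M) \<le> (\<integral>\<^sup>+x. f x + h x \<partial>M)"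
proof -
  let ?S = "\<lambda>f. {g. simple_function M g \<and> g \<le> f}"
  have ne: "?S f \<noteq> {}" for f :: "'a \<Rightarrow> ennreal"
    by (auto intro!: exI[of _ "\<lambda>_. 0"] simp: le_fun_def)
  have "(\<integral>\<^sup>+x. f x \<partial>M) + (\<integral>\<^sup>+x. h x \<partial>M) = (SUP g\<in>?S f. integral\<^sup>S M g + (\<integral>\<^sup>+x. h x \<partial>M))"
    unfolding nn_integral_def[of M f] by (rule ennreal_SUP_add_left[OF ne, symmetric])
  also have "\<dots> = (SUP g\<in>?S f. SUP k\<in>?S h. integral\<^sup>S M g + integral\<^sup>S M k)"
    unfolding nn_integral_def[of M h] by (intro SUP_cong refl ennreal_SUP_add_right ne)
  also have "\<dots> \<le> (\<integral>\<^sup>+x. f x + h x \<partial>M)"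
  proof (intro SUP_least)
    fix g k assume g: "g \<in> ?S f" and k: "k \<in> ?S h"
    have "integral\<^sup>S M g + integral\<^sup>S M k = (\<integral>\<^sup>+x. g x + k x \<partial>M)"
      using g k by (subst nn_integral_add) (auto simp: nn_integral_eq_simple_integral borel_measurable_simple_function)
    also have "\<dots> \<le> (\<integral>\<^sup>+x. f x + h x \<partial>M)"
      using g k by (intro nn_integral_mono add_mono) (auto simp: le_fun_def)
    finally show "integral\<^sup>S M g + integral\<^sup>S M k \<le> (\<integral>\<^sup>+x. f x + h x \<partial>M)" .
  qed
  finally show ?thesis .
qed

lemma nn_integral_disjoint_sum_le:
  assumes "finite K" and "\<And>k k'. k \<in> K \<Longrightarrow> k' \<in> K \<Longrightarrow> k \<noteq> k' \<Longrightarrow> E k \<inter> E k' = {}"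
  shows "(\<Sum>k\<in>K. \<integral>\<^sup>+x. f x * indicator (E k) x \<partial>M) \<le> (\<integral>\<^sup>+x. f x * indicator (\<Union>k\<in>K. E k) x \<partial>M)"
  using assms
proof (induction K rule: finite_induct)
  case (insert k K)
  have "(\<Sum>k\<in>insert k K. \<integral>\<^sup>+x. f x * indicator (E k) x \<partial>M)
     \<le> (\<integral>\<^sup>+x. f x * indicator (E k) x \<partial>M) + (\<integral>\<^sup>+x. f x * indicator (\<Union>k\<in>K. E k) x \<partial>M)"
    using insert by (auto intro!: add_left_mono)
  also have "\<dots> \<le> (\<integral>\<^sup>+x. f x * indicator (E k) x + f x * indicator (\<Union>k\<in>K. E k) x \<partial>M)"
    by (rule nn_integral_superadditive)
  also have "\<dots> = (\<integral>\<^sup>+x. f x * indicator (\<Union>k\<in>insert k K. E k) x \<partial>M)"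
  proof (rule nn_integral_cong)
    fix x
    have "E k \<inter> (\<Union>k\<in>K. E k) = {}" using insert.prems insert.hyps by blast
    then show "f x * indicator (E k) x + f x * indicator (\<Union>k\<in>K. E k) x = f x * indicator (\<Union>k\<in>insert k K. E k) x"
      by (auto simp: indicator_def)
  qed
  finally show ?case .
qed simp

text \<open>The change of variables formula is applied to the simple functions below the integrand.\<close>

lemma nn_integral_transition_le:
  assumes G: "holo_map n n D D' G" and F: "holo_map n n D' D F"
    and FG: "\<And>w. w \<in> D \<Longrightarrow> F (G w) = w" and GF: "\<And>z. z \<in> D' \<Longrightarrow> G (F z) = z"
    and A: "A \<subseteq> D'"
    and le: "\<And>w. w \<in> D \<Longrightarrow> G w \<in> A \<Longrightarrow> \<rho> (G w) * ennreal ((cmod (Determinant.det (jacobian n n G w)))\<^sup>2) \<le> \<rho>' w"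
  shows "(\<integral>\<^sup>+z. \<rho> z * indicator A z \<partial>lam n) \<le> (\<integral>\<^sup>+w. \<rho>' w * indicator (F ` A) w \<partial>lam n)"
proof (rule nn_integral_le_simple)
  fix g assume g: "simple_function (lam n) g" "g \<le> (\<lambda>z. \<rho> z * indicator A z)"
  have gm [measurable]: "g \<in> borel_measurable (lam n)" using g(1) by (rule borel_measurable_simple_function)
  have g0: "g z = 0" if "z \<notin> A" for z using g(2)[unfolded le_fun_def, rule_format, of z] that by simp
  have g\<rho>: "g z \<le> \<rho> z" if "z \<in> A" for z using g(2)[unfolded le_fun_def, rule_format, of z] that by simp
  \<comment> \<open>a total measurable function that agrees with \<open>G\<close> on \<open>D\<close>\<close>
  define G' where "G' w = (\<lambda>i\<in>{..<n}. if w \<in> D then G w i else 0)" for w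
  have DT: "D \<subseteq> tuples n" "D' \<subseteq> tuples n" using openin_CnD(1) holo_mapD(1,2)[OF G] by auto
  have G': "G' w = G w" if "w \<in> D" for w
    using holo_mapD(3)[OF G that] DT(2) that by (intro tuples_eqI[of _ n]) (auto simp: G'_def)
  have G'm: "G' \<in> measurable (lam n) (lam n)"
  proof (rule measurable_into_lam)
    fix i assume i: "i < n"
    have "(\<lambda>z. if z \<in> D then G z i else 0) \<in> borel_measurable (lam n)"
      using holo_contD[OF holo_mapD(4)[OF G i]] holo_mapD(1)[OF G] by (intro borel_measurable_continuous_open)
    then show "(\<lambda>z. G' z i) \<in> borel_measurable (lam n)"
      using i by (simp add: G'_def)
  qed (simp add: G'_def)
  have vm: "(\<lambda>w. g (G' w)) \<in> borel_measurable (lam n)" using G'm gm by (rule measurable_compose)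
  have "(\<integral>\<^sup>+z. g z \<partial>lam n) = (\<integral>\<^sup>+z. indicator D' z * g (G' (F z)) \<partial>lam n)"
  proof (rule nn_integral_cong)
    fix z
    show "g z = indicator D' z * g (G' (F z))"
      using g0[of z] A GF[of z] G'[OF holo_mapD(3)[OF F, of z]] by (cases "z \<in> D'") auto
  qed
  also have "\<dots> = (\<integral>\<^sup>+w. ennreal ((cmod (Determinant.det (jacobian n n G w)))\<^sup>2) * indicator D w * g (G' w) \<partial>lam n)"
    by (rule nn_integral_change_of_variables[OF G F FG GF vm, symmetric])
  also have "\<dots> \<le> (\<integral>\<^sup>+w. \<rho>' w * indicator (F ` A) w \<partial>lam n)"
  proof (rule nn_integral_mono)
    fix w
    show "ennreal ((cmod (Determinant.det (jacobian n n G w)))\<^sup>2) * indicator D w * g (G' w) \<le> \<rho>' w * indicator (F ` A) w"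
    proof (cases "w \<in> D \<and> G w \<in> A")
      case True
      then have "w \<in> F ` A" using FG[of w] by (intro image_eqI[of _ _ "G w"]) auto
      moreover have "ennreal ((cmod (Determinant.det (jacobian n n G w)))\<^sup>2) * g (G w) \<le> \<rho>' w"
        using le[of w] True mult_right_mono[OF g\<rho>[of "G w"], of "ennreal ((cmod (Determinant.det (jacobian n n G w)))\<^sup>2)"]
        by (simp add: mult.commute)
      ultimately show ?thesis using True G' by simp
    next
      case False
      then show ?thesis using g0[of "G w"] G'[of w] by (cases "w \<in> D") auto
    qed
  qed
  finally show "(\<integral>\<^sup>+z. g z \<partial>lam n) \<le> (\<integral>\<^sup>+w. \<rho>' w * indicator (F ` A) w \<partial>lam n)" .
qed

section \<open>Square integrable functions of one variable\<close>

lemma circle_mean: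
  assumes k: "k holomorphic_on S" "open S" "cball 0 r \<subseteq> S" and r: "0 < r"
  shows "((\<lambda>t. k (of_real r * exp (2 * of_real pi * \<i> * of_real t))) has_integral k 0) {0..1}"
proof -
  have "((\<lambda>u. k u / (u - 0)) has_contour_integral (2 * of_real pi * \<i> * k 0)) (circlepath 0 r)"
  proof (rule Cauchy_integral_circlepath)
    show "continuous_on (cball 0 r) k"
      by (rule holomorphic_on_imp_continuous_on[OF holomorphic_on_subset[OF k(1,3)]])
    show "k holomorphic_on ball 0 r"
      using k(3) ball_subset_cball by (intro holomorphic_on_subset[OF k(1)]) (rule order_trans)
  qed (use r in simp)
  then have "((\<lambda>t. k (circlepath 0 r t) / circlepath 0 r t * (2 * pi * \<i> * r * exp (2 * of_real pi * \<i> * t)))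
      has_integral (2 * of_real pi * \<i> * k 0)) {0..1}"
    unfolding has_contour_integral_def
    by (rule has_integral_eq[rotated]) (auto simp: vector_derivative_circlepath01)
  moreover define c where "c = 2 * complex_of_real pi * \<i>"
  ultimately have "((\<lambda>t. c * k (of_real r * exp (2 * of_real pi * \<i> * of_real t))) has_integral (c * k 0)) {0..1}"
    by (elim has_integral_eq_rhs[OF has_integral_eq[rotated]]) (use r in \<open>auto simp: circlepath field_simps c_def\<close>)
  then have "((\<lambda>t. inverse c * (c * k (of_real r * exp (2 * of_real pi * \<i> * of_real t))))
      has_integral (inverse c * (c * k 0))) {0..1}"
    by (rule has_integral_mult_right)
  moreover have "c \<noteq> 0" by (simp add: c_def)
  ultimately show ?thesis by (simp add: mult.assoc[symmetric])
qed

lemma circle_submean: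
  assumes k: "k holomorphic_on S" "open S" "cball 0 1 \<subseteq> S"
  shows "ennreal (cmod (k 0)) \<le> (\<integral>\<^sup>+t. ennreal (cmod (k (exp (2 * of_real pi * \<i> * of_real t)))) * indicator {0..1} t \<partial>lborel)"
proof -
  let ?e = "\<lambda>t::real. exp (2 * of_real pi * \<i> * of_real t)"
  have int: "((\<lambda>t. k (?e t)) has_integral k 0) {0..1}"
    using circle_mean[OF k, of] by simp
  have ke: "continuous_on UNIV (\<lambda>t. k (?e t))"
    using k by (intro continuous_on_compose2[OF holomorphic_on_imp_continuous_on[OF k(1)]] continuous_intros) (auto simp: subset_eq)
  then have cont: "continuous_on UNIV (\<lambda>t. cmod (k (?e t)))" by (intro continuous_intros)
  then have "(\<lambda>t. cmod (k (?e t))) integrable_on {0..1}"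
    by (intro integrable_continuous_real) (rule continuous_on_subset, auto)
  then have I: "((\<lambda>t. cmod (k (?e t))) has_integral integral {0..1} (\<lambda>t. cmod (k (?e t)))) {0..1}"
    by (rule integrable_integral)
  have "cmod (integral {0..1} (\<lambda>t. k (?e t))) \<le> integral {0..1} (\<lambda>t. cmod (k (?e t)))"
    using int I by (intro integral_norm_bound_integral) (auto intro: has_integral_integrable)
  then have le: "cmod (k 0) \<le> integral {0..1} (\<lambda>t. cmod (k (?e t)))"
    using int by (simp add: integral_unique)
  have "((\<lambda>t. if t \<in> {0..1} then cmod (k (?e t)) else 0) has_integral integral {0..1} (\<lambda>t. cmod (k (?e t)))) UNIV"
    using I by (simp only: has_integral_restrict_UNIV)
  moreover have "(\<lambda>t. if t \<in> {0..1} then cmod (k (?e t)) else 0) \<in> borel_measurable borel"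
    using borel_measurable_continuous_onI[OF cont] by measurable
  ultimately have "(\<integral>\<^sup>+t. ennreal (if t \<in> {0..1} then cmod (k (?e t)) else 0) \<partial>lborel) = ennreal (integral {0..1} (\<lambda>t. cmod (k (?e t))))"
    by (intro nn_integral_has_integral_lborel) auto
  moreover have "ennreal (if t \<in> {0..1} then cmod (k (?e t)) else 0) = ennreal (cmod (k (?e t))) * indicator {0..1} t" for t :: real
    by (auto simp: indicator_def)
  ultimately show ?thesis using le by (simp add: ennreal_leI)
qed

lemma emeasure_disc:
  assumes R: "0 < R"
  shows "emeasure lborel (ball (0::complex) R) = ennreal (R\<^sup>2) * emeasure lborel (ball (0::complex) 1)"
proof -
  have "emeasure lborel (ball (0::complex) R) = (\<integral>\<^sup>+w. indicator (ball (0::complex) R) w \<partial>lborel)" by simp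
  also have "\<dots> = ennreal ((cmod (of_real R))\<^sup>2) * (\<integral>\<^sup>+w. indicator (ball (0::complex) R) (of_real R * w) \<partial>lborel)"
    using R by (intro nn_integral_complex_scale borel_measurable_indicator) auto
  also have "(\<lambda>w. indicator (ball (0::complex) R) (of_real R * w) :: ennreal) = indicator (ball 0 1)"
    using R by (auto simp: indicator_def norm_mult)
  finally show ?thesis by simp
qed

lemma emeasure_unit_disc: "0 < emeasure lborel (ball (0::complex) 1)" "emeasure lborel (ball (0::complex) 1) < \<infinity>"
proof -
  have "emeasure lborel (csquare 0 (1/2)) \<le> emeasure lborel (ball (0::complex) 1)"
  proof (rule emeasure_mono)
    show "csquare 0 (1/2) \<subseteq> ball 0 1"
    proof
      fix w assume "w \<in> csquare 0 (1/2)"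
      then have "cmod w < 1" using cmod_le[of w] by (auto simp: csquare_def)
      then show "w \<in> ball 0 1" by simp
    qed
  qed simp
  moreover have "0 < emeasure lborel (csquare 0 (1/2))" by (simp add: emeasure_csquare)
  ultimately show "0 < emeasure lborel (ball (0::complex) 1)" by (rule less_le_trans[rotated])
  show "emeasure lborel (ball (0::complex) 1) < \<infinity>" using emeasure_lborel_ball_finite by auto
qed

text \<open>Averaging over rotations turns the mean value property on circles into one on discs.\<close>

lemma disc_submean:
  assumes h: "h holomorphic_on ball w0 R" and R: "0 < R"
  shows "ennreal ((cmod (h w0))\<^sup>2) * emeasure lborel (ball (0::complex) R)
     \<le> (\<integral>\<^sup>+w. ennreal ((cmod (h w))\<^sup>2) * indicator (ball w0 R) w \<partial>lborel)"
proof -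
  let ?e = "\<lambda>t::real. exp (2 * of_real pi * \<i> * of_real t)"
  define u where "u v = ennreal ((cmod (h (w0 + v)))\<^sup>2) * indicator (ball 0 R) v" for v
  have hc: "continuous_on (ball 0 R) (\<lambda>v. h (w0 + v))"
    by (intro continuous_on_compose2[OF holomorphic_on_imp_continuous_on[OF h]] continuous_intros) (auto simp: dist_norm)
  have um [measurable]: "u \<in> borel_measurable borel"
  proof -
    have "continuous_on (ball 0 R) (\<lambda>v. (cmod (h (w0 + v)))\<^sup>2)" using hc by (intro continuous_intros)
    then have "(\<lambda>v. if v \<in> ball 0 R then (cmod (h (w0 + v)))\<^sup>2 else 0) \<in> borel_measurable borel"
      by (rule borel_measurable_continuous_on_if[rotated 1]) auto
    then have "(\<lambda>v. ennreal (if v \<in> ball 0 R then (cmod (h (w0 + v)))\<^sup>2 else 0)) \<in> borel_measurable borel" by measurable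
    moreover have "(\<lambda>v. ennreal (if v \<in> ball 0 R then (cmod (h (w0 + v)))\<^sup>2 else 0)) = u"
      by (auto simp: u_def indicator_def)
    ultimately show ?thesis by (simp only:)
  qed
  have "(\<integral>\<^sup>+w. ennreal ((cmod (h w))\<^sup>2) * indicator (ball w0 R) w \<partial>lborel) = (\<integral>\<^sup>+v. u v \<partial>lborel)"
  proof -
    have "(\<integral>\<^sup>+v. u v \<partial>lborel) = (\<integral>\<^sup>+v. u v \<partial>distr lborel borel ((+) (- w0)))" by (simp add: lborel_distr_plus)
    also have "\<dots> = (\<integral>\<^sup>+w. u (- w0 + w) \<partial>lborel)" by (rule nn_integral_distr) auto
    also have "(\<lambda>w. u (- w0 + w)) = (\<lambda>w. ennreal ((cmod (h w))\<^sup>2) * indicator (ball w0 R) w)"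
      by (auto simp: u_def indicator_def dist_norm norm_minus_commute)
    finally show ?thesis by simp
  qed
  also have "(\<integral>\<^sup>+v. u v \<partial>lborel) = (\<integral>\<^sup>+t. (\<integral>\<^sup>+v. u (?e t * v) \<partial>lborel) * indicator {0..1} t \<partial>lborel)"
  proof -
    have "(\<integral>\<^sup>+v. u (?e t * v) \<partial>lborel) = (\<integral>\<^sup>+v. u v \<partial>lborel)" for t
      using nn_integral_complex_scale[OF um, of "?e t"] by simp
    then show ?thesis by (simp add: nn_integral_cmult_indicator)
  qed
  also have "\<dots> = (\<integral>\<^sup>+t. (\<integral>\<^sup>+v. u (?e t * v) * indicator {0..1} t \<partial>lborel) \<partial>lborel)"
    by (intro nn_integral_cong nn_integral_multc[symmetric]) simp
  also have "\<dots> = (\<integral>\<^sup>+v. (\<integral>\<^sup>+t. u (?e t * v) * indicator {0..1} t \<partial>lborel) \<partial>lborel)"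
    by (rule lborel_pair.Fubini') (simp add: case_prod_beta')
  also have "\<dots> \<ge> (\<integral>\<^sup>+v. ennreal ((cmod (h w0))\<^sup>2) * indicator (ball (0::complex) R) v \<partial>lborel)"
  proof (rule nn_integral_mono)
    fix v :: complex
    show "ennreal ((cmod (h w0))\<^sup>2) * indicator (ball 0 R) v \<le> (\<integral>\<^sup>+t. u (?e t * v) * indicator {0..1} t \<partial>lborel)"
    proof (cases "cmod v < R")
      case True
      let ?k = "\<lambda>\<zeta>. (h (w0 + \<zeta> * v))\<^sup>2"
      define S where "S = {\<zeta>. cmod (\<zeta> * v) < R}"
      have S: "open S" unfolding S_def by (intro open_Collect_less continuous_intros)
      have "(\<lambda>\<zeta>. h (w0 + \<zeta> * v)) holomorphic_on S"
        by (rule holomorphic_on_compose_gen[OF _ h, unfolded o_def])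
           (auto simp: S_def dist_norm intro!: holomorphic_intros)
      then have "?k holomorphic_on S" by (intro holomorphic_intros)
      moreover have "cball 0 1 \<subseteq> S"
      proof
        fix \<zeta> :: complex assume "\<zeta> \<in> cball 0 1"
        then have "cmod \<zeta> * cmod v \<le> 1 * cmod v" by (intro mult_right_mono) auto
        then show "\<zeta> \<in> S" using True by (simp add: S_def norm_mult)
      qed
      ultimately have "ennreal (cmod (?k 0)) \<le> (\<integral>\<^sup>+t. ennreal (cmod (?k (?e t))) * indicator {0..1} t \<partial>lborel)"
        using S by (intro circle_submean)
      also have "(\<lambda>t. ennreal (cmod (?k (?e t)))) = (\<lambda>t. u (?e t * v))"
        using True by (auto simp: u_def norm_mult norm_power)
      finally show ?thesis using True by (simp add: norm_power)
    qed simp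
  qed
  finally show ?thesis by (simp add: nn_integral_cmult_indicator)
qed

text \<open>The mean value inequality on the disc of radius \<open>\<bar>w - z0\<bar>\<close> about \<open>w\<close> bounds \<open>\<bar>(w - z0) h w\<bar>\<^sup>2\<close> by a
  constant times the integral of \<open>\<bar>h\<bar>\<^sup>2\<close> near \<open>z0\<close>, which tends to \<open>0\<close> as the neighbourhood shrinks.\<close>

lemma L2_isolated_singularity:
  assumes h: "h holomorphic_on ball z0 R - {z0}" and R: "0 < R"
    and fin: "(\<integral>\<^sup>+w. ennreal ((cmod (h w))\<^sup>2) * indicator (ball z0 R - {z0}) w \<partial>lborel) < \<infinity>"
  shows "((\<lambda>z. (z - z0) * h z) \<longlongrightarrow> 0) (at z0)"
proof -
  let ?U = "ball z0 R - {z0}"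
  define f where "f w = ennreal ((cmod (h w))\<^sup>2) * indicator ?U w" for w
  have fm [measurable]: "f \<in> borel_measurable borel"
  proof -
    have "continuous_on ?U (\<lambda>v. (cmod (h v))\<^sup>2)" using holomorphic_on_imp_continuous_on[OF h] by (intro continuous_intros)
    then have "(\<lambda>v. if v \<in> ?U then (cmod (h v))\<^sup>2 else 0) \<in> borel_measurable borel"
      by (rule borel_measurable_continuous_on_if[rotated 1]) auto
    then have "(\<lambda>v. ennreal (if v \<in> ?U then (cmod (h v))\<^sup>2 else 0)) \<in> borel_measurable borel" by measurable
    moreover have "(\<lambda>v. ennreal (if v \<in> ?U then (cmod (h v))\<^sup>2 else 0)) = f"
      by (auto simp: f_def indicator_def)
    ultimately show ?thesis by (simp only:)
  qed
  define A where "A k = ball z0 (1 / real (Suc k))" for k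
  define N where "N = density lborel f"
  have N: "emeasure N B = (\<integral>\<^sup>+w. f w * indicator B w \<partial>lborel)" if "B \<in> sets borel" for B
    unfolding N_def using that by (intro emeasure_density) auto
  have "(\<lambda>k. emeasure N (A k)) \<longlonglongrightarrow> emeasure N (\<Inter>k. A k)"
  proof (rule Lim_emeasure_decseq)
    show "range A \<subseteq> sets N" by (auto simp: A_def N_def)
    show "decseq A" unfolding decseq_def A_def by (auto intro!: subset_ball divide_left_mono)
    fix k
    have "emeasure N (A k) \<le> (\<integral>\<^sup>+w. f w \<partial>lborel)"
      by (subst N) (auto simp: A_def indicator_def intro!: nn_integral_mono)
    then show "emeasure N (A k) \<noteq> \<infinity>" using fin by (auto simp: f_def top_unique)
  qed
  moreover have "(\<Inter>k. A k) = {z0}"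
  proof -
    have "w = z0" if "\<And>k. dist z0 w < 1 / real (Suc k)" for w
    proof (rule ccontr)
      assume "w \<noteq> z0"
      then obtain k where "inverse (real (Suc k)) < dist z0 w" using reals_Archimedean[of "dist z0 w"] by auto
      then show False using that[of k] by (simp add: inverse_eq_divide)
    qed
    then show ?thesis by (auto simp: A_def)
  qed
  moreover have "emeasure N {z0} = 0"
  proof -
    have "f w * indicator {z0} w = 0" for w by (simp add: f_def indicator_def)
    then show ?thesis by (subst N) (auto simp del: mult_eq_0_iff)
  qed
  ultimately have lim: "(\<lambda>k. emeasure N (A k)) \<longlonglongrightarrow> 0" by simp
  obtain \<kappa> where \<kappa>: "emeasure lborel (ball (0::complex) 1) = ennreal \<kappa>" "\<kappa> > 0"
    using emeasure_unit_disc by (cases "emeasure lborel (ball (0::complex) 1)") auto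
  show ?thesis
  proof (rule tendstoI)
    fix \<epsilon> :: real assume \<epsilon>: "\<epsilon> > 0"
    have "\<forall>\<^sub>F k in sequentially. emeasure N (A k) < ennreal (\<epsilon>\<^sup>2 * \<kappa>)"
      using lim \<epsilon> \<kappa>(2) by (intro order_tendstoD) auto
    then obtain k where k: "emeasure N (A k) < ennreal (\<epsilon>\<^sup>2 * \<kappa>)" by (auto simp: eventually_sequentially)
    \<comment> \<open>half the radius, as the disc about \<open>w\<close> reaches out to twice the distance of \<open>w\<close> from \<open>z0\<close>\<close>
  define d0 where "d0 = min R (1 / real (Suc k)) / 2"
    have d0: "d0 > 0" using R by (simp add: d0_def)
    have "cmod ((w - z0) * h w) < \<epsilon>" if w: "w \<noteq> z0" "dist w z0 < d0" for w
    proof -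
      define d where "d = dist w z0"
      have d: "d > 0" "2 * d < R" "2 * d < 1 / real (Suc k)" using w R by (auto simp: d_def d0_def)
      have sub: "ball w d \<subseteq> ?U \<inter> A k"
      proof
        fix x assume x: "x \<in> ball w d"
        then have "dist z0 x < 2 * d" using dist_triangle[of z0 x w] by (simp add: d_def dist_commute)
        moreover have "x \<noteq> z0" using x by (auto simp: d_def)
        ultimately show "x \<in> ?U \<inter> A k" using d by (auto simp: A_def)
      qed
      have vol: "emeasure lborel (ball (0::complex) d) = ennreal (d\<^sup>2 * \<kappa>)"
        unfolding emeasure_disc[OF d(1)] \<kappa>(1) using \<kappa>(2) by (intro ennreal_mult[symmetric]) auto
      have "ennreal ((cmod (h w))\<^sup>2 * (d\<^sup>2 * \<kappa>)) = ennreal ((cmod (h w))\<^sup>2) * emeasure lborel (ball (0::complex) d)"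
        unfolding vol using \<kappa>(2) by (intro ennreal_mult) auto
      also have "\<dots> \<le> (\<integral>\<^sup>+x. ennreal ((cmod (h x))\<^sup>2) * indicator (ball w d) x \<partial>lborel)"
        using sub d by (intro disc_submean holomorphic_on_subset[OF h]) auto
      also have "\<dots> \<le> (\<integral>\<^sup>+x. f x * indicator (A k) x \<partial>lborel)"
        using sub by (intro nn_integral_mono) (auto simp: f_def indicator_def)
      also have "\<dots> = emeasure N (A k)" by (rule N[symmetric]) (simp add: A_def)
      also note k
      finally have "ennreal ((cmod (h w))\<^sup>2 * (d\<^sup>2 * \<kappa>)) < ennreal (\<epsilon>\<^sup>2 * \<kappa>)" .
      then have "(cmod (h w))\<^sup>2 * (d\<^sup>2 * \<kappa>) < \<epsilon>\<^sup>2 * \<kappa>" using \<kappa> \<epsilon> by (simp add: ennreal_less_iff)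
      then have "(d * cmod (h w))\<^sup>2 * \<kappa> < \<epsilon>\<^sup>2 * \<kappa>" by (simp only: power_mult_distrib mult_ac)
      then have "(d * cmod (h w))\<^sup>2 < \<epsilon>\<^sup>2" using \<kappa>(2) by (simp only: mult_less_cancel_right_pos)
      then have "d * cmod (h w) < \<epsilon>" by (rule power2_less_imp_less) (use \<epsilon> in simp)
      then show ?thesis unfolding norm_mult d_def dist_norm .
    qed
    then show "\<forall>\<^sub>F w in at z0. dist ((w - z0) * h w) 0 < \<epsilon>"
      unfolding eventually_at using d0 by (intro exI[of _ d0]) auto
  qed
qed

text \<open>The points of \<open>Z\<close> are removable singularities, and the extension has the mean value property;
  the centre and the circle are not affected, as they contain no point of \<open>Z\<close>. In this form, the value at the
  centre is expressed by values of \<open>h\<close> on the circle only.\<close>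

lemma L2_removable_circle_mean:
  assumes h: "h holomorphic_on ball 0 \<rho> - Z" and Z: "finite Z" "0 \<notin> Z" and r: "0 < r" "r < \<rho>"
    and circ: "\<And>w. cmod w = r \<Longrightarrow> w \<notin> Z"
    and fin: "(\<integral>\<^sup>+w. ennreal ((cmod (h w))\<^sup>2) * indicator (ball 0 \<rho> - Z) w \<partial>lborel) < \<infinity>"
  shows "h 0 = integral {0..1} (\<lambda>t. h (of_real r * exp (2 * of_real pi * \<i> * of_real t)))"
proof -
  let ?S = "ball (0::complex) \<rho>" and ?Z = "Z \<inter> ball 0 \<rho>"
  have hS: "h holomorphic_on (?S - ?Z)" using h by (rule holomorphic_on_subset) auto
  have "h \<in> O[at z0](\<lambda>_. 1)" if z0: "z0 \<in> ?Z" for z0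
  proof -
    have "open (?S - (Z - {z0}))" using Z by (intro open_Diff finite_imp_closed) auto
    moreover have "z0 \<in> ?S - (Z - {z0})" using z0 by auto
    ultimately obtain R where R: "R > 0" "ball z0 R \<subseteq> ?S - (Z - {z0})" using open_contains_ball by blast
    have hR: "h holomorphic_on ball z0 R - {z0}" using h by (rule holomorphic_on_subset) (use R in auto)
    have "(\<integral>\<^sup>+w. ennreal ((cmod (h w))\<^sup>2) * indicator (ball z0 R - {z0}) w \<partial>lborel) \<le>
      (\<integral>\<^sup>+w. ennreal ((cmod (h w))\<^sup>2) * indicator (ball 0 \<rho> - Z) w \<partial>lborel)"
      using R by (intro nn_integral_mono) (auto simp: indicator_def)
    then have "((\<lambda>z. (z - z0) * h z) \<longlongrightarrow> 0) (at z0)"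
      using L2_isolated_singularity[OF hR R(1)] fin by (meson le_less_trans)
    moreover have zi: "z0 \<in> interior (ball z0 R)" using R(1) by (simp add: interior_open)
    ultimately obtain B where "\<forall>\<^sub>F z in at z0. norm (h z) \<le> B"
      using holomorphic_on_extend_lim[OF hR zi] holomorphic_on_extend_bounded[OF hR zi] by blast
    then show ?thesis by (intro bigoI[of _ B]) auto
  qed
  moreover have "?Z \<subseteq> interior ?S" by (simp add: interior_open)
  ultimately have "\<exists>g. g holomorphic_on ?S \<and> (\<forall>z\<in>?S - ?Z. g z = h z)"
    using removable_singularities[of ?Z ?S h] Z hS by blast
  then obtain g where g: "g holomorphic_on ?S" "\<And>z. z \<in> ?S - ?Z \<Longrightarrow> g z = h z"
    by blast
  have "((\<lambda>t. g (of_real r * exp (2 * of_real pi * \<i> * of_real t))) has_integral g 0) {0..1}"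
    using r by (intro circle_mean[OF g(1)]) auto
  then have "g 0 = integral {0..1} (\<lambda>t. g (of_real r * exp (2 * of_real pi * \<i> * of_real t)))"
    by (simp add: integral_unique)
  moreover have "g 0 = h 0" using g(2)[of 0] Z r by auto
  moreover have "g (of_real r * exp (2 * of_real pi * \<i> * of_real t)) = h (of_real r * exp (2 * of_real pi * \<i> * of_real t))" for t :: real
    using r circ[of "of_real r * exp (2 * of_real pi * \<i> * of_real t)"] by (intro g(2)) (auto simp: norm_mult)
  ultimately show ?thesis by simp
qed

section \<open>Thin sets and extension of square integrable holomorphic functions\<close>

definition line :: "nat \<Rightarrow> (nat \<Rightarrow> complex) \<Rightarrow> (nat \<Rightarrow> complex) \<Rightarrow> complex \<Rightarrow> (nat \<Rightarrow> complex)" where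
  "line n z v w = (\<lambda>i\<in>{..<n}. z i + w * v i)"

lemma line_tuples [simp]: "line n z v w \<in> tuples n"
  by (simp add: line_def)

lemma line_zero: "z \<in> tuples n \<Longrightarrow> line n z v 0 = z"
  by (rule tuples_eqI[of _ n]) (auto simp: line_def)

lemma line_near: "z \<in> polydisc n a d \<Longrightarrow> line n z v w \<in> polydisc n (line n a v w) d"
  by (auto simp: polydisc_def line_def)

lemma continuous_line: "continuous_map euclidean (Cn n) (line n z v)"
  by (auto simp: continuous_map_into_Cn line_def intro!: continuous_intros)

lemma line_measurable: "(\<lambda>p. line n (fst p) v (snd p)) \<in> measurable (lam n \<Otimes>\<^sub>M lborel) (lam n)"
proof (rule measurable_into_lam)
  fix i assume i: "i < n"
  have "(\<lambda>p. fst p i) \<in> borel_measurable (lam n \<Otimes>\<^sub>M lborel)"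
    by (rule measurable_compose[OF measurable_fst coordinate_measurable_lam[OF i]])
  then have "(\<lambda>p. fst p i + snd p * v i) \<in> borel_measurable (lam n \<Otimes>\<^sub>M lborel)"
    by (intro borel_measurable_add borel_measurable_times) auto
  then show "(\<lambda>p. line n (fst p) v (snd p) i) \<in> borel_measurable (lam n \<Otimes>\<^sub>M lborel)"
    using i by (simp add: line_def)
qed simp

lemma holomorphic_on_line:
  assumes g: "holo n V g" and S: "\<And>w. w \<in> S \<Longrightarrow> line n z v w \<in> V"
  shows "(\<lambda>w. g (line n z v w)) holomorphic_on S"
  unfolding holomorphic_on_def
proof
  fix w assume w: "w \<in> S"
  have "((\<lambda>w. g (line n z v w)) has_field_derivative (\<Sum>i<n. pderiv_at i g (line n z v w) * v i)) (at w)"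
  proof (rule holo_curve[where \<gamma>="line n z v", OF g S[OF w]])
    fix i assume "i < n"
    then show "((\<lambda>w. line n z v w i) has_field_derivative v i) (at w)"
      by (auto simp: line_def intro!: derivative_eq_intros)
  qed simp
  then show "(\<lambda>w. g (line n z v w)) field_differentiable at w within S"
    using field_differentiable_def has_field_derivative_at_within by blast
qed

lemma finite_zeros_compact:
  assumes "\<phi> holomorphic_on S" "open S" "connected S" "compact K" "K \<subseteq> S" "w0 \<in> S" "\<phi> w0 \<noteq> 0"
  shows "finite {w \<in> K. \<phi> w = 0}"
proof (cases "\<phi> constant_on S")
  case True
  then have "{w \<in> K. \<phi> w = 0} = {}" using assms(5-7) unfolding constant_on_def by fastforce
  then show ?thesis by (simp only: finite.emptyI)
next
  case False
  then show ?thesis using holomorphic_compact_finite_zeros[OF assms(1-5)] by blast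
qed

text \<open>Choose the direction \<open>v\<close> such that \<open>g\<close> is not identically zero on the line through \<open>a\<close>. The zeros on this
  line are isolated, so that some circle avoids them; by compactness, parallel circles with nearby centres
  avoid zeros as well.\<close>

lemma zero_free_circle:
  assumes g: "holo n V g" and a: "a \<in> V" and nz: "\<And>e. e > 0 \<Longrightarrow> \<exists>b\<in>polydisc n a e. g b \<noteq> 0"
  obtains v r \<delta> where "0 < r" "r < 1" "0 < \<delta>"
    "\<And>z w. z \<in> polydisc n a \<delta> \<Longrightarrow> cmod w \<le> 1 \<Longrightarrow> line n z v w \<in> V"
    "\<And>z w. z \<in> polydisc n a \<delta> \<Longrightarrow> cmod w = r \<Longrightarrow> g (line n z v w) \<noteq> 0"
proof -
  have V: "openin (Cn n) V" using g holo_openD by blast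
  have aT: "a \<in> tuples n" using a openin_CnD(1)[OF V] by blast
  obtain e where e: "e > 0" "polydisc n a e \<subseteq> V" using openin_CnD(2)[OF V a] by blast
  obtain b where b: "b \<in> polydisc n a (e/2)" "g b \<noteq> 0" using nz[of "e/2"] e(1) by auto
  define v where "v i = b i - a i" for i
  have inV: "line n a v w \<in> V" if "cmod w < 2" for w
  proof -
    have "dist (line n a v w i) (a i) < e" if i: "i < n" for i
    proof -
      have "cmod (v i) < e / 2" using b(1) i by (simp add: polydisc_def v_def dist_norm)
      then have "cmod w * cmod (v i) \<le> 2 * cmod (v i)" using \<open>cmod w < 2\<close> by (intro mult_right_mono) auto
      then show ?thesis using i \<open>cmod (v i) < e / 2\<close> by (simp add: line_def dist_norm norm_mult)
    qed
    then have "line n a v w \<in> polydisc n a e" by (simp add: polydisc_def)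
    then show ?thesis using e(2) by blast
  qed
  let ?\<phi> = "\<lambda>w. g (line n a v w)"
  have hol: "?\<phi> holomorphic_on ball 0 2" using inV by (intro holomorphic_on_line[OF g]) auto
  have "line n a v 1 = b"
    using b(1) by (intro tuples_eqI[of _ n]) (auto simp: polydisc_def line_def v_def)
  then have "finite {w \<in> cball 0 1. ?\<phi> w = 0}"
    using b(2) by (intro finite_zeros_compact[OF hol, of _ 1]) auto
  then have "finite (cmod ` {w \<in> cball 0 1. ?\<phi> w = 0})" by simp
  moreover have "infinite {0<..<1::real}" by (rule infinite_Ioo) simp
  ultimately obtain r where r: "r \<in> {0<..<1}" "r \<notin> cmod ` {w \<in> cball 0 1. ?\<phi> w = 0}"
    by (meson finite_subset subsetI)
  have nzr: "?\<phi> w \<noteq> 0" if "cmod w = r" for w using r that by force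
  define K where "K = line n a v ` cball 0 1"
  have K: "compactin (Cn n) K" unfolding K_def by (rule image_compactin[OF _ continuous_line]) auto
  have KV: "K \<subseteq> V" using inV by (auto simp: K_def)
  have "compact (sphere (0::complex) r)" "sphere (0::complex) r \<noteq> {}" using r(1) by auto
  moreover have "continuous_on (sphere 0 r) (\<lambda>w. cmod (?\<phi> w))"
    using r(1) by (intro continuous_on_norm holomorphic_on_imp_continuous_on holomorphic_on_subset[OF hol]) auto
  ultimately obtain w1 where w1: "w1 \<in> sphere 0 r" "\<And>w. w \<in> sphere 0 r \<Longrightarrow> cmod (?\<phi> w1) \<le> cmod (?\<phi> w)"
    using continuous_attains_inf by metis
  define m where "m = cmod (?\<phi> w1)"
  have m: "m > 0" using nzr w1(1) by (simp add: m_def)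
  obtain \<delta> where \<delta>: "\<delta> > 0" "\<And>k z. k \<in> K \<Longrightarrow> z \<in> polydisc n k \<delta> \<Longrightarrow> z \<in> V \<and> dist (g z) (g k) < m"
    using uniform_near_compact[OF V holo_contD[OF g] K KV m] by blast
  show ?thesis
  proof
    show "0 < r" "r < 1" "0 < \<delta>" using r \<delta> by auto
    show "line n z v w \<in> V" if "z \<in> polydisc n a \<delta>" "cmod w \<le> 1" for z w
    proof -
      have "line n a v w \<in> K" using that(2) by (auto simp: K_def)
      then show ?thesis using \<delta>(2) line_near[OF that(1)] by blast
    qed
    show "g (line n z v w) \<noteq> 0" if "z \<in> polydisc n a \<delta>" "cmod w = r" for z w
    proof -
      have "line n a v w \<in> K" using that(2) r(1) by (auto simp: K_def)
      then have "dist (g (line n z v w)) (?\<phi> w) < m" using \<delta>(2) line_near[OF that(1)] by blast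
      moreover have "m \<le> cmod (?\<phi> w)" unfolding m_def using w1(2) that(2) by auto
      ultimately show ?thesis by (auto simp: dist_norm)
    qed
  qed
qed

text \<open>Fubini's theorem, as translation by \<open>w v\<close> preserves the measure for each \<open>w\<close>.\<close>

lemma nn_integral_lines:
  assumes u: "u \<in> borel_measurable (lam n)"
  shows "(\<integral>\<^sup>+z. (\<integral>\<^sup>+w. indicator (ball 0 \<rho>) w * u (line n z v w) \<partial>lborel) \<partial>lam n)
    = emeasure lborel (ball (0::complex) \<rho>) * (\<integral>\<^sup>+z. u z \<partial>lam n)"
proof -
  interpret pair_sigma_finite "lam n" "lborel :: complex measure"
    by (intro pair_sigma_finite.intro sigma_finite_lam lborel.sigma_finite_measure_axioms) simp
  have um: "(\<lambda>p. u (line n (fst p) v (snd p))) \<in> borel_measurable (lam n \<Otimes>\<^sub>M lborel)"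
    using line_measurable u by (rule measurable_compose)
  have "(\<integral>\<^sup>+z. (\<integral>\<^sup>+w. indicator (ball 0 \<rho>) w * u (line n z v w) \<partial>lborel) \<partial>lam n)
      = (\<integral>\<^sup>+w. (\<integral>\<^sup>+z. indicator (ball 0 \<rho>) w * u (line n z v w) \<partial>lam n) \<partial>lborel)"
    using um by (intro Fubini'[symmetric]) (auto simp: case_prod_beta' intro!: borel_measurable_times_ennreal measurable_compose[OF measurable_snd] borel_measurable_indicator)
  also have "\<dots> = (\<integral>\<^sup>+w. (\<integral>\<^sup>+z. u z \<partial>lam n) * indicator (ball (0::complex) \<rho>) w \<partial>lborel)"
  proof (rule nn_integral_cong)
    fix w :: complex
    have lm: "(\<lambda>z. line n z v w) \<in> measurable (lam n) (lam n)"
      by (rule measurable_into_lam) (auto simp: line_def)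
    have "(\<integral>\<^sup>+z. u (line n z v w) \<partial>lam n) = (\<integral>\<^sup>+z. u z \<partial>lam n)"
      unfolding line_def by (rule nn_integral_translate_lam[OF u])
    then show "(\<integral>\<^sup>+z. indicator (ball 0 \<rho>) w * u (line n z v w) \<partial>lam n) = (\<integral>\<^sup>+z. u z \<partial>lam n) * indicator (ball 0 \<rho>) w"
      by (simp add: nn_integral_cmult[OF measurable_compose[OF lm u]] mult.commute)
  qed
  also have "\<dots> = (\<integral>\<^sup>+z. u z \<partial>lam n) * emeasure lborel (ball (0::complex) \<rho>)"
    by (rule nn_integral_cmult_indicator) simp
  finally show ?thesis by (simp add: mult.commute)
qed

text \<open>Every line in a suitable direction that passes close to \<open>a\<close> meets the zero set near \<open>a\<close> in
  finitely many points, a null set of the line; then integrate over these lines.\<close>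

lemma zero_set_null_local:
  assumes g: "holo n V g" and a: "a \<in> V" and nz: "\<And>e. e > 0 \<Longrightarrow> \<exists>b\<in>polydisc n a e. g b \<noteq> 0"
  shows "\<exists>\<delta>>0. polydisc n a \<delta> \<subseteq> V \<and> {z \<in> polydisc n a \<delta>. g z = 0} \<in> null_sets (lam n)"
proof -
  have V: "openin (Cn n) V" using g holo_openD by blast
  obtain v r \<delta> where vr: "0 < r" "r < 1" "0 < \<delta>"
    "\<And>z w. z \<in> polydisc n a \<delta> \<Longrightarrow> cmod w \<le> 1 \<Longrightarrow> line n z v w \<in> V"
    "\<And>z w. z \<in> polydisc n a \<delta> \<Longrightarrow> cmod w = r \<Longrightarrow> g (line n z v w) \<noteq> 0"
    using zero_free_circle[OF g a nz] by metis
  have PV: "polydisc n a \<delta> \<subseteq> V"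
  proof
    fix z assume z: "z \<in> polydisc n a \<delta>"
    then show "z \<in> V" using vr(4)[OF z, of 0] line_zero[of z n v] polydisc_tuples[of n a \<delta>] by auto
  qed
  have PV2: "polydisc n a (\<delta>/2) \<subseteq> V" using PV polydisc_mono[of "\<delta>/2" \<delta> n a] vr(3) by auto
  define M where "M = 1 + (\<Sum>i<n. cmod (v i))"
  have M: "M \<ge> 1" "\<And>i. i < n \<Longrightarrow> cmod (v i) \<le> M"
  proof -
    show "M \<ge> 1" by (simp add: M_def sum_nonneg)
    show "cmod (v i) \<le> M" if "i < n" for i
      using member_le_sum[of i "{..<n}" "\<lambda>i. cmod (v i)"] that by (simp add: M_def)
  qed
  \<comment> \<open>a line segment of radius \<open>\<rho>\<close> that meets \<open>Z\<close> has its centre in the larger polydisc, where the circles avoid zeros\<close>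
  define \<rho> where "\<rho> = min r (\<delta> / (2 * M))"
  have \<rho>: "0 < \<rho>" "\<rho> \<le> r" "\<rho> * M \<le> \<delta> / 2"
  proof -
    show "0 < \<rho>" "\<rho> \<le> r" using vr M(1) by (auto simp: \<rho>_def)
    have "\<rho> * M \<le> \<delta> / (2 * M) * M" using M(1) by (intro mult_right_mono) (auto simp: \<rho>_def)
    then show "\<rho> * M \<le> \<delta> / 2" using M(1) by simp
  qed
  define Z where "Z = {z \<in> polydisc n a (\<delta>/2). g z = 0}"
  have ZS: "Z \<in> sets (lam n)"
  proof -
    have "(\<lambda>z. if z \<in> V then g z else 0) \<in> borel_measurable (lam n)"
      using V holo_contD[OF g] by (rule borel_measurable_continuous_open)
    then have "(\<lambda>z. if z \<in> V then g z else 0) -` {0} \<inter> space (lam n) \<in> sets (lam n)"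
      by (rule measurable_sets) simp
    then have "(\<lambda>z. if z \<in> V then g z else 0) -` {0} \<inter> space (lam n) \<inter> polydisc n a (\<delta>/2) \<in> sets (lam n)"
      using openin_sets_lam[OF openin_polydisc] by (rule sets.Int)
    moreover have "(\<lambda>z. if z \<in> V then g z else 0) -` {0} \<inter> space (lam n) \<inter> polydisc n a (\<delta>/2) = Z"
      using PV2 polydisc_tuples[of n a "\<delta>/2"] by (auto simp: Z_def split: if_splits)
    ultimately show ?thesis by simp
  qed
  have inner: "(\<integral>\<^sup>+w. indicator (ball 0 \<rho>) w * indicator Z (line n z v w) \<partial>lborel) = (0::ennreal)"
    if zT: "z \<in> tuples n" for z
  proof (cases "z \<in> polydisc n a \<delta>")
    case True
    have "(\<lambda>w. g (line n z v w)) holomorphic_on ball 0 1"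
      using vr(4)[OF True] by (intro holomorphic_on_line[OF g]) auto
    then have fin: "finite {w \<in> cball 0 r. g (line n z v w) = 0}"
      using vr(1,2) vr(5)[OF True, of "of_real r"]
      by (intro finite_zeros_compact[of _ "ball 0 1" _ "of_real r"]) auto
    have "(\<integral>\<^sup>+w. indicator (ball 0 \<rho>) w * indicator Z (line n z v w) \<partial>lborel)
       \<le> (\<integral>\<^sup>+w. indicator {w \<in> cball 0 r. g (line n z v w) = 0} w \<partial>lborel)"
      using \<rho>(2) by (intro nn_integral_mono) (auto simp: indicator_def Z_def)
    also have "\<dots> = emeasure lborel {w \<in> cball 0 r. g (line n z v w) = 0}"
      using fin by (intro nn_integral_indicator) (auto intro: borel_closed finite_imp_closed)
    also have "\<dots> = 0" using fin by (intro emeasure_lborel_countable countable_finite)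
    finally show ?thesis by simp
  next
    case False
    have "line n z v w \<notin> Z" if w: "cmod w < \<rho>" for w
    proof
      assume "line n z v w \<in> Z"
      then have l: "dist (z i + w * v i) (a i) < \<delta> / 2" if "i < n" for i
        using that by (auto simp: Z_def polydisc_def line_def)
      have "dist (z i) (a i) < \<delta>" if i: "i < n" for i
      proof -
        have "cmod w * cmod (v i) \<le> \<rho> * M" using w M i \<rho>(1) by (intro mult_mono) auto
        then have "dist (z i) (z i + w * v i) \<le> \<delta> / 2" using \<rho>(3) by (simp add: dist_norm norm_mult)
        then show ?thesis using l[OF i] dist_triangle[of "z i" "a i" "z i + w * v i"] by simp
      qed
      then show False using False zT by (auto simp: polydisc_def)
    qed
    then have "(\<lambda>w. indicator (ball 0 \<rho>) w * indicator Z (line n z v w)) = (\<lambda>_. 0 :: ennreal)"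
      by (auto simp: indicator_def fun_eq_iff)
    then show ?thesis by (simp only: nn_integral_0_iff_AE nn_integral_const) simp
  qed
  have "emeasure lborel (ball (0::complex) \<rho>) * emeasure (lam n) Z
      = (\<integral>\<^sup>+z. (\<integral>\<^sup>+w. indicator (ball 0 \<rho>) w * indicator Z (line n z v w) \<partial>lborel) \<partial>lam n)"
    using nn_integral_lines[of "indicator Z" n \<rho> v] ZS by simp
  also have "\<dots> = (\<integral>\<^sup>+z. 0 \<partial>lam n)" using inner by (intro nn_integral_cong) auto
  finally have "emeasure lborel (ball (0::complex) \<rho>) * emeasure (lam n) Z = 0" by simp
  moreover have "emeasure lborel (ball (0::complex) \<rho>) \<noteq> 0"
    using emeasure_disc[OF \<rho>(1)] emeasure_unit_disc(1) \<rho>(1) by auto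
  ultimately have "Z \<in> null_sets (lam n)" using ZS by auto
  then show ?thesis using vr(3) PV2 by (intro exI[of _ "\<delta>/2"]) (auto simp: Z_def)
qed

text \<open>Differentiation under the integral sign.\<close>

lemma holo_circle_mean:
  assumes f: "holo n U f" and P: "openin (Cn n) P"
    and circ: "\<And>z t. z \<in> P \<Longrightarrow> line n z v (\<gamma> t) \<in> U" and \<gamma>: "continuous_on UNIV (\<gamma> :: real \<Rightarrow> complex)"
  shows "holo n P (\<lambda>z. integral {0..1} (\<lambda>t. f (line n z v (\<gamma> t))))"
proof -
  have U: "openin (Cn n) U" using f holo_openD by blast
  have contl: "continuous_map euclidean (subtopology (Cn n) U) (\<lambda>t. line n z v (\<gamma> t))" if "z \<in> P" for z
    using circ[OF that] \<gamma>
    by (auto simp: continuous_map_in_subtopology continuous_map_into_Cn line_def intro!: continuous_intros)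
  have contf: "continuous_on UNIV (\<lambda>t. f (line n z v (\<gamma> t)))" if "z \<in> P" for z
    using continuous_map_compose[OF contl[OF that] holo_contD[OF f]] by (simp add: o_def)
  have intf: "(\<lambda>t. f (line n z v (\<gamma> t))) integrable_on {0..1}" if "z \<in> P" for z
    by (intro integrable_continuous_real continuous_on_subset[OF contf[OF that]]) auto
  show ?thesis
    unfolding holo_def
  proof (intro conjI ballI allI impI P)
    show "continuous_map (subtopology (Cn n) P) euclidean (\<lambda>z. integral {0..1} (\<lambda>t. f (line n z v (\<gamma> t))))"
      unfolding continuous_Cn_iff[OF P]
    proof (intro ballI allI impI)
      fix a and e :: real assume a: "a \<in> P" and e: "e > 0"
      define K where "K = (\<lambda>t. line n a v (\<gamma> t)) ` {0..1}"
      have "compactin (subtopology (Cn n) U) K"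
        unfolding K_def by (rule image_compactin[OF _ contl[OF a]]) auto
      then have K: "compactin (Cn n) K" "K \<subseteq> U" by (auto simp: compactin_subtopology)
      obtain d where d: "d > 0" "\<And>k z. k \<in> K \<Longrightarrow> z \<in> polydisc n k d \<Longrightarrow> z \<in> U \<and> dist (f z) (f k) < e / 2"
        using uniform_near_compact[OF U holo_contD[OF f] K, of "e/2"] e by auto
      obtain d' where d': "d' > 0" "polydisc n a d' \<subseteq> P" using openin_CnD(2)[OF P a] by blast
      have sub: "polydisc n a (min d d') \<subseteq> P" using d'(2) polydisc_mono[of "min d d'" d' n a] by auto
      have "dist (integral {0..1} (\<lambda>t. f (line n z v (\<gamma> t)))) (integral {0..1} (\<lambda>t. f (line n a v (\<gamma> t)))) < e"
        if z: "z \<in> polydisc n a (min d d')" for z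
      proof -
        have zP: "z \<in> P" using sub z by blast
        have "cmod (f (line n z v (\<gamma> t)) - f (line n a v (\<gamma> t))) \<le> e / 2" if t: "t \<in> {0..1}" for t
        proof -
          have "z \<in> polydisc n a d" using z polydisc_mono[of "min d d'" d n a] by auto
          then have "line n z v (\<gamma> t) \<in> polydisc n (line n a v (\<gamma> t)) d" by (rule line_near)
          moreover have "line n a v (\<gamma> t) \<in> K" using t by (auto simp: K_def)
          ultimately show ?thesis using d(2) by (force simp: dist_norm)
        qed
        then have "cmod (integral {0..1} (\<lambda>t. f (line n z v (\<gamma> t)) - f (line n a v (\<gamma> t)))) \<le> e / 2 * (1 - 0)"
          using contf[OF zP] contf[OF a] by (intro integral_bound continuous_on_diff) (auto intro: continuous_on_subset)
        then show ?thesis using e intf[OF zP] intf[OF a] by (simp add: dist_norm integral_diff)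
      qed
      then show "\<exists>d>0. polydisc n a d \<subseteq> P \<and> (\<forall>z\<in>polydisc n a d. dist (integral {0..1} (\<lambda>t. f (line n z v (\<gamma> t)))) (integral {0..1} (\<lambda>t. f (line n a v (\<gamma> t)))) < e)"
        using sub d(1) d'(1) by (intro exI[of _ "min d d'"]) auto
    qed
    fix z i assume z: "z \<in> P" and i: "i < n"
    have zT: "z \<in> tuples n" using z openin_CnD(1)[OF P] by blast
    obtain e where e: "e > 0" "polydisc n z e \<subseteq> P" using openin_CnD(2)[OF P z] by blast
    have inP: "z(i := x) \<in> P" if "x \<in> ball (z i) e" for x
      using polydisc_upd[OF polydisc_centre[OF zT e(1)] i, of x] that e(2) by (auto simp: dist_commute)
    have upd: "line n (z(i := x)) v w = (line n z v w)(i := x + w * v i)" for x w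
      using i by (auto simp: line_def)
    have "((\<lambda>x. integral (cbox 0 1) (\<lambda>t. f (line n (z(i := x)) v (\<gamma> t)))) has_field_derivative
        integral (cbox 0 1) (\<lambda>t. pderiv_at i f (line n (z(i := z i)) v (\<gamma> t)))) (at (z i) within ball (z i) e)"
    proof (rule leibniz_rule_field_derivative)
      fix x t assume x: "x \<in> ball (z i) e" and "t \<in> cbox 0 (1::real)"
      have "line n (z(i := x)) v (\<gamma> t) \<in> U" by (rule circ[OF inP[OF x]])
      then have "((\<lambda>y. f ((line n z v (\<gamma> t))(i := y))) has_field_derivative
          pderiv_at i f ((line n z v (\<gamma> t))(i := x + \<gamma> t * v i))) (at (x + \<gamma> t * v i))"
        unfolding upd by (intro holo_pderiv_upd[OF f _ i])
      then have "((\<lambda>x. f ((line n z v (\<gamma> t))(i := x + \<gamma> t * v i))) has_field_derivative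
          pderiv_at i f ((line n z v (\<gamma> t))(i := x + \<gamma> t * v i))) (at x)"
        by (simp add: DERIV_shift)
      then show "((\<lambda>x. f (line n (z(i := x)) v (\<gamma> t))) has_field_derivative
          pderiv_at i f (line n (z(i := x)) v (\<gamma> t))) (at x within ball (z i) e)"
        unfolding upd by (rule has_field_derivative_at_within)
    next
      fix x assume "x \<in> ball (z i) e"
      then show "(\<lambda>t. f (line n (z(i := x)) v (\<gamma> t))) integrable_on cbox 0 1"
        using intf[OF inP] by simp
    next
      let ?S = "ball (z i) e \<times> cbox 0 (1::real)"
      have "continuous_map (top_of_set ?S) (subtopology (Cn n) U) (\<lambda>p. line n (z(i := fst p)) v (\<gamma> (snd p)))"
        unfolding continuous_map_in_subtopology continuous_map_into_Cn
      proof (intro conjI allI impI)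
        fix j assume j: "j < n"
        have "continuous_on ?S (\<lambda>p. (z(i := fst p)) j + \<gamma> (snd p) * v j)"
          by (cases "j = i") (auto intro!: continuous_intros continuous_on_compose2[OF \<gamma>])
        then show "continuous_map (top_of_set ?S) euclidean (\<lambda>p. line n (z(i := fst p)) v (\<gamma> (snd p)) j)"
          using j by (simp add: line_def)
      qed (use circ inP in auto)
      from continuous_map_compose[OF this continuous_pderiv[OF f i]]
      show "continuous_on ?S (\<lambda>(x, t). pderiv_at i f (line n (z(i := x)) v (\<gamma> t)))"
        by (simp add: o_def case_prod_beta')
    qed (use e in auto)
    then have "((\<lambda>x. integral (cbox 0 1) (\<lambda>t. f (line n (z(i := x)) v (\<gamma> t)))) has_field_derivative
        integral (cbox 0 1) (\<lambda>t. pderiv_at i f (line n (z(i := z i)) v (\<gamma> t)))) (at (z i))"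
      using e(1) by (simp add: at_within_open[of "z i" "ball (z i) e"])
    then show "(\<lambda>w. integral {0..1} (\<lambda>t. f (line n (z(i := w)) v (\<gamma> t)))) field_differentiable at (z i)"
      using field_differentiable_def by auto
  qed
qed

lemma emeasure_polydisc_pos:
  assumes "a \<in> tuples n" "0 < d"
  shows "0 < emeasure (lam n) (polydisc n a d)"
proof -
  obtain m where m: "dcube n m a \<subseteq> polydisc n a d" using dcube_in_polydisc[OF assms] by blast
  have "0 < emeasure (lam n) (dcube n m a)" by (simp add: dcube_eq_cube emeasure_cube)
  also have "\<dots> \<le> emeasure (lam n) (polydisc n a d)"
    using m openin_sets_lam[OF openin_polydisc] by (rule emeasure_mono)
  finally show ?thesis .
qed

text \<open>On almost every line in direction \<open>v\<close>, the function is square integrable, so that its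
  singularities on this line, finite in number, are removable. Hence the value of \<open>f\<close> at the centre is the mean
  over a circle that avoids the zeros of \<open>g\<close>, and this mean is a holomorphic function of the centre.\<close>

lemma L2_extend_local:
  assumes g: "holo n V g" and a: "a \<in> V" and nz: "\<And>e. e > 0 \<Longrightarrow> \<exists>b\<in>polydisc n a e. g b \<noteq> 0"
    and f: "holo n U f" and UV: "\<And>z. z \<in> V \<Longrightarrow> g z \<noteq> 0 \<Longrightarrow> z \<in> U"
    and fin: "(\<integral>\<^sup>+z. ennreal ((cmod (f z))\<^sup>2) * indicator (V \<inter> U) z \<partial>lam n) < \<infinity>"
  shows "\<exists>\<delta>>0. \<exists>F. polydisc n a \<delta> \<subseteq> V \<and> holo n (polydisc n a \<delta>) F \<and> (\<forall>z\<in>polydisc n a \<delta> \<inter> U. F z = f z)"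
proof -
  have V: "openin (Cn n) V" and U: "openin (Cn n) U" using g f holo_openD by blast+
  have VU: "openin (Cn n) (V \<inter> U)" using V U by blast
  obtain v r \<delta>1 where vr: "0 < r" "r < 1" "0 < \<delta>1"
    "\<And>z w. z \<in> polydisc n a \<delta>1 \<Longrightarrow> cmod w \<le> 1 \<Longrightarrow> line n z v w \<in> V"
    "\<And>z w. z \<in> polydisc n a \<delta>1 \<Longrightarrow> cmod w = r \<Longrightarrow> g (line n z v w) \<noteq> 0"
    using zero_free_circle[OF g a nz] by metis
  obtain \<delta>2 where \<delta>2: "\<delta>2 > 0" "polydisc n a \<delta>2 \<subseteq> V" "{z \<in> polydisc n a \<delta>2. g z = 0} \<in> null_sets (lam n)"
    using zero_set_null_local[OF g a nz] by blast
  define \<delta> where "\<delta> = min \<delta>1 \<delta>2"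
  define P where "P = polydisc n a \<delta>"
  have \<delta>: "\<delta> > 0" using vr \<delta>2 by (simp add: \<delta>_def)
  have P: "P \<subseteq> polydisc n a \<delta>1" "P \<subseteq> polydisc n a \<delta>2" "P \<subseteq> V"
    using polydisc_mono[of \<delta> \<delta>1 n a] polydisc_mono[of \<delta> \<delta>2 n a] \<delta>2(2) by (auto simp: P_def \<delta>_def)
  have Po: "openin (Cn n) P" unfolding P_def by (rule openin_polydisc)
  have PT: "P \<subseteq> tuples n" unfolding P_def by (rule polydisc_tuples)
  let ?\<gamma> = "\<lambda>t::real. of_real r * exp (2 * of_real pi * \<i> * of_real t) :: complex"
  define F where "F z = integral {0..1} (\<lambda>t. f (line n z v (?\<gamma> t)))" for z
  have F: "holo n P F"
    unfolding F_def
  proof (rule holo_circle_mean[OF f Po])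
    fix z and t :: real assume z: "z \<in> P"
    have "cmod (?\<gamma> t) = r" using vr(1) by (simp add: norm_mult)
    then show "line n z v (?\<gamma> t) \<in> U" using vr(2) vr(4,5)[of z "?\<gamma> t"] z P(1) by (intro UV) auto
  qed (intro continuous_intros)
  define \<rho> where "\<rho> = (1 + r) / 2"
  have \<rho>: "r < \<rho>" "\<rho> < 1" using vr(2) by (auto simp: \<rho>_def)
  define u where "u z = ennreal ((cmod (f z))\<^sup>2) * indicator (V \<inter> U) z" for z
  have um: "u \<in> borel_measurable (lam n)"
  proof -
    have "(\<lambda>z. if z \<in> U then f z else 0) \<in> borel_measurable (lam n)"
      using U holo_contD[OF f] by (rule borel_measurable_continuous_open)
    then have "(\<lambda>z. ennreal ((cmod (if z \<in> U then f z else 0))\<^sup>2) * indicator (V \<inter> U) z) \<in> borel_measurable (lam n)"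
      using openin_sets_lam[OF VU] by measurable
    moreover have "(\<lambda>z. ennreal ((cmod (if z \<in> U then f z else 0))\<^sup>2) * indicator (V \<inter> U) z) = u"
      by (auto simp: u_def indicator_def)
    ultimately show ?thesis by (simp only:)
  qed
  let ?I = "\<lambda>z. \<integral>\<^sup>+w. indicator (ball 0 \<rho>) w * u (line n z v w) \<partial>lborel"
  have "(\<integral>\<^sup>+z. ?I z \<partial>lam n) = emeasure lborel (ball (0::complex) \<rho>) * (\<integral>\<^sup>+z. u z \<partial>lam n)"
    by (rule nn_integral_lines[OF um])
  also have "\<dots> < \<infinity>"
    using fin emeasure_lborel_ball_finite[of "0::complex" \<rho>] by (simp add: u_def ennreal_mult_less_top)
  finally have "(\<integral>\<^sup>+z. ?I z \<partial>lam n) \<noteq> \<infinity>" by simp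
  moreover have "?I \<in> borel_measurable (lam n)"
  proof (rule lborel.borel_measurable_nn_integral)
    have "(\<lambda>p. u (line n (fst p) v (snd p))) \<in> borel_measurable (lam n \<Otimes>\<^sub>M lborel)"
      using line_measurable um by (rule measurable_compose)
    then show "(\<lambda>(z, w). indicator (ball 0 \<rho>) w * u (line n z v w)) \<in> borel_measurable (lam n \<Otimes>\<^sub>M lborel)"
      by (auto simp: case_prod_beta' intro!: borel_measurable_times_ennreal measurable_compose[OF measurable_snd] borel_measurable_indicator)
  qed
  ultimately have "AE z in lam n. ?I z \<noteq> \<infinity>" by (rule nn_integral_PInf_AE[rotated])
  moreover have "AE z in lam n. \<not> (z \<in> polydisc n a \<delta>2 \<and> g z = 0)"
    using AE_not_in[OF \<delta>2(3)] by simp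
  ultimately have ae: "AE z in lam n. z \<in> P \<longrightarrow> F z = f z"
  proof eventually_elim
    case (elim z)
    show ?case
    proof
      assume z: "z \<in> P"
      have zT: "z \<in> tuples n" using z PT by blast
      have gz: "g z \<noteq> 0" using elim z P(2) by blast
      have zp: "z \<in> polydisc n a \<delta>1" using z P by blast
      let ?Z = "{w \<in> cball 0 \<rho>. g (line n z v w) = 0}"
      let ?h = "\<lambda>w. f (line n z v w)"
      have "(\<lambda>w. g (line n z v w)) holomorphic_on ball 0 1"
        using vr(4)[OF zp] by (intro holomorphic_on_line[OF g]) auto
      then have finZ: "finite ?Z"
        using vr(1,2) \<rho> vr(5)[OF zp, of "of_real r"]
        by (intro finite_zeros_compact[of _ "ball 0 1" _ "of_real r"]) auto
      have inVU: "line n z v w \<in> V \<inter> U" if "w \<in> ball 0 \<rho> - ?Z" for w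
        using that vr(4)[OF zp, of w] \<rho> UV by auto
      have "?h 0 = integral {0..1} (\<lambda>t. ?h (?\<gamma> t))"
      proof (rule L2_removable_circle_mean[OF _ finZ])
        show "?h holomorphic_on ball 0 \<rho> - ?Z" using inVU by (intro holomorphic_on_line[OF f]) auto
        show "0 \<notin> ?Z" using gz line_zero[OF zT] by simp
        show "w \<notin> ?Z" if "cmod w = r" for w using vr(5)[OF zp that] by simp
        have "(\<integral>\<^sup>+w. ennreal ((cmod (?h w))\<^sup>2) * indicator (ball 0 \<rho> - ?Z) w \<partial>lborel) \<le> ?I z"
        proof (rule nn_integral_mono)
          fix w
          show "ennreal ((cmod (?h w))\<^sup>2) * indicator (ball 0 \<rho> - ?Z) w \<le> indicator (ball 0 \<rho>) w * u (line n z v w)"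
            using inVU[of w] by (cases "w \<in> ball 0 \<rho> - ?Z") (auto simp: u_def)
        qed
        also have "\<dots> < \<infinity>" using elim(1) by (simp add: top.not_eq_extremum)
        finally show "(\<integral>\<^sup>+w. ennreal ((cmod (?h w))\<^sup>2) * indicator (ball 0 \<rho> - ?Z) w \<partial>lborel) < \<infinity>" .
      qed (use vr(1) \<rho>(1) in auto)
      then show "F z = f z" by (simp add: F_def line_zero[OF zT])
    qed
  qed
  have "F z = f z" if z: "z \<in> P \<inter> U" for z
  proof (rule ccontr)
    assume ne: "F z \<noteq> f z"
    have PU: "openin (Cn n) (P \<inter> U)" using Po U by blast
    have "holo n (P \<inter> U) F" "holo n (P \<inter> U) f" using F f PU holo_subset by blast+
    then have "continuous_map (subtopology (Cn n) (P \<inter> U)) euclidean (\<lambda>z. F z - f z)"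
      by (intro continuous_map_diff holo_contD)
    then obtain d where d: "d > 0" "polydisc n z d \<subseteq> P \<inter> U"
      "\<And>y. y \<in> polydisc n z d \<Longrightarrow> dist (F y - f y) (F z - f z) < cmod (F z - f z)"
      using continuous_CnD[OF _ PU z, of "\<lambda>z. F z - f z" "cmod (F z - f z)"] ne by auto
    have "F y \<noteq> f y" if "y \<in> polydisc n z d" for y using d(3)[OF that] by (auto simp: dist_norm norm_minus_commute)
    then have "AE y in lam n. y \<notin> polydisc n z d"
      using ae d(2) by (auto elim!: eventually_mono)
    then have "polydisc n z d \<in> null_sets (lam n)"
      using openin_sets_lam[OF openin_polydisc] by (simp add: AE_iff_null_sets)
    then have "emeasure (lam n) (polydisc n z d) = 0" by auto
    moreover have "z \<in> tuples n" using z PT by blast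
    ultimately show False using emeasure_polydisc_pos[OF _ d(1), of z n] by simp
  qed
  then show ?thesis using \<delta> P(3) F unfolding P_def
    by (intro exI[of _ \<delta>] exI[of _ F] conjI) auto
qed

text \<open>Thin subsets in the sense of several complex variables: relatively closed, and near every point
  contained in the zero set of a holomorphic function that does not vanish identically near that point.\<close>

definition thin :: "nat \<Rightarrow> (nat \<Rightarrow> complex) set \<Rightarrow> (nat \<Rightarrow> complex) set \<Rightarrow> bool" where
  "thin n D A \<longleftrightarrow> openin (Cn n) D \<and> openin (Cn n) (D - A) \<and>
     (\<forall>a\<in>D. \<exists>V g. a \<in> V \<and> V \<subseteq> D \<and> holo n V g \<and> (\<forall>z\<in>V. g z \<noteq> 0 \<longrightarrow> z \<notin> A) \<and>
        (\<forall>e>0. \<exists>b\<in>polydisc n a e. g b \<noteq> 0))"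

lemma thinE:
  assumes "thin n D A" "a \<in> D"
  obtains V g where "a \<in> V" "V \<subseteq> D" "holo n V g" "\<And>z. z \<in> V \<Longrightarrow> g z \<noteq> 0 \<Longrightarrow> z \<notin> A"
    "\<And>e. e > 0 \<Longrightarrow> \<exists>b\<in>polydisc n a e. g b \<noteq> 0"
  using assms unfolding thin_def by metis

lemma thin_dense:
  assumes t: "thin n D A" and a: "a \<in> D" and e: "e > 0"
  shows "\<exists>b\<in>polydisc n a e. b \<in> D - A"
proof -
  obtain V g where V: "a \<in> V" "V \<subseteq> D" "holo n V g" "\<And>z. z \<in> V \<Longrightarrow> g z \<noteq> 0 \<Longrightarrow> z \<notin> A"
    "\<And>e. e > 0 \<Longrightarrow> \<exists>b\<in>polydisc n a e. g b \<noteq> 0" using thinE[OF t a] by metis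
  obtain d where d: "d > 0" "polydisc n a d \<subseteq> V" using openin_CnD(2)[OF holo_openD[OF V(3)] V(1)] by blast
  obtain b where b: "b \<in> polydisc n a (min d e)" "g b \<noteq> 0" using V(5)[of "min d e"] d e by auto
  then have "b \<in> polydisc n a e" "b \<in> V"
    using polydisc_mono[of "min d e" d n a] polydisc_mono[of "min d e" e n a] d(2) by auto
  then show ?thesis using V b(2) by blast
qed

lemma thin_null:
  assumes t: "thin n D A"
  shows "D \<inter> A \<in> null_sets (lam n)"
proof -
  have D: "openin (Cn n) D" and DA: "openin (Cn n) (D - A)" using t by (auto simp: thin_def)
  have DT: "D \<subseteq> tuples n" using openin_CnD(1)[OF D] .
  have S: "D \<inter> A \<in> sets (lam n)"
    using sets.Diff[OF openin_sets_lam[OF D] openin_sets_lam[OF DA]] by (simp add: Diff_Diff_Int)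
  have "\<exists>m. dcube n m a \<subseteq> D \<and> A \<inter> dcube n m a \<in> null_sets (lam n)" if a: "a \<in> D" for a
  proof -
    obtain V g where V: "a \<in> V" "V \<subseteq> D" "holo n V g" "\<And>z. z \<in> V \<Longrightarrow> g z \<noteq> 0 \<Longrightarrow> z \<notin> A"
      "\<And>e. e > 0 \<Longrightarrow> \<exists>b\<in>polydisc n a e. g b \<noteq> 0" using thinE[OF t a] by metis
    obtain \<delta> where \<delta>: "\<delta> > 0" "polydisc n a \<delta> \<subseteq> V" "{z \<in> polydisc n a \<delta>. g z = 0} \<in> null_sets (lam n)"
      using zero_set_null_local[OF V(3,1,5)] by blast
    obtain m where m: "dcube n m a \<subseteq> polydisc n a \<delta>" using dcube_in_polydisc[of a n \<delta>] \<delta>(1) a DT by blast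
    have eq: "A \<inter> dcube n m a = (D \<inter> A) \<inter> dcube n m a" using m \<delta>(2) V(2) by blast
    have "A \<inter> dcube n m a \<subseteq> {z \<in> polydisc n a \<delta>. g z = 0}" using m \<delta>(2) V(4) by blast
    moreover have "A \<inter> dcube n m a \<in> sets (lam n)" unfolding eq by (rule sets.Int[OF S dcube_sets])
    ultimately have "A \<inter> dcube n m a \<in> null_sets (lam n)" using \<delta>(3) null_sets_subset by blast
    then show ?thesis using m \<delta>(2) V(2) by blast
  qed
  from dyadic_partition[OF DT this]
  obtain F where F: "countable F" "\<Union>F = D" "\<And>Q. Q \<in> F \<Longrightarrow> A \<inter> Q \<in> null_sets (lam n)"
    by metis
  have "(\<Union>Q\<in>F. A \<inter> Q) \<in> null_sets (lam n)" using F by (intro null_sets_UN') auto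
  moreover have "(\<Union>Q\<in>F. A \<inter> Q) = D \<inter> A" using F(2) by auto
  ultimately show ?thesis by simp
qed

lemma eq_off_thin_imp_eq:
  assumes t: "thin n D A" and W: "openin (Cn n) W" "W \<subseteq> D" and z: "z \<in> W"
    and f: "continuous_map (subtopology (Cn n) W) euclidean (f :: _ \<Rightarrow> complex)"
    and f': "continuous_map (subtopology (Cn n) W) euclidean f'"
    and eq: "\<And>y. y \<in> W \<Longrightarrow> y \<notin> A \<Longrightarrow> f y = f' y"
  shows "f z = f' z"
proof (rule ccontr)
  assume ne: "f z \<noteq> f' z"
  have "continuous_map (subtopology (Cn n) W) euclidean (\<lambda>z. f z - f' z)"
    using f f' by (rule continuous_map_diff)
  then obtain d where d: "d > 0" "polydisc n z d \<subseteq> W"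
    "\<And>y. y \<in> polydisc n z d \<Longrightarrow> dist (f y - f' y) (f z - f' z) < cmod (f z - f' z)"
    using continuous_CnD[OF _ W(1) z, of "\<lambda>z. f z - f' z" "cmod (f z - f' z)"] ne by auto
  obtain b where b: "b \<in> polydisc n z d" "b \<in> D - A" using thin_dense[OF t _ d(1)] z W(2) by blast
  then have "f b = f' b" using d(2) eq by blast
  then show False using d(3)[OF b(1)] by (auto simp: dist_norm norm_minus_commute)
qed

text \<open>The local extensions agree with \<open>f\<close> on a dense set, hence with each other; so \<open>F a\<close> may be evaluated
  at its own centre \<open>a\<close>.\<close>

theorem L2_extend:
  assumes t: "thin n D A" and f: "holo n (D - A) f"
    and L2: "\<And>a. a \<in> D \<Longrightarrow> \<exists>N. openin (Cn n) N \<and> a \<in> N \<and>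
       (\<integral>\<^sup>+z. ennreal ((cmod (f z))\<^sup>2) * indicator (N - A) z \<partial>lam n) < \<infinity>"
  shows "\<exists>F. holo n D F \<and> (\<forall>z\<in>D - A. F z = f z)"
proof -
  have D: "openin (Cn n) D" using t by (simp add: thin_def)
  have DT: "D \<subseteq> tuples n" using openin_CnD(1)[OF D] .
  define ext where "ext a \<delta> F \<longleftrightarrow> \<delta> > 0 \<and> polydisc n a \<delta> \<subseteq> D \<and> holo n (polydisc n a \<delta>) F \<and>
    (\<forall>z\<in>polydisc n a \<delta> - A. F z = f z)" for a \<delta> F
  have "\<exists>\<delta> F. ext a \<delta> F" if a: "a \<in> D" for a
  proof -
    obtain V g where V: "a \<in> V" "V \<subseteq> D" "holo n V g" "\<And>z. z \<in> V \<Longrightarrow> g z \<noteq> 0 \<Longrightarrow> z \<notin> A"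
      "\<And>e. e > 0 \<Longrightarrow> \<exists>b\<in>polydisc n a e. g b \<noteq> 0" using thinE[OF t a] by metis
    obtain N where N: "openin (Cn n) N" "a \<in> N"
      "(\<integral>\<^sup>+z. ennreal ((cmod (f z))\<^sup>2) * indicator (N - A) z \<partial>lam n) < \<infinity>" using L2[OF a] by blast
    have VN: "holo n (V \<inter> N) g" using V(3) N(1) holo_openD[OF V(3)] by (intro holo_subset[OF V(3)]) auto
    have "(\<integral>\<^sup>+z. ennreal ((cmod (f z))\<^sup>2) * indicator (V \<inter> N \<inter> (D - A)) z \<partial>lam n)
        \<le> (\<integral>\<^sup>+z. ennreal ((cmod (f z))\<^sup>2) * indicator (N - A) z \<partial>lam n)"
      by (intro nn_integral_mono) (auto simp: indicator_def)
    then have "(\<integral>\<^sup>+z. ennreal ((cmod (f z))\<^sup>2) * indicator (V \<inter> N \<inter> (D - A)) z \<partial>lam n) < \<infinity>"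
      using N(3) by (rule le_less_trans)
    then have "\<exists>\<delta>>0. \<exists>F. polydisc n a \<delta> \<subseteq> V \<inter> N \<and> holo n (polydisc n a \<delta>) F \<and> (\<forall>z\<in>polydisc n a \<delta> \<inter> (D - A). F z = f z)"
      using V N(2) by (intro L2_extend_local[OF VN _ V(5) f]) auto
    then show ?thesis using V(2) unfolding ext_def by blast
  qed
  then obtain \<delta> F where "\<And>a. a \<in> D \<Longrightarrow> ext a (\<delta> a) (F a)"
    by metis
  then have \<delta>: "\<And>a. a \<in> D \<Longrightarrow> \<delta> a > 0" "\<And>a. a \<in> D \<Longrightarrow> polydisc n a (\<delta> a) \<subseteq> D"
    "\<And>a. a \<in> D \<Longrightarrow> holo n (polydisc n a (\<delta> a)) (F a)"
    "\<And>a z. a \<in> D \<Longrightarrow> z \<in> polydisc n a (\<delta> a) - A \<Longrightarrow> F a z = f z"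
    unfolding ext_def by blast+
  have centre: "a \<in> polydisc n a (\<delta> a)" if "a \<in> D" for a
    using polydisc_centre \<delta>(1)[OF that] that DT by blast
  have glue: "F b b = F a b" if a: "a \<in> D" and b: "b \<in> polydisc n a (\<delta> a)" for a b
  proof -
    have bD: "b \<in> D" using \<delta>(2)[OF a] b by blast
    let ?W = "polydisc n a (\<delta> a) \<inter> polydisc n b (\<delta> b)"
    have W: "openin (Cn n) ?W" using openin_polydisc by blast
    have ca: "continuous_map (subtopology (Cn n) ?W) euclidean (F a)"
      by (rule holo_contD[OF holo_subset[OF \<delta>(3)[OF a] _ W]]) blast
    have cb: "continuous_map (subtopology (Cn n) ?W) euclidean (F b)"
      by (rule holo_contD[OF holo_subset[OF \<delta>(3)[OF bD] _ W]]) blast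
    show ?thesis
    proof (rule eq_off_thin_imp_eq[OF t W _ _ cb ca])
      show "?W \<subseteq> D" using \<delta>(2)[OF a] by blast
      show "b \<in> ?W" using b centre[OF bD] by blast
      show "F b y = F a y" if "y \<in> ?W" "y \<notin> A" for y
        using \<delta>(4)[OF a, of y] \<delta>(4)[OF bD, of y] that by simp
    qed
  qed
  have "holo n D (\<lambda>z. F z z)"
  proof (rule holo_local)
    fix a assume a: "a \<in> D"
    have "holo n (polydisc n a (\<delta> a)) (\<lambda>z. F z z)"
      by (rule holo_cong[OF _ \<delta>(3)[OF a]]) (simp add: glue[OF a])
    then show "\<exists>V. a \<in> V \<and> V \<subseteq> D \<and> holo n V (\<lambda>z. F z z)" using centre[OF a] \<delta>(2)[OF a] by blast
  qed
  moreover have "F z z = f z" if "z \<in> D - A" for z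
    using \<delta>(4)[of z z] centre[of z] that by blast
  ultimately show ?thesis by blast
qed

section \<open>Charts\<close>

lemma is_chartD:
  assumes "is_chart M n c"
  shows "openin (top M) (fst c)" "openin (Cn n) (snd c ` fst c)"
    "homeomorphic_map (subtopology (top M) (fst c)) (subtopology (Cn n) (snd c ` fst c)) (snd c)"
  using assms by (auto simp: is_chart_def split: prod.splits)

lemma chart_str:
  assumes "is_chart M n c" "openin (top M) V" "V \<subseteq> fst c"
  shows "f \<in> str M V \<longleftrightarrow> holo n (snd c ` V) (\<lambda>z. f (inv_chart c z))"
  using assms by (cases c) (auto simp: is_chart_def o_def)

lemma chart_inj: 
  assumes "is_chart M n c"
  shows "inj_on (snd c) (fst c)"
  using homeomorphic_imp_injective_map[OF is_chartD(3)[OF assms]] openin_subset[OF is_chartD(1)[OF assms]]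
  by (simp add: Int_absorb1)

lemma inv_chart_eq [simp]: "is_chart M n c \<Longrightarrow> x \<in> fst c \<Longrightarrow> inv_chart c (snd c x) = x"
  by (simp add: inv_chart_def chart_inj)

lemma inv_chart_mem: "z \<in> snd c ` V \<Longrightarrow> V \<subseteq> fst c \<Longrightarrow> is_chart M n c \<Longrightarrow> inv_chart c z \<in> V"
  by auto

lemma chart_inv_chart [simp]: "z \<in> snd c ` fst c \<Longrightarrow> snd c (inv_chart c z) = z"
  by (simp add: inv_chart_def f_inv_into_f)

lemma chart_image_open:
  assumes c: "is_chart M n c" and V: "openin (top M) V" "V \<subseteq> fst c"
  shows "openin (Cn n) (snd c ` V)"
proof -
  have "openin (subtopology (top M) (fst c)) V" using V by (metis inf.absorb1 openin_subtopology)
  then have "openin (subtopology (Cn n) (snd c ` fst c)) (snd c ` V)"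
    using homeomorphic_imp_open_map[OF is_chartD(3)[OF c]] unfolding open_map_def by blast
  then show ?thesis using is_chartD(2)[OF c] openin_open_subtopology by blast
qed

lemma chart_preimage_open:
  assumes c: "is_chart M n c" and V: "openin (top M) V" "V \<subseteq> fst c" and U: "openin (Cn n) U"
  shows "openin (top M) {x \<in> V. snd c x \<in> U}"
proof -
  have "continuous_map (subtopology (top M) V) (Cn n) (snd c)"
    using homeomorphic_imp_continuous_map[OF is_chartD(3)[OF c]] V(2)
    by (auto simp: continuous_map_in_subtopology intro: continuous_map_from_subtopology_mono)
  then have "openin (subtopology (top M) V) {x \<in> topspace (subtopology (top M) V). snd c x \<in> U}"
    using U by (rule openin_continuous_map_preimage)
  then show ?thesis
    using V openin_open_subtopology[OF V(1)] openin_subset[OF V(1)] by (simp add: Int_absorb1)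
qed

lemma continuous_chart:
  assumes c: "is_chart M n c" and V: "V \<subseteq> fst c"
  shows "continuous_map (subtopology (top M) V) (subtopology (Cn n) (snd c ` V)) (snd c)"
  using homeomorphic_imp_continuous_map[OF is_chartD(3)[OF c]] V
  by (auto simp: continuous_map_in_subtopology intro: continuous_map_from_subtopology_mono)

lemma continuous_inv_chart:
  assumes c: "is_chart M n c"
  shows "continuous_map (subtopology (Cn n) (snd c ` fst c)) (subtopology (top M) (fst c)) (inv_chart c)"
proof -
  obtain g where g: "homeomorphic_maps (subtopology (top M) (fst c)) (subtopology (Cn n) (snd c ` fst c)) (snd c) g"
    using is_chartD(3)[OF c] homeomorphic_map_maps by blast
  have ts: "topspace (subtopology (Cn n) (snd c ` fst c)) = snd c ` fst c"
    "topspace (subtopology (top M) (fst c)) = fst c"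
    using openin_subset[OF is_chartD(1)[OF c]] openin_subset[OF is_chartD(2)[OF c]]
    by (simp_all add: Int_absorb1)
  have "g z = inv_chart c z" if "z \<in> snd c ` fst c" for z
    using g that c ts unfolding homeomorphic_maps_def by auto
  then show ?thesis
    using g ts unfolding homeomorphic_maps_def by (metis (no_types, lifting) continuous_map_eq)
qed

lemma continuous_in_chart:
  assumes c: "is_chart M n c" and V: "V \<subseteq> fst c"
    and f: "continuous_map (subtopology (Cn n) (snd c ` V)) euclidean (\<lambda>z. f (inv_chart c z))"
  shows "continuous_map (subtopology (top M) V) euclidean f"
proof -
  have "continuous_map (subtopology (top M) V) euclidean (\<lambda>x. f (inv_chart c (snd c x)))"
    using continuous_map_compose[OF continuous_chart[OF c V] f] by (simp add: o_def)
  then show ?thesis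
    by (rule continuous_map_eq) (use c V in auto)
qed

lemma continuous_in_chart_point:
  fixes f :: "_ \<Rightarrow> 'c::metric_space"
  assumes f: "continuous_map (subtopology T V) euclidean f" and V: "openin T V" and x: "x \<in> V" and e: "e > 0"
  obtains N where "openin T N" "x \<in> N" "N \<subseteq> V" "\<And>y. y \<in> N \<Longrightarrow> dist (f y) (f x) < e"
proof -
  let ?N = "{y \<in> topspace (subtopology T V). f y \<in> ball (f x) e}"
  have "openin (subtopology T V) ?N"
    using f by (rule openin_continuous_map_preimage) auto
  then have "openin T ?N" using openin_open_subtopology[OF V] by blast
  moreover have "x \<in> ?N" using x e openin_subset[OF V] by auto
  moreover have "?N \<subseteq> V" by auto
  moreover have "dist (f y) (f x) < e" if "y \<in> ?N" for y using that by (simp add: dist_commute)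
  ultimately show ?thesis by (rule that)
qed

lemma str_continuous:
  assumes "is_chart M n c" "openin (top M) V" "V \<subseteq> fst c" "f \<in> str M V"
  shows "continuous_map (subtopology (top M) V) euclidean f"
  using assms chart_str[OF assms(1-3)] by (intro continuous_in_chart[OF assms(1,3)] holo_contD) auto

lemma str_cong:
  assumes c: "is_chart M n c" and V: "openin (top M) V" "V \<subseteq> fst c" and f: "f \<in> str M V"
    and eq: "\<And>x. x \<in> V \<Longrightarrow> f x = g x"
  shows "g \<in> str M V"
  using f eq c V unfolding chart_str[OF c V] by (elim holo_cong[rotated]) auto

lemma str_restrict:
  "complex_space M \<Longrightarrow> f \<in> str M U \<Longrightarrow> openin (top M) U \<Longrightarrow> openin (top M) V \<Longrightarrow> V \<subseteq> U \<Longrightarrow> f \<in> str M V"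
  unfolding complex_space_def by blast


lemma chart_coordinate_str:
  assumes c: "is_chart M n c" and i: "i < n"
  shows "(\<lambda>x. snd c x i) \<in> str M (fst c)"
proof (subst chart_str[OF c is_chartD(1)[OF c] order_refl])
  show "holo n (snd c ` fst c) (\<lambda>z. snd c (inv_chart c z) i)"
    by (rule holo_cong[OF _ holo_coordinate[OF is_chartD(2)[OF c] i]]) simp
qed

lemma preim_open:
  "holomorphic_map Y X p \<Longrightarrow> openin (top X) U \<Longrightarrow> openin (top Y) (preim Y p U)"
  unfolding holomorphic_map_def preim_def by (auto intro: openin_continuous_map_preimage)

lemma holo_map_in_charts:
  assumes Y: "complex_space Y" and p: "holomorphic_map Y X p" and c': "is_chart Y m c'" and c: "is_chart X n c"
    and W: "openin (top Y) W" "W \<subseteq> fst c'" "p ` W \<subseteq> V" "V \<subseteq> fst c" "openin (top X) V"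
  shows "holo_map m n (snd c' ` W) (snd c ` V) (\<lambda>z. snd c (p (inv_chart c' z)))"
  unfolding holo_map_def
proof (intro conjI allI impI)
  show "openin (Cn m) (snd c' ` W)" using chart_image_open[OF c' W(1,2)] .
  show "openin (Cn n) (snd c ` V)" using chart_image_open[OF c W(5,4)] .
  show "(\<lambda>z. snd c (p (inv_chart c' z))) \<in> snd c' ` W \<rightarrow> snd c ` V"
    using inv_chart_eq[OF c'] W(2,3) by (auto simp: subset_eq)
  fix i assume i: "i < n"
  have "(\<lambda>x. snd c x i) \<circ> p \<in> str Y (preim Y p (fst c))"
    using p chart_coordinate_str[OF c i] is_chartD(1)[OF c] unfolding holomorphic_map_def by blast
  moreover have "W \<subseteq> preim Y p (fst c)"
    using W(3,4) openin_subset[OF W(1)] by (auto simp: preim_def)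
  ultimately have "(\<lambda>x. snd c x i) \<circ> p \<in> str Y W"
    using str_restrict[OF Y _ preim_open[OF p is_chartD(1)[OF c]] W(1)] by blast
  then show "holo m (snd c' ` W) (\<lambda>z. snd c (p (inv_chart c' z)) i)"
    by (simp add: chart_str[OF c' W(1,2)])
qed

lemma preim_id: "openin (top X) U \<Longrightarrow> preim X (\<lambda>x. x) U = U"
  using openin_subset by (fastforce simp: preim_def)

lemma holomorphic_map_id: "holomorphic_map X X (\<lambda>x. x)"
  unfolding holomorphic_map_def by (auto simp: preim_id o_def)

lemma holo_map_transition:
  assumes M: "complex_space M" and c: "is_chart M m c" and c': "is_chart M n c'"
    and W: "openin (top M) W" "W \<subseteq> fst c" "W \<subseteq> fst c'"
  shows "holo_map m n (snd c ` W) (snd c' ` W) (\<lambda>z. snd c' (inv_chart c z))"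
  using holo_map_in_charts[OF M holomorphic_map_id c c' W(1,2) _ W(3,1)] by simp

lemma chart_dim_unique:
  assumes M: "complex_space M" and c: "is_chart M m c" and c': "is_chart M n c'" and x: "x \<in> fst c \<inter> fst c'"
  shows "m = n"
proof -
  let ?W = "fst c \<inter> fst c'"
  have W: "openin (top M) ?W" using is_chartD(1)[OF c] is_chartD(1)[OF c'] by blast
  let ?F = "\<lambda>z. snd c' (inv_chart c z)" and ?G = "\<lambda>z. snd c (inv_chart c' z)"
  have F: "holo_map m n (snd c ` ?W) (snd c' ` ?W) ?F" and G: "holo_map n m (snd c' ` ?W) (snd c ` ?W) ?G"
    using holo_map_transition[OF M c c' W] holo_map_transition[OF M c' c W] by auto
  have GF: "?G (?F z) = z" if "z \<in> snd c ` ?W" for z using that c c' by auto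
  have FG: "?F (?G z) = z" if "z \<in> snd c' ` ?W" for z using that c c' by auto
  define z where "z = snd c x"
  have z: "z \<in> snd c ` ?W" "?F z \<in> snd c' ` ?W" "?G (?F z) = z" using x c c' by (auto simp: z_def)
  define A where "A = jacobian m n ?G (?F z)"
  define B where "B = jacobian n m ?F z"
  have carr: "A \<in> carrier_mat m n" "B \<in> carrier_mat n m" by (auto simp: A_def B_def)
  have AB: "A * B = 1\<^sub>m m" using jacobian_left_inverse[OF F G z(1) GF] by (simp add: A_def B_def)
  have BA: "B * A = 1\<^sub>m n" using jacobian_left_inverse[OF G F z(2) FG] z(3) by (simp add: A_def B_def)
  \<comment> \<open>compare the traces of \<open>A * B\<close> and \<open>B * A\<close>\<close>
  have "of_nat m = (\<Sum>i<m. (A * B) $$ (i, i))" unfolding AB by simp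
  also have "\<dots> = (\<Sum>i<m. \<Sum>j<n. A $$ (i, j) * B $$ (j, i))"
    using carr by (intro sum.cong refl) (auto simp: scalar_prod_def lessThan_atLeast0)
  also have "\<dots> = (\<Sum>j<n. \<Sum>i<m. A $$ (i, j) * B $$ (j, i))" by (rule sum.swap)
  also have "\<dots> = (\<Sum>j<n. (B * A) $$ (j, j))"
    using carr by (intro sum.cong refl) (auto simp: scalar_prod_def lessThan_atLeast0 mult.commute)
  also have "\<dots> = (of_nat n :: complex)" unfolding BA by simp
  finally show ?thesis by simp
qed

text \<open>The factor by which the pullback under \<open>p\<close> of \<open>dz\<^sub>0 \<and> \<dots> \<and> dz\<^sub>n\<^sub>-\<^sub>1\<close> in the chart \<open>c\<close> differs from the same
  form in the chart \<open>c'\<close>. For the identity map, these are the transition functions of the canonical bundle.\<close>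

definition map_det :: "nat \<Rightarrow> ('b \<Rightarrow> 'a) \<Rightarrow> 'b chart \<Rightarrow> 'a chart \<Rightarrow> 'b \<Rightarrow> complex" where
  "map_det n p c' c y = Determinant.det (jacobian n n (\<lambda>z. snd c (p (inv_chart c' z))) (snd c' y))"

lemma continuous_map_det:
  assumes Y: "complex_space Y" and p: "holomorphic_map Y X p" and c': "is_chart Y n c'" and c: "is_chart X n c"
    and W: "openin (top Y) W" "W \<subseteq> fst c'" "p ` W \<subseteq> fst c"
  shows "continuous_map (subtopology (top Y) W) euclidean (map_det n p c' c)"
proof (rule continuous_in_chart[OF c' W(2)])
  have "continuous_map (subtopology (Cn n) (snd c' ` W)) euclidean
     (\<lambda>z. Determinant.det (jacobian n n (\<lambda>z. snd c (p (inv_chart c' z))) z))"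
    using holo_map_in_charts[OF Y p c' c W order_refl is_chartD(1)[OF c]] by (rule continuous_det_jacobian)
  then show "continuous_map (subtopology (Cn n) (snd c' ` W)) euclidean (\<lambda>z. map_det n p c' c (inv_chart c' z))"
    by (rule continuous_map_eq) (use W(2) c' in \<open>auto simp: map_det_def\<close>)
qed

lemma map_det_compose:
  assumes Z: "complex_space Z" and Y: "complex_space Y"
    and p: "holomorphic_map Z Y p" and p': "holomorphic_map Y X p'"
    and c: "is_chart Z n c" and c': "is_chart Y n c'" and c'': "is_chart X n c''"
    and y: "y \<in> fst c" "p y \<in> fst c'" "p' (p y) \<in> fst c''"
  shows "map_det n (\<lambda>y. p' (p y)) c c'' y = map_det n p' c' c'' (p y) * map_det n p c c' y"
proof -
  let ?V = "fst c' \<inter> preim Y p' (fst c'')"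
  have V: "openin (top Y) ?V" using is_chartD(1)[OF c'] preim_open[OF p' is_chartD(1)[OF c'']] by blast
  let ?W = "fst c \<inter> preim Z p ?V"
  have W: "openin (top Z) ?W" using is_chartD(1)[OF c] preim_open[OF p V] by blast
  let ?F = "\<lambda>z. snd c' (p (inv_chart c z))" and ?G = "\<lambda>z. snd c'' (p' (inv_chart c' z))"
  have F: "holo_map n n (snd c ` ?W) (snd c' ` ?V) ?F"
    by (rule holo_map_in_charts[OF Z p c c' W _ _ _ V]) (auto simp: preim_def)
  have G: "holo_map n n (snd c' ` ?V) (snd c'' ` fst c'') ?G"
    by (rule holo_map_in_charts[OF Y p' c' c'' V _ _ _ is_chartD(1)[OF c'']]) (auto simp: preim_def)
  have "y \<in> points Z" "p y \<in> points Y"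
    using y openin_subset[OF is_chartD(1)[OF c]] openin_subset[OF is_chartD(1)[OF c']] by auto
  then have yW: "snd c y \<in> snd c ` ?W" using y by (auto simp: preim_def)
  have "jacobian n n (\<lambda>z. snd c'' (p' (p (inv_chart c z)))) (snd c y) = jacobian n n (\<lambda>z. ?G (?F z)) (snd c y)"
    using c c' by (intro jacobian_cong[OF holo_mapD(1)[OF F] yW]) (auto simp: preim_def)
  also have "\<dots> = jacobian n n ?G (?F (snd c y)) * jacobian n n ?F (snd c y)"
    by (rule jacobian_compose[OF F G yW])
  finally show ?thesis
    using y(1) c unfolding map_det_def by (simp add: det_mult[OF jacobian_carrier jacobian_carrier])
qed

lemma map_det_id:
  assumes c: "is_chart M n c" and x: "x \<in> fst c"
  shows "map_det n (\<lambda>x. x) c c x = 1"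
proof -
  have "jacobian n n (\<lambda>z. snd c (inv_chart c z)) (snd c x) = jacobian n n (\<lambda>z. z) (snd c x)"
    using x by (intro jacobian_cong[OF is_chartD(2)[OF c]]) auto
  then show ?thesis by (simp add: map_det_def jacobian_ident)
qed

lemma hol_nform_iff:
  "hol_nform M n W f \<longleftrightarrow> (\<forall>c. is_chart M n c \<longrightarrow> f c \<in> str M (fst c \<inter> W)) \<and>
     (\<forall>c c' x. is_chart M n c \<longrightarrow> is_chart M n c' \<longrightarrow> x \<in> fst c \<inter> fst c' \<inter> W \<longrightarrow>
        f c x = map_det n (\<lambda>x. x) c c' x * f c' x)"
  by (simp add: hol_nform_def map_det_def o_def)

lemma hol_nformD:
  assumes "hol_nform M n W f"
  shows "is_chart M n c \<Longrightarrow> f c \<in> str M (fst c \<inter> W)"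
    "is_chart M n c \<Longrightarrow> is_chart M n c' \<Longrightarrow> x \<in> fst c \<inter> fst c' \<inter> W \<Longrightarrow>
       f c x = map_det n (\<lambda>x. x) c c' x * f c' x"
  using assms unfolding hol_nform_iff by blast+

section \<open>Extension across nowhere dense analytic sets\<close>

lemma eq_off_nowhere_dense:
  assumes A: "nowhere_dense_in M A" and V: "openin (top M) V"
    and f: "continuous_map (subtopology (top M) V) euclidean (f :: _ \<Rightarrow> complex)"
    and g: "continuous_map (subtopology (top M) V) euclidean g"
    and eq: "\<And>y. y \<in> V \<Longrightarrow> y \<notin> A \<Longrightarrow> f y = g y" and x: "x \<in> V"
  shows "f x = g x"
proof (rule forall_in_closure_of_eq[OF _ _ f g])
  have VT: "V \<subseteq> points M" using openin_subset[OF V] .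
  show "x \<in> subtopology (top M) V closure_of (V - A)"
    unfolding in_closure_of
  proof (intro conjI allI impI)
    show "x \<in> topspace (subtopology (top M) V)" using x VT by auto
    fix T assume T: "x \<in> T \<and> openin (subtopology (top M) V) T"
    then have TM: "openin (top M) T" "T \<subseteq> V" using openin_open_subtopology[OF V] by blast+
    show "\<exists>y. y \<in> V - A \<and> y \<in> T"
    proof (rule ccontr)
      assume "\<not> ?thesis"
      then have "T \<subseteq> A" using TM(2) by blast
      moreover have "T \<subseteq> points M" using openin_subset[OF TM(1)] .
      ultimately have "T \<subseteq> top M closure_of A" using closure_of_subset_Int[of "top M" A] by blast
      then have "T \<subseteq> top M interior_of (top M closure_of A)" using TM(1) by (rule interior_of_maximal)
      then show False using A T unfolding nowhere_dense_in_def by blast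
    qed
  qed
qed (use eq in auto)

lemma nowhere_dense_ex:
  assumes A: "nowhere_dense_in M A" and V: "openin (top M) V" "x \<in> V"
  shows "\<exists>y\<in>V. y \<notin> A"
proof (rule ccontr)
  assume "\<not> ?thesis"
  then have "V \<subseteq> A" by blast
  then have "V \<subseteq> top M closure_of A" using closure_of_subset_Int[of "top M" A] openin_subset[OF V(1)] by blast
  then have "V \<subseteq> top M interior_of (top M closure_of A)" using V(1) by (rule interior_of_maximal)
  then show False using A V(2) unfolding nowhere_dense_in_def by blast
qed

text \<open>Of the finitely many local equations of \<open>A\<close>, at least one does not vanish identically near a given
  point: otherwise \<open>A\<close> would contain a neighbourhood of it.\<close>

lemma analytic_thin:
  assumes M: "complex_space M" and A: "analytic_in M A" and nd: "nowhere_dense_in M A"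
    and c: "is_chart M n c" and V: "openin (top M) V" "V \<subseteq> fst c"
  shows "thin n (snd c ` V) (snd c ` (V \<inter> A))"
  unfolding thin_def
proof (intro conjI ballI)
  have Ac: "closedin (top M) A" using A by (simp add: analytic_in_def)
  have inj: "inj_on (snd c) V" using inj_on_subset[OF chart_inj[OF c] V(2)] .
  show "openin (Cn n) (snd c ` V)" by (rule chart_image_open[OF c V])
  have "snd c ` V - snd c ` (V \<inter> A) = snd c ` (V - A)"
    using inj by (auto simp: inj_on_def)
  moreover have "openin (top M) (V - A)" using V(1) Ac by blast
  ultimately show "openin (Cn n) (snd c ` V - snd c ` (V \<inter> A))"
    using chart_image_open[OF c, of "V - A"] V(2) by auto
  fix a assume "a \<in> snd c ` V"
  then obtain x where x: "x \<in> V" "a = snd c x" by blast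
  have "x \<in> points M" using x openin_subset[OF V(1)] by blast
  then obtain V0 fs where V0: "openin (top M) V0" "x \<in> V0" "finite fs" "fs \<subseteq> str M V0"
     "A \<inter> V0 = {y \<in> V0. \<forall>f\<in>fs. f y = 0}" using A unfolding analytic_in_def by meson
  let ?V1 = "V0 \<inter> V"
  have V1: "openin (top M) ?V1" "?V1 \<subseteq> fst c" "x \<in> ?V1" using V0 V x by auto
  define vanish where "vanish f \<longleftrightarrow> (\<exists>N. openin (top M) N \<and> x \<in> N \<and> N \<subseteq> ?V1 \<and> (\<forall>y\<in>N. f y = 0))" for f :: "_ \<Rightarrow> complex"
  have "\<exists>f\<in>fs. \<not> vanish f"
  proof (rule ccontr)
    assume "\<not> ?thesis"
    then have "\<forall>f\<in>fs. vanish f" by blast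
    then obtain N where N: "\<And>f. f \<in> fs \<Longrightarrow> openin (top M) (N f) \<and> x \<in> N f \<and> N f \<subseteq> ?V1 \<and> (\<forall>y\<in>N f. f y = 0)"
      unfolding vanish_def by metis
    let ?N = "?V1 \<inter> (\<Inter>f\<in>fs. N f)"
    have "openin (top M) ?N"
    proof (cases "fs = {}")
      case False
      then have "openin (top M) (\<Inter>f\<in>fs. N f)" using V0(3) N by (intro openin_Inter) auto
      then show ?thesis using V1(1) by blast
    qed (use V1 in simp)
    moreover have "x \<in> ?N" using V1 N by blast
    ultimately obtain y where y: "y \<in> ?N" "y \<notin> A" using nowhere_dense_ex[OF nd] by blast
    then have "y \<in> A \<inter> V0" unfolding V0(5) using N by blast
    then show False using y(2) by blast
  qed
  then obtain f where f1: "f \<in> fs" "\<not> vanish f" by (elim bexE)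
  have f2: "\<exists>y\<in>N. f y \<noteq> 0" if "openin (top M) N" "x \<in> N" "N \<subseteq> ?V1" for N
  proof (rule ccontr)
    assume "\<not> ?thesis"
    then have "\<forall>y\<in>N. f y = 0" by simp
    then have "vanish f" unfolding vanish_def using that by (intro exI[of _ N] conjI)
    then show False using f1(2) by simp
  qed
  have "f \<in> str M ?V1" using str_restrict[OF M _ V0(1) V1(1)] V0(4) f1(1) by blast
  then have h1: "holo n (snd c ` ?V1) (\<lambda>z. f (inv_chart c z))" by (simp add: chart_str[OF c V1(1,2)])
  have h2: "z \<notin> snd c ` (V \<inter> A)" if z: "z \<in> snd c ` ?V1" "f (inv_chart c z) \<noteq> 0" for z
  proof
    assume "z \<in> snd c ` (V \<inter> A)"
    moreover obtain y where y: "y \<in> ?V1" "z = snd c y" using z(1) by blast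
    ultimately have "y \<in> A" using inj by (auto simp: inj_on_def)
    then have "f y = 0" using y(1) f1(1) V0(5) by blast
    then show False using z(2) y c V(2) by auto
  qed
  have h3: "\<exists>b\<in>polydisc n a e. f (inv_chart c b) \<noteq> 0" if e: "e > 0" for e
  proof -
    have "a \<in> tuples n" using x openin_CnD(1)[OF is_chartD(2)[OF c]] V(2) by blast
    then have "snd c x \<in> polydisc n a e" using polydisc_centre[OF _ e] x(2) by simp
    then have "x \<in> {y \<in> ?V1. snd c y \<in> polydisc n a e}" using V1(3) by simp
    then have "\<exists>y\<in>{y \<in> ?V1. snd c y \<in> polydisc n a e}. f y \<noteq> 0"
      by (intro f2 chart_preimage_open[OF c V1(1,2) openin_polydisc]) auto
    then obtain y where y: "y \<in> ?V1" "snd c y \<in> polydisc n a e" "f y \<noteq> 0"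
      by blast
    then have "f (inv_chart c (snd c y)) \<noteq> 0" using inv_chart_eq[OF c, of y] V1(2) by auto
    then show ?thesis using y(2) by (rule bexI)
  qed
  have h4: "a \<in> snd c ` ?V1" "snd c ` ?V1 \<subseteq> snd c ` V" using x V0(2) by auto
  show "\<exists>V' g. a \<in> V' \<and> V' \<subseteq> snd c ` V \<and> holo n V' g \<and>
     (\<forall>z\<in>V'. g z \<noteq> 0 \<longrightarrow> z \<notin> snd c ` (V \<inter> A)) \<and> (\<forall>e>0. \<exists>b\<in>polydisc n a e. g b \<noteq> 0)"
    by (intro exI[of _ "snd c ` ?V1"] exI[of _ "\<lambda>z. f (inv_chart c z)"] conjI ballI allI impI h4 h1 h2 h3)
qed

lemma L2_extend_chart:
  assumes M: "complex_space M" and A: "analytic_in M A" and nd: "nowhere_dense_in M A"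
    and c: "is_chart M n c" and V: "openin (top M) V" "V \<subseteq> fst c"
    and f: "f \<in> str M (V - A)"
    and L2: "\<And>x. x \<in> V \<Longrightarrow> \<exists>N. openin (top M) N \<and> x \<in> N \<and> N \<subseteq> V \<and>
       (\<integral>\<^sup>+z. ennreal ((cmod (f (inv_chart c z)))\<^sup>2) * indicator (snd c ` (N - A)) z \<partial>lam n) < \<infinity>"
  shows "\<exists>g\<in>str M V. \<forall>x\<in>V - A. g x = f x"
proof -
  have VA: "openin (top M) (V - A)" "V - A \<subseteq> fst c" using V A unfolding analytic_in_def by blast+
  have inj: "inj_on (snd c) V" using inj_on_subset[OF chart_inj[OF c] V(2)] .
  have eq: "snd c ` V - snd c ` (V \<inter> A) = snd c ` (V - A)"
    using inj by (auto simp: inj_on_def)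
  have "\<exists>F. holo n (snd c ` V) F \<and> (\<forall>z\<in>snd c ` V - snd c ` (V \<inter> A). F z = f (inv_chart c z))"
  proof (rule L2_extend[OF analytic_thin[OF M A nd c V]])
    show "holo n (snd c ` V - snd c ` (V \<inter> A)) (\<lambda>z. f (inv_chart c z))"
      unfolding eq using f by (simp add: chart_str[OF c VA])
    fix a assume "a \<in> snd c ` V"
    then obtain x where x: "x \<in> V" "a = snd c x" by blast
    obtain N where N: "openin (top M) N" "x \<in> N" "N \<subseteq> V"
      "(\<integral>\<^sup>+z. ennreal ((cmod (f (inv_chart c z)))\<^sup>2) * indicator (snd c ` (N - A)) z \<partial>lam n) < \<infinity>"
      using L2[OF x(1)] by blast
    have "snd c ` N - snd c ` (V \<inter> A) = snd c ` (N - A)"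
      using inj N(3) by (auto simp: inj_on_def)
    then show "\<exists>N. openin (Cn n) N \<and> a \<in> N \<and>
        (\<integral>\<^sup>+z. ennreal ((cmod (f (inv_chart c z)))\<^sup>2) * indicator (N - snd c ` (V \<inter> A)) z \<partial>lam n) < \<infinity>"
      using chart_image_open[OF c N(1)] N V(2) x(2) by (intro exI[of _ "snd c ` N"]) auto
  qed
  then obtain F where F: "holo n (snd c ` V) F" "\<And>z. z \<in> snd c ` (V - A) \<Longrightarrow> F z = f (inv_chart c z)"
    unfolding eq by blast
  have "(\<lambda>x. F (snd c x)) \<in> str M V"
    unfolding chart_str[OF c V] using V(2) c by (intro holo_cong[OF _ F(1)]) auto
  moreover have "F (snd c x) = f x" if "x \<in> V - A" for x
  proof -
    have "F (snd c x) = f (inv_chart c (snd c x))" using that by (intro F(2) imageI)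
    moreover have "x \<in> fst c" using that V(2) by blast
    ultimately show ?thesis by (simp only: inv_chart_eq[OF c])
  qed
  ultimately show ?thesis by (intro bexI[of _ "\<lambda>x. F (snd c x)"] ballI)
qed

lemma bundle_triv:
  assumes E: "hol_vector_bundle M E" and T: "(V, r, \<tau>) \<in> trivs E"
  shows "openin (top M) V" "\<And>x. x \<in> V \<Longrightarrow> bij_betw (\<tau> x) (fibre E x) (carrier_vec r)"
  using E T unfolding hol_vector_bundle_def by auto

lemma bundle_transition:
  assumes E: "hol_vector_bundle M E" and T: "(V, r, \<tau>) \<in> trivs E" and T': "(V', r', \<tau>') \<in> trivs E"
    and x: "x \<in> V" "x \<in> V'"
  obtains g where "r' = r" "\<And>y. y \<in> V \<inter> V' \<Longrightarrow> g y \<in> carrier_mat r r"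
    "\<And>y e. y \<in> V \<inter> V' \<Longrightarrow> e \<in> fibre E y \<Longrightarrow> \<tau>' y e = g y *\<^sub>v \<tau> y e"
    "\<And>i j. i < r \<Longrightarrow> j < r \<Longrightarrow> (\<lambda>y. g y $$ (i, j)) \<in> str M (V \<inter> V')"
proof -
  have ne: "V \<inter> V' \<noteq> {}" using x by blast
  have 1: "\<forall>(V, r, \<tau>)\<in>trivs E. \<forall>(V', r', \<tau>')\<in>trivs E. V \<inter> V' \<noteq> {} \<longrightarrow> r = r' \<and>
        (\<exists>g :: 'a \<Rightarrow> complex mat.
           (\<forall>x\<in>V \<inter> V'. g x \<in> carrier_mat r r \<and> (\<forall>e\<in>fibre E x. \<tau>' x e = g x *\<^sub>v \<tau> x e)) \<and>
           (\<forall>i<r. \<forall>j<r. (\<lambda>x. g x $$ (i, j)) \<in> str M (V \<inter> V')))"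
    using E unfolding hol_vector_bundle_def by (elim conjE)
  from mp[OF bspec[OF bspec[OF 1 T, unfolded prod.case] T', unfolded prod.case] ne]
  obtain g :: "'a \<Rightarrow> complex mat" where g: "r = r'"
    "\<forall>x\<in>V \<inter> V'. g x \<in> carrier_mat r r \<and> (\<forall>e\<in>fibre E x. \<tau>' x e = g x *\<^sub>v \<tau> x e)"
    "\<forall>i<r. \<forall>j<r. (\<lambda>x. g x $$ (i, j)) \<in> str M (V \<inter> V')"
    by (elim conjE exE) (rule that)
  show ?thesis by (rule that[of g]) (use g in auto)
qed

lemma triv_eqI:
  assumes E: "hol_vector_bundle M E" and T: "(V, r, \<tau>) \<in> trivs E" and x: "x \<in> V"
    and e: "e \<in> fibre E x" "e' \<in> fibre E x" and eq: "\<And>i. i < r \<Longrightarrow> \<tau> x e $ i = \<tau> x e' $ i"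
  shows "e = e'"
proof -
  note b = bundle_triv(2)[OF E T x]
  have "\<tau> x e \<in> carrier_vec r" "\<tau> x e' \<in> carrier_vec r" using b e by (auto dest: bij_betwE)
  then have "\<tau> x e = \<tau> x e'" using eq by (intro eq_vecI) auto
  then show ?thesis using b e by (auto simp: bij_betw_def inj_on_def)
qed

lemma E_formsD:
  assumes "s \<in> E_forms M n E W"
  shows "is_chart M n c \<Longrightarrow> x \<in> fst c \<Longrightarrow> x \<in> W \<Longrightarrow> s c x \<in> fibre E x"
    "\<not> (is_chart M n c \<and> x \<in> fst c \<inter> W) \<Longrightarrow> s c x = undefined"
    "(V, r, \<tau>) \<in> trivs E \<Longrightarrow> i < r \<Longrightarrow> hol_nform M n (V \<inter> W) (\<lambda>c x. \<tau> x (s c x) $ i)"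
proof -
  have 1: "if is_chart M n c \<and> x \<in> fst c \<inter> W then s c x \<in> fibre E x else s c x = undefined" for c x
    using assms unfolding E_forms_def by blast
  show "is_chart M n c \<Longrightarrow> x \<in> fst c \<Longrightarrow> x \<in> W \<Longrightarrow> s c x \<in> fibre E x" using 1[of c x] by simp
  show "\<not> (is_chart M n c \<and> x \<in> fst c \<inter> W) \<Longrightarrow> s c x = undefined" using 1[of c x] by (simp only: if_False)
  have 2: "\<forall>(V, r, \<tau>)\<in>trivs E. \<forall>i<r. hol_nform M n (V \<inter> W) (\<lambda>c x. \<tau> x (s c x) $ i)"
    using assms unfolding E_forms_def by blast
  show "hol_nform M n (V \<inter> W) (\<lambda>c x. \<tau> x (s c x) $ i)" if "(V, r, \<tau>) \<in> trivs E" "i < r"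
    using bspec[OF 2 that(1)] that(2) by simp
qed

lemma E_forms_str:
  assumes "s \<in> E_forms M n E W" "(V, r, \<tau>) \<in> trivs E" "i < r" "is_chart M n c"
  shows "(\<lambda>x. \<tau> x (s c x) $ i) \<in> str M (fst c \<inter> (V \<inter> W))"
  by (rule hol_nformD(1)[OF E_formsD(3)[OF assms(1-3)] assms(4)])

lemma E_forms_transform:
  assumes "s \<in> E_forms M n E W" "(V, r, \<tau>) \<in> trivs E" "i < r" "is_chart M n c" "is_chart M n c'"
    "x \<in> fst c" "x \<in> fst c'" "x \<in> V" "x \<in> W"
  shows "\<tau> x (s c x) $ i = map_det n (\<lambda>x. x) c c' x * \<tau> x (s c' x) $ i"
  using assms(6-) by (intro hol_nformD(2)[OF E_formsD(3)[OF assms(1-3)] assms(4,5)]) simp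

lemma E_forms_eqI:
  assumes E: "hol_vector_bundle M E" and nd: "nowhere_dense_in M A" and W: "openin (top M) W" 
    and s: "s \<in> E_forms M n E W" and s': "s' \<in> E_forms M n E W"
    and eq: "\<And>c x. is_chart M n c \<Longrightarrow> x \<in> fst c \<Longrightarrow> x \<in> W \<Longrightarrow> x \<notin> A \<Longrightarrow> s c x = s' c x"
  shows "s = s'"
proof (intro ext)
  fix c x
  show "s c x = s' c x"
  proof (cases "is_chart M n c \<and> x \<in> fst c \<inter> W")
    case True
    then have c: "is_chart M n c" and x: "x \<in> fst c" "x \<in> W" by auto
    have "x \<in> points M" using x openin_subset[OF W] by blast
    then obtain V r \<tau> where T: "(V, r, \<tau>) \<in> trivs E" "x \<in> V" using E unfolding hol_vector_bundle_def by auto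
    show ?thesis
    proof (rule triv_eqI[OF E T E_formsD(1)[OF s c x] E_formsD(1)[OF s' c x]])
      fix i assume i: "i < r"
      let ?V = "fst c \<inter> (V \<inter> W)"
      have V: "openin (top M) ?V" using is_chartD(1)[OF c] bundle_triv(1)[OF E T(1)] W by blast
      show "\<tau> x (s c x) $ i = \<tau> x (s' c x) $ i"
      proof (rule eq_off_nowhere_dense[OF nd V])
        show "continuous_map (subtopology (top M) ?V) euclidean (\<lambda>x. \<tau> x (s c x) $ i)"
          by (rule str_continuous[OF c V _ E_forms_str[OF s T(1) i c]]) simp
        show "continuous_map (subtopology (top M) ?V) euclidean (\<lambda>x. \<tau> x (s' c x) $ i)"
          by (rule str_continuous[OF c V _ E_forms_str[OF s' T(1) i c]]) simp
      qed (use eq c x T in auto)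
    qed
  next
    case False
    then show ?thesis using E_formsD(2)[OF s, of c x] E_formsD(2)[OF s', of c x] by simp
  qed
qed

text \<open>Each component in each trivialization and chart extends separately. The transformation rules
  between trivializations and between charts hold off \<open>A\<close>, hence everywhere by continuity; so the extended components
  fit together to a form.\<close>

theorem E_forms_extend:
  assumes M: "complex_space M" and E: "hol_vector_bundle M E" and A: "analytic_in M A" and nd: "nowhere_dense_in M A"
    and W: "openin (top M) W"
    and fib: "\<And>c x. is_chart M n c \<Longrightarrow> x \<in> fst c \<inter> W - A \<Longrightarrow> s0 c x \<in> fibre E x"
    and nform: "\<And>V r \<tau> i. (V, r, \<tau>) \<in> trivs E \<Longrightarrow> i < r \<Longrightarrow> hol_nform M n (V \<inter> W - A) (\<lambda>c x. \<tau> x (s0 c x) $ i)"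
    and L2: "\<And>V r \<tau> i c x. (V, r, \<tau>) \<in> trivs E \<Longrightarrow> i < r \<Longrightarrow> is_chart M n c \<Longrightarrow> x \<in> fst c \<inter> (V \<inter> W) \<Longrightarrow>
       \<exists>N. openin (top M) N \<and> x \<in> N \<and> N \<subseteq> fst c \<inter> (V \<inter> W) \<and>
       (\<integral>\<^sup>+z. ennreal ((cmod (\<tau> (inv_chart c z) (s0 c (inv_chart c z)) $ i))\<^sup>2) * indicator (snd c ` (N - A)) z \<partial>lam n) < \<infinity>"
  shows "\<exists>s\<in>E_forms M n E W. \<forall>c x. is_chart M n c \<longrightarrow> x \<in> fst c \<inter> W - A \<longrightarrow> s c x = s0 c x"
proof -
  have Vo: "openin (top M) (fst c \<inter> (V \<inter> W))" if "is_chart M n c" "(V, r, \<tau>) \<in> trivs E" for c V r \<tau>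
    using is_chartD(1)[OF that(1)] bundle_triv(1)[OF E that(2)] W by blast
  have Gex: "\<exists>g\<in>str M (fst c \<inter> (V \<inter> W)). \<forall>x\<in>fst c \<inter> (V \<inter> W) - A. g x = \<tau> x (s0 c x) $ i"
    if c: "is_chart M n c" and T: "(V, r, \<tau>) \<in> trivs E" and i: "i < r" for c V r \<tau> i
  proof (rule L2_extend_chart[OF M A nd c Vo[OF c T] _ _ L2[OF T i c]])
    have "(\<lambda>x. \<tau> x (s0 c x) $ i) \<in> str M (fst c \<inter> (V \<inter> W - A))"
      by (rule hol_nformD(1)[OF nform[OF T i] c])
    then show "(\<lambda>x. \<tau> x (s0 c x) $ i) \<in> str M (fst c \<inter> (V \<inter> W) - A)" by (simp add: Int_Diff)
  qed auto
  obtain G where G: "\<And>c V r \<tau> i. is_chart M n c \<Longrightarrow> (V, r, \<tau>) \<in> trivs E \<Longrightarrow> i < r \<Longrightarrow> G c (V, r, \<tau>) i \<in> str M (fst c \<inter> (V \<inter> W))"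
    "\<And>c V r \<tau> i x. is_chart M n c \<Longrightarrow> (V, r, \<tau>) \<in> trivs E \<Longrightarrow> i < r \<Longrightarrow> x \<in> fst c \<inter> (V \<inter> W) - A \<Longrightarrow> G c (V, r, \<tau>) i x = \<tau> x (s0 c x) $ i"
  proof -
    define G where "G c T i = (SOME g. g \<in> str M (fst c \<inter> (fst T \<inter> W)) \<and>
      (\<forall>x\<in>fst c \<inter> (fst T \<inter> W) - A. g x = snd (snd T) x (s0 c x) $ i))" for c and T :: "_ set \<times> nat \<times> _" and i
    have "G c (V, r, \<tau>) i \<in> str M (fst c \<inter> (V \<inter> W)) \<and> (\<forall>x\<in>fst c \<inter> (V \<inter> W) - A. G c (V, r, \<tau>) i x = \<tau> x (s0 c x) $ i)"
      if "is_chart M n c" "(V, r, \<tau>) \<in> trivs E" "i < r" for c V r \<tau> i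
    proof -
      have "\<exists>g. g \<in> str M (fst c \<inter> (V \<inter> W)) \<and> (\<forall>x\<in>fst c \<inter> (V \<inter> W) - A. g x = \<tau> x (s0 c x) $ i)"
        using Gex[OF that] by blast
      from someI_ex[OF this] show ?thesis by (simp add: G_def)
    qed
    then show ?thesis using that[of G] by blast
  qed
  have Gc: "continuous_map (subtopology (top M) N) euclidean (G c (V, r, \<tau>) i)"
    if "is_chart M n c" "(V, r, \<tau>) \<in> trivs E" "i < r" "N \<subseteq> fst c \<inter> (V \<inter> W)" for c V r \<tau> i N
    using str_continuous[OF that(1) Vo[OF that(1,2)] _ G(1)[OF that(1-3)]] that(4)
    by (meson continuous_map_from_subtopology_mono inf_le1)
  define T where "T x = (SOME t. t \<in> trivs E \<and> x \<in> fst t)" for x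
  have T: "T x \<in> trivs E" "x \<in> fst (T x)" if "x \<in> W" for x
  proof -
    have "x \<in> points M" using that openin_subset[OF W] by blast
    then have "\<exists>t. t \<in> trivs E \<and> x \<in> fst t" using E unfolding hol_vector_bundle_def by fastforce
    from someI_ex[OF this] show "T x \<in> trivs E" "x \<in> fst (T x)" by (auto simp: T_def)
  qed
  define s where "s c x = (if is_chart M n c \<and> x \<in> fst c \<inter> W then
      inv_into (fibre E x) (snd (snd (T x)) x) (Matrix.vec (fst (snd (T x))) (\<lambda>i. G c (T x) i x)) else undefined)" for c x
  have s1: "s c x \<in> fibre E x \<and> \<tau> x (s c x) = Matrix.vec r (\<lambda>i. G c (T x) i x)"
    if c: "is_chart M n c" and x: "x \<in> fst c" "x \<in> W" and Tx: "T x = (V, r, \<tau>)" for c x V r \<tau>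
  proof -
    have "(V, r, \<tau>) \<in> trivs E" "x \<in> V" using T[OF x(2)] Tx by auto
    then have b: "bij_betw (\<tau> x) (fibre E x) (carrier_vec r)" using bundle_triv(2)[OF E] by blast
    let ?v = "Matrix.vec r (\<lambda>i. G c (T x) i x)"
    have v: "?v \<in> \<tau> x ` fibre E x" using b by (simp add: bij_betw_def)
    have "s c x = inv_into (fibre E x) (\<tau> x) ?v" using c x Tx by (simp add: s_def)
    then show ?thesis using v by (simp add: inv_into_into f_inv_into_f)
  qed
  have sfib: "s c x \<in> fibre E x" if "is_chart M n c" "x \<in> fst c" "x \<in> W" for c x
    using s1[OF that] by (cases "T x") auto
  \<comment> \<open>the value of \<open>s\<close> does not depend on the choice of the trivialization\<close>
  have comp: "\<tau> x (s c x) $ i = G c (V, r, \<tau>) i x"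
    if c: "is_chart M n c" and T': "(V, r, \<tau>) \<in> trivs E" and i: "i < r" and x: "x \<in> fst c" "x \<in> V" "x \<in> W" for c x V r \<tau> i
  proof -
    obtain V0 r0 \<tau>0 where T0: "T x = (V0, r0, \<tau>0)" by (cases "T x") auto
    have T0': "(V0, r0, \<tau>0) \<in> trivs E" "x \<in> V0" using T[OF x(3)] T0 by auto
    obtain g where g: "r = r0" "\<And>y. y \<in> V0 \<inter> V \<Longrightarrow> g y \<in> carrier_mat r0 r0"
      "\<And>y e. y \<in> V0 \<inter> V \<Longrightarrow> e \<in> fibre E y \<Longrightarrow> \<tau> y e = g y *\<^sub>v \<tau>0 y e"
      "\<And>i j. i < r0 \<Longrightarrow> j < r0 \<Longrightarrow> (\<lambda>y. g y $$ (i, j)) \<in> str M (V0 \<inter> V)"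
      using bundle_transition[OF E T0'(1) T' T0'(2) x(2)] by metis
    have mv: "(g y *\<^sub>v v) $ i = (\<Sum>j<r0. g y $$ (i, j) * v $ j)" if "y \<in> V0 \<inter> V" "v \<in> carrier_vec r0" for y v
    proof -
      have "g y \<in> carrier_mat r0 r0" using g(2) that(1) by blast
      then show ?thesis using g(1) that(2) i by (auto simp: scalar_prod_def lessThan_atLeast0)
    qed
    let ?N = "fst c \<inter> (V0 \<inter> V \<inter> W)"
    have V0V: "openin (top M) (V0 \<inter> V)"
      using bundle_triv(1)[OF E T0'(1)] bundle_triv(1)[OF E T'] by blast
    have N: "openin (top M) ?N" using is_chartD(1)[OF c] V0V W by blast
    have "G c (V, r, \<tau>) i x = (\<Sum>j<r0. g x $$ (i, j) * G c (V0, r0, \<tau>0) j x)"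
    proof (rule eq_off_nowhere_dense[OF nd N])
      show "continuous_map (subtopology (top M) ?N) euclidean (G c (V, r, \<tau>) i)"
        by (rule Gc[OF c T' i]) auto
      have "continuous_map (subtopology (top M) ?N) euclidean (\<lambda>y. g y $$ (i, j))" if "j < r0" for j
        using g(1,4) i that str_restrict[OF M _ V0V N] by (intro str_continuous[OF c N]) auto
      then show "continuous_map (subtopology (top M) ?N) euclidean (\<lambda>x. \<Sum>j<r0. g x $$ (i, j) * G c (V0, r0, \<tau>0) j x)"
        by (intro continuous_map_sum continuous_map_mult_field Gc[OF c T0'(1)]) auto
      fix y assume y: "y \<in> ?N" "y \<notin> A"
      have f: "s0 c y \<in> fibre E y" using fib[OF c] y by blast
      then have "\<tau>0 y (s0 c y) \<in> carrier_vec r0" using bundle_triv(2)[OF E T0'(1), of y] y by (auto dest: bij_betwE)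
      then have "\<tau> y (s0 c y) $ i = (\<Sum>j<r0. g y $$ (i, j) * \<tau>0 y (s0 c y) $ j)"
        using g(3)[OF _ f] mv y by auto
      then show "G c (V, r, \<tau>) i y = (\<Sum>j<r0. g y $$ (i, j) * G c (V0, r0, \<tau>0) j y)"
        using G(2)[OF c T' i, of y] G(2)[OF c T0'(1), of _ y] y by simp
    qed (use x T0' in auto)
    also have "\<dots> = (g x *\<^sub>v \<tau>0 x (s c x)) $ i"
      using s1[OF c x(1,3) T0] T0 T0' x by (subst mv) auto
    also have "\<dots> = \<tau> x (s c x) $ i" using g(3) sfib[OF c x(1,3)] T0' x by simp
    finally show ?thesis by simp
  qed
  have "s \<in> E_forms M n E W"
    unfolding E_forms_def
  proof (intro CollectI conjI allI ballI)
    show "if is_chart M n c \<and> x \<in> fst c \<inter> W then s c x \<in> fibre E x else s c x = undefined" for c x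
      using sfib[of c x] by (auto simp: s_def)
    fix T' assume "T' \<in> trivs E"
    moreover obtain V r \<tau> where T'eq: "T' = (V, r, \<tau>)" by (cases T') auto
    ultimately have T': "(V, r, \<tau>) \<in> trivs E" by simp
    have "hol_nform M n (V \<inter> W) (\<lambda>c x. \<tau> x (s c x) $ i)" if i: "i < r" for i
      unfolding hol_nform_iff
    proof (intro conjI allI impI)
      fix c assume c: "is_chart M n c"
      show "(\<lambda>x. \<tau> x (s c x) $ i) \<in> str M (fst c \<inter> (V \<inter> W))"
        by (rule str_cong[OF c Vo[OF c T'] _ G(1)[OF c T' i]]) (auto simp: comp[OF c T' i])
      fix c' x assume c': "is_chart M n c'" and x: "x \<in> fst c \<inter> fst c' \<inter> (V \<inter> W)"
      let ?N = "fst c \<inter> fst c' \<inter> (V \<inter> W)"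
      have N: "openin (top M) ?N" by (intro openin_Int is_chartD(1)[OF c] is_chartD(1)[OF c'] bundle_triv(1)[OF E T'] W)
      have "G c (V, r, \<tau>) i x = map_det n (\<lambda>x. x) c c' x * G c' (V, r, \<tau>) i x"
      proof (rule eq_off_nowhere_dense[OF nd N])
        show "continuous_map (subtopology (top M) ?N) euclidean (G c (V, r, \<tau>) i)"
          by (rule Gc[OF c T' i]) auto
        show "continuous_map (subtopology (top M) ?N) euclidean (\<lambda>x. map_det n (\<lambda>x. x) c c' x * G c' (V, r, \<tau>) i x)"
          by (intro continuous_map_mult_field continuous_map_det[OF M holomorphic_map_id c c' N] Gc[OF c' T' i]) auto
        fix y assume y: "y \<in> ?N" "y \<notin> A"
        then show "G c (V, r, \<tau>) i y = map_det n (\<lambda>x. x) c c' y * G c' (V, r, \<tau>) i y"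
          using G(2)[OF c T' i, of y] G(2)[OF c' T' i, of y] hol_nformD(2)[OF nform[OF T' i] c c', of y] by simp
      qed (rule x)
      then show "\<tau> x (s c x) $ i = map_det n (\<lambda>x. x) c c' x * \<tau> x (s c' x) $ i"
        using comp[OF c T' i, of x] comp[OF c' T' i, of x] x by simp
    qed
    then show "case T' of (V, r, \<tau>) \<Rightarrow> \<forall>i<r. hol_nform M n (V \<inter> W) (\<lambda>c x. \<tau> x (s c x) $ i)"
      by (simp add: T'eq)
  qed
  moreover have "s c x = s0 c x" if c: "is_chart M n c" and x: "x \<in> fst c \<inter> W - A" for c x
  proof -
    obtain V r \<tau> where Tx: "T x = (V, r, \<tau>)" by (cases "T x") auto
    then have T': "(V, r, \<tau>) \<in> trivs E" "x \<in> V" using T[of x] x by auto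
    have "s c x \<in> fibre E x" using sfib[OF c] x by blast
    moreover have "\<tau> x (s c x) $ i = \<tau> x (s0 c x) $ i" if "i < r" for i
      using comp[OF c T'(1) that, of x] G(2)[OF c T'(1) that, of x] x T'(2) by simp
    ultimately show ?thesis using triv_eqI[OF E T'] fib[OF c x] by blast
  qed
  ultimately show ?thesis by blast
qed

section \<open>The volume density of a Hermitian metric\<close>

lemma hermitian_matD:
  assumes "hermitian_mat n A"
  shows "A \<in> carrier_mat n n" "i < n \<Longrightarrow> j < n \<Longrightarrow> A $$ (j, i) = cnj (A $$ (i, j))"
  using assms unfolding hermitian_mat_def by blast+

lemma pos_matD:
  assumes "pos_mat n A"
  shows "hermitian_mat n A" "v \<in> carrier_vec n \<Longrightarrow> v \<noteq> 0\<^sub>v n \<Longrightarrow> 0 < Re (sesqui A v v)"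
  using assms unfolding pos_mat_def by blast+

text \<open>The conjugate of a vector in the kernel would have length \<open>0\<close>; conjugation is due to \<open>sesqui\<close> being
  linear in its first argument.\<close>

lemma pos_mat_det_nonzero:
  assumes A: "pos_mat n A"
  shows "Determinant.det A \<noteq> 0"
proof
  have carr: "A \<in> carrier_mat n n" by (rule hermitian_matD(1)[OF pos_matD(1)[OF A]])
  assume "Determinant.det A = 0"
  then obtain v where v: "v \<in> carrier_vec n" "v \<noteq> 0\<^sub>v n" "A *\<^sub>v v = 0\<^sub>v n"
    using det_0_iff_vec_prod_zero[OF carr] by blast
  define w where "w = Matrix.vec n (\<lambda>i. cnj (v $ i))"
  have w: "w \<in> carrier_vec n" "w \<noteq> 0\<^sub>v n"
  proof -
    show "w \<in> carrier_vec n" by (simp add: w_def)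
    show "w \<noteq> 0\<^sub>v n"
    proof
      assume w0: "w = 0\<^sub>v n"
      have "v $ i = 0" if "i < n" for i
      proof -
        have "w $ i = 0" using w0 that by simp
        then show ?thesis using that by (simp add: w_def)
      qed
      then have "v = 0\<^sub>v n" using v(1) by (intro eq_vecI) auto
      then show False using v(2) by simp
    qed
  qed
  have "sesqui A w w = (\<Sum>i<n. cnj (v $ i) * (\<Sum>j<n. A $$ (i, j) * v $ j))"
    by (simp add: sesqui_def w_def sum_distrib_left mult_ac)
  also have "\<dots> = (\<Sum>i<n. cnj (v $ i) * (A *\<^sub>v v) $ i)"
    using v(1) carr by (intro sum.cong refl arg_cong2[where f="(*)"]) (auto simp: scalar_prod_def lessThan_atLeast0)
  also have "\<dots> = 0" using v(3) by simp
  finally show False using pos_matD(2)[OF A w] by simp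
qed

lemma hermitian_mat_det_real:
  assumes A: "hermitian_mat n A"
  shows "Im (Determinant.det A) = 0"
proof -
  note carr = hermitian_matD(1)[OF A] and h = hermitian_matD(2)[OF A]
  have "cnj (Determinant.det A) = (\<Sum>p | p permutes {0..<n}. cnj (signof p) * (\<Prod>i = 0..<n. cnj (A $$ (i, p i))))"
    unfolding det_def'[OF carr] by simp
  also have "\<dots> = (\<Sum>p | p permutes {0..<n}. signof p * (\<Prod>i = 0..<n. transpose_mat A $$ (i, p i)))"
  proof (intro sum.cong refl arg_cong2[where f="(*)"] prod.cong)
    fix p i assume "p \<in> {p. p permutes {0..<n}}" "i \<in> {0..<n}"
    then have "i < n" "p i < n" by (auto simp: permutes_in_image dest: permutes_in_image[of p "{0..<n}" i])
    then show "cnj (A $$ (i, p i)) = transpose_mat A $$ (i, p i)" using h[of i "p i", symmetric] carr by simp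
  qed (simp add: sign_def)
  also have "\<dots> = Determinant.det (transpose_mat A)"
    using carr by (intro det_def'[symmetric]) simp
  also have "\<dots> = Determinant.det A" by (rule det_transpose[OF carr])
  finally have "cnj (Determinant.det A) = Determinant.det A" .
  then show ?thesis by (simp add: complex_eq_iff)
qed

text \<open>The determinant is real and does not vanish on the segment from the identity matrix to \<open>A\<close>.\<close>

lemma pos_mat_det_pos:
  assumes A: "pos_mat n A"
  shows "0 < Re (Determinant.det A)"
proof (rule ccontr)
  assume neg: "\<not> ?thesis"
  have carr: "A \<in> carrier_mat n n" by (rule hermitian_matD(1)[OF pos_matD(1)[OF A]])
  define B where "B t = mat n n (\<lambda>(i, j). of_real (1 - t) * (if i = j then 1 else 0) + of_real t * A $$ (i, j))" for t :: real
  have Bc: "B t \<in> carrier_mat n n" for t by (simp add: B_def)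
  have B: "pos_mat n (B t)" if t: "0 \<le> t" "t \<le> 1" for t
    unfolding pos_mat_def
  proof (intro conjI ballI)
    show "hermitian_mat n (B t)"
      unfolding hermitian_mat_def
    proof (intro conjI allI impI Bc)
      fix i j assume ij: "i < n" "j < n"
      show "B t $$ (j, i) = cnj (B t $$ (i, j))"
        using ij hermitian_matD(2)[OF pos_matD(1)[OF A] ij] by (simp add: B_def)
    qed
    fix v :: "complex Matrix.vec" assume v: "v \<in> carrier_vec n - {0\<^sub>v n}"
    have "sesqui (B t) v v = (\<Sum>i<n. \<Sum>j<n. (if j = i then of_real (1 - t) * (v $ i * cnj (v $ j)) else 0) + of_real t * (A $$ (i, j) * v $ i * cnj (v $ j)))"
      unfolding sesqui_def using v by (intro sum.cong) (auto simp: B_def algebra_simps)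
    also have "\<dots> = of_real (1 - t) * (\<Sum>i<n. v $ i * cnj (v $ i)) + of_real t * sesqui A v v"
    proof -
      have "dim_vec v = n" using v by auto
      then show ?thesis by (simp add: sum.distrib sesqui_def sum_distrib_left)
    qed
    finally have eq: "Re (sesqui (B t) v v) = (1 - t) * (\<Sum>i<n. (cmod (v $ i))\<^sup>2) + t * Re (sesqui A v v)"
      by (simp add: complex_norm_square[symmetric] Re_sum)
    have pos: "0 < Re (sesqui A v v)" using pos_matD(2)[OF A] v by blast
    have "0 < (\<Sum>i<n. (cmod (v $ i))\<^sup>2)"
    proof -
      obtain i where "i < n" "v $ i \<noteq> 0" using v by (metis DiffE carrier_vecD eq_vecI index_zero_vec singletonI)
      then show ?thesis by (intro sum_pos2[of _ i]) auto
    qed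
    then show "0 < Re (sesqui (B t) v v)"
      unfolding eq using pos t by (cases "t = 0") (auto intro: add_nonneg_pos)
  qed
  let ?d = "\<lambda>t. Re (Determinant.det (B t))"
  have "continuous_on {0..1} ?d"
  proof -
    have "Determinant.det (B t) = (\<Sum>p | p permutes {0..<n}. signof p *
        (\<Prod>i = 0..<n. of_real (1 - t) * (if i = p i then 1 else 0) + of_real t * A $$ (i, p i)))" for t
      unfolding det_def'[OF Bc]
    proof (intro sum.cong refl arg_cong2[where f="(*)"] prod.cong)
      fix p i assume "p \<in> {p. p permutes {0..<n}}" "i \<in> {0..<n}"
      then have "i < n" "p i < n" by (auto dest: permutes_in_image[of p "{0..<n}" i])
      then show "B t $$ (i, p i) = of_real (1 - t) * (if i = p i then 1 else 0) + of_real t * A $$ (i, p i)"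
        by (simp add: B_def)
    qed
    then show ?thesis by (simp add: continuous_intros)
  qed
  moreover have "B 0 = 1\<^sub>m n" "B 1 = A" using carr by (auto simp: B_def intro!: eq_matI)
  ultimately have "\<exists>t\<ge>0. t \<le> 1 \<and> ?d t = 0"
    using neg by (intro IVT2') auto
  then obtain t where t: "0 \<le> t" "t \<le> 1" "?d t = 0" by blast
  have "Im (Determinant.det (B t)) = 0"
    by (rule hermitian_mat_det_real[OF pos_matD(1)[OF B[OF t(1,2)]]])
  then have "Determinant.det (B t) = 0" using t(3) by (simp add: complex_eq_iff)
  then show False using pos_mat_det_nonzero[OF B[OF t(1,2)]] by simp
qed

lemma closed_embeddingD:
  assumes "closed_embedding X N D e"
  shows "openin (top X) (fst e)" "openin (Cn N) D" "snd e ` fst e \<subseteq> D"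
    "openin (top X) V \<Longrightarrow> V \<subseteq> fst e \<Longrightarrow> f \<in> str X V \<longleftrightarrow> locally_restr_holo N (snd e ` V) (\<lambda>z. f (inv_chart e z))"
    "homeomorphic_map (subtopology (top X) (fst e)) (subtopology (Cn N) (snd e ` fst e)) (snd e)"
proof -
  obtain U \<phi> where e: "e = (U, \<phi>)" by (cases e)
  have *: "openin (top X) U" "openin (Cn N) D" "analytic_subset N D (\<phi> ` U)"
     "homeomorphic_map (subtopology (top X) U) (subtopology (Cn N) (\<phi> ` U)) \<phi>"
     "\<forall>V f. openin (top X) V \<longrightarrow> V \<subseteq> U \<longrightarrow> (f \<in> str X V \<longleftrightarrow> locally_restr_holo N (\<phi> ` V) (f \<circ> inv_chart (U, \<phi>)))"
    using assms unfolding closed_embedding_def e by auto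
  show "openin (top X) (fst e)" "openin (Cn N) D"
    "homeomorphic_map (subtopology (top X) (fst e)) (subtopology (Cn N) (snd e ` fst e)) (snd e)"
    using * e by auto
  show "snd e ` fst e \<subseteq> D"
    using *(3) closedin_subset unfolding analytic_subset_def e by fastforce
  show "openin (top X) V \<Longrightarrow> V \<subseteq> fst e \<Longrightarrow> f \<in> str X V \<longleftrightarrow> locally_restr_holo N (snd e ` V) (\<lambda>z. f (inv_chart e z))"
    using *(5) by (simp add: e o_def)
qed

text \<open>An embedding has injective differential, since the coordinates of a chart are restrictions of
  holomorphic functions on the ambient space.\<close>

lemma embedding_jacobian_left_inverse:
  assumes X: "complex_space X" and e: "closed_embedding X N D e" and c: "is_chart X n c"
    and y: "y \<in> fst c" "y \<in> fst e"
  shows "\<exists>B\<in>carrier_mat n N. B * jacobian N n (\<lambda>z. snd e (inv_chart c z)) (snd c y) = 1\<^sub>m n"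
proof -
  note eD = closed_embeddingD[OF e]
  have e_inj: "inj_on (snd e) (fst e)"
    using homeomorphic_imp_injective_map[OF eD(5)] openin_subset[OF eD(1)] by (simp add: Int_absorb1)
  have inv_e: "inv_chart e (snd e x) = x" if "x \<in> fst e" for x
    using that e_inj by (simp add: inv_chart_def)
  let ?W = "fst c \<inter> fst e"
  have W: "openin (top X) ?W" "?W \<subseteq> fst c" "?W \<subseteq> fst e" using is_chartD(1)[OF c] eD(1) by auto
  have \<Phi>: "holo n (snd c ` ?W) (\<lambda>z. snd e (inv_chart c z) i)" if i: "i < N" for i
  proof -
    have "locally_restr_holo N (snd e ` fst e) (\<lambda>z. snd e (inv_chart e z) i)"
      unfolding locally_restr_holo_def
    proof
      fix a assume a: "a \<in> snd e ` fst e"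
      have "snd e (inv_chart e z) i = z i" if "z \<in> snd e ` fst e" for z
        using that inv_e by auto
      then show "\<exists>V F. a \<in> V \<and> holo N V F \<and> (\<forall>z\<in>V \<inter> snd e ` fst e. snd e (inv_chart e z) i = F z)"
        using a eD(3) holo_coordinate[OF eD(2) i] by (intro exI[of _ D] exI[of _ "\<lambda>z. z i"]) auto
    qed
    then have "(\<lambda>x. snd e x i) \<in> str X (fst e)" by (simp add: eD(4)[OF eD(1) order_refl])
    then have "(\<lambda>x. snd e x i) \<in> str X ?W" using str_restrict[OF X _ eD(1) W(1,3)] by blast
    then show ?thesis by (simp add: chart_str[OF c W(1,2)])
  qed
  have yW: "y \<in> ?W" using y by simp
  define a where "a = snd e y"
  have "\<exists>V F. a \<in> V \<and> holo N V F \<and> (\<forall>z\<in>V \<inter> snd e ` ?W. snd c (inv_chart e z) k = F z)" if k: "k < n" for k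
  proof -
    have "(\<lambda>x. snd c x k) \<in> str X ?W"
      using str_restrict[OF X chart_coordinate_str[OF c k] is_chartD(1)[OF c] W(1,2)] .
    then have "locally_restr_holo N (snd e ` ?W) (\<lambda>z. snd c (inv_chart e z) k)" by (simp add: eD(4)[OF W(1,3)])
    then show ?thesis using yW unfolding locally_restr_holo_def a_def by blast
  qed
  then obtain V F where VF: "\<And>k. k < n \<Longrightarrow> a \<in> V k \<and> holo N (V k) (F k) \<and> (\<forall>z\<in>V k \<inter> snd e ` ?W. snd c (inv_chart e z) k = F k z)"
    by metis
  \<comment> \<open>on this neighbourhood, the extensions of all coordinates are defined\<close>
  define O' where "O' = D \<inter> (\<Inter>k\<in>{..<n}. V k)"
  have O': "openin (Cn N) O'"
  proof (cases "n = 0")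
    case False
    have "openin (Cn N) (V k)" if "k < n" for k using holo_openD VF[OF that] by blast
    then have "openin (Cn N) (\<Inter>k\<in>{..<n}. V k)" using False by (intro openin_Inter) auto
    then show ?thesis unfolding O'_def using eD(2) by blast
  qed (use eD(2) in \<open>simp add: O'_def\<close>)
  have aO: "a \<in> O'" using VF y eD(3) by (auto simp: O'_def a_def)
  let ?W' = "{x \<in> ?W. snd e x \<in> O'}"
  have W': "openin (top X) ?W'"
  proof -
    have "continuous_map (subtopology (top X) ?W) (Cn N) (snd e)"
      using homeomorphic_imp_continuous_map[OF eD(5)] W(3)
      by (auto simp: continuous_map_in_subtopology intro: continuous_map_from_subtopology_mono)
    then have "openin (subtopology (top X) ?W) {x \<in> topspace (subtopology (top X) ?W). snd e x \<in> O'}"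
      using O' by (rule openin_continuous_map_preimage)
    then show ?thesis using openin_open_subtopology[OF W(1)] openin_subset[OF W(1)] by (simp add: Int_absorb1)
  qed
  have holo\<Phi>: "holo_map n N (snd c ` ?W') O' (\<lambda>z. snd e (inv_chart c z))"
    unfolding holo_map_def
  proof (intro conjI allI impI O')
    show op: "openin (Cn n) (snd c ` ?W')" by (rule chart_image_open[OF c W']) auto
    show "(\<lambda>z. snd e (inv_chart c z)) \<in> snd c ` ?W' \<rightarrow> O'" using c by auto
    show "holo n (snd c ` ?W') (\<lambda>z. snd e (inv_chart c z) i)" if "i < N" for i
      by (rule holo_subset[OF \<Phi>[OF that] _ op]) auto
  qed
  define \<Psi> where "\<Psi> z = (\<lambda>k\<in>{..<n}. F k z)" for z
  have holo\<Psi>: "holo_map N n O' (tuples n) \<Psi>"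
    unfolding holo_map_def
  proof (intro conjI allI impI O')
    show "openin (Cn n) (tuples n)" using openin_topspace[of "Cn n"] by simp
    show "holo N O' (\<lambda>z. \<Psi> z k)" if "k < n" for k
      using VF[OF that] that by (auto simp: \<Psi>_def O'_def intro!: holo_subset[OF _ _ O'[unfolded O'_def]])
  qed (auto simp: \<Psi>_def)
  have inv: "\<Psi> (snd e (inv_chart c z)) = z" if z: "z \<in> snd c ` ?W'" for z
  proof (rule tuples_eqI[of _ n])
    obtain x where x: "x \<in> ?W" "snd e x \<in> O'" "z = snd c x" using z by blast
    show "z \<in> tuples n" using x openin_CnD(1)[OF is_chartD(2)[OF c]] by blast
    fix k assume k: "k < n"
    have "snd e x \<in> V k \<inter> snd e ` ?W" using x k by (auto simp: O'_def)
    then have "snd c (inv_chart e (snd e x)) k = F k (snd e x)" using VF[OF k] by blast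
    then show "\<Psi> (snd e (inv_chart c z)) k = z k" using k x c inv_e by (simp add: \<Psi>_def)
  qed (simp add: \<Psi>_def)
  have "snd c y \<in> snd c ` ?W'" using yW aO by (auto simp: a_def)
  from jacobian_left_inverse[OF holo\<Phi> holo\<Psi> this inv]
  show ?thesis by (intro bexI[of _ "jacobian n N \<Psi> (snd e (inv_chart c (snd c y)))"]) auto
qed

text \<open>The Hermitian form of the matrix is that of \<open>G\<close> composed with \<open>J\<close>, and \<open>J\<close> is injective.\<close>

lemma pos_mat_pullback:
  assumes G: "pos_mat N G" and J: "J \<in> carrier_mat N n" and B: "B \<in> carrier_mat n N" "B * J = 1\<^sub>m n"
  shows "pos_mat n (mat n n (\<lambda>(j, k). \<Sum>a<N. \<Sum>b<N. G $$ (a, b) * J $$ (a, j) * cnj (J $$ (b, k))))" (is "pos_mat n ?A")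
proof -
  note herm = hermitian_matD(2)[OF pos_matD(1)[OF G]]
  have A_herm: "?A $$ (k, j) = cnj (?A $$ (j, k))" if "j < n" "k < n" for j k
  proof -
    have "?A $$ (k, j) = (\<Sum>a<N. \<Sum>b<N. G $$ (a, b) * J $$ (a, k) * cnj (J $$ (b, j)))" using that by simp
    also have "\<dots> = (\<Sum>b<N. \<Sum>a<N. G $$ (a, b) * J $$ (a, k) * cnj (J $$ (b, j)))" by (rule sum.swap)
    also have "\<dots> = (\<Sum>b<N. \<Sum>a<N. cnj (G $$ (b, a) * J $$ (b, j) * cnj (J $$ (a, k))))"
    proof (intro sum.cong refl)
      fix a b assume "b \<in> {..<N}" "a \<in> {..<N}"
      then have "G $$ (a, b) = cnj (G $$ (b, a))" using herm[of b a] by simp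
      then show "G $$ (a, b) * J $$ (a, k) * cnj (J $$ (b, j)) = cnj (G $$ (b, a) * J $$ (b, j) * cnj (J $$ (a, k)))"
        by simp
    qed
    also have "\<dots> = cnj (?A $$ (j, k))" using that by simp
    finally show ?thesis .
  qed
  have A_pos: "0 < Re (sesqui ?A v v)" if v: "v \<in> carrier_vec n - {0\<^sub>v n}" for v
  proof -
    have vn: "v \<in> carrier_vec n" using v by blast
    let ?w = "J *\<^sub>v v"
    have wN: "?w \<in> carrier_vec N" by (rule mult_mat_vec_carrier[OF J vn])
    have w: "?w $ a = (\<Sum>j<n. J $$ (a, j) * v $ j)" if "a < N" for a
      using J vn that by (auto simp: scalar_prod_def lessThan_atLeast0)
    have "?w \<noteq> 0\<^sub>v N"
    proof
      assume "?w = 0\<^sub>v N"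
      moreover have "B *\<^sub>v 0\<^sub>v N = 0\<^sub>v n" using B(1) by (intro eq_vecI) (auto simp: scalar_prod_def)
      ultimately have "(B * J) *\<^sub>v v = 0\<^sub>v n" using vn by (simp add: assoc_mult_mat_vec[OF B(1) J])
      then show False using v B(2) by simp
    qed
    then have "0 < Re (sesqui G ?w ?w)" using pos_matD(2)[OF G wN] by blast
    also have "sesqui G ?w ?w = (\<Sum>a<N. \<Sum>b<N. G $$ (a, b) * (\<Sum>j<n. J $$ (a, j) * v $ j) * cnj (\<Sum>k<n. J $$ (b, k) * v $ k))"
      unfolding sesqui_def using J w by (intro sum.cong) auto
    also have "\<dots> = (\<Sum>a<N. \<Sum>b<N. \<Sum>j<n. \<Sum>k<n. G $$ (a, b) * J $$ (a, j) * cnj (J $$ (b, k)) * v $ j * cnj (v $ k))"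
      by (simp add: sum_distrib_left sum_distrib_right mult_ac)
    also have "\<dots> = (\<Sum>a<N. \<Sum>j<n. \<Sum>b<N. \<Sum>k<n. G $$ (a, b) * J $$ (a, j) * cnj (J $$ (b, k)) * v $ j * cnj (v $ k))"
      by (intro sum.cong refl sum.swap)
    also have "\<dots> = (\<Sum>j<n. \<Sum>a<N. \<Sum>b<N. \<Sum>k<n. G $$ (a, b) * J $$ (a, j) * cnj (J $$ (b, k)) * v $ j * cnj (v $ k))"
      by (rule sum.swap)
    also have "\<dots> = (\<Sum>j<n. \<Sum>a<N. \<Sum>k<n. \<Sum>b<N. G $$ (a, b) * J $$ (a, j) * cnj (J $$ (b, k)) * v $ j * cnj (v $ k))"
      by (intro sum.cong refl sum.swap)
    also have "\<dots> = (\<Sum>j<n. \<Sum>k<n. \<Sum>a<N. \<Sum>b<N. G $$ (a, b) * J $$ (a, j) * cnj (J $$ (b, k)) * v $ j * cnj (v $ k))"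
      by (intro sum.cong refl sum.swap)
    also have "\<dots> = sesqui ?A v v"
      unfolding sesqui_def using vn by (intro sum.cong) (auto simp: sum_distrib_right)
    finally show ?thesis .
  qed
  show ?thesis
    unfolding pos_mat_def hermitian_mat_def using A_herm A_pos by (intro conjI allI impI ballI) auto
qed

theorem hermitian_metric_det_pos:
  assumes X: "complex_space X" and \<omega>: "hermitian_metric X n \<omega>" and c: "is_chart X n c" and y: "y \<in> fst c"
  shows "0 < Re (Determinant.det (\<omega> c y))"
proof -
  have "y \<in> points X" using y openin_subset[OF is_chartD(1)[OF c]] by blast
  then obtain N D e G where e: "closed_embedding X N D e" "y \<in> fst e" "hermitian_metric_Cn N D G"
     "\<forall>c y. is_chart X n c \<longrightarrow> y \<in> fst c \<inter> fst e \<longrightarrow>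
        (let J = jacobian N n (snd e \<circ> inv_chart c) (snd c y) in
         \<omega> c y = mat n n (\<lambda>(j, k). \<Sum>a<N. \<Sum>b<N. G (snd e y) $$ (a, b) * J $$ (a, j) * cnj (J $$ (b, k))))"
    using \<omega> unfolding hermitian_metric_def by blast
  define J where "J = jacobian N n (\<lambda>z. snd e (inv_chart c z)) (snd c y)"
  have "\<omega> c y = mat n n (\<lambda>(j, k). \<Sum>a<N. \<Sum>b<N. G (snd e y) $$ (a, b) * J $$ (a, j) * cnj (J $$ (b, k)))"
    using e(4) c y e(2) unfolding Let_def o_def J_def by blast
  moreover obtain B where "B \<in> carrier_mat n N" "B * J = 1\<^sub>m n"
    using embedding_jacobian_left_inverse[OF X e(1) c y e(2)] unfolding J_def by blast
  moreover have "pos_mat N (G (snd e y))"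
    using e(2,3) closed_embeddingD(3)[OF e(1)] unfolding hermitian_metric_Cn_def by blast
  ultimately have "pos_mat n (\<omega> c y)" using pos_mat_pullback[of N _ J n B] by (simp add: J_def)
  then show ?thesis by (rule pos_mat_det_pos)
qed

section \<open>Integrals over the base of a modification\<close>

lemma holo_cong_iff: "(\<And>z. z \<in> D \<Longrightarrow> f z = g z) \<Longrightarrow> holo n D f \<longleftrightarrow> holo n D g"
  using holo_cong[of D f g n] holo_cong[of D g f n] by auto

lemma str_glue:
  assumes M: "complex_space M" and U: "openin (top M) U"
    and loc: "\<And>x. x \<in> U \<Longrightarrow> \<exists>V. openin (top M) V \<and> x \<in> V \<and> V \<subseteq> U \<and> f \<in> str M V"
  shows "f \<in> str M U"
proof -
  have "\<forall>U f. openin (top M) U \<longrightarrow>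
        (\<forall>x\<in>U. \<exists>V. openin (top M) V \<and> x \<in> V \<and> V \<subseteq> U \<and> f \<in> str M V) \<longrightarrow> f \<in> str M U"
    using M unfolding complex_space_def by (elim conjE)
  then show ?thesis using U loc by simp
qed

lemma str_cong_reg:
  assumes M: "complex_space M" and V: "openin (top M) V" "V \<subseteq> reg M" and f: "f \<in> str M V"
    and eq: "\<And>x. x \<in> V \<Longrightarrow> f x = g x"
  shows "g \<in> str M V"
proof (rule str_glue[OF M V(1)])
  fix x assume x: "x \<in> V"
  then obtain m c where c: "is_chart M m c" "x \<in> fst c" using V(2) unfolding reg_def by blast
  have N: "openin (top M) (V \<inter> fst c)" using V(1) is_chartD(1)[OF c(1)] by blast
  have "f \<in> str M (V \<inter> fst c)" using str_restrict[OF M f V(1) N] by blast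
  then have "g \<in> str M (V \<inter> fst c)" by (rule str_cong[OF c(1) N, rotated 1]) (use eq in auto)
  then show "\<exists>N. openin (top M) N \<and> x \<in> N \<and> N \<subseteq> V \<and> g \<in> str M N"
    using N x c(2) by (intro exI[of _ "V \<inter> fst c"]) auto
qed

lemma reg_open: "openin (top M) (reg M)"
proof (subst openin_subopen, intro ballI)
  fix x assume "x \<in> reg M"
  then obtain m c where c: "is_chart M m c" "x \<in> fst c" unfolding reg_def by blast
  then have "fst c \<subseteq> reg M" unfolding reg_def by blast
  then show "\<exists>T. openin (top M) T \<and> x \<in> T \<and> T \<subseteq> reg M" using c is_chartD(1)[OF c(1)] by blast
qed

lemma chart_subset_reg: "is_chart M m c \<Longrightarrow> fst c \<subseteq> reg M"
  unfolding reg_def by blast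

lemma integral_piece_le_density:
  assumes c: "is_chart X n c" and B: "B \<subseteq> fst c \<inter> R" "snd c ` B \<in> sets (lam n)"
  shows "(\<integral>\<^sup>+z. \<rho> c (inv_chart c z) * indicator (snd c ` B) z \<partial>lam n) \<le> integral_density X n R \<rho>"
proof -
  have "{(c, B)} \<in> chart_pieces X n R"
    using c B by (auto simp: chart_pieces_def lebesgue_Cn_def)
  from SUP_upper[OF this, of "\<lambda>F. \<Sum>(c, B)\<in>F. \<integral>\<^sup>+z\<in>snd c ` B. \<rho> c (inv_chart c z) \<partial>lebesgue_Cn n"]
  show ?thesis
    by (simp add: integral_density_def lebesgue_Cn_def nn_integral_completion)
qed

text \<open>A proper modification with centre \<open>S\<close>; over the complement of the centre, \<open>p\<close> has the inverse \<open>q\<close>.\<close>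

locale modification =
  fixes X :: "'a cspace" and Y :: "'b cspace" and p :: "'b \<Rightarrow> 'a" and S :: "'a set" and q :: "'a \<Rightarrow> 'b" and n :: nat
  assumes X: "complex_space X" and Ym: "complex_manifold Y" and pure: "pure_dim X n"
    and hol: "holomorphic_map Y X p" and proper: "proper_map (top Y) (top X) p"
    and surj: "p ` points Y = points X"
    and S: "analytic_in X S" and S_nd: "nowhere_dense_in X S" and T_nd: "nowhere_dense_in Y (preim Y p S)"
    and bih: "biholomorphic_over Y X p (points X - S)"
    and q: "homeomorphic_maps (subtopology (top Y) (preim Y p (points X - S))) (subtopology (top X) (points X - S)) p q"
begin

abbreviation T :: "'b set" where "T \<equiv> preim Y p S"

lemma Y: "complex_space Y" and regY: "reg Y = points Y"
  using Ym by (auto simp: complex_manifold_def)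

lemma X0_open: "openin (top X) (points X - S)"
  using bih by (simp add: biholomorphic_over_def)

lemma p_mem: "y \<in> points Y \<Longrightarrow> p y \<in> points X"
  using surj by blast

lemma Y0_eq: "preim Y p (points X - S) = points Y - T"
  using p_mem by (auto simp: preim_def)

lemma topspaces: "topspace (subtopology (top Y) (preim Y p (points X - S))) = points Y - T"
  "topspace (subtopology (top X) (points X - S)) = points X - S"
  using Y0_eq by auto

lemma qp: "y \<in> points Y - T \<Longrightarrow> q (p y) = y" and pq: "x \<in> points X - S \<Longrightarrow> p (q x) = x"
  using q unfolding homeomorphic_maps_def topspaces by blast+

lemma q_mem: "x \<in> points X - S \<Longrightarrow> q x \<in> points Y - T"
proof -
  have "continuous_map (subtopology (top X) (points X - S)) (subtopology (top Y) (preim Y p (points X - S))) q"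
    using q unfolding homeomorphic_maps_def by blast
  then have "q \<in> (points X - S) \<rightarrow> (points Y - T)"
    using continuous_map_funspace topspaces by metis
  then show "x \<in> points X - S \<Longrightarrow> q x \<in> points Y - T" by blast
qed

lemma p_notin_S: "y \<in> points Y - T \<Longrightarrow> p y \<in> points X - S"
  using p_mem by (auto simp: preim_def)

lemma T_analytic: "analytic_in Y T"
  unfolding analytic_in_def
proof (intro conjI ballI)
  show "closedin (top Y) T"
    using S hol unfolding analytic_in_def holomorphic_map_def preim_def
    by (auto intro: closedin_continuous_map_preimage)
  fix y assume y: "y \<in> points Y"
  obtain V fs where V: "openin (top X) V" "p y \<in> V" "finite fs" "fs \<subseteq> str X V" "S \<inter> V = {x \<in> V. \<forall>f\<in>fs. f x = 0}"
    using S p_mem[OF y] unfolding analytic_in_def by meson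
  have "(\<lambda>f. f \<circ> p) ` fs \<subseteq> str Y (preim Y p V)"
    using hol V(1,4) unfolding holomorphic_map_def by blast
  moreover have "T \<inter> preim Y p V = {y \<in> preim Y p V. \<forall>f\<in>(\<lambda>f. f \<circ> p) ` fs. f y = 0}"
    using V(5) by (auto simp: preim_def)
  ultimately show "\<exists>V fs. openin (top Y) V \<and> y \<in> V \<and> finite fs \<and> fs \<subseteq> str Y V \<and> T \<inter> V = {y \<in> V. \<forall>f\<in>fs. f y = 0}"
    using preim_open[OF hol V(1)] V(2,3) y
    by (intro exI[of _ "preim Y p V"] exI[of _ "(\<lambda>f. f \<circ> p) ` fs"]) (auto simp: preim_def)
qed

lemma image_p: "N \<subseteq> points Y - T \<Longrightarrow> p ` N = {x \<in> points X - S. q x \<in> N}"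
proof
  assume N: "N \<subseteq> points Y - T"
  show "p ` N \<subseteq> {x \<in> points X - S. q x \<in> N}" using N p_notin_S qp by auto
  show "{x \<in> points X - S. q x \<in> N} \<subseteq> p ` N" using pq by force
qed

lemma image_p_open:
  assumes N: "openin (top Y) N" "N \<subseteq> points Y - T"
  shows "openin (top X) (p ` N)"
proof -
  have "continuous_map (subtopology (top X) (points X - S)) (top Y) q"
    using q unfolding homeomorphic_maps_def continuous_map_in_subtopology by blast
  then have "openin (subtopology (top X) (points X - S)) {x \<in> topspace (subtopology (top X) (points X - S)). q x \<in> N}"
    using N(1) by (rule openin_continuous_map_preimage)
  then show ?thesis
    unfolding image_p[OF N(2)] topspaces using openin_open_subtopology[OF X0_open] by blast
qed

lemma str_push: "openin (top X) V \<Longrightarrow> V \<subseteq> points X - S \<Longrightarrow> f \<in> str X V \<longleftrightarrow> (\<lambda>y. f (p y)) \<in> str Y (preim Y p V)"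
  using bih by (auto simp: biholomorphic_over_def o_def)

lemma preim_image: "N \<subseteq> points Y - T \<Longrightarrow> preim Y p (p ` N) = N"
proof
  assume N: "N \<subseteq> points Y - T"
  show "N \<subseteq> preim Y p (p ` N)" using N by (auto simp: preim_def)
  show "preim Y p (p ` N) \<subseteq> N"
  proof
    fix y assume y: "y \<in> preim Y p (p ` N)"
    then obtain y' where y': "y' \<in> N" "p y = p y'" by (auto simp: preim_def)
    then have "p y \<in> points X - S" using N p_notin_S by auto
    then have "y \<in> points Y - T" using y by (auto simp: preim_def)
    then have "y = y'" using qp[of y] qp[of y'] y' N by auto
    then show "y \<in> N" using y'(1) by simp
  qed
qed

lemma image_preim: "V \<subseteq> points X - S \<Longrightarrow> p ` preim Y p V = V" "V \<subseteq> points X - S \<Longrightarrow> q ` V = preim Y p V"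
proof -
  assume V: "V \<subseteq> points X - S"
  show "p ` preim Y p V = V"
    using V surj by (auto simp: preim_def)
  show "q ` V = preim Y p V"
  proof
    show "q ` V \<subseteq> preim Y p V" using V q_mem pq by (auto simp: preim_def)
    show "preim Y p V \<subseteq> q ` V"
    proof
      fix y assume y: "y \<in> preim Y p V"
      then have "y \<in> points Y - T" using V by (auto simp: preim_def)
      then show "y \<in> q ` V" using y qp[of y] by (intro image_eqI[of _ _ "p y"]) (auto simp: preim_def)
    qed
  qed
qed

lemma homeo_p:
  assumes V: "V \<subseteq> points X - S"
  shows "homeomorphic_map (subtopology (top Y) (preim Y p V)) (subtopology (top X) V) p"
    "homeomorphic_map (subtopology (top X) V) (subtopology (top Y) (preim Y p V)) q"
proof -
  have sub: "preim Y p V \<subseteq> points Y - T" using V by (auto simp: preim_def)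
  have "homeomorphic_map (subtopology (top Y) (preim Y p (points X - S))) (subtopology (top X) (points X - S)) p"
    using q homeomorphic_map_maps by blast
  from homeomorphic_map_subtopologies[OF this, of "preim Y p V" V]
  show "homeomorphic_map (subtopology (top Y) (preim Y p V)) (subtopology (top X) V) p"
    unfolding topspaces subtopology_subtopology using V sub image_preim(1)[OF V] Y0_eq
    by (simp add: Int_absorb1)
  have "homeomorphic_map (subtopology (top X) (points X - S)) (subtopology (top Y) (preim Y p (points X - S))) q"
    using q homeomorphic_maps_sym homeomorphic_map_maps by blast
  from homeomorphic_map_subtopologies[OF this, of V "preim Y p V"]
  show "homeomorphic_map (subtopology (top X) V) (subtopology (top Y) (preim Y p V)) q"
    unfolding topspaces subtopology_subtopology using V sub image_preim(2)[OF V] Y0_eq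
    by (simp add: Int_absorb1)
qed

text \<open>All holomorphic charts belong to the structure of a space. Over the complement of \<open>S\<close>, charts can
  therefore be carried from one space to the other, and transporting a form only means to rename charts.\<close>

definition push :: "'b chart \<Rightarrow> 'a chart" where
  "push c = (p ` (fst c - T), \<lambda>x. snd c (q x))"

definition pull :: "'a chart \<Rightarrow> 'b chart" where
  "pull c = (preim Y p (fst c - S), \<lambda>y. snd c (p y))"

lemma chart_points: "is_chart M m c \<Longrightarrow> fst c \<subseteq> points M"
  using is_chartD(1) openin_subset by blast

lemma chart_off_T: 
  assumes "is_chart Y m c"
  shows "openin (top Y) (fst c - T)" "fst c - T \<subseteq> points Y - T"
  using is_chartD(1)[OF assms] T_analytic chart_points[OF assms] unfolding analytic_in_def by blast+

lemma chart_off_S: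
  assumes "is_chart X m c"
  shows "openin (top X) (fst c - S)" "fst c - S \<subseteq> points X - S"
  using is_chartD(1)[OF assms] S chart_points[OF assms] unfolding analytic_in_def by blast+

lemma homeomorphic_chart_restrict:
  assumes c: "is_chart M m c" and V: "V \<subseteq> fst c"
  shows "homeomorphic_map (subtopology (top M) V) (subtopology (Cn m) (snd c ` V)) (snd c)"
proof -
  have ts: "topspace (subtopology (top M) (fst c)) = fst c" "topspace (subtopology (Cn m) (snd c ` fst c)) = snd c ` fst c"
    using openin_subset[OF is_chartD(1)[OF c]] openin_subset[OF is_chartD(2)[OF c]] by (simp_all add: Int_absorb1)
  have "snd c ` V \<subseteq> snd c ` fst c" using V by blast
  then show ?thesis
    using homeomorphic_map_subtopologies[OF is_chartD(3)[OF c], of V "snd c ` V"] V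
    unfolding ts subtopology_subtopology by (simp add: Int_absorb1)
qed

lemma push_image: "V \<subseteq> points X - S \<Longrightarrow> snd (push c) ` V = snd c ` preim Y p V"
  using image_preim(2)[of V] by (simp add: push_def image_image[symmetric])

lemma push_chart:
  assumes c: "is_chart Y m c"
  shows "is_chart X m (push c)"
proof -
  let ?V = "p ` (fst c - T)"
  note off = chart_off_T[OF c]
  have V: "?V \<subseteq> points X - S" using image_p[OF off(2)] by blast
  have pV: "preim Y p ?V = fst c - T" by (rule preim_image[OF off(2)])
  have img: "(\<lambda>x. snd c (q x)) ` ?V = snd c ` (fst c - T)" using push_image[OF V, of c] pV by (simp add: push_def)
  have "homeomorphic_map (subtopology (top X) ?V) (subtopology (Cn m) (snd c ` (fst c - T))) (snd c \<circ> q)"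
    using homeo_p(2)[OF V] homeomorphic_chart_restrict[OF c, of "fst c - T"] pV
    by (intro homeomorphic_map_compose[of _ "subtopology (top Y) (fst c - T)"]) auto
  then have hm: "homeomorphic_map (subtopology (top X) ?V) (subtopology (Cn m) (snd c ` (fst c - T))) (\<lambda>x. snd c (q x))"
    by (simp add: o_def)
  have str: "f \<in> str X V' \<longleftrightarrow> holo m ((\<lambda>x. snd c (q x)) ` V') (f \<circ> inv_chart (?V, \<lambda>x. snd c (q x)))"
    if V': "openin (top X) V'" "V' \<subseteq> ?V" for V' f
  proof -
    have V'0: "V' \<subseteq> points X - S" using V'(2) V by blast
    have W: "openin (top Y) (preim Y p V')" by (rule preim_open[OF hol V'(1)])
    have Wc: "preim Y p V' \<subseteq> fst c - T" using V'(2) pV by (auto simp: preim_def)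
    have "f \<in> str X V' \<longleftrightarrow> (\<lambda>y. f (p y)) \<in> str Y (preim Y p V')" by (rule str_push[OF V'(1) V'0])
    also have "\<dots> \<longleftrightarrow> holo m (snd c ` preim Y p V') (\<lambda>z. f (p (inv_chart c z)))"
      using Wc by (intro chart_str[OF c W]) auto
    also have "\<dots> \<longleftrightarrow> holo m (snd c ` preim Y p V') (f \<circ> inv_chart (?V, \<lambda>x. snd c (q x)))"
    proof -
      have "inj_on (\<lambda>x. snd c (q x)) ?V"
        using homeomorphic_imp_injective_map[OF hm] V by (simp add: Int_absorb1 subset_iff)
      then have "inv_chart (?V, \<lambda>x. snd c (q x)) (snd c y) = p (inv_chart c (snd c y))" if "y \<in> preim Y p V'" for y
      proof -
        have y: "y \<in> fst c - T" using Wc that by blast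
        then have "q (p y) = y" using qp off(2) by blast
        then have "inv_chart (?V, \<lambda>x. snd c (q x)) (snd c y) = inv_into ?V (\<lambda>x. snd c (q x)) ((\<lambda>x. snd c (q x)) (p y))"
          by (simp add: inv_chart_def)
        also have "\<dots> = p y" using y \<open>inj_on _ ?V\<close> by (intro inv_into_f_f) auto
        finally show ?thesis using y c by simp
      qed
      then have eq: "f (p (inv_chart c z)) = (f \<circ> inv_chart (?V, \<lambda>x. snd c (q x))) z" if "z \<in> snd c ` preim Y p V'" for z
        using that by auto
      show ?thesis by (rule holo_cong_iff) (rule eq)
    qed
    also have "snd c ` preim Y p V' = (\<lambda>x. snd c (q x)) ` V'" using push_image[OF V'0, of c] by (simp add: push_def)
    finally show ?thesis .
  qed
  have "openin (Cn m) (snd c ` (fst c - T))" by (rule chart_image_open[OF c off(1)]) blast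
  then show ?thesis
    unfolding is_chart_def push_def prod.case img by (intro conjI allI impI image_p_open[OF off] hm str)
qed

lemma pull_chart:
  assumes c: "is_chart X m c"
  shows "is_chart Y m (pull c)"
proof -
  let ?W = "preim Y p (fst c - S)"
  note off = chart_off_S[OF c]
  have W: "openin (top Y) ?W" by (rule preim_open[OF hol off(1)])
  have W0: "?W \<subseteq> points Y - T" using off(2) by (auto simp: preim_def)
  have img: "(\<lambda>y. snd c (p y)) ` V' = snd c ` p ` V'" for V' by (simp add: image_image)
  have imgW: "(\<lambda>y. snd c (p y)) ` ?W = snd c ` (fst c - S)" using img image_preim(1)[OF off(2)] by simp
  have "homeomorphic_map (subtopology (top Y) ?W) (subtopology (Cn m) (snd c ` (fst c - S))) (snd c \<circ> p)"
    using homeo_p(1)[OF off(2)] homeomorphic_chart_restrict[OF c, of "fst c - S"]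
    by (intro homeomorphic_map_compose[of _ "subtopology (top X) (fst c - S)"]) auto
  then have hm: "homeomorphic_map (subtopology (top Y) ?W) (subtopology (Cn m) (snd c ` (fst c - S))) (\<lambda>y. snd c (p y))"
    by (simp add: o_def)
  have inj: "inj_on (\<lambda>y. snd c (p y)) ?W"
    using homeomorphic_imp_injective_map[OF hm] openin_subset[OF W] by (simp add: Int_absorb1)
  have str: "f \<in> str Y V' \<longleftrightarrow> holo m ((\<lambda>y. snd c (p y)) ` V') (f \<circ> inv_chart (?W, \<lambda>y. snd c (p y)))"
    if V': "openin (top Y) V'" "V' \<subseteq> ?W" for V' f
  proof -
    have V'0: "V' \<subseteq> points Y - T" using V'(2) W0 by blast
    have pV: "openin (top X) (p ` V')" "p ` V' \<subseteq> fst c - S" "preim Y p (p ` V') = V'"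
      using image_p_open[OF V'(1) V'0] V'(2) preim_image[OF V'0] by (auto simp: preim_def)
    have qp': "q (p y) = y" if "y \<in> V'" for y using qp V'0 that by blast
    have V'r: "V' \<subseteq> reg Y" using regY V'0 by blast
    have "f \<in> str Y V' \<longleftrightarrow> (\<lambda>y. f (q (p y))) \<in> str Y V'"
      using str_cong_reg[OF Y V'(1) V'r, of f "\<lambda>y. f (q (p y))"] str_cong_reg[OF Y V'(1) V'r, of "\<lambda>y. f (q (p y))" f] qp'
      by auto
    also have "\<dots> \<longleftrightarrow> (\<lambda>x. f (q x)) \<in> str X (p ` V')"
      using str_push[OF pV(1), of "\<lambda>x. f (q x)"] pV(2,3) off(2) by auto
    also have "\<dots> \<longleftrightarrow> holo m (snd c ` p ` V') (\<lambda>z. f (q (inv_chart c z)))"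
      using pV(2) by (intro chart_str[OF c pV(1)]) auto
    also have "\<dots> \<longleftrightarrow> holo m (snd c ` p ` V') (f \<circ> inv_chart (?W, \<lambda>y. snd c (p y)))"
    proof -
      have "inv_chart (?W, \<lambda>y. snd c (p y)) (snd c (p y)) = q (inv_chart c (snd c (p y)))" if y: "y \<in> V'" for y
      proof -
        have "inv_into ?W (\<lambda>y. snd c (p y)) ((\<lambda>y. snd c (p y)) y) = y"
          using inj y V'(2) by (intro inv_into_f_f) auto
        moreover have "p y \<in> fst c" using pV(2) y by blast
        ultimately show ?thesis using c qp'[OF y] by (simp add: inv_chart_def[of "(_, _)"])
      qed
      then have eq: "f (q (inv_chart c z)) = (f \<circ> inv_chart (?W, \<lambda>y. snd c (p y))) z" if "z \<in> snd c ` p ` V'" for z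
        using that by auto
      show ?thesis by (rule holo_cong_iff) (rule eq)
    qed
    finally show ?thesis by (simp add: img)
  qed
  have "openin (Cn m) (snd c ` (fst c - S))" by (rule chart_image_open[OF c off(1)]) blast
  then show ?thesis
    unfolding is_chart_def pull_def prod.case imgW by (intro conjI allI impI W hm str)
qed

lemma push_mem: "is_chart Y m c \<Longrightarrow> y \<in> fst c - T \<Longrightarrow> p y \<in> fst (push c)"
  by (simp add: push_def)

lemma snd_push: "is_chart Y m c \<Longrightarrow> y \<in> fst c - T \<Longrightarrow> snd (push c) (p y) = snd c y"
  using qp chart_off_T(2) by (simp add: push_def subset_iff)

lemma pull_mem: "is_chart X m c \<Longrightarrow> x \<in> fst c - S \<Longrightarrow> q x \<in> fst (pull c)"
  using q_mem pq chart_off_S(2)[of m c] by (auto simp: pull_def preim_def)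

lemma chart_push_points: "x \<in> fst (push c) \<Longrightarrow> is_chart Y m c \<Longrightarrow> x \<in> points X - S"
  using chart_off_T(2)[of m c] p_notin_S by (auto simp: push_def)

lemma inv_push: 
  assumes c: "is_chart Y m c" and y: "y \<in> fst c - T"
  shows "inv_chart (push c) (snd c y) = p y"
  using inv_chart_eq[OF push_chart[OF c] push_mem[OF c y]] snd_push[OF c y] by simp

lemma map_det_push:
  assumes c': "is_chart Y n c'" and c: "is_chart X n c" and y: "y \<in> fst c' - T"
  shows "map_det n (\<lambda>x. x) (push c') c (p y) = map_det n p c' c y"
proof -
  note off = chart_off_T[OF c']
  have "jacobian n n (\<lambda>z. snd c (inv_chart (push c') z)) (snd c' y) = jacobian n n (\<lambda>z. snd c (p (inv_chart c' z))) (snd c' y)"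
  proof (rule jacobian_cong[OF chart_image_open[OF c' off(1)]])
    fix z i assume "z \<in> snd c' ` (fst c' - T)"
    then obtain y' where "y' \<in> fst c' - T" "z = snd c' y'" by blast
    then show "snd c (inv_chart (push c') z) i = snd c (p (inv_chart c' z)) i"
      using inv_push[OF c', of y'] c' by simp
  qed (use y in auto)
  then show ?thesis using snd_push[OF c' y] by (simp add: map_det_def)
qed

lemma map_det_pull: "map_det n (\<lambda>x. x) c' (pull c) y = map_det n p c' c y"
  by (simp add: map_det_def pull_def)

lemma map_det_p_push:
  assumes c: "is_chart Y n c" and c': "is_chart Y n c'" and y: "y \<in> fst c - T" "y \<in> fst c'"
  shows "map_det n p c (push c') y = map_det n (\<lambda>x. x) c c' y"
proof -
  note off = chart_off_T[OF c]
  have "jacobian n n (\<lambda>z. snd (push c') (p (inv_chart c z))) (snd c y) = jacobian n n (\<lambda>z. snd c' (inv_chart c z)) (snd c y)"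
  proof (rule jacobian_cong[OF chart_image_open[OF c off(1)]])
    fix z i assume "z \<in> snd c ` (fst c - T)"
    then obtain y' where "y' \<in> fst c - T" "z = snd c y'" by blast
    then show "snd (push c') (p (inv_chart c z)) i = snd c' (inv_chart c z) i"
      using qp[of y'] off(2) c by (auto simp: push_def)
  qed (use y in auto)
  then show ?thesis by (simp add: map_det_def)
qed

lemma map_det_pull_self:
  assumes c: "is_chart X n c" and y: "y \<in> fst (pull c)"
  shows "map_det n p (pull c) c y = 1"
  using map_det_pull[of "pull c" c y] map_det_id[OF pull_chart[OF c] y] by simp

lemma X0_cover:
  assumes "x \<in> points X - S"
  shows "\<exists>c. is_chart X n c \<and> x \<in> fst c"
proof -
  have "q x \<in> reg Y" using q_mem[OF assms] regY by blast
  then obtain m c where c: "is_chart Y m c" "q x \<in> fst c" unfolding reg_def by blast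
  then have "x \<in> fst (push c)" using push_mem[OF c(1), of "q x"] q_mem[OF assms] pq[OF assms] by auto
  then have "x \<in> reg X" using chart_subset_reg[OF push_chart[OF c(1)]] by blast
  then show ?thesis using pure unfolding pure_dim_def by blast
qed

text \<open>The dimension of \<open>Y\<close> can be read off near a point outside \<open>T\<close>, where \<open>Y\<close> is isomorphic to \<open>X\<close>.\<close>

lemma Y_cover:
  assumes y: "y \<in> points Y"
  shows "\<exists>c. is_chart Y n c \<and> y \<in> fst c"
proof -
  obtain m c where c: "is_chart Y m c" "y \<in> fst c" using y regY unfolding reg_def by blast
  obtain y1 where y1: "y1 \<in> fst c" "y1 \<notin> T" using nowhere_dense_ex[OF T_nd is_chartD(1)[OF c(1)] c(2)] by blast
  have p1: "p y1 \<in> fst (push c)" using push_mem[OF c(1)] y1 by blast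
  obtain c1 where c1: "is_chart X n c1" "p y1 \<in> fst c1" using X0_cover[OF chart_push_points[OF p1 c(1)]] by blast
  have "m = n" using chart_dim_unique[OF X push_chart[OF c(1)] c1(1)] p1 c1(2) by blast
  then show ?thesis using c by blast
qed

lemma X0_reg: "points X - S \<subseteq> reg X"
  using X0_cover chart_subset_reg by blast

lemma S_null:
  assumes c: "is_chart X n c"
  shows "snd c ` (fst c \<inter> S) \<in> null_sets (lam n)"
proof -
  have "snd c ` fst c \<inter> snd c ` (fst c \<inter> S) = snd c ` (fst c \<inter> S)" by blast
  then show ?thesis using thin_null[OF analytic_thin[OF X S S_nd c is_chartD(1)[OF c] order_refl]] by simp
qed

lemma T_null:
  assumes c: "is_chart Y n c"
  shows "snd c ` (fst c \<inter> T) \<in> null_sets (lam n)"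
proof -
  have "snd c ` fst c \<inter> snd c ` (fst c \<inter> T) = snd c ` (fst c \<inter> T)" by blast
  then show ?thesis using thin_null[OF analytic_thin[OF Y T_analytic T_nd c is_chartD(1)[OF c] order_refl]] by simp
qed

lemma nn_integral_off_null:
  assumes "N \<in> null_sets M" "B - B' \<subseteq> N" "B' \<subseteq> B"
  shows "(\<integral>\<^sup>+z. f z * indicator B z \<partial>M) = (\<integral>\<^sup>+z. f z * indicator B' z \<partial>M)"
proof (rule nn_integral_cong_AE)
  show "AE z in M. f z * indicator B z = f z * indicator B' z"
    using AE_not_in[OF assms(1)] assms(2,3) by (auto elim!: eventually_mono simp: indicator_def)
qed

text \<open>Up to null sets, a piece of a chart of \<open>X\<close> is covered by the images of the sets \<open>P j\<close>, and
  is compared with the part over it of \<open>P j\<close> by a change of variables.\<close>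

lemma integral_piece_le:
  assumes J: "finite J" "\<And>j. j \<in> J \<Longrightarrow> is_chart Y n (c' j) \<and> openin (top Y) (P j) \<and> P j \<subseteq> fst (c' j)"
    and cov: "preim Y p R \<subseteq> (\<Union>j\<in>J. P j)"
    and dom: "\<And>j c y. j \<in> J \<Longrightarrow> is_chart X n c \<Longrightarrow> y \<in> P j - T \<Longrightarrow> p y \<in> fst c \<Longrightarrow>
        \<rho> c (p y) * ennreal ((cmod (map_det n p (c' j) c y))\<^sup>2) \<le> \<rho>' j y"
    and c: "is_chart X n c" and B: "B \<subseteq> fst c \<inter> R"
  shows "(\<integral>\<^sup>+z. \<rho> c (inv_chart c z) * indicator (snd c ` B) z \<partial>lam n) \<le>
     (\<Sum>j\<in>J. \<integral>\<^sup>+z. \<rho>' j (inv_chart (c' j) z) * indicator (snd (c' j) ` (P j \<inter> preim Y p B - T)) z \<partial>lam n)"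
proof -
  have Bc: "B \<subseteq> fst c" "B \<subseteq> points X" using B chart_points[OF c] by auto
  define A where "A j = fst c \<inter> p ` (P j - T)" for j
  have PT: "openin (top Y) (P j - T)" "P j - T \<subseteq> points Y - T" "P j - T \<subseteq> fst (c' j) - T" if "j \<in> J" for j
    using J(2)[OF that] T_analytic openin_subset unfolding analytic_in_def by blast+
  have A: "openin (top X) (A j)" "A j \<subseteq> fst c" "A j \<subseteq> points X - S" if "j \<in> J" for j
    using is_chartD(1)[OF c] image_p_open[OF PT(1,2)[OF that]] image_p[OF PT(2)[OF that]] by (auto simp: A_def)
  have "(\<integral>\<^sup>+z. \<rho> c (inv_chart c z) * indicator (snd c ` B) z \<partial>lam n)
      = (\<integral>\<^sup>+z. \<rho> c (inv_chart c z) * indicator (snd c ` (B - S)) z \<partial>lam n)"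
    by (rule nn_integral_off_null[OF S_null[OF c]]) (use Bc in auto)
  also have "\<dots> \<le> (\<Sum>j\<in>J. \<integral>\<^sup>+z. \<rho> c (inv_chart c z) * indicator (snd c ` (B - S)) z * indicator (snd c ` A j) z \<partial>lam n)"
  proof (rule nn_integral_finite_cover_le[OF J(1)])
    show "snd c ` A j \<in> sets (lam n)" if "j \<in> J" for j
      using openin_sets_lam[OF chart_image_open[OF c A(1,2)[OF that]]] .
    fix z assume "\<rho> c (inv_chart c z) * indicator (snd c ` (B - S)) z \<noteq> 0"
    then have "z \<in> snd c ` (B - S)" by (auto simp: indicator_def split: if_splits)
    then obtain x where x: "x \<in> B" "x \<notin> S" "z = snd c x" by blast
    then have xX: "x \<in> points X - S" using Bc by blast
    then have "q x \<in> preim Y p R" using q_mem pq x B by (auto simp: preim_def)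
    then obtain j where j: "j \<in> J" "q x \<in> P j" using cov by blast
    then have "x \<in> A j" using xX q_mem[OF xX] pq[OF xX] x Bc by (auto simp: A_def intro!: image_eqI[of _ _ "q x"])
    then show "\<exists>j\<in>J. z \<in> snd c ` A j" using j x by blast
  qed
  also have "\<dots> \<le> (\<Sum>j\<in>J. \<integral>\<^sup>+z. \<rho>' j (inv_chart (c' j) z) * indicator (snd (c' j) ` (P j \<inter> preim Y p B - T)) z \<partial>lam n)"
  proof (rule sum_mono)
    fix j assume j: "j \<in> J"
    note Aj = A[OF j] and cj = J(2)[OF j, THEN conjunct1]
    let ?W = "P j \<inter> preim Y p (fst c) - T"
    have pA: "preim Y p (A j) = ?W"
    proof -
      have "preim Y p (A j) = preim Y p (fst c) \<inter> preim Y p (p ` (P j - T))" by (auto simp: preim_def A_def)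
      then show ?thesis using preim_image[OF PT(2)[OF j]] by blast
    qed
    have W: "openin (top Y) ?W" "?W \<subseteq> fst (c' j)" "p ` ?W \<subseteq> A j"
      using preim_open[OF hol Aj(1)] pA PT(3)[OF j] by (auto simp: preim_def)
    let ?G = "\<lambda>z. snd c (p (inv_chart (c' j) z))" and ?F = "\<lambda>z. snd (push (c' j)) (inv_chart c z)"
    have G: "holo_map n n (snd (c' j) ` ?W) (snd c ` A j) ?G"
      by (rule holo_map_in_charts[OF Y hol cj c W Aj(2,1)])
    have img: "snd (push (c' j)) ` A j = snd (c' j) ` ?W" using push_image[OF Aj(3)] pA by simp
    have "A j \<subseteq> fst (push (c' j))" using PT(3)[OF j] by (auto simp: A_def push_def)
    then have F: "holo_map n n (snd c ` A j) (snd (c' j) ` ?W) ?F"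
      using holo_map_transition[OF X c push_chart[OF cj] Aj(1,2)] img by simp
    have FG: "?F (?G w) = w" if w: "w \<in> snd (c' j) ` ?W" for w
    proof -
      obtain y where y: "y \<in> ?W" "w = snd (c' j) y" using w by (elim imageE)
      then have "y \<in> fst (c' j) - T" "p y \<in> fst c" using W(2) by (auto simp: preim_def)
      then show ?thesis using y(2) cj c snd_push[OF cj] by simp
    qed
    have GF: "?G (?F z) = z" if z: "z \<in> snd c ` A j" for z
    proof -
      obtain x where x: "x \<in> A j" "z = snd c x" using z by (elim imageE)
      then obtain y where y: "y \<in> P j - T" "x = p y" by (auto simp: A_def)
      then have "y \<in> fst (c' j) - T" using PT(3)[OF j] by blast
      then show ?thesis using x y(2) cj c snd_push[OF cj, of y] Aj(2) by auto
    qed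
    let ?A = "snd c ` (B \<inter> A j)"
    have "(\<integral>\<^sup>+z. \<rho> c (inv_chart c z) * indicator (snd c ` (B - S)) z * indicator (snd c ` A j) z \<partial>lam n)
       \<le> (\<integral>\<^sup>+z. \<rho> c (inv_chart c z) * indicator ?A z \<partial>lam n)"
    proof (rule nn_integral_mono)
      fix z
      have "z \<in> ?A" if z: "z \<in> snd c ` (B - S)" "z \<in> snd c ` A j"
      proof -
        obtain x where x: "x \<in> B" "z = snd c x" using z(1) by blast
        obtain x' where x': "x' \<in> A j" "z = snd c x'" using z(2) by (elim imageE)
        have "x = x'" using chart_inj[OF c] Bc Aj(2) x x' by (auto simp: inj_on_def)
        then show ?thesis using x x' by blast
      qed
      then show "\<rho> c (inv_chart c z) * indicator (snd c ` (B - S)) z * indicator (snd c ` A j) z \<le> \<rho> c (inv_chart c z) * indicator ?A z"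
        by (auto simp: indicator_def)
    qed
    also have "\<dots> \<le> (\<integral>\<^sup>+w. \<rho>' j (inv_chart (c' j) w) * indicator (?F ` ?A) w \<partial>lam n)"
    proof (rule nn_integral_transition_le[OF G F FG GF])
      fix w assume w: "w \<in> snd (c' j) ` ?W" "?G w \<in> ?A"
      obtain y where y: "y \<in> ?W" "w = snd (c' j) y" using w(1) by (elim imageE)
      then have yc: "y \<in> fst (c' j)" "p y \<in> fst c" "y \<in> P j - T" using W(2) by (auto simp: preim_def)
      then show "\<rho> c (inv_chart c (?G w)) * ennreal ((cmod (Determinant.det (jacobian n n ?G w)))\<^sup>2) \<le> \<rho>' j (inv_chart (c' j) w)"
        using dom[OF j c yc(3,2)] y(2) cj c by (simp add: map_det_def)
    qed auto
    also have "\<dots> \<le> (\<integral>\<^sup>+z. \<rho>' j (inv_chart (c' j) z) * indicator (snd (c' j) ` (P j \<inter> preim Y p B - T)) z \<partial>lam n)"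
    proof -
      have "?F ` ?A \<subseteq> snd (c' j) ` (P j \<inter> preim Y p B - T)"
      proof
        fix w assume "w \<in> ?F ` ?A"
        then obtain x where x: "x \<in> B" "x \<in> A j" "w = ?F (snd c x)" by blast
        then obtain y where y: "y \<in> P j - T" "x = p y" by (auto simp: A_def)
        then have yc: "y \<in> fst (c' j) - T" using PT(3)[OF j] by blast
        then have "w = snd (c' j) y" using x y(2) c snd_push[OF cj yc] Aj(2) by auto
        moreover have "y \<in> P j \<inter> preim Y p B - T" using x y PT(2)[OF j] by (auto simp: preim_def)
        ultimately show "w \<in> snd (c' j) ` (P j \<inter> preim Y p B - T)" by blast
      qed
      then show ?thesis by (intro nn_integral_mono) (auto simp: indicator_def)
    qed
    finally show "(\<integral>\<^sup>+z. \<rho> c (inv_chart c z) * indicator (snd c ` (B - S)) z * indicator (snd c ` A j) z \<partial>lam n)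
      \<le> (\<integral>\<^sup>+z. \<rho>' j (inv_chart (c' j) z) * indicator (snd (c' j) ` (P j \<inter> preim Y p B - T)) z \<partial>lam n)" .
  qed
  finally show ?thesis .
qed

lemma integral_density_le:
  assumes J: "finite J" "\<And>j. j \<in> J \<Longrightarrow> is_chart Y n (c' j) \<and> openin (top Y) (P j) \<and> P j \<subseteq> fst (c' j)"
    and cov: "preim Y p R \<subseteq> (\<Union>j\<in>J. P j)"
    and dom: "\<And>j c y. j \<in> J \<Longrightarrow> is_chart X n c \<Longrightarrow> y \<in> P j - T \<Longrightarrow> p y \<in> fst c \<Longrightarrow>
        \<rho> c (p y) * ennreal ((cmod (map_det n p (c' j) c y))\<^sup>2) \<le> \<rho>' j y"
  shows "integral_density X n (R \<inter> reg X) \<rho> \<le>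
     (\<Sum>j\<in>J. \<integral>\<^sup>+z. \<rho>' j (inv_chart (c' j) z) * indicator (snd (c' j) ` P j) z \<partial>lam n)"
  unfolding integral_density_def
proof (rule SUP_least)
  fix F assume F: "F \<in> chart_pieces X n (R \<inter> reg X)"
  have fin: "finite F" and piece: "\<And>c B. (c, B) \<in> F \<Longrightarrow> is_chart X n c \<and> B \<subseteq> fst c \<inter> R"
    and dis: "\<And>k k'. k \<in> F \<Longrightarrow> k' \<in> F \<Longrightarrow> k \<noteq> k' \<Longrightarrow> snd k \<inter> snd k' = {}"
    using F by (auto simp: chart_pieces_def pairwise_def)
  let ?I = "\<lambda>j B. \<integral>\<^sup>+z. \<rho>' j (inv_chart (c' j) z) * indicator (snd (c' j) ` (P j \<inter> preim Y p B - T)) z \<partial>lam n"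
  have "(\<Sum>(c, B)\<in>F. \<integral>\<^sup>+z\<in>snd c ` B. \<rho> c (inv_chart c z) \<partial>lebesgue_Cn n) \<le> (\<Sum>k\<in>F. \<Sum>j\<in>J. ?I j (snd k))"
  proof (rule sum_mono)
    fix k assume "k \<in> F"
    moreover obtain c B where k: "k = (c, B)" by (cases k)
    ultimately have cB: "is_chart X n c" "B \<subseteq> fst c \<inter> R" using piece by auto
    have "(\<integral>\<^sup>+z. \<rho> c (inv_chart c z) * indicator (snd c ` B) z \<partial>lam n) \<le> (\<Sum>j\<in>J. ?I j B)"
      by (rule integral_piece_le[OF J cov dom cB])
    then show "(case k of (c, B) \<Rightarrow> \<integral>\<^sup>+z\<in>snd c ` B. \<rho> c (inv_chart c z) \<partial>lebesgue_Cn n) \<le> (\<Sum>j\<in>J. ?I j (snd k))"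
      by (simp add: k lebesgue_Cn_def nn_integral_completion)
  qed
  also have "\<dots> = (\<Sum>j\<in>J. \<Sum>k\<in>F. ?I j (snd k))" by (rule sum.swap)
  also have "\<dots> \<le> (\<Sum>j\<in>J. \<integral>\<^sup>+z. \<rho>' j (inv_chart (c' j) z) * indicator (snd (c' j) ` P j) z \<partial>lam n)"
  proof (rule sum_mono)
    fix j assume j: "j \<in> J"
    let ?E = "\<lambda>k. snd (c' j) ` (P j \<inter> preim Y p (snd k) - T)"
    have inj: "inj_on (snd (c' j)) (P j)" using J(2)[OF j] chart_inj inj_on_subset by blast
    have "(\<Sum>k\<in>F. ?I j (snd k)) \<le> (\<integral>\<^sup>+z. \<rho>' j (inv_chart (c' j) z) * indicator (\<Union>k\<in>F. ?E k) z \<partial>lam n)"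
    proof (rule nn_integral_disjoint_sum_le[OF fin])
      fix k k' assume k: "k \<in> F" "k' \<in> F" "k \<noteq> k'"
      show "?E k \<inter> ?E k' = {}"
      proof (rule ccontr)
        assume "?E k \<inter> ?E k' \<noteq> {}"
        then obtain y y' where y: "y \<in> P j" "y' \<in> P j" "snd (c' j) y = snd (c' j) y'" "p y \<in> snd k" "p y' \<in> snd k'"
          by (auto simp: preim_def)
        then have "y = y'" using inj by (auto simp: inj_on_def)
        then show False using y dis[OF k] by blast
      qed
    qed
    also have "\<dots> \<le> (\<integral>\<^sup>+z. \<rho>' j (inv_chart (c' j) z) * indicator (snd (c' j) ` P j) z \<partial>lam n)"
      by (intro nn_integral_mono) (auto simp: indicator_def)
    finally show "(\<Sum>k\<in>F. ?I j (snd k)) \<le> (\<integral>\<^sup>+z. \<rho>' j (inv_chart (c' j) z) * indicator (snd (c' j) ` P j) z \<partial>lam n)" .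
  qed
  finally show "(\<Sum>(c, B)\<in>F. \<integral>\<^sup>+z\<in>snd c ` B. \<rho> c (inv_chart c z) \<partial>lebesgue_Cn n) \<le>
     (\<Sum>j\<in>J. \<integral>\<^sup>+z. \<rho>' j (inv_chart (c' j) z) * indicator (snd (c' j) ` P j) z \<partial>lam n)" .
qed

text \<open>The function \<open>\<rho>'\<close> is an integrable majorant near \<open>y\<close> of the density \<open>\<rho>\<close> pulled back to \<open>Y\<close>; the factor
  \<open>\<bar>map_det\<bar>\<^sup>2\<close> changes from the coordinates \<open>c\<close> to the coordinates \<open>c'\<close>.\<close>

definition dominated_at :: "('a chart \<Rightarrow> 'a \<Rightarrow> ennreal) \<Rightarrow> 'b \<Rightarrow> 'b chart \<Rightarrow> 'b set \<Rightarrow> ('b \<Rightarrow> ennreal) \<Rightarrow> bool" where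
  "dominated_at \<rho> y c' P \<rho>' \<longleftrightarrow> is_chart Y n c' \<and> openin (top Y) P \<and> y \<in> P \<and> P \<subseteq> fst c' \<and>
     (\<integral>\<^sup>+z. \<rho>' (inv_chart c' z) * indicator (snd c' ` P) z \<partial>lam n) < \<infinity> \<and>
     (\<forall>c y'. is_chart X n c \<longrightarrow> y' \<in> P - T \<longrightarrow> p y' \<in> fst c \<longrightarrow>
        \<rho> c (p y') * ennreal ((cmod (map_det n p c' c y'))\<^sup>2) \<le> \<rho>' y')"

definition dominated :: "('a chart \<Rightarrow> 'a \<Rightarrow> ennreal) \<Rightarrow> 'a set \<Rightarrow> bool" where
  "dominated \<rho> U \<longleftrightarrow> (\<forall>y\<in>preim Y p U. \<exists>c' P \<rho>'. dominated_at \<rho> y c' P \<rho>')"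

text \<open>Finitely many of the sets with integrable majorants cover the compact set \<open>C\<close>.\<close>

lemma dominated_finite_near:
  assumes d: "dominated \<rho> U" and C: "compactin (top Y) C" "C \<subseteq> preim Y p U"
  shows "\<exists>N. openin (top Y) N \<and> C \<subseteq> N \<and> (\<forall>R. preim Y p R \<subseteq> N \<longrightarrow> integral_density X n (R \<inter> reg X) \<rho> < \<infinity>)"
proof -
  have "\<forall>y\<in>C. \<exists>c' P \<rho>'. dominated_at \<rho> y c' P \<rho>'" using d C(2) unfolding dominated_def by blast
  then obtain c' P \<rho>' where *: "\<And>y. y \<in> C \<Longrightarrow> dominated_at \<rho> y (c' y) (P y) (\<rho>' y)" by metis
  have op: "openin (top Y) (P y)" "y \<in> P y" if "y \<in> C" for y using *[OF that] unfolding dominated_at_def by blast+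
  have "C \<subseteq> \<Union> (P ` C)" using op by blast
  then obtain Q where Q: "finite Q" "Q \<subseteq> P ` C" "C \<subseteq> \<Union>Q"
    using compactinD[OF C(1), of "P ` C"] op(1) by blast
  then obtain J where J: "J \<subseteq> C" "finite J" "Q = P ` J" by (meson finite_subset_image)
  show ?thesis
  proof (intro exI conjI allI impI)
    show "openin (top Y) (\<Union>y\<in>J. P y)" using op(1) J(1) by blast
    show "C \<subseteq> (\<Union>y\<in>J. P y)" using Q(3) J(3) by blast
    fix R assume R: "preim Y p R \<subseteq> (\<Union>y\<in>J. P y)"
    have "integral_density X n (R \<inter> reg X) \<rho> \<le>
       (\<Sum>j\<in>J. \<integral>\<^sup>+z. \<rho>' j (inv_chart (c' j) z) * indicator (snd (c' j) ` P j) z \<partial>lam n)"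
    proof (rule integral_density_le[OF J(2) _ R])
      show "is_chart Y n (c' j) \<and> openin (top Y) (P j) \<and> P j \<subseteq> fst (c' j)" if "j \<in> J" for j
        using *[of j] J(1) that unfolding dominated_at_def by blast
      show "\<rho> c (p y) * ennreal ((cmod (map_det n p (c' j) c y))\<^sup>2) \<le> \<rho>' j y"
        if "j \<in> J" "is_chart X n c" "y \<in> P j - T" "p y \<in> fst c" for j c y
        using *[of j] J(1) that unfolding dominated_at_def by blast
    qed
    also have "\<dots> < \<infinity>"
    proof -
      have "(\<integral>\<^sup>+z. \<rho>' j (inv_chart (c' j) z) * indicator (snd (c' j) ` P j) z \<partial>lam n) < \<infinity>" if "j \<in> J" for j
        using *[of j] J(1) that unfolding dominated_at_def by blast
      then show ?thesis using J(2) by (simp add: less_top[symmetric])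
    qed
    finally show "integral_density X n (R \<inter> reg X) \<rho> < \<infinity>" .
  qed
qed

lemma dominated_finite_compact:
  assumes d: "dominated \<rho> U" and K: "compactin (top X) K" "K \<subseteq> U"
  shows "integral_density X n (K \<inter> reg X) \<rho> < \<infinity>"
proof -
  have "compactin (top Y) (preim Y p K)"
    unfolding preim_def by (rule compactin_proper_map_preimage[OF proper K(1)])
  moreover have "preim Y p K \<subseteq> preim Y p U" using K(2) by (auto simp: preim_def)
  ultimately show ?thesis using dominated_finite_near[OF d] by blast
qed

text \<open>As \<open>p\<close> is proper, the fibre over \<open>x\<close> is compact, and \<open>p\<close> is a closed map, so that every neighbourhood of
  the fibre contains the preimage of a neighbourhood of \<open>x\<close>.\<close>

lemma dominated_finite_local:
  assumes d: "dominated \<rho> U" and U: "openin (top X) U" "x \<in> U"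
  shows "\<exists>B. openin (top X) B \<and> x \<in> B \<and> B \<subseteq> U \<and> integral_density X n (B \<inter> reg X) \<rho> < \<infinity>"
proof -
  have xX: "x \<in> points X" using U openin_subset by blast
  have C: "compactin (top Y) (preim Y p {x})"
    unfolding preim_def using xX by (intro compactin_proper_map_preimage[OF proper]) simp
  have CU: "preim Y p {x} \<subseteq> preim Y p U" using U(2) by (auto simp: preim_def)
  obtain N where N: "openin (top Y) N" "preim Y p {x} \<subseteq> N"
    "\<forall>R. preim Y p R \<subseteq> N \<longrightarrow> integral_density X n (R \<inter> reg X) \<rho> < \<infinity>"
    using dominated_finite_near[OF d C CU] by (elim exE conjE) (rule that)
  \<comment> \<open>the points of \<open>U\<close> whose entire fibre lies in \<open>N\<close>\<close>
  define B where "B = U \<inter> (points X - p ` (points Y - N))"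
  have "closedin (top X) (p ` (points Y - N))"
    using proper_imp_closed_map[OF proper] N(1) unfolding closed_map_def by blast
  then have "openin (top X) B" unfolding B_def using U(1) by blast
  moreover have "x \<in> B" using U(2) xX N(2) by (auto simp: B_def preim_def)
  moreover have "preim Y p B \<subseteq> N" by (auto simp: B_def preim_def)
  ultimately show ?thesis using N(3) by (intro exI[of _ B]) (auto simp: B_def)
qed

end

section \<open>Pullback of bundle-valued forms\<close>

lemma semipos_form_scale:
  assumes "semipos_form r Q" and v: "v \<in> carrier_vec r"
  shows "Q (a \<cdot>\<^sub>v v) = ennreal ((cmod a)\<^sup>2) * Q v"
proof -
  obtain F H where F0: "F \<subseteq> carrier_vec r \<and> 0\<^sub>v r \<in> F \<and> (\<forall>u\<in>F. \<forall>v\<in>F. u + v \<in> F) \<and> (\<forall>a. \<forall>v\<in>F. a \<cdot>\<^sub>v v \<in> F) \<and>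
     (\<forall>u\<in>F. \<forall>v\<in>F. \<forall>w\<in>F. H (u + v) w = H u w + H v w) \<and>
     (\<forall>a. \<forall>u\<in>F. \<forall>v\<in>F. H (a \<cdot>\<^sub>v u) v = a * H u v) \<and>
     (\<forall>u\<in>F. \<forall>v\<in>F. H v u = cnj (H u v)) \<and> (\<forall>v\<in>F. 0 \<le> Re (H v v)) \<and>
     (\<forall>v\<in>carrier_vec r. Q v = (if v \<in> F then ennreal (Re (H v v)) else \<infinity>))"
    using assms(1) unfolding semipos_form_def by (elim exE) (rule that)
  have FH: "0\<^sub>v r \<in> F" "\<And>a v. v \<in> F \<Longrightarrow> a \<cdot>\<^sub>v v \<in> F"
     "\<And>a u v. u \<in> F \<Longrightarrow> v \<in> F \<Longrightarrow> H (a \<cdot>\<^sub>v u) v = a * H u v"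
     "\<And>u v. u \<in> F \<Longrightarrow> v \<in> F \<Longrightarrow> H v u = cnj (H u v)" "\<And>v. v \<in> F \<Longrightarrow> 0 \<le> Re (H v v)"
     "\<And>v. v \<in> carrier_vec r \<Longrightarrow> Q v = (if v \<in> F then ennreal (Re (H v v)) else \<infinity>)"
    using F0 by (elim conjE, blast)+
  have av: "a \<cdot>\<^sub>v v \<in> carrier_vec r" using v by simp
  show ?thesis
  proof (cases "v \<in> F")
    case True
    have "H v (a \<cdot>\<^sub>v v) = cnj (a * H v v)" using FH(4)[OF FH(2)[OF True] True, of a] FH(3)[OF True True] by simp
    then have "H (a \<cdot>\<^sub>v v) (a \<cdot>\<^sub>v v) = (a * cnj a) * cnj (H v v)"
      using FH(3)[OF True FH(2)[OF True], of a a] by simp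
    also have "a * cnj a = of_real ((cmod a)\<^sup>2)" by (simp add: complex_norm_square[symmetric])
    finally have "Re (H (a \<cdot>\<^sub>v v) (a \<cdot>\<^sub>v v)) = (cmod a)\<^sup>2 * Re (H v v)" by simp
    then show ?thesis using FH(6)[OF v] FH(6)[OF av] True FH(2)[OF True] FH(5)[OF True] by (simp add: ennreal_mult)
  next
    case False
    show ?thesis
    proof (cases "a = 0")
      case True
      have z: "a \<cdot>\<^sub>v v = 0\<^sub>v r" using v True by (intro eq_vecI) auto
      have "0 \<cdot>\<^sub>v 0\<^sub>v r = (0\<^sub>v r :: complex Matrix.vec)" by (intro eq_vecI) auto
      then have "H (0\<^sub>v r) (0\<^sub>v r) = 0" using FH(3)[OF FH(1) FH(1), of 0] by simp
      then show ?thesis unfolding z using FH(6)[OF zero_carrier_vec] FH(1) True by simp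
    next
      case a: False
      have "a \<cdot>\<^sub>v v \<notin> F"
      proof
        assume "a \<cdot>\<^sub>v v \<in> F"
        then have "(1 / a) \<cdot>\<^sub>v (a \<cdot>\<^sub>v v) \<in> F" by (rule FH(2))
        moreover have "(1 / a) \<cdot>\<^sub>v (a \<cdot>\<^sub>v v) = v" using a by (intro eq_vecI) auto
        ultimately show False using False by simp
      qed
      then show ?thesis using FH(6)[OF v] FH(6)[OF av] False a by (simp add: ennreal_mult_top)
    qed
  qed
qed

text \<open>Homogeneity of the metric. That \<open>e'\<close> is the multiple \<open>a e\<close> is expressed by components, since the fibres
  carry their vector space structure only through trivializations.\<close>

lemma metric_scale:
  assumes E: "hol_vector_bundle X E" and h: "singular_hermitian_metric X n E h"
    and T: "(V, r, \<tau>) \<in> trivs E" and x: "x \<in> V" and e: "e \<in> fibre E x" "e' \<in> fibre E x"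
    and eq: "\<And>i. i < r \<Longrightarrow> \<tau> x e' $ i = a * \<tau> x e $ i"
  shows "h x e' = ennreal ((cmod a)\<^sup>2) * h x e"
proof -
  note b = bundle_triv(2)[OF E T x]
  have c: "\<tau> x e \<in> carrier_vec r" "\<tau> x e' \<in> carrier_vec r" using b e by (auto dest: bij_betwE)
  then have "\<tau> x e' = a \<cdot>\<^sub>v \<tau> x e" using eq by (intro eq_vecI) auto
  moreover have "semipos_form r (form_in_triv E \<tau> h x)"
    using h T x unfolding singular_hermitian_metric_def by fastforce
  moreover have "form_in_triv E \<tau> h x (\<tau> x e) = h x e" "form_in_triv E \<tau> h x (\<tau> x e') = h x e'"
    using b e by (auto simp: form_in_triv_def bij_betw_def)
  ultimately show ?thesis using semipos_form_scale[OF _ c(1), of _ a] by metis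
qed

lemma closed_polydisc_compact: "compactin (Cn n) (PiE {..<n} (\<lambda>i. cball (a i) e))"
  unfolding Cn_def by (simp add: compactin_PiE)

locale bundle_modification = modification X Y p S q n
  for X :: "'a cspace" and Y :: "'b cspace" and p S q n +
  fixes E :: "('a, 'e) vbundle" and h :: "'a \<Rightarrow> 'e \<Rightarrow> ennreal" and \<omega> :: "'a chart \<Rightarrow> 'a \<Rightarrow> complex mat"
  assumes E: "hol_vector_bundle X E" and h: "singular_hermitian_metric X n E h" and \<omega>: "hermitian_metric X n \<omega>"
begin

abbreviation E' where "E' \<equiv> pullback_bundle Y p E"

lemma fibre_E' [simp]: "fibre E' y = fibre E (p y)"
  by (simp add: pullback_bundle_def)

lemma trivs_E': "t \<in> trivs E' \<longleftrightarrow> (\<exists>V r \<tau>. (V, r, \<tau>) \<in> trivs E \<and> t = (preim Y p V, r, \<lambda>y. \<tau> (p y)))"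
  by (force simp: pullback_bundle_def image_iff)

lemma triv_E': "(V, r, \<tau>) \<in> trivs E \<Longrightarrow> (preim Y p V, r, \<lambda>y. \<tau> (p y)) \<in> trivs E'"
  using trivs_E' by blast

lemma E': "hol_vector_bundle Y E'"
  unfolding hol_vector_bundle_def
proof (intro conjI ballI)
  fix t assume "t \<in> trivs E'"
  then obtain V r \<tau> where t: "(V, r, \<tau>) \<in> trivs E" "t = (preim Y p V, r, \<lambda>y. \<tau> (p y))" using trivs_E' by blast
  show "case t of (V, r, \<tau>) \<Rightarrow> openin (top Y) V \<and> (\<forall>x\<in>V. bij_betw (\<tau> x) (fibre E' x) (carrier_vec r))"
    unfolding t(2) prod.case using preim_open[OF hol bundle_triv(1)[OF E t(1)]] bundle_triv(2)[OF E t(1)]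
    by (auto simp: preim_def)
  show "case t of (V, r, \<tau>) \<Rightarrow> \<forall>(V', r', \<tau>')\<in>trivs E'. V \<inter> V' \<noteq> {} \<longrightarrow> r = r' \<and>
        (\<exists>g :: 'b \<Rightarrow> complex mat.
           (\<forall>x\<in>V \<inter> V'. g x \<in> carrier_mat r r \<and> (\<forall>e\<in>fibre E' x. \<tau>' x e = g x *\<^sub>v \<tau> x e)) \<and>
           (\<forall>i<r. \<forall>j<r. (\<lambda>x. g x $$ (i, j)) \<in> str Y (V \<inter> V')))"
    unfolding t(2) prod.case
  proof (intro ballI)
    fix t' assume "t' \<in> trivs E'"
    then obtain V' r' \<tau>' where t': "(V', r', \<tau>') \<in> trivs E" "t' = (preim Y p V', r', \<lambda>y. \<tau>' (p y))" using trivs_E' by blast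
    show "case t' of (V', r', \<tau>') \<Rightarrow> preim Y p V \<inter> V' \<noteq> {} \<longrightarrow> r = r' \<and>
        (\<exists>g :: 'b \<Rightarrow> complex mat.
           (\<forall>x\<in>preim Y p V \<inter> V'. g x \<in> carrier_mat r r \<and> (\<forall>e\<in>fibre E' x. \<tau>' x e = g x *\<^sub>v \<tau> (p x) e)) \<and>
           (\<forall>i<r. \<forall>j<r. (\<lambda>x. g x $$ (i, j)) \<in> str Y (preim Y p V \<inter> V')))"
      unfolding t'(2) prod.case
    proof (intro impI)
      assume "preim Y p V \<inter> preim Y p V' \<noteq> {}"
      then obtain x where x: "x \<in> V" "x \<in> V'" by (auto simp: preim_def)
      obtain g where g: "r' = r" "\<And>y. y \<in> V \<inter> V' \<Longrightarrow> g y \<in> carrier_mat r r"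
        "\<And>y e. y \<in> V \<inter> V' \<Longrightarrow> e \<in> fibre E y \<Longrightarrow> \<tau>' y e = g y *\<^sub>v \<tau> y e"
        "\<And>i j. i < r \<Longrightarrow> j < r \<Longrightarrow> (\<lambda>y. g y $$ (i, j)) \<in> str X (V \<inter> V')"
        by (rule bundle_transition[OF E t(1) t'(1) x]) (rule that)
      have VV: "openin (top X) (V \<inter> V')" using bundle_triv(1)[OF E t(1)] bundle_triv(1)[OF E t'(1)] by blast
      have pVV: "preim Y p V \<inter> preim Y p V' = preim Y p (V \<inter> V')" by (auto simp: preim_def)
      have "(\<lambda>y. g (p y) $$ (i, j)) \<in> str Y (preim Y p (V \<inter> V'))" if "i < r" "j < r" for i j
      proof -
        have "(\<lambda>y. g y $$ (i, j)) \<circ> p \<in> str Y (preim Y p (V \<inter> V'))"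
          using hol g(4)[OF that] VV unfolding holomorphic_map_def by blast
        then show ?thesis by (simp add: o_def)
      qed
      then show "r = r' \<and> (\<exists>g :: 'b \<Rightarrow> complex mat.
           (\<forall>x\<in>preim Y p V \<inter> preim Y p V'. g x \<in> carrier_mat r r \<and> (\<forall>e\<in>fibre E' x. \<tau>' (p x) e = g x *\<^sub>v \<tau> (p x) e)) \<and>
           (\<forall>i<r. \<forall>j<r. (\<lambda>x. g x $$ (i, j)) \<in> str Y (preim Y p V \<inter> preim Y p V')))"
        using g(1-3) unfolding pVV by (intro conjI exI[of _ "\<lambda>y. g (p y)"]) (auto simp: preim_def)
    qed
  qed
next
  fix y assume y: "y \<in> points Y"
  then have "p y \<in> points X" by (rule p_mem)
  then obtain V r \<tau> where T: "(V, r, \<tau>) \<in> trivs E" "p y \<in> V" using E unfolding hol_vector_bundle_def by auto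
  then show "\<exists>(V, r, \<tau>)\<in>trivs E'. y \<in> V"
    using triv_E'[OF T(1)] y by (intro bexI[of _ "(preim Y p V, r, \<lambda>y. \<tau> (p y))"]) (auto simp: preim_def)
qed

text \<open>This expresses that \<open>t\<close> is the pullback of \<open>s\<close> off \<open>T\<close>. In the chart \<open>push c\<close> the Jacobian determinant of \<open>p\<close>
  is \<open>1\<close>, so that no scalar multiplication in the fibres occurs.\<close>

definition corresponds :: "'a set \<Rightarrow> ('a chart \<Rightarrow> 'a \<Rightarrow> 'e) \<Rightarrow> ('b chart \<Rightarrow> 'b \<Rightarrow> 'e) \<Rightarrow> bool" where
  "corresponds U s t \<longleftrightarrow> (\<forall>c y. is_chart Y n c \<longrightarrow> y \<in> fst c \<inter> preim Y p U - T \<longrightarrow> t c y = s (push c) (p y))"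

lemma correspondsD: "corresponds U s t \<Longrightarrow> is_chart Y n c \<Longrightarrow> y \<in> fst c - T \<Longrightarrow> p y \<in> U \<Longrightarrow> t c y = s (push c) (p y)"
  using chart_points[of Y n c] unfolding corresponds_def preim_def by blast

lemma is_pullback_form_iff:
  "is_pullback_form Y X p n E U s t \<longleftrightarrow>
     (\<forall>c' c y. is_chart Y n c' \<longrightarrow> is_chart X n c \<longrightarrow> y \<in> fst c' \<longrightarrow> p y \<in> fst c \<inter> U \<inter> reg X \<longrightarrow>
        (\<forall>(V, r, \<tau>)\<in>trivs E. p y \<in> V \<longrightarrow> \<tau> (p y) (t c' y) = map_det n p c' c y \<cdot>\<^sub>v \<tau> (p y) (s c (p y))))"
  by (simp add: is_pullback_form_def map_det_def o_def)

lemma cover_triv: "x \<in> points X \<Longrightarrow> \<exists>V r \<tau>. (V, r, \<tau>) \<in> trivs E \<and> x \<in> V"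
proof -
  assume x: "x \<in> points X"
  have "\<forall>x\<in>points X. \<exists>(V, r, \<tau>)\<in>trivs E. x \<in> V" using E unfolding hol_vector_bundle_def by (elim conjE)
  from bspec[OF this x] show ?thesis by blast
qed

lemma str_pull_continuous:
  assumes c': "is_chart Y n c'" and V: "openin (top X) V" and f: "f \<in> str X V" and N: "openin (top Y) N" "N \<subseteq> fst c'" "N \<subseteq> preim Y p V"
  shows "continuous_map (subtopology (top Y) N) euclidean (\<lambda>y. f (p y))"
proof -
  have "f \<circ> p \<in> str Y (preim Y p V)" using hol V f unfolding holomorphic_map_def by blast
  then have "f \<circ> p \<in> str Y N" using str_restrict[OF Y _ preim_open[OF hol V] N(1,3)] by blast
  from str_continuous[OF c' N(1,2) this] show ?thesis by (simp add: o_def)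
qed

text \<open>The two sides of the pullback condition are continuous and agree off \<open>T\<close>.\<close>

lemma corresponds_imp_pullback:
  assumes U: "openin (top X) U" and s: "s \<in> E_forms X n E (U \<inter> reg X)" and t: "t \<in> E_forms Y n E' (preim Y p U)"
    and corresponds: "corresponds U s t"
  shows "is_pullback_form Y X p n E U s t"
  unfolding is_pullback_form_iff
proof (intro allI impI ballI)
  fix c' c y T' assume c': "is_chart Y n c'" and c: "is_chart X n c" and y: "y \<in> fst c'"
    and py: "p y \<in> fst c \<inter> U \<inter> reg X" and "T' \<in> trivs E"
  obtain V r \<tau> where T'eq: "T' = (V, r, \<tau>)" by (cases T') auto
  then have T': "(V, r, \<tau>) \<in> trivs E" using \<open>T' \<in> trivs E\<close> by simp
  show "case T' of (V, r, \<tau>) \<Rightarrow> p y \<in> V \<longrightarrow> \<tau> (p y) (t c' y) = map_det n p c' c y \<cdot>\<^sub>v \<tau> (p y) (s c (p y))"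
    unfolding T'eq prod.case
  proof
    assume yV: "p y \<in> V"
    have yY: "y \<in> points Y" using chart_points[OF c'] y by blast
    let ?D = "fst c \<inter> (V \<inter> (U \<inter> reg X))"
    have D: "openin (top X) ?D"
      by (intro openin_Int is_chartD(1)[OF c] bundle_triv(1)[OF E T'] U reg_open)
    let ?N = "fst c' \<inter> preim Y p ?D"
    have N: "openin (top Y) ?N" by (intro openin_Int is_chartD(1)[OF c'] preim_open[OF hol D])
    have yN: "y \<in> ?N" using y yY py yV by (auto simp: preim_def)
    have comp: "\<tau> (p y) (t c' y) $ i = map_det n p c' c y * \<tau> (p y) (s c (p y)) $ i" if i: "i < r" for i
    proof (rule eq_off_nowhere_dense[OF T_nd N])
      have "(\<lambda>y. \<tau> (p y) (t c' y) $ i) \<in> str Y (fst c' \<inter> (preim Y p V \<inter> preim Y p U))"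
        by (rule E_forms_str[OF t triv_E'[OF T'] i c'])
      moreover have "openin (top Y) (fst c' \<inter> (preim Y p V \<inter> preim Y p U))"
        by (intro openin_Int is_chartD(1)[OF c'] preim_open[OF hol] bundle_triv(1)[OF E T'] U)
      moreover have "?N \<subseteq> fst c' \<inter> (preim Y p V \<inter> preim Y p U)" by (auto simp: preim_def)
      ultimately have "(\<lambda>y. \<tau> (p y) (t c' y) $ i) \<in> str Y ?N" using str_restrict[OF Y _ _ N] by blast
      then show "continuous_map (subtopology (top Y) ?N) euclidean (\<lambda>y. \<tau> (p y) (t c' y) $ i)"
        by (rule str_continuous[OF c' N Int_lower1])
      have "continuous_map (subtopology (top Y) ?N) euclidean (\<lambda>y. \<tau> (p y) (s c (p y)) $ i)"
        by (rule str_pull_continuous[OF c' D E_forms_str[OF s T' i c] N]) auto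
      then show "continuous_map (subtopology (top Y) ?N) euclidean (\<lambda>y. map_det n p c' c y * \<tau> (p y) (s c (p y)) $ i)"
        by (intro continuous_map_mult_field continuous_map_det[OF Y hol c' c N]) (auto simp: preim_def)
      fix z assume z: "z \<in> ?N" "z \<notin> T"
      have zc: "z \<in> fst c' - T" and pz: "p z \<in> fst c" "p z \<in> V" "p z \<in> U" "p z \<in> reg X" using z by (auto simp: preim_def)
      have "t c' z = s (push c') (p z)" by (rule correspondsD[OF corresponds c' zc pz(3)])
      moreover have "\<tau> (p z) (s (push c') (p z)) $ i = map_det n (\<lambda>x. x) (push c') c (p z) * \<tau> (p z) (s c (p z)) $ i"
        using pz by (intro E_forms_transform[OF s T' i push_chart[OF c'] c push_mem[OF c' zc]]) auto
      ultimately show "\<tau> (p z) (t c' z) $ i = map_det n p c' c z * \<tau> (p z) (s c (p z)) $ i"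
        using map_det_push[OF c' c zc] by simp
    qed (rule yN)
    have "t c' y \<in> fibre E (p y)" "s c (p y) \<in> fibre E (p y)"
      using E_formsD(1)[OF t c' y] E_formsD(1)[OF s c, of "p y"] yN py yY by (auto simp: preim_def)
    then have "\<tau> (p y) (t c' y) \<in> carrier_vec r" "\<tau> (p y) (s c (p y)) \<in> carrier_vec r"
      using bundle_triv(2)[OF E T' yV] by (auto dest: bij_betwE)
    then show "\<tau> (p y) (t c' y) = map_det n p c' c y \<cdot>\<^sub>v \<tau> (p y) (s c (p y))"
      using comp by (intro eq_vecI) auto
  qed
qed

lemma corresponds_unique_right:
  assumes U: "openin (top X) U" and t: "t \<in> E_forms Y n E' (preim Y p U)" "t' \<in> E_forms Y n E' (preim Y p U)"
    and corresponds: "corresponds U s t" "corresponds U s t'"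
  shows "t = t'"
proof (rule E_forms_eqI[OF E' T_nd preim_open[OF hol U] t])
  fix c y assume "is_chart Y n c" "y \<in> fst c" "y \<in> preim Y p U" "y \<notin> T"
  then have "y \<in> fst c - T" "p y \<in> U" "is_chart Y n c" by (simp_all add: preim_def)
  then show "t c y = t' c y" using correspondsD[OF corresponds(1)] correspondsD[OF corresponds(2)] by metis
qed

text \<open>The correspondence read in the opposite direction: off \<open>S\<close>, the form \<open>s\<close> is determined by \<open>t\<close>.\<close>

lemma corresponds_pull:
  assumes corresponds: "corresponds U s t" and c: "is_chart X n c" and x: "x \<in> fst c - S" "x \<in> U"
    and s: "s \<in> E_forms X n E (U \<inter> reg X)"
  shows "s c x = t (pull c) (q x)"
proof -
  have x0: "x \<in> points X - S" using chart_off_S(2)[OF c] x by blast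
  have qx: "q x \<in> fst (pull c) - T" "p (q x) = x" using pull_mem[OF c x(1)] q_mem[OF x0] pq[OF x0] by auto
  note pc = pull_chart[OF c] 
  note ppc = push_chart[OF pc]
  have m: "x \<in> fst (push (pull c))" using push_mem[OF pc qx(1)] qx(2) by simp
  have t: "t (pull c) (q x) = s (push (pull c)) x"
    using correspondsD[OF corresponds pc qx(1)] qx(2) x(2) by simp
  have reg: "x \<in> reg X" using X0_reg x0 by blast
  have "x \<in> points X" using x0 by blast
  then obtain V r \<tau> where T': "(V, r, \<tau>) \<in> trivs E" "x \<in> V" using cover_triv by blast
  have "map_det n (\<lambda>x. x) (push (pull c)) c x = 1"
    using map_det_push[OF pc c qx(1)] map_det_pull_self[OF c] qx by simp
  then have "s (push (pull c)) x = s c x"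
    using E_forms_transform[OF s T'(1) _ ppc c m _ T'(2)] x reg
    by (intro triv_eqI[OF E T' E_formsD(1)[OF s ppc m] E_formsD(1)[OF s c]]) auto
  then show ?thesis using t by simp
qed

lemma corresponds_unique_left:
  assumes U: "openin (top X) U" and s: "s \<in> E_forms X n E (U \<inter> reg X)" "s' \<in> E_forms X n E (U \<inter> reg X)"
    and corresponds: "corresponds U s t" "corresponds U s' t"
  shows "s = s'"
proof (rule E_forms_eqI[OF E S_nd _ s])
  show "openin (top X) (U \<inter> reg X)" using U reg_open by blast
  fix c x assume "is_chart X n c" "x \<in> fst c" "x \<in> U \<inter> reg X" "x \<notin> S"
  then show "s c x = s' c x" using corresponds_pull[OF corresponds(1) _ _ _ s(1)] corresponds_pull[OF corresponds(2) _ _ _ s(2)] by simp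
qed

section \<open>From forms on the base to forms on the modification\<close>

text \<open>A closed polydisc in the chart is a compact neighbourhood of \<open>y\<close>. This serves to apply the condition of
  the Grauert--Riemenschneider sheaf, which refers to compact subsets of \<open>X\<close>.\<close>

lemma compact_image_nbhd:
  assumes c': "is_chart Y n c'" and U: "openin (top X) U" and y: "y \<in> fst c' \<inter> preim Y p U"
  obtains N K where "openin (top Y) N" "y \<in> N" "N \<subseteq> fst c' \<inter> preim Y p U" "compactin (top X) K" "K \<subseteq> U" "p ` N \<subseteq> K"
proof -
  let ?V = "fst c' \<inter> preim Y p U"
  have V: "openin (top Y) ?V" "?V \<subseteq> fst c'" using is_chartD(1)[OF c'] preim_open[OF hol U] by auto
  define a where "a = snd c' y"
  have "a \<in> snd c' ` ?V" using y by (simp add: a_def)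
  then obtain e where e: "e > 0" "polydisc n a e \<subseteq> snd c' ` ?V" using openin_CnD(2)[OF chart_image_open[OF c' V]] by blast
  have aT: "a \<in> tuples n" using \<open>a \<in> _\<close> openin_CnD(1)[OF chart_image_open[OF c' V]] by blast
  define C where "C = PiE {..<n} (\<lambda>i. cball (a i) (e/2))"
  have CV: "C \<subseteq> snd c' ` ?V"
  proof
    fix z assume "z \<in> C"
    then have zC: "z \<in> tuples n" "\<And>i. i < n \<Longrightarrow> dist (z i) (a i) \<le> e / 2" by (auto simp: C_def PiE_def dist_commute)
    have "dist (z i) (a i) < e" if "i < n" for i using zC(2)[OF that] e(1) by linarith
    then have "z \<in> polydisc n a e" using zC(1) by (simp add: polydisc_def)
    then show "z \<in> snd c' ` ?V" using e(2) by blast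
  qed
  have "compactin (subtopology (Cn n) (snd c' ` fst c')) C"
    using closed_polydisc_compact[of n a "e/2"] CV by (auto simp: compactin_subtopology C_def)
  then have "compactin (top Y) (inv_chart c' ` C)"
    using image_compactin[OF _ continuous_inv_chart[OF c']] by (auto simp: compactin_subtopology)
  then have K: "compactin (top X) (p ` inv_chart c' ` C)"
    using image_compactin[of "top Y" _ "top X" p] hol unfolding holomorphic_map_def by blast
  have "inv_chart c' ` C \<subseteq> ?V" using CV c' by auto
  then have KU: "p ` inv_chart c' ` C \<subseteq> U" by (auto simp: preim_def)
  let ?N = "{y' \<in> ?V. snd c' y' \<in> polydisc n a (e/2)}"
  have N: "openin (top Y) ?N" by (rule chart_preimage_open[OF c' V openin_polydisc])
  have yN: "y \<in> ?N" using y polydisc_centre[OF aT, of "e/2"] e(1) by (simp add: a_def)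
  have "p ` ?N \<subseteq> p ` inv_chart c' ` C"
  proof (rule image_mono, rule subsetI)
    fix y' assume y': "y' \<in> ?N"
    then have "snd c' y' \<in> C" by (auto simp: C_def polydisc_def PiE_def dist_commute less_imp_le)
    moreover have "y' = inv_chart c' (snd c' y')" using y' c' by simp
    ultimately show "y' \<in> inv_chart c' ` C" using imageI[of "snd c' y'" C "inv_chart c'"] by simp
  qed
  then show ?thesis by (intro that[OF N yN _ K KU]) auto
qed

text \<open>The image of \<open>N - T\<close> lies in the single chart \<open>push c'\<close> of \<open>X\<close>, so that the integral over it is one of those
  in the supremum that defines the integral on \<open>X\<close>.\<close>

lemma push_piece_le:
  assumes c': "is_chart Y n c'" and N: "openin (top Y) N" "N \<subseteq> fst c'" and R: "p ` (N - T) \<subseteq> R"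
    and le: "\<And>y. y \<in> N - T \<Longrightarrow> \<rho>' y \<le> \<rho> (push c') (p y)"
  shows "(\<integral>\<^sup>+z. \<rho>' (inv_chart c' z) * indicator (snd c' ` (N - T)) z \<partial>lam n) \<le> integral_density X n (R \<inter> reg X) \<rho>"
proof -
  let ?B = "p ` (N - T)"
  have NT: "openin (top Y) (N - T)" "N - T \<subseteq> fst c' - T" using N T_analytic unfolding analytic_in_def by blast+
  have img: "snd (push c') ` ?B = snd c' ` (N - T)"
    unfolding image_image using snd_push[OF c'] NT(2) by (intro image_cong) auto
  have "(\<integral>\<^sup>+z. \<rho>' (inv_chart c' z) * indicator (snd c' ` (N - T)) z \<partial>lam n)
     \<le> (\<integral>\<^sup>+z. \<rho> (push c') (inv_chart (push c') z) * indicator (snd (push c') ` ?B) z \<partial>lam n)"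
  proof (rule nn_integral_mono)
    fix z
    show "\<rho>' (inv_chart c' z) * indicator (snd c' ` (N - T)) z \<le> \<rho> (push c') (inv_chart (push c') z) * indicator (snd (push c') ` ?B) z"
    proof (cases "z \<in> snd c' ` (N - T)")
      case True
      then obtain y where y: "y \<in> N - T" "z = snd c' y" by blast
      then have "y \<in> fst c' - T" using NT by blast
      then show ?thesis using le[OF y(1)] y(2) inv_push[OF c'] c' img True by simp
    qed simp
  qed
  also have "\<dots> \<le> integral_density X n (R \<inter> reg X) \<rho>"
  proof (rule integral_piece_le_density[OF push_chart[OF c']])
    have "?B \<subseteq> fst (push c')" using NT(2) by (auto simp: push_def)
    then show "?B \<subseteq> fst (push c') \<inter> (R \<inter> reg X)" using R chart_subset_reg[OF push_chart[OF c']] by blast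
    have "snd c' ` (N - T) \<in> sets (lam n)" using NT by (intro openin_sets_lam chart_image_open[OF c' NT(1)]) auto
    then show "snd (push c') ` ?B \<in> sets (lam n)" by (simp add: img)
  qed
  finally show ?thesis .
qed

text \<open>The norm of \<open>dz\<^sub>0 \<and> \<dots> \<and> dz\<^sub>n\<^sub>-\<^sub>1\<close> and the volume form cancel; the measure is therefore independent of \<open>\<omega>\<close>.\<close>

lemma norm_volume:
  assumes "is_chart X n c" "x \<in> fst c"
  shows "norm_sq_form h \<omega> s c x * volume_density \<omega> c x = h x (s c x)"
proof -
  have pos: "0 < Re (Determinant.det (\<omega> c x))" by (rule hermitian_metric_det_pos[OF X \<omega> assms])
  then have "ennreal (1 / Re (Determinant.det (\<omega> c x))) * ennreal (Re (Determinant.det (\<omega> c x))) = 1"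
    by (simp flip: ennreal_mult)
  then show ?thesis by (simp add: norm_sq_form_def volume_density_def mult.assoc)
qed

text \<open>Off \<open>T\<close>, the pullback is \<open>s\<close> in the pushed charts. The components of \<open>s\<close> are sections of the
  Grauert--Riemenschneider sheaf, so those of the pullback are square integrable near \<open>T\<close>, and the pullback extends
  across \<open>T\<close>. As \<open>T\<close> is a null set, integrability with respect to the metric passes from \<open>s\<close> to the extension.\<close>

theorem pullback_exists:
  assumes U: "openin (top X) U" and s: "s \<in> GR_L2 X n E h \<omega> U"
  shows "\<exists>t\<in>K_tensor_L2 Y n E' (pullback_metric p h) (preim Y p U). corresponds U s t"
proof -
  let ?W = "preim Y p U"
  have W: "openin (top Y) ?W" by (rule preim_open[OF hol U])
  have sT: "s \<in> GR_tensor X n E U" using s unfolding GR_L2_def by blast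
  then have sE: "s \<in> E_forms X n E (U \<inter> reg X)" unfolding GR_tensor_def by blast
  have sGR: "GR_form X n (U \<inter> V) (\<lambda>c x. \<tau> x (s c x) $ i)" if "(V, r, \<tau>) \<in> trivs E" "i < r" for V r \<tau> i
  proof -
    have "\<forall>(V, r, \<tau>)\<in>trivs E. \<forall>i<r. GR_form X n (U \<inter> V) (\<lambda>c x. \<tau> x (s c x) $ i)"
      using sT unfolding GR_tensor_def by blast
    from bspec[OF this that(1)] that(2) show ?thesis by simp
  qed
  have sL2: "\<forall>x\<in>U. \<exists>B. openin (top X) B \<and> x \<in> B \<and> B \<subseteq> U \<and>
       integral_density X n (B \<inter> reg X) (\<lambda>c y. norm_sq_form h \<omega> s c y * volume_density \<omega> c y) < \<infinity>"
    using s unfolding GR_L2_def by blast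
  define s0 where "s0 c y = s (push c) (p y)" for c y
  have py: "p y \<in> fst (push c)" "p y \<in> U" "p y \<in> reg X" if "is_chart Y n c" "y \<in> fst c \<inter> ?W - T" for c y
    using push_mem[OF that(1), of y] that(2) chart_subset_reg[OF push_chart[OF that(1)]] by (auto simp: preim_def)
  have "\<exists>t\<in>E_forms Y n E' ?W. \<forall>c y. is_chart Y n c \<longrightarrow> y \<in> fst c \<inter> ?W - T \<longrightarrow> t c y = s0 c y"
  proof (rule E_forms_extend[OF Y E' T_analytic T_nd W])
    show "s0 c y \<in> fibre E' y" if "is_chart Y n c" "y \<in> fst c \<inter> ?W - T" for c y
      using E_formsD(1)[OF sE push_chart[OF that(1)], of "p y"] py[OF that] by (simp add: s0_def)
  next
    fix V' r \<tau>' i assume "(V', r, \<tau>') \<in> trivs E'" and i: "i < r"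
    then obtain V \<tau> where T': "(V, r, \<tau>) \<in> trivs E" "V' = preim Y p V" "\<tau>' = (\<lambda>y. \<tau> (p y))" using trivs_E' by auto
    show "hol_nform Y n (V' \<inter> ?W - T) (\<lambda>c y. \<tau>' y (s0 c y) $ i)"
      unfolding hol_nform_iff T'(2,3)
    proof (intro conjI allI impI)
      fix c assume c: "is_chart Y n c"
      let ?V1 = "fst (push c) \<inter> (V \<inter> (U \<inter> reg X))"
      have V1: "openin (top X) ?V1"
        by (intro openin_Int is_chartD(1)[OF push_chart[OF c]] bundle_triv(1)[OF E T'(1)] U reg_open)
      have V10: "?V1 \<subseteq> points X - S" using chart_push_points[OF _ c] by blast
      have "(\<lambda>y. \<tau> (p y) (s (push c) (p y)) $ i) \<in> str Y (preim Y p ?V1)"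
        using str_push[OF V1 V10] E_forms_str[OF sE T'(1) i push_chart[OF c]] by simp
      moreover have "preim Y p ?V1 = fst c \<inter> (preim Y p V \<inter> ?W - T)"
      proof -
        have "preim Y p (fst (push c)) = fst c - T" using preim_image[OF chart_off_T(2)[OF c]] by (simp add: push_def)
        then have "preim Y p ?V1 = (fst c - T) \<inter> (preim Y p V \<inter> (?W \<inter> preim Y p (reg X)))" by (auto simp: preim_def)
        moreover have "fst c - T \<subseteq> preim Y p (reg X)"
          using push_mem[OF c] chart_subset_reg[OF push_chart[OF c]] chart_points[OF c] by (auto simp: preim_def)
        ultimately show ?thesis by blast
      qed
      ultimately show "(\<lambda>y. \<tau> (p y) (s0 c y) $ i) \<in> str Y (fst c \<inter> (preim Y p V \<inter> ?W - T))"
        by (simp add: s0_def)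
      fix c2 y assume c2: "is_chart Y n c2" and y: "y \<in> fst c \<inter> fst c2 \<inter> (preim Y p V \<inter> ?W - T)"
      have y1: "y \<in> fst c \<inter> ?W - T" "y \<in> fst c2 \<inter> ?W - T" "y \<in> fst c - T" "y \<in> fst c2" and pV: "p y \<in> V"
        using y by (simp_all add: preim_def)
      note p1 = py[OF c y1(1)] py(1)[OF c2 y1(2)] pV
      have "\<tau> (p y) (s (push c) (p y)) $ i = map_det n (\<lambda>x. x) (push c) (push c2) (p y) * \<tau> (p y) (s (push c2) (p y)) $ i"
        using p1 by (intro E_forms_transform[OF sE T'(1) i push_chart[OF c] push_chart[OF c2]] IntI)
      also have "map_det n (\<lambda>x. x) (push c) (push c2) (p y) = map_det n (\<lambda>x. x) c c2 y"
        using map_det_push[OF c push_chart[OF c2] y1(3)] map_det_p_push[OF c c2 y1(3,4)] by simp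
      finally show "\<tau> (p y) (s0 c y) $ i = map_det n (\<lambda>x. x) c c2 y * \<tau> (p y) (s0 c2 y) $ i"
        by (simp add: s0_def)
    qed
  next
    fix V' r \<tau>' i c y assume "(V', r, \<tau>') \<in> trivs E'" and i: "i < r" and c: "is_chart Y n c" and y: "y \<in> fst c \<inter> (V' \<inter> ?W)"
    then obtain V \<tau> where T': "(V, r, \<tau>) \<in> trivs E" "V' = preim Y p V" "\<tau>' = (\<lambda>y. \<tau> (p y))" using trivs_E' by auto
    have UV: "openin (top X) (U \<inter> V)" using U bundle_triv(1)[OF E T'(1)] by blast
    have "y \<in> fst c \<inter> preim Y p (U \<inter> V)" using y T'(2) by (auto simp: preim_def)
    from c UV this
    obtain N K where N: "openin (top Y) N" "y \<in> N" "N \<subseteq> fst c \<inter> preim Y p (U \<inter> V)" "compactin (top X) K" "K \<subseteq> U \<inter> V" "p ` N \<subseteq> K"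
      by (rule compact_image_nbhd)
    have "(\<integral>\<^sup>+z. ennreal ((cmod (\<tau>' (inv_chart c z) (s0 c (inv_chart c z)) $ i))\<^sup>2) * indicator (snd c ` (N - T)) z \<partial>lam n)
       \<le> integral_density X n (K \<inter> reg X) (\<lambda>c x. ennreal (2 ^ n * (cmod (\<tau> x (s c x) $ i))\<^sup>2))"
    proof (rule push_piece_le[OF c N(1)])
      fix y assume "y \<in> N - T"
      have "(cmod w)\<^sup>2 \<le> 2 ^ n * (cmod w)\<^sup>2" for w using mult_right_mono[of 1 "2 ^ n" "(cmod w)\<^sup>2"] by simp
      then show "ennreal ((cmod (\<tau>' y (s0 c y) $ i))\<^sup>2) \<le> ennreal (2 ^ n * (cmod (\<tau> (p y) (s (push c) (p y)) $ i))\<^sup>2)"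
        by (simp add: T'(3) s0_def ennreal_leI)
    qed (use N in auto)
    also have "\<dots> < \<infinity>" using sGR[OF T'(1) i] N(4,5) unfolding GR_form_def by blast
    finally have "(\<integral>\<^sup>+z. ennreal ((cmod (\<tau>' (inv_chart c z) (s0 c (inv_chart c z)) $ i))\<^sup>2) * indicator (snd c ` (N - T)) z \<partial>lam n) < \<infinity>" .
    moreover have "N \<subseteq> fst c \<inter> (V' \<inter> ?W)" using N(3) T'(2) by (auto simp: preim_def)
    ultimately show "\<exists>N. openin (top Y) N \<and> y \<in> N \<and> N \<subseteq> fst c \<inter> (V' \<inter> ?W) \<and>
       (\<integral>\<^sup>+z. ennreal ((cmod (\<tau>' (inv_chart c z) (s0 c (inv_chart c z)) $ i))\<^sup>2) * indicator (snd c ` (N - T)) z \<partial>lam n) < \<infinity>"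
      using N(1,2) by blast
  qed
  then obtain t where t: "t \<in> E_forms Y n E' ?W" "\<And>c y. is_chart Y n c \<Longrightarrow> y \<in> fst c \<inter> ?W - T \<Longrightarrow> t c y = s0 c y"
    by blast
  have corresponds: "corresponds U s t" using t(2) unfolding corresponds_def s0_def by blast
  have "L2_section Y n E' (pullback_metric p h) (fst c \<inter> ?W) (t c)" if c: "is_chart Y n c" for c
    unfolding L2_section_def hol_section_def
  proof (intro conjI ballI)
    show "t c y \<in> fibre E' y" if "y \<in> fst c \<inter> ?W" for y using E_formsD(1)[OF t(1) c] that by blast
    fix T' assume "T' \<in> trivs E'"
    moreover obtain V r \<tau> where T'eq: "T' = (V, r, \<tau>)" by (cases T') auto
    ultimately have "\<forall>i<r. (\<lambda>x. \<tau> x (t c x) $ i) \<in> str Y (fst c \<inter> (V \<inter> ?W))"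
      using E_forms_str[OF t(1) _ _ c] by blast
    moreover have "fst c \<inter> (V \<inter> ?W) = V \<inter> (fst c \<inter> ?W)" by blast
    ultimately show "case T' of (V, r, \<tau>) \<Rightarrow> \<forall>i<r. (\<lambda>x. \<tau> x (t c x) $ i) \<in> str Y (V \<inter> (fst c \<inter> ?W))"
      by (simp add: T'eq)
  next
    fix y assume y: "y \<in> fst c \<inter> ?W"
    then have "p y \<in> U" by (simp add: preim_def)
    then obtain B where B: "openin (top X) B" "p y \<in> B" "B \<subseteq> U"
       "integral_density X n (B \<inter> reg X) (\<lambda>c y. norm_sq_form h \<omega> s c y * volume_density \<omega> c y) < \<infinity>"
      using sL2 by blast
    let ?N = "fst c \<inter> preim Y p B"
    have N: "openin (top Y) ?N" using is_chartD(1)[OF c] preim_open[OF hol B(1)] by blast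
    have "(\<integral>\<^sup>+z\<in>snd c ` ?N. pullback_metric p h (inv_chart c z) (t c (inv_chart c z)) \<partial>lebesgue_Cn n)
      = (\<integral>\<^sup>+z. h (p (inv_chart c z)) (t c (inv_chart c z)) * indicator (snd c ` ?N) z \<partial>lam n)"
      by (simp add: lebesgue_Cn_def nn_integral_completion pullback_metric_def)
    also have "\<dots> = (\<integral>\<^sup>+z. h (p (inv_chart c z)) (t c (inv_chart c z)) * indicator (snd c ` (?N - T)) z \<partial>lam n)"
      by (rule nn_integral_off_null[OF T_null[OF c]]) auto
    also have "\<dots> \<le> integral_density X n (B \<inter> reg X) (\<lambda>c y. norm_sq_form h \<omega> s c y * volume_density \<omega> c y)"
    proof (rule push_piece_le[OF c N])
      fix y assume y: "y \<in> ?N - T"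
      then have "p y \<in> U" "y \<in> fst c - T" using B(3) by (auto simp: preim_def)
      then have "t c y = s (push c) (p y)" using correspondsD[OF corresponds c] by blast
      then show "h (p y) (t c y) \<le> norm_sq_form h \<omega> s (push c) (p y) * volume_density \<omega> (push c) (p y)"
        using norm_volume[OF push_chart[OF c] push_mem[OF c]] \<open>y \<in> fst c - T\<close> by simp
    qed (auto simp: preim_def)
    also note B(4)
    finally have fin: "(\<integral>\<^sup>+z\<in>snd c ` ?N. pullback_metric p h (inv_chart c z) (t c (inv_chart c z)) \<partial>lebesgue_Cn n) < \<infinity>" .
    show "\<exists>c0 B. is_chart Y n c0 \<and> openin (top Y) B \<and> y \<in> B \<and> B \<subseteq> fst c0 \<inter> (fst c \<inter> ?W) \<and>
        (\<integral>\<^sup>+z\<in>snd c0 ` B. pullback_metric p h (inv_chart c0 z) (t c (inv_chart c0 z)) \<partial>lebesgue_Cn n) < \<infinity>"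
      by (rule exI[of _ c], rule exI[of _ ?N]) (use c N y B fin in \<open>auto simp: preim_def\<close>)
  qed
  then have "t \<in> K_tensor_L2 Y n E' (pullback_metric p h) ?W" using t(1) unfolding K_tensor_L2_def by blast
  then show ?thesis using corresponds by blast
qed

end

section \<open>From forms on the modification to forms on the base\<close>

lemma nn_integral_cmult_le:
  assumes "0 < C"
  shows "(\<integral>\<^sup>+x. ennreal C * f x \<partial>M) \<le> ennreal C * (\<integral>\<^sup>+x. f x \<partial>M)"
proof (rule nn_integral_le_simple)
  fix g assume g: "simple_function M g" "g \<le> (\<lambda>x. ennreal C * f x)"
  then have [measurable]: "g \<in> borel_measurable M" by (simp add: borel_measurable_simple_function)
  have C: "ennreal (1 / C) * ennreal C = 1" "ennreal C * ennreal (1 / C) = 1"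
    using assms by (simp_all flip: ennreal_mult)
  have "ennreal (1 / C) * g x \<le> f x" for x
  proof -
    have "ennreal (1 / C) * g x \<le> ennreal (1 / C) * (ennreal C * f x)"
      using g(2) by (intro mult_left_mono) (auto simp: le_fun_def)
    also have "\<dots> = f x" by (simp only: mult.assoc[symmetric] C mult_1)
    finally show ?thesis .
  qed
  then have "(\<integral>\<^sup>+x. ennreal (1 / C) * g x \<partial>M) \<le> (\<integral>\<^sup>+x. f x \<partial>M)" by (intro nn_integral_mono)
  then have "ennreal C * (ennreal (1 / C) * (\<integral>\<^sup>+x. g x \<partial>M)) \<le> ennreal C * (\<integral>\<^sup>+x. f x \<partial>M)"
    by (intro mult_left_mono) (simp_all add: nn_integral_cmult)
  then show "(\<integral>\<^sup>+x. g x \<partial>M) \<le> ennreal C * (\<integral>\<^sup>+x. f x \<partial>M)"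
    by (simp only: mult.assoc[symmetric] C mult_1)
qed

text \<open>The set is made small enough to have finite volume in the chart, so that bounded functions are
  integrable on it.\<close>

lemma local_bound:
  assumes c: "is_chart M n c" and V: "openin (top M) V" "V \<subseteq> fst c"
    and f: "continuous_map (subtopology (top M) V) euclidean (f :: _ \<Rightarrow> complex)" and y: "y \<in> V"
  obtains P where "openin (top M) P" "y \<in> P" "P \<subseteq> V" "\<And>z. z \<in> P \<Longrightarrow> cmod (f z) \<le> cmod (f y) + 1"
    "emeasure (lam n) (snd c ` P) < \<infinity>"
proof -
  obtain N where N: "openin (top M) N" "y \<in> N" "N \<subseteq> V" "\<And>z. z \<in> N \<Longrightarrow> dist (f z) (f y) < 1"
    by (rule continuous_in_chart_point[OF f V(1) y, of 1]) (simp, rule that)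
  have Nc: "N \<subseteq> fst c" using N(3) V(2) by blast
  define a where "a = snd c y"
  have "a \<in> snd c ` N" using N(2) by (simp add: a_def)
  then have aT: "a \<in> tuples n" using openin_CnD(1)[OF chart_image_open[OF c N(1) Nc]] by blast
  let ?P = "{z \<in> N. snd c z \<in> polydisc n a 1}"
  have P: "openin (top M) ?P" by (rule chart_preimage_open[OF c N(1) Nc openin_polydisc])
  have yP: "y \<in> ?P" using N(2) polydisc_centre[OF aT, of 1] by (simp add: a_def)
  have b: "cmod (f z) \<le> cmod (f y) + 1" if "z \<in> ?P" for z
  proof -
    have "cmod (f z - f y) < 1" using N(4)[of z] that by (simp add: dist_norm)
    then show ?thesis using norm_triangle_ineq2[of "f z" "f y"] by linarith
  qed
  have "emeasure (lam n) (snd c ` ?P) \<le> emeasure (lam n) (polydisc n a 1)"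
    by (intro emeasure_mono openin_sets_lam openin_polydisc) auto
  also note emeasure_polydisc_finite
  finally show ?thesis using N(3) b by (intro that[OF P yP]) auto
qed

context bundle_modification
begin

text \<open>Over the complement of \<open>S\<close>, the form on \<open>X\<close> that corresponds to \<open>t\<close> has the coefficient \<open>t (pull c) (q x)\<close>
  in the chart \<open>c\<close>; its pullback is \<open>t\<close> again.\<close>

lemma pulled_transform:
  assumes t: "t \<in> E_forms Y n E' (preim Y p U)" and T': "(V, r, \<tau>) \<in> trivs E" and i: "i < r"
    and c': "is_chart Y n c'" and c: "is_chart X n c" and y: "y \<in> fst c' - T" "p y \<in> fst c" "p y \<in> U" "p y \<in> V"
  shows "\<tau> (p y) (t c' y) $ i = map_det n p c' c y * \<tau> (p y) (t (pull c) (q (p y))) $ i"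
proof -
  have yY: "y \<in> points Y - T" using chart_off_T(2)[OF c'] y(1) by blast
  have "p y \<in> fst c - S" using y(2) p_notin_S[OF yY] by blast
  from pull_mem[OF c this] have yp: "y \<in> fst (pull c)" using qp[OF yY] by simp
  have "\<tau> (p y) (t c' y) $ i = map_det n (\<lambda>x. x) c' (pull c) y * \<tau> (p y) (t (pull c) y) $ i"
    using E_forms_transform[OF t triv_E'[OF T'] i c' pull_chart[OF c] _ yp] y yY by (simp add: preim_def)
  then show ?thesis using qp[OF yY] map_det_pull by simp
qed

text \<open>The components of \<open>t\<close> are holomorphic also at the points of \<open>T\<close>, hence locally bounded on \<open>Y\<close>.\<close>

lemma dominated_component:
  assumes U: "openin (top X) U" and t: "t \<in> E_forms Y n E' (preim Y p U)" and T': "(V, r, \<tau>) \<in> trivs E" and i: "i < r"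
    and st: "\<And>c x. is_chart X n c \<Longrightarrow> x \<in> fst c - S \<Longrightarrow> x \<in> U \<Longrightarrow> s c x = t (pull c) (q x)" and k: "0 \<le> k"
  shows "dominated (\<lambda>c x. ennreal (k * (cmod (\<tau> x (s c x) $ i))\<^sup>2)) (U \<inter> V)"
  unfolding dominated_def
proof
  fix y assume "y \<in> preim Y p (U \<inter> V)"
  then have y: "y \<in> points Y" "p y \<in> U" "p y \<in> V" by (auto simp: preim_def)
  obtain c' where c': "is_chart Y n c'" "y \<in> fst c'" using Y_cover[OF y(1)] by blast
  define f where "f y = \<tau> (p y) (t c' y) $ i" for y
  let ?D = "fst c' \<inter> (preim Y p V \<inter> preim Y p U)"
  have D: "openin (top Y) ?D"
    by (intro openin_Int is_chartD(1)[OF c'(1)] preim_open[OF hol] U bundle_triv(1)[OF E T'])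
  have "f \<in> str Y ?D" unfolding f_def by (rule E_forms_str[OF t triv_E'[OF T'] i c'(1)])
  then have cont: "continuous_map (subtopology (top Y) ?D) euclidean f" by (rule str_continuous[OF c'(1) D Int_lower1])
  have "y \<in> ?D" using y c'(2) by (simp add: preim_def)
  then obtain P where P: "openin (top Y) P" "y \<in> P" "P \<subseteq> ?D" "\<And>z. z \<in> P \<Longrightarrow> cmod (f z) \<le> cmod (f y) + 1"
    "emeasure (lam n) (snd c' ` P) < \<infinity>"
    by (rule local_bound[OF c'(1) D Int_lower1 cont]) (rule that)
  have Pc: "P \<subseteq> fst c'" using P(3) by blast
  define C where "C = k * (cmod (f y) + 1)\<^sup>2"
  have "(\<integral>\<^sup>+z. ennreal (k * (cmod (f (inv_chart c' z)))\<^sup>2) * indicator (snd c' ` P) z \<partial>lam n)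
     \<le> (\<integral>\<^sup>+z. ennreal C * indicator (snd c' ` P) z \<partial>lam n)"
  proof (rule nn_integral_mono)
    fix z
    have "k * (cmod (f (inv_chart c' z)))\<^sup>2 \<le> C" if z: "z \<in> snd c' ` P"
    proof -
      have "inv_chart c' z \<in> P" using inv_chart_mem[OF z Pc c'(1)] .
      then show ?thesis unfolding C_def using P(4) k by (intro mult_left_mono power_mono) auto
    qed
    then show "ennreal (k * (cmod (f (inv_chart c' z)))\<^sup>2) * indicator (snd c' ` P) z \<le> ennreal C * indicator (snd c' ` P) z"
      by (cases "z \<in> snd c' ` P") (simp_all add: ennreal_leI)
  qed
  also have "\<dots> = ennreal C * emeasure (lam n) (snd c' ` P)"
    by (intro nn_integral_cmult_indicator openin_sets_lam chart_image_open[OF c'(1) P(1) Pc])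
  also have "\<dots> < \<infinity>" using P(5) by (simp add: ennreal_mult_less_top)
  finally have fin: "(\<integral>\<^sup>+z. ennreal (k * (cmod (f (inv_chart c' z)))\<^sup>2) * indicator (snd c' ` P) z \<partial>lam n) < \<infinity>" .
  have "dominated_at (\<lambda>c x. ennreal (k * (cmod (\<tau> x (s c x) $ i))\<^sup>2)) y c' P (\<lambda>y. ennreal (k * (cmod (f y))\<^sup>2))"
    unfolding dominated_at_def
  proof (intro conjI allI impI)
    fix c y' assume c: "is_chart X n c" and y': "y' \<in> P - T" "p y' \<in> fst c"
    have D': "y' \<in> fst c' - T" "p y' \<in> U" "p y' \<in> V" using y' P(3) by (auto simp: preim_def)
    have "p y' \<in> points X - S" using p_notin_S chart_off_T(2)[OF c'(1)] D'(1) by blast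
    then have "s c (p y') = t (pull c) (q (p y'))" using st[OF c] y'(2) D'(2) by blast
    then have "f y' = map_det n p c' c y' * \<tau> (p y') (s c (p y')) $ i"
      unfolding f_def using pulled_transform[OF t T' i c'(1) c D'(1) y'(2) D'(2,3)] by simp
    then show "ennreal (k * (cmod (\<tau> (p y') (s c (p y')) $ i))\<^sup>2) * ennreal ((cmod (map_det n p c' c y'))\<^sup>2) \<le> ennreal (k * (cmod (f y'))\<^sup>2)"
      using k by (simp add: norm_mult power_mult_distrib mult_ac flip: ennreal_mult)
  qed (fact c'(1) P(1) P(2) Pc fin)+
  then show "\<exists>c' P \<rho>'. dominated_at (\<lambda>c x. ennreal (k * (cmod (\<tau> x (s c x) $ i))\<^sup>2)) y c' P \<rho>'" by blast
qed

text \<open>The chart in which square integrability of \<open>t c'\<close> is known may differ from \<open>c'\<close>, but the transition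
  determinant between the two is bounded near \<open>y\<close>, and it scales the metric by its square.\<close>

lemma dominated_norm:
  assumes U: "openin (top X) U" and t: "t \<in> K_tensor_L2 Y n E' (pullback_metric p h) (preim Y p U)"
    and st: "\<And>c x. is_chart X n c \<Longrightarrow> x \<in> fst c - S \<Longrightarrow> x \<in> U \<Longrightarrow> s c x = t (pull c) (q x)"
  shows "dominated (\<lambda>c y. norm_sq_form h \<omega> s c y * volume_density \<omega> c y) U"
  unfolding dominated_def
proof
  fix y assume "y \<in> preim Y p U"
  then have y: "y \<in> points Y" "p y \<in> U" by (auto simp: preim_def)
  have tE: "t \<in> E_forms Y n E' (preim Y p U)" using t unfolding K_tensor_L2_def by blast
  obtain c' where c': "is_chart Y n c'" "y \<in> fst c'" using Y_cover[OF y(1)] by blast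
  have "L2_section Y n E' (pullback_metric p h) (fst c' \<inter> preim Y p U) (t c')"
    using t c'(1) unfolding K_tensor_L2_def by blast
  moreover have "y \<in> fst c' \<inter> preim Y p U" using y c'(2) by (simp add: preim_def)
  ultimately obtain c0 B where c0: "is_chart Y n c0" and B: "openin (top Y) B" "y \<in> B" "B \<subseteq> fst c0 \<inter> (fst c' \<inter> preim Y p U)"
    "(\<integral>\<^sup>+z\<in>snd c0 ` B. pullback_metric p h (inv_chart c0 z) (t c' (inv_chart c0 z)) \<partial>lebesgue_Cn n) < \<infinity>"
    unfolding L2_section_def by meson
  have Bc: "B \<subseteq> fst c0" "B \<subseteq> fst c'" "B \<subseteq> preim Y p U" using B(3) by auto
  define g where "g y = h (p y) (t c' y)" for y
  have B4: "(\<integral>\<^sup>+z. g (inv_chart c0 z) * indicator (snd c0 ` B) z \<partial>lam n) < \<infinity>"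
    using B(4) by (simp add: g_def lebesgue_Cn_def nn_integral_completion pullback_metric_def)
  let ?d = "map_det n (\<lambda>x. x) c0 c'"
  have "continuous_map (subtopology (top Y) B) euclidean ?d"
    using Bc by (intro continuous_map_det[OF Y holomorphic_map_id c0 c'(1) B(1)]) auto
  then obtain P where P: "openin (top Y) P" "y \<in> P" "P \<subseteq> B" "\<And>z. z \<in> P \<Longrightarrow> cmod (?d z) \<le> cmod (?d y) + 1"
    using local_bound[OF c0 B(1) Bc(1) _ B(2), of ?d] by metis
  define C where "C = (cmod (?d y) + 1)\<^sup>2"
  have C: "0 < C" unfolding C_def using norm_ge_zero[of "?d y"] by (intro zero_less_power) linarith
  have "(\<integral>\<^sup>+z. ennreal C * g (inv_chart c0 z) * indicator (snd c0 ` P) z \<partial>lam n)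
     \<le> (\<integral>\<^sup>+z. ennreal C * (g (inv_chart c0 z) * indicator (snd c0 ` B) z) \<partial>lam n)"
    using P(3) by (intro nn_integral_mono) (auto simp: indicator_def)
  also have "\<dots> \<le> ennreal C * (\<integral>\<^sup>+z. g (inv_chart c0 z) * indicator (snd c0 ` B) z \<partial>lam n)"
    by (rule nn_integral_cmult_le[OF C])
  also have "\<dots> < \<infinity>" using B4 by (simp add: ennreal_mult_less_top)
  finally have fin: "(\<integral>\<^sup>+z. ennreal C * g (inv_chart c0 z) * indicator (snd c0 ` P) z \<partial>lam n) < \<infinity>" .
  have Pc: "P \<subseteq> fst c0" using P(3) Bc(1) by blast
  have "dominated_at (\<lambda>c y. norm_sq_form h \<omega> s c y * volume_density \<omega> c y) y c0 P (\<lambda>y. ennreal C * g y)"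
    unfolding dominated_at_def
  proof (intro conjI allI impI)
    fix c y' assume c: "is_chart X n c" and y': "y' \<in> P - T" "p y' \<in> fst c"
    have y'B: "y' \<in> B" using y' P(3) by blast
    then have D': "y' \<in> fst c0 - T" "y' \<in> fst c0" "y' \<in> fst c'" "y' \<in> preim Y p U" "p y' \<in> U"
      using y' Bc by (auto simp: preim_def)
    have y'0: "y' \<in> points Y - T" using chart_off_T(2)[OF c0] D'(1) by blast
    have x: "p y' \<in> points X - S" by (rule p_notin_S[OF y'0])
    then have px: "p y' \<in> fst c - S" "p y' \<in> points X" using y'(2) by auto
    have sx: "s c (p y') = t (pull c) (q (p y'))" by (rule st[OF c px(1) D'(5)])
    obtain V r \<tau> where T': "(V, r, \<tau>) \<in> trivs E" "p y' \<in> V" using cover_triv[OF px(2)] by blast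
    have "q (p y') \<in> fst (pull c)" by (rule pull_mem[OF c px(1)])
    then have "y' \<in> fst (pull c)" using qp[OF y'0] by simp
    then have f1: "s c (p y') \<in> fibre E (p y')" using E_formsD(1)[OF tE pull_chart[OF c] _ D'(4)] sx qp[OF y'0] by simp
    have f2: "t c0 y' \<in> fibre E (p y')" using E_formsD(1)[OF tE c0 D'(2,4)] by simp
    have f3: "t c' y' \<in> fibre E (p y')" using E_formsD(1)[OF tE c'(1) D'(3,4)] by simp
    have "norm_sq_form h \<omega> s c (p y') * volume_density \<omega> c (p y') * ennreal ((cmod (map_det n p c0 c y'))\<^sup>2)
       = ennreal ((cmod (map_det n p c0 c y'))\<^sup>2) * h (p y') (s c (p y'))"
      using norm_volume[OF c y'(2)] by (simp add: mult.commute)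
    also have "\<dots> = h (p y') (t c0 y')"
    proof (rule metric_scale[OF E h T' f1 f2, symmetric])
      show "\<tau> (p y') (t c0 y') $ i = map_det n p c0 c y' * \<tau> (p y') (s c (p y')) $ i" if "i < r" for i
        using pulled_transform[OF tE T'(1) that c0 c D'(1) y'(2) D'(5) T'(2)] sx by simp
    qed
    also have "\<dots> = ennreal ((cmod (?d y'))\<^sup>2) * h (p y') (t c' y')"
    proof (rule metric_scale[OF E h T' f3 f2])
      have "y' \<in> preim Y p V" using T'(2) y'0 by (simp add: preim_def)
      then show "\<tau> (p y') (t c0 y') $ i = ?d y' * \<tau> (p y') (t c' y') $ i" if "i < r" for i
        by (rule E_forms_transform[OF tE triv_E'[OF T'(1)] that c0 c'(1) D'(2,3) _ D'(4)])
    qed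
    also have "\<dots> \<le> ennreal C * g y'"
      unfolding g_def C_def using y' P(4) by (intro mult_right_mono ennreal_leI power_mono) auto
    finally show "norm_sq_form h \<omega> s c (p y') * volume_density \<omega> c (p y') * ennreal ((cmod (map_det n p c0 c y'))\<^sup>2) \<le> ennreal C * g y'" .
  qed (fact c0 P(1) P(2) Pc fin)+
  then show "\<exists>c' P \<rho>'. dominated_at (\<lambda>c y. norm_sq_form h \<omega> s c y * volume_density \<omega> c y) y c' P \<rho>'" by blast
qed

text \<open>The form on \<open>X - S\<close> that corresponds to \<open>t\<close> has components with integrable majorants on \<open>Y\<close>, so that they
  are square integrable near \<open>S\<close> and extend to the regular locus of \<open>X\<close>. The same majorants show that the components of the
  extension belong to the Grauert--Riemenschneider sheaf, also at the singular points of \<open>X\<close>; for the condition on the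
  metric, the majorants come from the square integrability of \<open>t\<close>.\<close>

theorem pushforward_exists:
  assumes U: "openin (top X) U" and t: "t \<in> K_tensor_L2 Y n E' (pullback_metric p h) (preim Y p U)"
  shows "\<exists>s\<in>GR_L2 X n E h \<omega> U. corresponds U s t"
proof -
  let ?W = "U \<inter> reg X"
  have W: "openin (top X) ?W" using U reg_open by blast
  have tE: "t \<in> E_forms Y n E' (preim Y p U)" using t unfolding K_tensor_L2_def by blast
  define s0 where "s0 c x = t (pull c) (q x)" for c x
  have qx: "q x \<in> fst (pull c)" "p (q x) = x" "q x \<in> preim Y p U" "x \<in> points X - S"
    if "is_chart X n c" "x \<in> fst c \<inter> ?W - S" for c x
  proof -
    have x: "x \<in> fst c - S" "x \<in> U" using that(2) by auto
    show x0: "x \<in> points X - S" using chart_off_S(2)[OF that(1)] x(1) by blast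
    show "q x \<in> fst (pull c)" by (rule pull_mem[OF that(1) x(1)])
    show "p (q x) = x" by (rule pq[OF x0])
    then show "q x \<in> preim Y p U" using q_mem[OF x0] x(2) by (simp add: preim_def)
  qed
  have "\<exists>s\<in>E_forms X n E ?W. \<forall>c x. is_chart X n c \<longrightarrow> x \<in> fst c \<inter> ?W - S \<longrightarrow> s c x = s0 c x"
  proof (rule E_forms_extend[OF X E S S_nd W])
    show "s0 c x \<in> fibre E x" if "is_chart X n c" "x \<in> fst c \<inter> ?W - S" for c x
      using E_formsD(1)[OF tE pull_chart[OF that(1)], of "q x"] qx[OF that] by (simp add: s0_def)
  next
    fix V r \<tau> i assume T': "(V, r, \<tau>) \<in> trivs E" and i: "i < r"
    show "hol_nform X n (V \<inter> ?W - S) (\<lambda>c x. \<tau> x (s0 c x) $ i)"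
      unfolding hol_nform_iff
    proof (intro conjI allI impI)
      fix c assume c: "is_chart X n c"
      let ?V1 = "fst c \<inter> (V \<inter> ?W - S)"
      have V1: "openin (top X) ?V1"
      proof -
        have "?V1 = (fst c - S) \<inter> (V \<inter> ?W)" by blast
        also have "openin (top X) \<dots>" by (intro openin_Int chart_off_S(1)[OF c] bundle_triv(1)[OF E T'] W)
        finally show ?thesis .
      qed
      have V10: "?V1 \<subseteq> points X - S" using chart_points[OF c] by blast
      have "(\<lambda>y. \<tau> (p y) (t (pull c) (q (p y))) $ i) \<in> str Y (preim Y p ?V1)"
      proof (rule str_cong[OF pull_chart[OF c] preim_open[OF hol V1]])
        show sub: "preim Y p ?V1 \<subseteq> fst (pull c)" by (auto simp: pull_def preim_def)
        have "fst (pull c) \<inter> (preim Y p V \<inter> preim Y p U) = preim Y p ?V1"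
          using chart_subset_reg[OF c] by (auto simp: pull_def preim_def)
        then show "(\<lambda>y. \<tau> (p y) (t (pull c) y) $ i) \<in> str Y (preim Y p ?V1)"
          using E_forms_str[OF tE triv_E'[OF T'] i pull_chart[OF c]] by simp
        fix y assume "y \<in> preim Y p ?V1"
        then have "y \<in> points Y - T" by (simp add: preim_def)
        then show "\<tau> (p y) (t (pull c) y) $ i = \<tau> (p y) (t (pull c) (q (p y))) $ i" using qp by simp
      qed
      then show "(\<lambda>x. \<tau> x (s0 c x) $ i) \<in> str X ?V1"
        using str_push[OF V1 V10] by (simp add: s0_def)
      fix c2 x assume c2: "is_chart X n c2" and x: "x \<in> fst c \<inter> fst c2 \<inter> (V \<inter> ?W - S)"
      have x1: "x \<in> fst c \<inter> ?W - S" "x \<in> fst c2 \<inter> ?W - S" "x \<in> fst c" "x \<in> fst c2" "x \<in> V" using x by auto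
      note q1 = qx[OF c x1(1)] and q2 = qx[OF c2 x1(2)]
      have "q x \<in> preim Y p V" using q_mem[OF q1(4)] q1(2) x1(5) by (simp add: preim_def)
      then have "\<tau> (p (q x)) (t (pull c) (q x)) $ i
          = map_det n (\<lambda>x. x) (pull c) (pull c2) (q x) * \<tau> (p (q x)) (t (pull c2) (q x)) $ i"
        by (rule E_forms_transform[OF tE triv_E'[OF T'] i pull_chart[OF c] pull_chart[OF c2] q1(1) q2(1) _ q1(3)])
      moreover have "map_det n (\<lambda>x. x) (pull c) (pull c2) (q x) = map_det n (\<lambda>x. x) c c2 x"
        using map_det_compose[OF Y X hol holomorphic_map_id pull_chart[OF c] c c2 q1(1)] q1(2) x1(3,4)
          map_det_pull_self[OF c q1(1)] map_det_pull[of "pull c" c2 "q x"] by simp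
      ultimately show "\<tau> x (s0 c x) $ i = map_det n (\<lambda>x. x) c c2 x * \<tau> x (s0 c2 x) $ i"
        using q1(2) by (simp add: s0_def)
    qed
  next
    fix V r \<tau> i c x assume T': "(V, r, \<tau>) \<in> trivs E" and i: "i < r" and c: "is_chart X n c" and x: "x \<in> fst c \<inter> (V \<inter> ?W)"
    have UV: "openin (top X) (U \<inter> V)" using U bundle_triv(1)[OF E T'] by blast
    have "dominated (\<lambda>c x. ennreal (1 * (cmod (\<tau> x (s0 c x) $ i))\<^sup>2)) (U \<inter> V)"
      by (rule dominated_component[OF U tE T' i]) (simp_all add: s0_def)
    from dominated_finite_local[OF this UV, of x]
    obtain B where B: "openin (top X) B" "x \<in> B" "B \<subseteq> U \<inter> V"
      "integral_density X n (B \<inter> reg X) (\<lambda>c x. ennreal (1 * (cmod (\<tau> x (s0 c x) $ i))\<^sup>2)) < \<infinity>"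
      using x by blast
    let ?N = "fst c \<inter> B"
    have N: "openin (top X) ?N" using is_chartD(1)[OF c] B(1) by blast
    have NS: "openin (top X) (?N - S)" using N S unfolding analytic_in_def by blast
    have "(\<integral>\<^sup>+z. ennreal (1 * (cmod (\<tau> (inv_chart c z) (s0 c (inv_chart c z)) $ i))\<^sup>2) * indicator (snd c ` (?N - S)) z \<partial>lam n)
      \<le> integral_density X n (B \<inter> reg X) (\<lambda>c x. ennreal (1 * (cmod (\<tau> x (s0 c x) $ i))\<^sup>2))"
      using chart_subset_reg[OF c]
      by (intro integral_piece_le_density[OF c] openin_sets_lam chart_image_open[OF c NS]) auto
    also note B(4)
    finally have "(\<integral>\<^sup>+z. ennreal ((cmod (\<tau> (inv_chart c z) (s0 c (inv_chart c z)) $ i))\<^sup>2) * indicator (snd c ` (?N - S)) z \<partial>lam n) < \<infinity>"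
      by simp
    moreover have "?N \<subseteq> fst c \<inter> (V \<inter> ?W)" using B(3) chart_subset_reg[OF c] by blast
    moreover have "x \<in> ?N" using x B(2) by blast
    ultimately show "\<exists>N. openin (top X) N \<and> x \<in> N \<and> N \<subseteq> fst c \<inter> (V \<inter> ?W) \<and>
       (\<integral>\<^sup>+z. ennreal ((cmod (\<tau> (inv_chart c z) (s0 c (inv_chart c z)) $ i))\<^sup>2) * indicator (snd c ` (N - S)) z \<partial>lam n) < \<infinity>"
      using N by blast
  qed
  then obtain s where s: "s \<in> E_forms X n E ?W" "\<And>c x. is_chart X n c \<Longrightarrow> x \<in> fst c \<inter> ?W - S \<Longrightarrow> s c x = s0 c x"
    by blast
  have st: "s c x = t (pull c) (q x)" if "is_chart X n c" "x \<in> fst c - S" "x \<in> U" for c x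
    using s(2)[OF that(1), of x] that chart_subset_reg[OF that(1)] by (auto simp: s0_def)
  have "corresponds U s t"
    unfolding corresponds_def
  proof (intro allI impI)
    fix c' y assume c': "is_chart Y n c'" and y: "y \<in> fst c' \<inter> preim Y p U - T"
    have y1: "y \<in> fst c' - T" "y \<in> fst c'" "y \<in> preim Y p U" "p y \<in> U" using y by (auto simp: preim_def)
    have y0: "y \<in> points Y - T" using chart_off_T(2)[OF c'] y1(1) by blast
    note pc = push_chart[OF c'] and pm = push_mem[OF c' y1(1)]
    have py: "p y \<in> fst (push c') - S" using pm p_notin_S[OF y0] by blast
    have yp: "y \<in> fst (pull (push c'))" using pull_mem[OF pc py] qp[OF y0] by simp
    have sp: "s (push c') (p y) = t (pull (push c')) y" using st[OF pc py y1(4)] qp[OF y0] by simp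
    have "p y \<in> points X" using p_mem y0 by blast
    then obtain V r \<tau> where T': "(V, r, \<tau>) \<in> trivs E" "p y \<in> V" using cover_triv by blast
    have "map_det n p c' (push c') y = 1"
      using map_det_p_push[OF c' c' y1(1,2)] map_det_id[OF c' y1(2)] by simp
    then have eq: "\<tau> (p y) (t c' y) $ i = \<tau> (p y) (s (push c') (p y)) $ i" if "i < r" for i
      using pulled_transform[OF tE T'(1) that c' pc y1(1) pm y1(4) T'(2)] sp qp[OF y0] by simp
    have "t c' y \<in> fibre E (p y)" using E_formsD(1)[OF tE c' y1(2,3)] by simp
    moreover have "s (push c') (p y) \<in> fibre E (p y)"
      using E_formsD(1)[OF tE pull_chart[OF pc] yp y1(3)] sp by simp
    ultimately show "t c' y = s (push c') (p y)" by (rule triv_eqI[OF E T' _ _ eq])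
  qed
  moreover have "s \<in> GR_tensor X n E U"
    unfolding GR_tensor_def
  proof (intro CollectI conjI ballI)
    fix T' assume "T' \<in> trivs E"
    moreover obtain V r \<tau> where T'eq: "T' = (V, r, \<tau>)" by (cases T') auto
    ultimately have T': "(V, r, \<tau>) \<in> trivs E" by simp
    have "GR_form X n (U \<inter> V) (\<lambda>c x. \<tau> x (s c x) $ i)" if i: "i < r" for i
      unfolding GR_form_def
    proof (intro conjI allI impI)
      have "U \<inter> V \<inter> reg X = V \<inter> ?W" by blast
      then show "hol_nform X n (U \<inter> V \<inter> reg X) (\<lambda>c x. \<tau> x (s c x) $ i)"
        using E_formsD(3)[OF s(1) T' i] by simp
      fix K assume K: "compactin (top X) K" "K \<subseteq> U \<inter> V"
      show "integral_density X n (K \<inter> reg X) (\<lambda>c x. ennreal (2 ^ n * (cmod (\<tau> x (s c x) $ i))\<^sup>2)) < \<infinity>"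
        by (rule dominated_finite_compact[OF dominated_component[OF U tE T' i] K]) (simp_all add: st)
    qed
    then show "case T' of (V, r, \<tau>) \<Rightarrow> \<forall>i<r. GR_form X n (U \<inter> V) (\<lambda>c x. \<tau> x (s c x) $ i)"
      by (simp add: T'eq)
  qed (rule s(1))
  moreover have "\<exists>B. openin (top X) B \<and> x \<in> B \<and> B \<subseteq> U \<and>
      integral_density X n (B \<inter> reg X) (\<lambda>c y. norm_sq_form h \<omega> s c y * volume_density \<omega> c y) < \<infinity>" if "x \<in> U" for x
    by (rule dominated_finite_local[OF dominated_norm[OF U t] U that]) (rule st)
  ultimately show ?thesis unfolding GR_L2_def by blast
qed

theorem equals_direct_image:
  "equals_direct_image Y X p n E (GR_L2 X n E h \<omega>) (K_tensor_L2 Y n E' (pullback_metric p h))"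
  unfolding equals_direct_image_def direct_image_def
proof (intro allI impI)
  fix U assume U: "openin (top X) U"
  let ?G = "GR_L2 X n E h \<omega> U" and ?F = "K_tensor_L2 Y n E' (pullback_metric p h) (preim Y p U)"
  have GE: "?G \<subseteq> E_forms X n E (U \<inter> reg X)" unfolding GR_L2_def GR_tensor_def by blast
  have FE: "?F \<subseteq> E_forms Y n E' (preim Y p U)" unfolding K_tensor_L2_def by blast
  define \<Phi> where "\<Phi> s = (SOME t. t \<in> ?F \<and> corresponds U s t)" for s
  have \<Phi>: "\<Phi> s \<in> ?F" "corresponds U s (\<Phi> s)" if "s \<in> ?G" for s
  proof -
    have "\<exists>t. t \<in> ?F \<and> corresponds U s t" using pullback_exists[OF U that] by blast
    from someI_ex[OF this] show "\<Phi> s \<in> ?F" "corresponds U s (\<Phi> s)" unfolding \<Phi>_def by blast+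
  qed
  have "bij_betw \<Phi> ?G ?F"
    unfolding bij_betw_def
  proof
    show "inj_on \<Phi> ?G"
    proof (rule inj_onI)
      fix s s' assume s: "s \<in> ?G" "s' \<in> ?G" "\<Phi> s = \<Phi> s'"
      show "s = s'"
      proof (rule corresponds_unique_left[OF U _ _ \<Phi>(2)[OF s(1)]])
        show "corresponds U s' (\<Phi> s)" using \<Phi>(2)[OF s(2)] s(3) by simp
      qed (use s GE in blast)+
    qed
    show "\<Phi> ` ?G = ?F"
    proof
      show "\<Phi> ` ?G \<subseteq> ?F" using \<Phi>(1) by blast
      show "?F \<subseteq> \<Phi> ` ?G"
      proof
        fix t assume t: "t \<in> ?F"
        obtain s where s: "s \<in> ?G" "corresponds U s t" using pushforward_exists[OF U t] by blast
        have "t = \<Phi> s"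
        proof (rule corresponds_unique_right[OF U _ _ s(2) \<Phi>(2)[OF s(1)]])
          show "t \<in> E_forms Y n E' (preim Y p U)" using t FE by blast
          show "\<Phi> s \<in> E_forms Y n E' (preim Y p U)" using \<Phi>(1)[OF s(1)] FE by blast
        qed
        then show "t \<in> \<Phi> ` ?G" using s(1) by blast
      qed
    qed
  qed
  moreover have "is_pullback_form Y X p n E U s (\<Phi> s)" if "s \<in> ?G" for s
    by (rule corresponds_imp_pullback[OF U _ _ \<Phi>(2)[OF that]]) (use GE FE \<Phi>(1)[OF that] that in blast)+
  ultimately show "\<exists>\<Phi>. bij_betw \<Phi> ?G ?F \<and> (\<forall>s\<in>?G. is_pullback_form Y X p n E U s (\<Phi> s))" by blast
qed

end

section \<open>Proper modifications and the identity\<close>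

lemma proper_modification_equals_direct_image:
  assumes X: "complex_space X" and pure: "pure_dim X n" and E: "hol_vector_bundle X E"
    and h: "singular_hermitian_metric X n E h" and \<omega>: "hermitian_metric X n \<omega>"
    and Y: "complex_manifold Y" and p: "proper_modification Y X p"
  shows "equals_direct_image Y X p n E (GR_L2 X n E h \<omega>) (K_tensor_L2 Y n (pullback_bundle Y p E) (pullback_metric p h))"
proof -
  have p': "holomorphic_map Y X p" "proper_map (top Y) (top X) p" "p ` points Y = points X"
    using p unfolding proper_modification_def by blast+
  obtain S where S: "analytic_in X S" "nowhere_dense_in X S" "nowhere_dense_in Y (preim Y p S)"
      "biholomorphic_over Y X p (points X - S)"
    using p unfolding proper_modification_def by blast
  then have "homeomorphic_map (subtopology (top Y) (preim Y p (points X - S))) (subtopology (top X) (points X - S)) p"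
    unfolding biholomorphic_over_def by blast
  then obtain q where q: "homeomorphic_maps (subtopology (top Y) (preim Y p (points X - S))) (subtopology (top X) (points X - S)) p q"
    unfolding homeomorphic_map_maps by blast
  interpret bundle_modification X Y p S q n E h \<omega>
    by unfold_locales (fact X Y pure p' S q E h \<omega>)+
  show ?thesis by (rule equals_direct_image)
qed

lemma proper_modification_id:
  assumes Xm: "complex_manifold X"
  shows "proper_modification X X (\<lambda>x. x)"
proof -
  have X: "complex_space X" and reg: "reg X = points X" using Xm by (auto simp: complex_manifold_def)
  have "analytic_in X {}"
    unfolding analytic_in_def
  proof (intro conjI ballI)
    fix x assume x: "x \<in> points X"
    then obtain m c where c: "is_chart X m c" "x \<in> fst c" using reg unfolding reg_def by blast
    have "(\<lambda>_. 1) \<in> str X (fst c)"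
      unfolding chart_str[OF c(1) is_chartD(1)[OF c(1)] order_refl] using is_chartD(2)[OF c(1)] by (simp add: holo_def)
    then show "\<exists>V fs. openin (top X) V \<and> x \<in> V \<and> finite fs \<and> fs \<subseteq> str X V \<and> {} \<inter> V = {y \<in> V. \<forall>f\<in>fs. f y = 0}"
      using c(2) is_chartD(1)[OF c(1)] by (intro exI[of _ "fst c"] exI[of _ "{\<lambda>_. 1}"]) auto
  qed simp
  moreover have "nowhere_dense_in X {}" "nowhere_dense_in X (preim X (\<lambda>x. x) {})"
    by (simp_all add: nowhere_dense_in_def preim_def)
  moreover have "biholomorphic_over X X (\<lambda>x. x) (points X - {})"
    using preim_id[of X] homeomorphic_map_id[of "top X" "top X"] by (simp add: biholomorphic_over_def o_def id_def)
  moreover have "proper_map (top X) (top X) (\<lambda>x. x)" using proper_map_id[of "top X"] by (simp add: id_def)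
  ultimately show ?thesis
    unfolding proper_modification_def using X holomorphic_map_id by blast
qed

lemma pullback_bundle_id:
  assumes "hol_vector_bundle X E"
  shows "pullback_bundle X (\<lambda>x. x) E = E"
proof -
  have "(\<lambda>(V, r, \<tau>). (preim X (\<lambda>x. x) V, r, \<lambda>y. \<tau> y)) t = t" if "t \<in> trivs E" for t
  proof -
    obtain V r \<tau> where t: "t = (V, r, \<tau>)" by (cases t) auto
    then show ?thesis using preim_id[OF bundle_triv(1)[OF assms, of V r \<tau>]] that by simp
  qed
  then have "(\<lambda>(V, r, \<tau>). (preim X (\<lambda>x. x) V, r, \<lambda>y. \<tau> y)) ` trivs E = (\<lambda>t. t) ` trivs E"
    by (intro image_cong refl)
  then show ?thesis by (simp add: pullback_bundle_def)
qed

text \<open>Compare \<open>s\<close> and \<open>t\<close> in one and the same chart, where the Jacobian determinant of the identity is \<open>1\<close>.\<close>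

lemma pullback_form_id:
  assumes X: "complex_manifold X" and E: "hol_vector_bundle X E" and U: "openin (top X) U"
    and s: "s \<in> E_forms X n E U" and t: "t \<in> E_forms X n E U" and pb: "is_pullback_form X X (\<lambda>x. x) n E U s t"
  shows "t = s"
proof (intro ext)
  fix c x
  show "t c x = s c x"
  proof (cases "is_chart X n c \<and> x \<in> fst c \<inter> U")
    case True
    then have c: "is_chart X n c" and x: "x \<in> fst c" "x \<in> U" by auto
    have xX: "x \<in> points X" "x \<in> reg X" using x(2) openin_subset[OF U] X unfolding complex_manifold_def by auto
    have "\<forall>x\<in>points X. \<exists>(V, r, \<tau>)\<in>trivs E. x \<in> V" using E unfolding hol_vector_bundle_def by (elim conjE)
    from bspec[OF this xX(1)] obtain V r \<tau> where T: "(V, r, \<tau>) \<in> trivs E" "x \<in> V" by blast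
    have "\<tau> x (t c x) = map_det n (\<lambda>x. x) c c x \<cdot>\<^sub>v \<tau> x (s c x)"
    proof -
      have "\<forall>(V, r, \<tau>)\<in>trivs E. x \<in> V \<longrightarrow> \<tau> x (t c x) = map_det n (\<lambda>x. x) c c x \<cdot>\<^sub>v \<tau> x (s c x)"
        using pb c x xX(2) unfolding is_pullback_form_def map_det_def o_def by blast
      from bspec[OF this T(1)] T(2) show ?thesis by simp
    qed
    then have eq: "\<tau> x (t c x) = \<tau> x (s c x)" using map_det_id[OF c x(1)] by simp
    show ?thesis
      by (rule triv_eqI[OF E T E_formsD(1)[OF t c x] E_formsD(1)[OF s c x]]) (simp add: eq)
  next
    case False
    then show ?thesis using E_formsD(2)[OF s] E_formsD(2)[OF t] by simp
  qed
qed

text \<open>The identity map is a modification of \<open>X\<close> with empty centre, and a form is its own pullback.\<close>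

lemma manifold_GR_L2_eq:
  assumes Xm: "complex_manifold X" and pure: "pure_dim X n" and E: "hol_vector_bundle X E"
    and h: "singular_hermitian_metric X n E h" and \<omega>: "hermitian_metric X n \<omega>" and U: "openin (top X) U"
  shows "GR_L2 X n E h \<omega> U = K_tensor_L2 X n E h U"
proof -
  have X: "complex_space X" and reg: "reg X = points X" using Xm by (auto simp: complex_manifold_def)
  have UX: "U \<inter> reg X = U" using openin_subset[OF U] reg by blast
  have "equals_direct_image X X (\<lambda>x. x) n E (GR_L2 X n E h \<omega>) (K_tensor_L2 X n E h)"
    using proper_modification_equals_direct_image[OF X pure E h \<omega> Xm proper_modification_id[OF Xm]]
    by (simp add: pullback_bundle_id[OF E] pullback_metric_def)
  then obtain \<Phi> where \<Phi>: "bij_betw \<Phi> (GR_L2 X n E h \<omega> U) (K_tensor_L2 X n E h U)"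
    "\<forall>s\<in>GR_L2 X n E h \<omega> U. is_pullback_form X X (\<lambda>x. x) n E U s (\<Phi> s)"
    using U preim_id[OF U] unfolding equals_direct_image_def direct_image_def by metis
  have "\<Phi> s = s" if s: "s \<in> GR_L2 X n E h \<omega> U" for s
  proof (rule pullback_form_id[OF Xm E U])
    show "s \<in> E_forms X n E U" using s UX unfolding GR_L2_def GR_tensor_def by simp
    show "\<Phi> s \<in> E_forms X n E U" using \<Phi>(1) s unfolding bij_betw_def K_tensor_L2_def by blast
    show "is_pullback_form X X (\<lambda>x. x) n E U s (\<Phi> s)" using \<Phi>(2) s by blast
  qed
  then have "\<Phi> ` GR_L2 X n E h \<omega> U = GR_L2 X n E h \<omega> U" by (auto simp: image_iff)
  then show ?thesis using \<Phi>(1) unfolding bij_betw_def by simp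
qed

theorem proposition1p6:
  fixes X :: "'a cspace" and Y :: "'b cspace" and \<pi> :: "'b \<Rightarrow> 'a"
    and E :: "('a, 'e) vbundle" and h :: "'a \<Rightarrow> 'e \<Rightarrow> ennreal"
    and \<omega> :: "'a chart \<Rightarrow> 'a \<Rightarrow> complex mat" and n :: nat
  assumes "complex_space X" and "pure_dim X n"
    and "hol_vector_bundle X E"
    and "singular_hermitian_metric X n E h"
    and "hermitian_metric X n \<omega>"
  shows "(resolution_of_singularities Y X \<pi> \<longrightarrow>
            equals_direct_image Y X \<pi> n E (GR_L2 X n E h \<omega>)
              (K_tensor_L2 Y n (pullback_bundle Y \<pi> E) (pullback_metric \<pi> h)))
       \<and> (complex_manifold X \<longrightarrow>
            (\<forall>U. openin (top X) U \<longrightarrow> GR_L2 X n E h \<omega> U = K_tensor_L2 X n E h U))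
       \<and> (complex_manifold X \<and> complex_manifold Y \<and> proper_modification Y X \<pi> \<longrightarrow>
            equals_direct_image Y X \<pi> n E (GR_L2 X n E h \<omega>)
              (K_tensor_L2 Y n (pullback_bundle Y \<pi> E) (pullback_metric \<pi> h)))"
  using proper_modification_equals_direct_image[OF assms] manifold_GR_L2_eq[OF _ assms(2-5)]
  unfolding resolution_of_singularities_def by blast

end
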